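(* Let $R=R_0[x_1,\dots,x_d]$ be a Noetherian $\mathbb{N}$-graded ring, let $L$ and $M$ be finitely generated $\mathbb{Z}$-graded $R$-modules, let $N$ be a graded submodule of $M$, and let $I$ be a homogeneous ideal of $R$. Let $J$ be a reduction ideal of $I$ generated by homogeneous elements $y_1,\dots,y_c$ of degrees $d_1\le\cdots\le d_c$ respectively. Fix $k\in\mathbb{N}$, and set $H_n:=\operatorname{Tor}_k^R(L,I^nM/I^nN)$ for all $n\ge 0$. Let $\mathfrak{p}$ be such that $\mathfrak{p}\in\operatorname{Ass}_R(H_n)$ for all $n\gg 0$. Set $$\mathcal{H}:=\operatorname{Tor}_k^R\big(L,\mathscr{R}(I,M)/\mathscr{R}(I,N)\big)=\bigoplus_{n\ge 0}H_n$$ and $$\delta:=\inf\Big\{j:1\le j\le c,\ y_j\notin\sqrt{\operatorname{ann}_{\mathscr{R}(J)}(\mathcal{H})}\Big\}.$$ Then there exist $a\in\{d_\delta,\dots,d_c\}$ and $b\in\mathbb{Z}$ such that $v_{\mathfrak{p}}(H_n)=an+b$ for all $n\gg 0$. Moreover, both functions $\operatorname{indeg}(H_n)$ and $v(H_n)$ are eventually linear in $n$ with the same leading coefficient $d_\delta\in\{d_1,\dots,d_c\}$.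
   Context: Rings are commutative and $\mathbb{N}=\{0,1,2,\dots\}$. $R=R_0[x_1,\dots,x_d]$ means that $R$ is generated over its degree-zero component $R_0$ by homogeneous elements $x_1,\dots,x_d$. An ideal $J\subseteq I$ is a reduction of $I$ if $JI^m=I^{m+1}$ for some $m\ge 0$. Tor of finitely generated graded $R$-modules carries its natural $\mathbb{Z}$-graded structure. Rees objects: $\mathscr{R}(I)=\bigoplus_{n\ge 0}I^n$ and $\mathscr{R}(J)=\bigoplus_{n\ge 0}J^n$ are the Rees algebras; $\mathscr{R}(I,M)=\bigoplus_{n\ge 0}I^nM$ and $\mathscr{R}(I,N)=\bigoplus_{n\ge 0}I^nN$ are the Rees modules, so $\mathscr{R}(I,M)/\mathscr{R}(I,N)=\bigoplus_{n\ge 0}I^nM/I^nN$. For $r\in\mathbb{N}$ and $a\in I^r$, multiplication by $a$, $I^nM/I^nN\to I^{n+r}M/I^{n+r}N$, induces maps $H_n\to H_{n+r}$; this makes $\mathcal{H}=\bigoplus_{n\ge0}H_n$ a graded $\mathscr{R}(I)$-module, and hence an $\mathscr{R}(J)$-module. Here $\mathscr{R}(J)=R_0[x_1,\dots,x_d,y_1,\dots,y_c]$, where each $y_j$ is viewed as the element of $\mathscr{R}(J)$ lying in its Rees-degree-one component $J^1$ (so $y_j$ has bidegree $(1,d_j)$). $\operatorname{ann}_{\mathscr{R}(J)}(\mathcal{H})$ denotes the annihilator ideal of $\mathcal{H}$ in $\mathscr{R}(J)$. For a finitely generated $\mathbb{Z}$-graded $R$-module $E$ with graded components $E_n$: $\operatorname{indeg}(E):=\inf\{n:E_n\ne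 0\}$ (with $\operatorname{indeg}(0)=\infty$); for $\mathfrak{p}\in\operatorname{Ass}_R(E)$, the local v-number is $v_{\mathfrak{p}}(E):=\inf\{n:\text{there exists }x\in E_n\text{ with }\mathfrak{p}=(0:_R x)\}$, where $(0:_R x)$ is the annihilator of $x$ in $R$; and $v(E):=\inf\{v_{\mathfrak{p}}(E):\mathfrak{p}\in\operatorname{Ass}_R(E)\}$, with $v(0)=\infty$. A function $f(n)$ is eventually linear with leading coefficient $a$ if there is a constant $b\in\mathbb{Z}$ with $f(n)=an+b$ for all $n\gg 0$. *)

theory Defs
  imports "HOL-Library.Extended_Real" "HOL-Algebra.Algebra"
begin

section \<open>Graded rings and modules\<close>

record 'a gring = "'a ring" +
  ring_part :: "nat \<Rightarrow> 'a set"

record ('a, 'b) gmodule = "('a, 'b) module" +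
  mod_part :: "int \<Rightarrow> 'b set"

definition internal_direct_sum :: "('b, 'z) ring_scheme \<Rightarrow> ('i \<Rightarrow> 'b set) \<Rightarrow> bool" where
  "internal_direct_sum G C \<longleftrightarrow>
     (\<forall>i. additive_subgroup (C i) G) \<and>
     (\<forall>x\<in>carrier G. \<exists>!f. (\<forall>i. f i \<in> C i) \<and> finite {i. f i \<noteq> \<zero>\<^bsub>G\<^esub>} \<and>
        x = finsum G f {i. f i \<noteq> \<zero>\<^bsub>G\<^esub>})"

definition graded_ring :: "'a gring \<Rightarrow> bool" where
  "graded_ring R \<longleftrightarrow> cring R \<and> internal_direct_sum R (ring_part R) \<and> \<one>\<^bsub>R\<^esub> \<in> ring_part R 0 \<and>
     (\<forall>i j. \<forall>a\<in>ring_part R i. \<forall>b\<in>ring_part R j. a \<otimes>\<^bsub>R\<^esub> b \<in> ring_part R (i + j))"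

definition homogeneous :: "'a gring \<Rightarrow> 'a \<Rightarrow> bool" where
  "homogeneous R a \<longleftrightarrow> (\<exists>n. a \<in> ring_part R n)"

definition graded_module :: "'a gring \<Rightarrow> ('a, 'b) gmodule \<Rightarrow> bool" where
  "graded_module R M \<longleftrightarrow> module R M \<and> internal_direct_sum M (mod_part M) \<and>
     (\<forall>i j. \<forall>a\<in>ring_part R i. \<forall>x\<in>mod_part M j. a \<odot>\<^bsub>M\<^esub> x \<in> mod_part M (int i + j))"

definition graded_submodule :: "'a gring \<Rightarrow> ('a, 'b) gmodule \<Rightarrow> 'b set \<Rightarrow> bool" where
  "graded_submodule R M N \<longleftrightarrow> submodule N R M \<and>
     internal_direct_sum (M\<lparr>carrier := N\<rparr>) (\<lambda>n. N \<inter> mod_part M n)"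

definition homogeneous_ideal :: "'a gring \<Rightarrow> 'a set \<Rightarrow> bool" where
  "homogeneous_ideal R I \<longleftrightarrow> ideal I R \<and>
     internal_direct_sum (R\<lparr>carrier := I\<rparr>) (\<lambda>n. I \<inter> ring_part R n)"

definition graded_by :: "('a, 'b, 'z) module_scheme \<Rightarrow> (int \<Rightarrow> 'b set) \<Rightarrow> ('a, 'b) gmodule" where
  "graded_by M G = module.extend (module.truncate M) (gmodule.fields G)"

definition graded_hom ::
  "'a gring \<Rightarrow> ('a, 'b) gmodule \<Rightarrow> ('a, 'c) gmodule \<Rightarrow> ('b \<Rightarrow> 'c) \<Rightarrow> bool" where
  "graded_hom R A B f \<longleftrightarrow> f \<in> carrier A \<rightarrow> carrier B \<and>
     (\<forall>x\<in>carrier A. \<forall>y\<in>carrier A. f (x \<oplus>\<^bsub>A\<^esub> y) = f x \<oplus>\<^bsub>B\<^esub> f y) \<and>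
     (\<forall>r\<in>carrier R. \<forall>x\<in>carrier A. f (r \<odot>\<^bsub>A\<^esub> x) = r \<odot>\<^bsub>B\<^esub> f x) \<and>
     (\<forall>n. f ` mod_part A n \<subseteq> mod_part B n)"


section \<open>Submodules and quotients\<close>

definition span :: "('a, 'r) ring_scheme \<Rightarrow> ('a, 'b, 'z) module_scheme \<Rightarrow> 'b set \<Rightarrow> 'b set" where
  "span R M S = \<Inter>{P. submodule P R M \<and> S \<subseteq> P}"

definition fin_gen_module :: "('a, 'r) ring_scheme \<Rightarrow> ('a, 'b, 'z) module_scheme \<Rightarrow> bool" where
  "fin_gen_module R M \<longleftrightarrow> (\<exists>S\<subseteq>carrier M. finite S \<and> span R M S = carrier M)"

definition ideal_smult ::
  "('a, 'r) ring_scheme \<Rightarrow> ('a, 'b, 'z) module_scheme \<Rightarrow> 'a set \<Rightarrow> 'b set \<Rightarrow> 'b set" where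
  "ideal_smult R M A P = span R M {a \<odot>\<^bsub>M\<^esub> x | a x. a \<in> A \<and> x \<in> P}"

definition gsub :: "('a, 'b) gmodule \<Rightarrow> 'b set \<Rightarrow> ('a, 'b) gmodule" where
  "gsub M P = M\<lparr>carrier := P, mod_part := (\<lambda>n. P \<inter> mod_part M n)\<rparr>"

text \<open>If \<open>g : A \<rightarrow> M\<close> maps a submodule \<open>Q\<close> of \<open>A\<close> into \<open>P\<close>, then \<open>coset_map M P g\<close> is the
  induced map from \<open>A/Q\<close> to \<open>M/P\<close>, where quotients consist of cosets.\<close>

definition coset_map :: "('a, 'b, 'z) module_scheme \<Rightarrow> 'b set \<Rightarrow> ('c \<Rightarrow> 'b) \<Rightarrow> 'c set \<Rightarrow> 'b set" where
  "coset_map M P g c = (\<Union>x\<in>c. P +>\<^bsub>M\<^esub> g x)"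

definition quotient_module :: "('a, 'b, 'z) module_scheme \<Rightarrow> 'b set \<Rightarrow> ('a, 'b set) module" where
  "quotient_module M P = \<lparr>
     carrier = a_rcosets\<^bsub>M\<^esub> P, monoid.mult = undefined, one = undefined,
     ring.zero = P, add = set_add M,
     smult = (\<lambda>r. coset_map M P (\<lambda>x. r \<odot>\<^bsub>M\<^esub> x))\<rparr>"

definition gquotient :: "('a, 'b) gmodule \<Rightarrow> 'b set \<Rightarrow> ('a, 'b set) gmodule" where
  "gquotient M P = graded_by (quotient_module M P) (\<lambda>n. (\<lambda>x. P +>\<^bsub>M\<^esub> x) ` mod_part M n)"


section \<open>Free modules and tensor products\<close>

definition free_module :: "('a, 'r) ring_scheme \<Rightarrow> 'x set \<Rightarrow> ('a, 'x \<Rightarrow> 'a) module" where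
  "free_module R B = \<lparr>
     carrier = {f. (\<forall>x. f x \<in> carrier R) \<and> (\<forall>x. x \<notin> B \<longrightarrow> f x = \<zero>\<^bsub>R\<^esub>) \<and> finite {x. f x \<noteq> \<zero>\<^bsub>R\<^esub>}},
     monoid.mult = undefined, one = undefined,
     ring.zero = (\<lambda>x. \<zero>\<^bsub>R\<^esub>), add = (\<lambda>f g x. f x \<oplus>\<^bsub>R\<^esub> g x),
     smult = (\<lambda>r f x. r \<otimes>\<^bsub>R\<^esub> f x)\<rparr>"

definition basis_vec :: "('a, 'r) ring_scheme \<Rightarrow> 'x \<Rightarrow> 'x \<Rightarrow> 'a" where
  "basis_vec R x = (\<lambda>z. if z = x then \<one>\<^bsub>R\<^esub> else \<zero>\<^bsub>R\<^esub>)"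

text \<open>The linear map between free modules that sends the basis vector of \<open>x\<close> to that of \<open>h x\<close>;
  \<open>Y\<close> is the basis of the target.\<close>

definition free_map ::
  "('a, 'r) ring_scheme \<Rightarrow> 'y set \<Rightarrow> ('x \<Rightarrow> 'y) \<Rightarrow> ('x \<Rightarrow> 'a) \<Rightarrow> 'y \<Rightarrow> 'a" where
  "free_map R Y h f = finsum (free_module R Y)
     (\<lambda>x. f x \<odot>\<^bsub>free_module R Y\<^esub> basis_vec R (h x)) {x. f x \<noteq> \<zero>\<^bsub>R\<^esub>}"

definition bilinear_relations ::
  "('a, 'r) ring_scheme \<Rightarrow> ('a, 'b, 'y) module_scheme \<Rightarrow> ('a, 'c, 'z) module_scheme
    \<Rightarrow> ('b \<times> 'c \<Rightarrow> 'a) set" where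
  "bilinear_relations R A B =
    (let F = free_module R (carrier A \<times> carrier B); e = (\<lambda>x y. basis_vec R (x, y)) in
      {e (x \<oplus>\<^bsub>A\<^esub> x') y \<ominus>\<^bsub>F\<^esub> (e x y \<oplus>\<^bsub>F\<^esub> e x' y) | x x' y.
         x \<in> carrier A \<and> x' \<in> carrier A \<and> y \<in> carrier B} \<union>
      {e x (y \<oplus>\<^bsub>B\<^esub> y') \<ominus>\<^bsub>F\<^esub> (e x y \<oplus>\<^bsub>F\<^esub> e x y') | x y y'.
         x \<in> carrier A \<and> y \<in> carrier B \<and> y' \<in> carrier B} \<union>
      {e (r \<odot>\<^bsub>A\<^esub> x) y \<ominus>\<^bsub>F\<^esub> r \<odot>\<^bsub>F\<^esub> e x y | r x y.
         r \<in> carrier R \<and> x \<in> carrier A \<and> y \<in> carrier B} \<union>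
      {e x (r \<odot>\<^bsub>B\<^esub> y) \<ominus>\<^bsub>F\<^esub> r \<odot>\<^bsub>F\<^esub> e x y | r x y.
         r \<in> carrier R \<and> x \<in> carrier A \<and> y \<in> carrier B})"

definition tensor_kernel ::
  "('a, 'r) ring_scheme \<Rightarrow> ('a, 'b, 'y) module_scheme \<Rightarrow> ('a, 'c, 'z) module_scheme
    \<Rightarrow> ('b \<times> 'c \<Rightarrow> 'a) set" where
  "tensor_kernel R A B = span R (free_module R (carrier A \<times> carrier B)) (bilinear_relations R A B)"

definition pure_tensor ::
  "('a, 'r) ring_scheme \<Rightarrow> ('a, 'b, 'y) module_scheme \<Rightarrow> ('a, 'c, 'z) module_scheme
    \<Rightarrow> 'b \<Rightarrow> 'c \<Rightarrow> ('b \<times> 'c \<Rightarrow> 'a) set" where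
  "pure_tensor R A B x y =
     tensor_kernel R A B +>\<^bsub>free_module R (carrier A \<times> carrier B)\<^esub> basis_vec R (x, y)"

definition tensor_module ::
  "('a, 'r) ring_scheme \<Rightarrow> ('a, 'b, 'y) module_scheme \<Rightarrow> ('a, 'c, 'z) module_scheme
    \<Rightarrow> ('a, ('b \<times> 'c \<Rightarrow> 'a) set) module" where
  "tensor_module R A B =
     quotient_module (free_module R (carrier A \<times> carrier B)) (tensor_kernel R A B)"

definition gtensor ::
  "'a gring \<Rightarrow> ('a, 'b) gmodule \<Rightarrow> ('a, 'c) gmodule \<Rightarrow> ('a, ('b \<times> 'c \<Rightarrow> 'a) set) gmodule" where
  "gtensor R A B = graded_by (tensor_module R A B)
     (\<lambda>n. generate (add_monoid (tensor_module R A B))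
        {pure_tensor R A B x y | x y i j. x \<in> mod_part A i \<and> y \<in> mod_part B j \<and> i + j = n})"

text \<open>\<open>tensor_map R A' B' f g\<close> is \<open>f \<otimes> g : A \<otimes> B \<rightarrow> A' \<otimes> B'\<close> for linear
  \<open>f : A \<rightarrow> A'\<close> and \<open>g : B \<rightarrow> B'\<close>.\<close>

definition tensor_map ::
  "('a, 'r) ring_scheme \<Rightarrow> ('a, 'd, 'y) module_scheme \<Rightarrow> ('a, 'e, 'z) module_scheme
    \<Rightarrow> ('b \<Rightarrow> 'd) \<Rightarrow> ('c \<Rightarrow> 'e) \<Rightarrow> ('b \<times> 'c \<Rightarrow> 'a) set \<Rightarrow> ('d \<times> 'e \<Rightarrow> 'a) set" where
  "tensor_map R A' B' f g =
     coset_map (free_module R (carrier A' \<times> carrier B')) (tensor_kernel R A' B')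
       (free_map R (carrier A' \<times> carrier B') (map_prod f g))"


section \<open>Tor\<close>

text \<open>The graded free module \<open>R(-e\<^sub>0) \<oplus> \<dots> \<oplus> R(-e\<^sub>r\<^sub>-\<^sub>1)\<close> for a list
  \<open>e\<close> of length \<open>r\<close>: the \<open>j\<close>-th basis vector has degree \<open>e\<^sub>j\<close>.\<close>

definition gfree :: "'a gring \<Rightarrow> int list \<Rightarrow> ('a, nat \<Rightarrow> 'a) gmodule" where
  "gfree R e = graded_by (free_module R {..<length e})
     (\<lambda>n. {f \<in> carrier (free_module R {..<length e}).
        \<forall>j<length e. if e ! j \<le> n then f j \<in> ring_part R (nat (n - e ! j)) else f j = \<zero>\<^bsub>R\<^esub>})"

record ('a, 'l) gresolution =
  shifts :: "nat \<Rightarrow> int list"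
  diff :: "nat \<Rightarrow> (nat \<Rightarrow> 'a) \<Rightarrow> nat \<Rightarrow> 'a"
  aug :: "(nat \<Rightarrow> 'a) \<Rightarrow> 'l"

definition res_module :: "'a gring \<Rightarrow> ('a, 'l) gresolution \<Rightarrow> nat \<Rightarrow> ('a, nat \<Rightarrow> 'a) gmodule" where
  "res_module R F i = gfree R (shifts F i)"

text \<open>Graded free resolutions \<open>\<dots> \<rightarrow> F\<^sub>2 \<rightarrow> F\<^sub>1 \<rightarrow> F\<^sub>0 \<rightarrow> L \<rightarrow> 0\<close>
  by finitely generated free modules, with \<open>diff F i : F\<^sub>i\<^sub>+\<^sub>1 \<rightarrow> F\<^sub>i\<close>.\<close>

definition graded_free_resolution :: "'a gring \<Rightarrow> ('a, 'l) gmodule \<Rightarrow> ('a, 'l) gresolution \<Rightarrow> bool" where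
  "graded_free_resolution R L F \<longleftrightarrow>
     graded_hom R (res_module R F 0) L (aug F) \<and>
     (\<forall>i. graded_hom R (res_module R F (Suc i)) (res_module R F i) (diff F i)) \<and>
     aug F ` carrier (res_module R F 0) = carrier L \<and>
     diff F 0 ` carrier (res_module R F 1) = a_kernel (res_module R F 0) L (aug F) \<and>
     (\<forall>i. diff F (Suc i) ` carrier (res_module R F (Suc (Suc i))) =
        a_kernel (res_module R F (Suc i)) (res_module R F i) (diff F i))"

text \<open>Every finitely generated graded module over a Noetherian graded ring has such a resolution;
  as usual, \<open>Tor\<close> is computed from a chosen one and is independent of it up to graded
  isomorphism.\<close>

definition resolution :: "'a gring \<Rightarrow> ('a, 'l) gmodule \<Rightarrow> ('a, 'l) gresolution" where
  "resolution R L = (SOME F. graded_free_resolution R L F)"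

definition tor_chain :: "'a gring \<Rightarrow> nat \<Rightarrow> ('a, 'l) gmodule \<Rightarrow> ('a, 'b) gmodule
    \<Rightarrow> ('a, ((nat \<Rightarrow> 'a) \<times> 'b \<Rightarrow> 'a) set) gmodule" where
  "tor_chain R i L E = gtensor R (res_module R (resolution R L) i) E"

definition tor_diff :: "'a gring \<Rightarrow> nat \<Rightarrow> ('a, 'l) gmodule \<Rightarrow> ('a, 'b) gmodule
    \<Rightarrow> ((nat \<Rightarrow> 'a) \<times> 'b \<Rightarrow> 'a) set \<Rightarrow> ((nat \<Rightarrow> 'a) \<times> 'b \<Rightarrow> 'a) set" where
  "tor_diff R i L E =
     tensor_map R (res_module R (resolution R L) i) E (diff (resolution R L) i) id"

definition tor_cycles :: "'a gring \<Rightarrow> nat \<Rightarrow> ('a, 'l) gmodule \<Rightarrow> ('a, 'b) gmodule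
    \<Rightarrow> ((nat \<Rightarrow> 'a) \<times> 'b \<Rightarrow> 'a) set set" where
  "tor_cycles R k L E = (case k of
     0 \<Rightarrow> carrier (tor_chain R 0 L E)
   | Suc i \<Rightarrow> a_kernel (tor_chain R (Suc i) L E) (tor_chain R i L E) (tor_diff R i L E))"

definition tor_boundaries :: "'a gring \<Rightarrow> nat \<Rightarrow> ('a, 'l) gmodule \<Rightarrow> ('a, 'b) gmodule
    \<Rightarrow> ((nat \<Rightarrow> 'a) \<times> 'b \<Rightarrow> 'a) set set" where
  "tor_boundaries R k L E = tor_diff R k L E ` carrier (tor_chain R (Suc k) L E)"

type_synonym ('a, 'b) tor = "((nat \<Rightarrow> 'a) \<times> 'b \<Rightarrow> 'a) set set"

definition Tor :: "'a gring \<Rightarrow> nat \<Rightarrow> ('a, 'l) gmodule \<Rightarrow> ('a, 'b) gmodule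
    \<Rightarrow> ('a, ('a, 'b) tor) gmodule" where
  "Tor R k L E = gquotient (gsub (tor_chain R k L E) (tor_cycles R k L E)) (tor_boundaries R k L E)"

text \<open>\<open>Tor_map R k L E' g\<close> is the map from \<open>Tor R k L E\<close> to \<open>Tor R k L E'\<close> induced by a linear
  \<open>g : E \<rightarrow> E'\<close>.\<close>

definition Tor_map :: "'a gring \<Rightarrow> nat \<Rightarrow> ('a, 'l) gmodule \<Rightarrow> ('a, 'c) gmodule
    \<Rightarrow> ('b \<Rightarrow> 'c) \<Rightarrow> ('a, 'b) tor \<Rightarrow> ('a, 'c) tor" where
  "Tor_map R k L E' g =
     coset_map (tor_chain R k L E') (tor_boundaries R k L E')
       (tensor_map R (res_module R (resolution R L) k) E' id g)"


section \<open>Reductions, annihilators, associated primes and v-numbers\<close>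

abbreviation ideal_pow :: "('a, 'r) ring_scheme \<Rightarrow> 'a set \<Rightarrow> nat \<Rightarrow> 'a set" where
  "ideal_pow R I n \<equiv> I [^]\<^bsub>ideals_set R\<^esub> n"

definition reduction :: "('a, 'r) ring_scheme \<Rightarrow> 'a set \<Rightarrow> 'a set \<Rightarrow> bool" where
  "reduction R J I \<longleftrightarrow> ideal J R \<and> ideal I R \<and> J \<subseteq> I \<and>
     (\<exists>m. ideal_prod R J (ideal_pow R I m) = ideal_pow R I (Suc m))"

definition ann_elem :: "('a, 'r) ring_scheme \<Rightarrow> ('a, 'b, 'z) module_scheme \<Rightarrow> 'b \<Rightarrow> 'a set" where
  "ann_elem R E x = {r \<in> carrier R. r \<odot>\<^bsub>E\<^esub> x = \<zero>\<^bsub>E\<^esub>}"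

definition annihilator :: "('a, 'r) ring_scheme \<Rightarrow> ('a, 'b, 'z) module_scheme \<Rightarrow> 'a set" where
  "annihilator R E = {r \<in> carrier R. \<forall>x\<in>carrier E. r \<odot>\<^bsub>E\<^esub> x = \<zero>\<^bsub>E\<^esub>}"

definition radical :: "('a, 'r) ring_scheme \<Rightarrow> 'a set \<Rightarrow> 'a set" where
  "radical R A = {r \<in> carrier R. \<exists>m::nat. r [^]\<^bsub>R\<^esub> m \<in> A}"

definition Ass :: "('a, 'r) ring_scheme \<Rightarrow> ('a, 'b, 'z) module_scheme \<Rightarrow> 'a set set" where
  "Ass R E = {p. primeideal p R \<and> (\<exists>x\<in>carrier E. p = ann_elem R E x)}"

text \<open>The infima are taken in the extended reals, so that \<open>Inf {} = \<infinity>\<close>.\<close>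

definition indeg :: "('a, 'b) gmodule \<Rightarrow> ereal" where
  "indeg E = Inf {ereal (of_int n) | n. mod_part E n \<noteq> {\<zero>\<^bsub>E\<^esub>}}"

definition local_v_number :: "'a gring \<Rightarrow> 'a set \<Rightarrow> ('a, 'b) gmodule \<Rightarrow> ereal" where
  "local_v_number R p E = Inf {ereal (of_int n) | n. \<exists>x\<in>mod_part E n. p = ann_elem R E x}"

definition v_number :: "'a gring \<Rightarrow> ('a, 'b) gmodule \<Rightarrow> ereal" where
  "v_number R E = Inf {local_v_number R p E | p. p \<in> Ass R E}"


section \<open>Rees objects\<close>

text \<open>The Rees algebra as the subring of the polynomial ring over \<open>R\<close> of all
  \<open>\<Sum> a\<^sub>n t\<^sup>n\<close> with \<open>a\<^sub>n\<close> in the \<open>n\<close>-th power of \<open>J\<close>.\<close>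

definition rees_algebra :: "('a, 'r) ring_scheme \<Rightarrow> 'a set \<Rightarrow> ('a, nat \<Rightarrow> 'a) up_ring" where
  "rees_algebra R J =
     (UP R)\<lparr>carrier := {s \<in> carrier (UP R). \<forall>n. coeff (UP R) s n \<in> ideal_pow R J n}\<rparr>"

definition rees_piece ::
  "'a gring \<Rightarrow> 'a set \<Rightarrow> ('a, 'b) gmodule \<Rightarrow> 'b set \<Rightarrow> nat \<Rightarrow> ('a, 'b set) gmodule" where
  "rees_piece R I M N n = gquotient
     (gsub M (ideal_smult R M (ideal_pow R I n) (carrier M))) (ideal_smult R M (ideal_pow R I n) N)"

text \<open>For \<open>a\<close> in the \<open>r\<close>-th power of \<open>I\<close>, \<open>rees_piece_mult R I M N (n + r) a\<close> is multiplication
  by \<open>a\<close> from \<open>rees_piece R I M N n\<close> to \<open>rees_piece R I M N (n + r)\<close>.\<close>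

definition rees_piece_mult ::
  "'a gring \<Rightarrow> 'a set \<Rightarrow> ('a, 'b) gmodule \<Rightarrow> 'b set \<Rightarrow> nat \<Rightarrow> 'a \<Rightarrow> 'b set \<Rightarrow> 'b set" where
  "rees_piece_mult R I M N m a =
     coset_map M (ideal_smult R M (ideal_pow R I m) N) (\<lambda>x. a \<odot>\<^bsub>M\<^esub> x)"

text \<open>The direct sum of the modules \<open>Tor R k L (rees_piece R I M N n)\<close> as a module over
  \<open>rees_algebra R I\<close>, and by restriction over \<open>rees_algebra R J\<close> for \<open>J \<subseteq> I\<close>: the component of
  \<open>s \<cdot> h\<close> in degree \<open>m\<close> is the sum over \<open>r \<le> m\<close> of the images of \<open>h\<^sub>m\<^sub>-\<^sub>r\<close> under the maps
  induced by multiplication by \<open>s\<^sub>r\<close>.\<close>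

definition Tor_rees :: "'a gring \<Rightarrow> nat \<Rightarrow> ('a, 'l) gmodule \<Rightarrow> 'a set \<Rightarrow> ('a, 'b) gmodule \<Rightarrow> 'b set
    \<Rightarrow> (nat \<Rightarrow> 'a, nat \<Rightarrow> ('a, 'b set) tor) module" where
  "Tor_rees R k L I M N = (let H = (\<lambda>n. Tor R k L (rees_piece R I M N n)) in \<lparr>
     carrier = {h. (\<forall>n. h n \<in> carrier (H n)) \<and> finite {n. h n \<noteq> \<zero>\<^bsub>H n\<^esub>}},
     monoid.mult = undefined, one = undefined,
     ring.zero = (\<lambda>n. \<zero>\<^bsub>H n\<^esub>), add = (\<lambda>h h' n. h n \<oplus>\<^bsub>H n\<^esub> h' n),
     smult = (\<lambda>s h m. \<Oplus>\<^bsub>H m\<^esub> r\<in>{..m}.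
        Tor_map R k L (rees_piece R I M N m)
          (rees_piece_mult R I M N m (coeff (UP R) s r)) (h (m - r)))\<rparr>)"

end

theory Submission
  imports Defs "HOL-Library.Multiset_Order"
begin

text \<open>Let \<open>F\<close> be the chosen resolution of \<open>L\<close>. Then \<open>H\<^sub>n = Z\<^sub>n/B\<^sub>n\<close> for graded submodules
  \<open>B\<^sub>n \<subseteq> Z\<^sub>n\<close> of one fixed graded module, the direct sum \<open>W\<close> of shifted copies of \<open>M\<close> given by
  \<open>F\<^sub>k \<otimes> M\<close>, and multiplication by \<open>y\<^sub>j\<close> maps \<open>Z\<^sub>n\<close> and \<open>B\<^sub>n\<close> to \<open>Z\<^sub>n\<^sub>+\<^sub>1\<close> and \<open>B\<^sub>n\<^sub>+\<^sub>1\<close>.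
  As \<open>J\<close> is a reduction of \<open>I\<close>, the \<open>Z\<^sub>n\<close> lie in a family with \<open>E\<^sub>n\<^sub>+\<^sub>1 = J E\<^sub>n\<close> for large \<open>n\<close>, and an
  Artin-Rees argument shows that every family of submodules of the \<open>Z\<^sub>n\<close> that is stable under the
  \<open>y\<^sub>j\<close> is finally generated by them as well.

  For two such families \<open>K\<^sub>n \<subseteq> P\<^sub>n\<close> the initial degree of \<open>P\<^sub>n/K\<^sub>n\<close> is the minimum of
  \<open>deg y\<^sup>\<alpha> + deg g\<close> over finitely many generators \<open>g\<close> and the exponents \<open>\<alpha>\<close> of size \<open>n - n\<^sub>0\<close> with
  \<open>y\<^sup>\<alpha> g \<notin> K\<^sub>n\<close>. These exponents are closed under divisors, so the minimum is eventually linear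
  with slope the least \<open>d\<^sub>j\<close> for which \<open>y\<^sub>j\<close> acts non-nilpotently. This applies to \<open>Z\<^sub>n/B\<^sub>n\<close> and, for
  an associated prime \<open>p\<close>, to the elements of \<open>H\<^sub>n\<close> killed by \<open>p\<close> modulo those killed by an element
  outside \<open>p\<close>, whose initial degree is the local v-number. Only finitely many primes occur, and
  some prime sees the non-nilpotency of \<open>y\<^sub>\<delta>\<close>, which gives the v-number.\<close>


section \<open>Submodules, spans and linear maps\<close>

text \<open>Elements of \<open>Tor\<close> are cosets of cosets built from a resolution picked by
  \<open>SOME\<close>, so classes for different \<open>n\<close> cannot be compared directly.
  Freeness of the modules in the resolution removes this obstacle: a free module of rank r tensored
  with P/Q is P^r/Q^r, so a class becomes a vector over \<open>M\<close> modulo boundaries. No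
  module over the Rees algebra is formed either. Such a module is represented by a sequence of
  submodules that the \<open>y j\<close> carry from one stage to the next; finite generation reads
  "the next stage is \<open>J\<close> times the present one, for large \<open>n\<close>", and the
  chain condition is proved for such sequences. The reduction hypothesis makes (I^n M)^r finally
  generated by the \<open>y j\<close>, which is why slopes are degrees of the \<open>y j\<close> and
  not of generators of \<open>I\<close>. Elements with annihilator exactly \<open>p\<close> do not
  form a submodule, but those killed by \<open>p\<close> do, and so do, for \<open>p\<close> prime,
  the ones among them that are also killed by something outside \<open>p\<close>. An initial degree
  of this pair is what the general argument can handle. Fewer of the \<open>y j\<close> may act
  non-nilpotently on this pair than on the whole of \<open>Tor\<close>, so the slope at a single
  prime can be larger than \<open>d \<delta>\<close>.\<close>

lemma (in cring) idealI_cring: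
  assumes "A \<subseteq> carrier R" "\<zero> \<in> A" "\<And>a b. a \<in> A \<Longrightarrow> b \<in> A \<Longrightarrow> a \<oplus> b \<in> A"
    and "\<And>r a. r \<in> carrier R \<Longrightarrow> a \<in> A \<Longrightarrow> r \<otimes> a \<in> A"
  shows "ideal A R"
proof (rule idealI)
  show "ring R" by (rule ring_axioms)
  show "subgroup A (add_monoid R)"
  proof (rule add.subgroupI)
    fix a assume a: "a \<in> A"
    then have "\<ominus> a = (\<ominus> \<one>) \<otimes> a"
      using assms(1) by (auto simp: l_minus)
    then show "\<ominus> a \<in> A"
      using assms(4)[OF _ a, of "\<ominus> \<one>"] by simp
  qed (use assms in auto)
next
  fix a x assume "a \<in> A" "x \<in> carrier R"
  then show "x \<otimes> a \<in> A" "a \<otimes> x \<in> A"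
    using assms(1,4) m_comm[of a x] by auto
qed

context module
begin

lemma submoduleI':
  assumes "P \<subseteq> carrier M" "\<zero>\<^bsub>M\<^esub> \<in> P" "\<And>x y. x \<in> P \<Longrightarrow> y \<in> P \<Longrightarrow> x \<oplus>\<^bsub>M\<^esub> y \<in> P"
    and "\<And>r x. r \<in> carrier R \<Longrightarrow> x \<in> P \<Longrightarrow> r \<odot>\<^bsub>M\<^esub> x \<in> P"
  shows "submodule P R M"
proof (rule submoduleI)
  fix a assume a: "a \<in> P"
  then have "\<ominus>\<^bsub>M\<^esub> a = (\<ominus> \<one>) \<odot>\<^bsub>M\<^esub> a"
    using assms(1) by (auto simp: smult_l_minus)
  then show "\<ominus>\<^bsub>M\<^esub> a \<in> P"
    using assms(4)[OF _ a, of "\<ominus> \<one>"] by simp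
qed (use assms in auto)

lemma submoduleD:
  assumes "submodule P R M"
  shows "x \<in> P \<Longrightarrow> x \<in> carrier M" "\<zero>\<^bsub>M\<^esub> \<in> P" "x \<in> P \<Longrightarrow> y \<in> P \<Longrightarrow> x \<oplus>\<^bsub>M\<^esub> y \<in> P"
    "r \<in> carrier R \<Longrightarrow> x \<in> P \<Longrightarrow> r \<odot>\<^bsub>M\<^esub> x \<in> P" "x \<in> P \<Longrightarrow> \<ominus>\<^bsub>M\<^esub> x \<in> P"
    "x \<in> P \<Longrightarrow> y \<in> P \<Longrightarrow> x \<ominus>\<^bsub>M\<^esub> y \<in> P"
proof -
  note E = submoduleE[OF assms]
  show "x \<in> P \<Longrightarrow> x \<in> carrier M" "x \<in> P \<Longrightarrow> y \<in> P \<Longrightarrow> x \<oplus>\<^bsub>M\<^esub> y \<in> P"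
    "r \<in> carrier R \<Longrightarrow> x \<in> P \<Longrightarrow> r \<odot>\<^bsub>M\<^esub> x \<in> P" "x \<in> P \<Longrightarrow> \<ominus>\<^bsub>M\<^esub> x \<in> P"
    using E by auto
  show "\<zero>\<^bsub>M\<^esub> \<in> P"
    using subgroup.one_closed[OF submodule.axioms(1)[OF assms]] by simp
  show "x \<in> P \<Longrightarrow> y \<in> P \<Longrightarrow> x \<ominus>\<^bsub>M\<^esub> y \<in> P"
    using E(5) E(3) by (auto simp: a_minus_def)
qed

lemma submodule_additive: "submodule P R M \<Longrightarrow> additive_subgroup P M"
  by (rule additive_subgroup.intro) (rule submodule.axioms(1))

lemma submodule_finsum:
  assumes "submodule P R M" "\<And>i. i \<in> A \<Longrightarrow> f i \<in> P"
  shows "finsum M f A \<in> P"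
  using assms(2)
proof (induction A rule: infinite_finite_induct)
  case (insert a A)
  then show ?case
    using submoduleD(1,3)[OF assms(1)] by (subst finsum_insert) auto
qed (use submoduleD(2)[OF assms(1)] in auto)

lemma submodule_diff_iff:
  assumes "submodule P R M" "x \<in> carrier M" "y \<in> carrier M" "x \<ominus>\<^bsub>M\<^esub> y \<in> P"
  shows "x \<in> P \<longleftrightarrow> y \<in> P"
proof
  note D = submoduleD[OF assms(1)]
  assume "x \<in> P"
  then have "x \<ominus>\<^bsub>M\<^esub> (x \<ominus>\<^bsub>M\<^esub> y) \<in> P" using D(6) assms(4) by blast
  moreover have "x \<ominus>\<^bsub>M\<^esub> (x \<ominus>\<^bsub>M\<^esub> y) = y"
    using assms by (simp add: a_minus_def M.minus_add M.a_assoc[symmetric] M.r_neg)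
  ultimately show "y \<in> P" by simp
next
  note D = submoduleD[OF assms(1)]
  assume "y \<in> P"
  then have "(x \<ominus>\<^bsub>M\<^esub> y) \<oplus>\<^bsub>M\<^esub> y \<in> P" using D(3) assms(4) by blast
  moreover have "(x \<ominus>\<^bsub>M\<^esub> y) \<oplus>\<^bsub>M\<^esub> y = x"
    using assms by (simp add: a_minus_def M.a_assoc M.l_neg)
  ultimately show "x \<in> P" by simp
qed

lemma submodule_Int: "submodule P R M \<Longrightarrow> submodule Q R M \<Longrightarrow> submodule (P \<inter> Q) R M"
  by (rule submoduleI') (auto dest: submoduleD)

lemma submodule_sum:
  assumes "submodule P R M" "submodule Q R M"
  shows "submodule {x \<oplus>\<^bsub>M\<^esub> y | x y. x \<in> P \<and> y \<in> Q} R M"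
proof (rule submoduleI')
  note P = submoduleD[OF assms(1)] and Q = submoduleD[OF assms(2)]
  show "{x \<oplus>\<^bsub>M\<^esub> y | x y. x \<in> P \<and> y \<in> Q} \<subseteq> carrier M" using P(1) Q(1) by auto
  show "\<zero>\<^bsub>M\<^esub> \<in> {x \<oplus>\<^bsub>M\<^esub> y | x y. x \<in> P \<and> y \<in> Q}" using P(2) Q(2) by force
  fix u v assume "u \<in> {x \<oplus>\<^bsub>M\<^esub> y | x y. x \<in> P \<and> y \<in> Q}" "v \<in> {x \<oplus>\<^bsub>M\<^esub> y | x y. x \<in> P \<and> y \<in> Q}"
  then obtain x y x' y' where *: "u = x \<oplus>\<^bsub>M\<^esub> y" "v = x' \<oplus>\<^bsub>M\<^esub> y'" "x \<in> P" "x' \<in> P" "y \<in> Q" "y' \<in> Q"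
    by auto
  moreover have "u \<oplus>\<^bsub>M\<^esub> v = (x \<oplus>\<^bsub>M\<^esub> x') \<oplus>\<^bsub>M\<^esub> (y \<oplus>\<^bsub>M\<^esub> y')"
    using * P(1) Q(1) by (simp add: M.a_ac)
  ultimately show "u \<oplus>\<^bsub>M\<^esub> v \<in> {x \<oplus>\<^bsub>M\<^esub> y | x y. x \<in> P \<and> y \<in> Q}"
    using P(3) Q(3) by blast
next
  note P = submoduleD[OF assms(1)] and Q = submoduleD[OF assms(2)]
  fix r u assume r: "r \<in> carrier R" and "u \<in> {x \<oplus>\<^bsub>M\<^esub> y | x y. x \<in> P \<and> y \<in> Q}"
  then obtain x y where *: "u = x \<oplus>\<^bsub>M\<^esub> y" "x \<in> P" "y \<in> Q" by auto
  then have "r \<odot>\<^bsub>M\<^esub> u = r \<odot>\<^bsub>M\<^esub> x \<oplus>\<^bsub>M\<^esub> r \<odot>\<^bsub>M\<^esub> y"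
    using r P(1) Q(1) by (simp add: smult_r_distr)
  then show "r \<odot>\<^bsub>M\<^esub> u \<in> {x \<oplus>\<^bsub>M\<^esub> y | x y. x \<in> P \<and> y \<in> Q}"
    using P(4) Q(4) r * by blast
qed

lemma submodule_cyclic:
  assumes "x \<in> carrier M"
  shows "submodule {r \<odot>\<^bsub>M\<^esub> x | r. r \<in> carrier R} R M"
proof (rule submoduleI')
  show "\<zero>\<^bsub>M\<^esub> \<in> {r \<odot>\<^bsub>M\<^esub> x | r. r \<in> carrier R}"
    using assms by (force intro: exI[of _ "\<zero>"])
next
  fix u v assume "u \<in> {r \<odot>\<^bsub>M\<^esub> x | r. r \<in> carrier R}" "v \<in> {r \<odot>\<^bsub>M\<^esub> x | r. r \<in> carrier R}"
  then show "u \<oplus>\<^bsub>M\<^esub> v \<in> {r \<odot>\<^bsub>M\<^esub> x | r. r \<in> carrier R}"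
    using assms by (auto simp: smult_l_distr[symmetric])
next
  fix s u assume "s \<in> carrier R" "u \<in> {r \<odot>\<^bsub>M\<^esub> x | r. r \<in> carrier R}"
  then show "s \<odot>\<^bsub>M\<^esub> u \<in> {r \<odot>\<^bsub>M\<^esub> x | r. r \<in> carrier R}"
    using assms by (auto simp: smult_assoc1[symmetric])
qed (use assms in auto)

lemma submodule_zero: "submodule {\<zero>\<^bsub>M\<^esub>} R M"
  by (rule submoduleI') auto

lemma span_submodule:
  assumes "S \<subseteq> carrier M"
  shows "submodule (span R M S) R M"
proof (rule submoduleI')
  show "span R M S \<subseteq> carrier M"
    unfolding span_def using carrier_is_submodule assms by blast
qed (auto simp: span_def dest: submoduleD)

lemma span_superset: "S \<subseteq> span R M S"
  by (auto simp: span_def)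

lemma span_least: "submodule P R M \<Longrightarrow> S \<subseteq> P \<Longrightarrow> span R M S \<subseteq> P"
  by (auto simp: span_def)

lemma span_mono: "S \<subseteq> T \<Longrightarrow> span R M S \<subseteq> span R M T"
  by (auto simp: span_def)

lemma span_insert:
  assumes "x \<in> carrier M" "S \<subseteq> carrier M" "u \<in> span R M (insert x S)"
  shows "\<exists>r\<in>carrier R. \<exists>s\<in>span R M S. u = r \<odot>\<^bsub>M\<^esub> x \<oplus>\<^bsub>M\<^esub> s"
proof -
  let ?P = "{r \<odot>\<^bsub>M\<^esub> x | r. r \<in> carrier R}" and ?Q = "span R M S"
  let ?T = "{a \<oplus>\<^bsub>M\<^esub> b | a b. a \<in> ?P \<and> b \<in> ?Q}"
  note sQ = span_submodule[OF assms(2)]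
  have sub: "submodule ?T R M"
    by (rule submodule_sum[OF submodule_cyclic[OF assms(1)] sQ])
  have "\<one> \<odot>\<^bsub>M\<^esub> x \<in> ?P" by blast
  moreover have "\<one> \<odot>\<^bsub>M\<^esub> x \<oplus>\<^bsub>M\<^esub> \<zero>\<^bsub>M\<^esub> = x" using assms by simp
  ultimately have "x \<in> ?T" using submoduleD(2)[OF sQ] by (metis (mono_tags, lifting) mem_Collect_eq)
  moreover have "s \<in> ?T" if "s \<in> S" for s
  proof -
    have "\<zero> \<odot>\<^bsub>M\<^esub> x \<in> ?P" by blast
    moreover have "s \<in> ?Q" using that span_superset by blast
    moreover have "\<zero> \<odot>\<^bsub>M\<^esub> x \<oplus>\<^bsub>M\<^esub> s = s" using assms that by auto
    ultimately show ?thesis by (metis (mono_tags, lifting) mem_Collect_eq)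
  qed
  ultimately have "span R M (insert x S) \<subseteq> ?T" by (intro span_least[OF sub]) auto
  then have "u \<in> ?T" using assms(3) by blast
  then obtain a b where "u = a \<oplus>\<^bsub>M\<^esub> b" "a \<in> ?P" "b \<in> ?Q" by auto
  then show ?thesis by auto
qed

text \<open>The vectors that multiplication by \<open>r\<close> sends into the right-hand span form
  a submodule containing \<open>S\<close>; commutativity of the ring makes it closed under
  scalars.\<close>

lemma smult_span:
  assumes "S \<subseteq> carrier M" "r \<in> carrier R" "u \<in> span R M S"
  shows "r \<odot>\<^bsub>M\<^esub> u \<in> span R M ((\<lambda>x. r \<odot>\<^bsub>M\<^esub> x) ` S)"
proof -
  let ?S = "(\<lambda>x. r \<odot>\<^bsub>M\<^esub> x) ` S"
  have S: "?S \<subseteq> carrier M" using assms by auto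
  note D = submoduleD[OF span_submodule[OF S]]
  have "submodule {x \<in> carrier M. r \<odot>\<^bsub>M\<^esub> x \<in> span R M ?S} R M"
  proof (rule submoduleI')
    fix s x assume s: "s \<in> carrier R" and x: "x \<in> {x \<in> carrier M. r \<odot>\<^bsub>M\<^esub> x \<in> span R M ?S}"
    then have "s \<odot>\<^bsub>M\<^esub> (r \<odot>\<^bsub>M\<^esub> x) \<in> span R M ?S" using D(4) by simp
    moreover have "s \<odot>\<^bsub>M\<^esub> (r \<odot>\<^bsub>M\<^esub> x) = r \<odot>\<^bsub>M\<^esub> (s \<odot>\<^bsub>M\<^esub> x)"
      using x s assms(2) by (simp add: smult_assoc1[symmetric] R.m_comm)
    ultimately show "s \<odot>\<^bsub>M\<^esub> x \<in> {x \<in> carrier M. r \<odot>\<^bsub>M\<^esub> x \<in> span R M ?S}"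
      using x s by simp
  qed (use assms D in \<open>auto simp: smult_r_distr\<close>)
  moreover have "S \<subseteq> {x \<in> carrier M. r \<odot>\<^bsub>M\<^esub> x \<in> span R M ?S}"
    using assms(1) span_superset[of ?S] by auto
  ultimately show ?thesis using span_least assms(3) by blast
qed

end

text \<open>Linearity without degrees: \<open>graded_hom\<close> needs a grading on both sides,
  whereas free modules, tensor modules and plain quotients have none, and source and target may be
  records of different types.\<close>

definition linear_map ::
  "('a, 'r) ring_scheme \<Rightarrow> ('a, 'b, 'y) module_scheme \<Rightarrow> ('a, 'c, 'z) module_scheme \<Rightarrow> ('b \<Rightarrow> 'c) \<Rightarrow> bool" where
  "linear_map R A B f \<longleftrightarrow> f \<in> carrier A \<rightarrow> carrier B \<and>
     (\<forall>x\<in>carrier A. \<forall>y\<in>carrier A. f (x \<oplus>\<^bsub>A\<^esub> y) = f x \<oplus>\<^bsub>B\<^esub> f y) \<and>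
     (\<forall>r\<in>carrier R. \<forall>x\<in>carrier A. f (r \<odot>\<^bsub>A\<^esub> x) = r \<odot>\<^bsub>B\<^esub> f x)"

lemma linear_mapI:
  assumes "\<And>x. x \<in> carrier A \<Longrightarrow> f x \<in> carrier B"
    and "\<And>x y. x \<in> carrier A \<Longrightarrow> y \<in> carrier A \<Longrightarrow> f (x \<oplus>\<^bsub>A\<^esub> y) = f x \<oplus>\<^bsub>B\<^esub> f y"
    and "\<And>r x. r \<in> carrier R \<Longrightarrow> x \<in> carrier A \<Longrightarrow> f (r \<odot>\<^bsub>A\<^esub> x) = r \<odot>\<^bsub>B\<^esub> f x"
  shows "linear_map R A B f"
  using assms by (auto simp: linear_map_def)

lemma linear_mapD:
  assumes "linear_map R A B f"
  shows "x \<in> carrier A \<Longrightarrow> f x \<in> carrier B"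
    "x \<in> carrier A \<Longrightarrow> y \<in> carrier A \<Longrightarrow> f (x \<oplus>\<^bsub>A\<^esub> y) = f x \<oplus>\<^bsub>B\<^esub> f y"
    "r \<in> carrier R \<Longrightarrow> x \<in> carrier A \<Longrightarrow> f (r \<odot>\<^bsub>A\<^esub> x) = r \<odot>\<^bsub>B\<^esub> f x"
  using assms by (auto simp: linear_map_def)

lemma graded_hom_linear: "graded_hom R A B f \<Longrightarrow> linear_map R A B f"
  by (auto simp: linear_map_def graded_hom_def)

lemma linear_map_comp:
  "linear_map R A B f \<Longrightarrow> linear_map R B C g \<Longrightarrow> linear_map R A C (\<lambda>x. g (f x))"
  by (auto simp: linear_map_def Pi_iff)

lemma linear_map_zero:
  assumes "module R A" "module R B" "linear_map R A B f"
  shows "f \<zero>\<^bsub>A\<^esub> = \<zero>\<^bsub>B\<^esub>"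
proof -
  interpret A: module R A by fact
  interpret B: module R B by fact
  have "f (\<zero>\<^bsub>R\<^esub> \<odot>\<^bsub>A\<^esub> \<zero>\<^bsub>A\<^esub>) = \<zero>\<^bsub>R\<^esub> \<odot>\<^bsub>B\<^esub> f \<zero>\<^bsub>A\<^esub>"
    by (rule linear_mapD(3)[OF assms(3)]) auto
  then show ?thesis using linear_mapD(1)[OF assms(3)] by simp
qed

lemma linear_map_minus:
  assumes "module R A" "module R B" "linear_map R A B f" "x \<in> carrier A" "y \<in> carrier A"
  shows "f (x \<ominus>\<^bsub>A\<^esub> y) = f x \<ominus>\<^bsub>B\<^esub> f y"
proof -
  interpret A: module R A by fact
  interpret B: module R B by fact
  note f = linear_mapD[OF assms(3)]
  have "f (\<ominus>\<^bsub>A\<^esub> y) = \<ominus>\<^bsub>B\<^esub> f y"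
  proof -
    have "f ((\<ominus>\<^bsub>R\<^esub> \<one>\<^bsub>R\<^esub>) \<odot>\<^bsub>A\<^esub> y) = (\<ominus>\<^bsub>R\<^esub> \<one>\<^bsub>R\<^esub>) \<odot>\<^bsub>B\<^esub> f y"
      by (rule f(3)) (use assms in auto)
    then show ?thesis using assms(5) f(1) by (simp add: A.smult_l_minus B.smult_l_minus)
  qed
  then show ?thesis using assms(4,5) f by (simp add: a_minus_def)
qed

lemma linear_map_finsum:
  assumes "module R A" "module R B" "linear_map R A B f" "\<And>i. i \<in> I \<Longrightarrow> g i \<in> carrier A"
  shows "f (finsum A g I) = finsum B (\<lambda>i. f (g i)) I"
proof -
  interpret A: module R A by fact
  interpret B: module R B by fact
  note f = linear_mapD[OF assms(3)]
  show ?thesis using assms(4)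
  proof (induction I rule: infinite_finite_induct)
    case (insert a I)
    then show ?case
      by (subst A.finsum_insert, simp, simp, auto, subst B.finsum_insert)
         (auto simp: f intro!: A.finsum_closed)
  qed (auto simp: linear_map_zero[OF assms(1-3)])
qed

lemma linear_map_preimage:
  assumes "module R A" "module R B" "linear_map R A B f" "submodule P R B"
  shows "submodule {x \<in> carrier A. f x \<in> P} R A"
proof -
  interpret A: module R A by fact
  interpret B: module R B by fact
  show ?thesis
    by (rule A.submoduleI')
       (use linear_mapD[OF assms(3)] linear_map_zero[OF assms(1-3)] B.submoduleD[OF assms(4)] in auto)
qed

lemma linear_map_image:
  assumes "module R A" "module R B" "linear_map R A B f" "submodule P R A"
  shows "submodule (f ` P) R B"
proof -
  interpret A: module R A by fact
  interpret B: module R B by fact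
  note f = linear_mapD[OF assms(3)] and P = A.submoduleD[OF assms(4)]
  show ?thesis
  proof (rule B.submoduleI')
    show "\<zero>\<^bsub>B\<^esub> \<in> f ` P"
      using linear_map_zero[OF assms(1-3)] P(2) by (metis imageI)
    fix u v assume "u \<in> f ` P" "v \<in> f ` P"
    then obtain x y where "u = f x" "v = f y" "x \<in> P" "y \<in> P" by auto
    then show "u \<oplus>\<^bsub>B\<^esub> v \<in> f ` P"
      using f(2)[of x y] P(1,3) by (metis imageI)
  next
    fix r u assume "r \<in> carrier R" "u \<in> f ` P"
    then show "r \<odot>\<^bsub>B\<^esub> u \<in> f ` P" using f(3) P(1,4) by (auto simp flip: f(3))
  qed (use P(1) f(1) in auto)
qed

lemma linear_map_span:
  assumes "module R A" "module R B" "linear_map R A B f" "S \<subseteq> carrier A" "x \<in> span R A S"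
    and "submodule P R B" "f ` S \<subseteq> P"
  shows "f x \<in> P"
proof -
  interpret A: module R A by fact
  have "span R A S \<subseteq> {x \<in> carrier A. f x \<in> P}"
    by (rule A.span_least[OF linear_map_preimage[OF assms(1-3,6)]]) (use assms in auto)
  then show ?thesis using assms(5) by auto
qed

section \<open>Quotients\<close>

lemma quotient_module_simps [simp]:
  "carrier (quotient_module M P) = a_rcosets\<^bsub>M\<^esub> P"
  "\<zero>\<^bsub>quotient_module M P\<^esub> = P" "add (quotient_module M P) = set_add M"
  "smult (quotient_module M P) = (\<lambda>r. coset_map M P (\<lambda>x. r \<odot>\<^bsub>M\<^esub> x))"
  by (simp_all add: quotient_module_def)

context module
begin

lemma coset_eq_iff:
  assumes "submodule P R M" "x \<in> carrier M" "y \<in> carrier M"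
  shows "P +>\<^bsub>M\<^esub> x = P +>\<^bsub>M\<^esub> y \<longleftrightarrow> x \<ominus>\<^bsub>M\<^esub> y \<in> P"
proof -
  interpret P: abelian_subgroup P M
    by (rule abelian_subgroupI3[OF submodule_additive[OF assms(1)]]) unfold_locales
  show ?thesis
    using P.a_rcos_module[OF assms(3,2)] a_repr_independence[OF _ assms(3) P.a_subgroup, of x]
      P.a_rcos_self[OF assms(2)] unfolding a_minus_def by metis
qed

lemma coset_zero_iff:
  assumes "submodule P R M" "x \<in> carrier M"
  shows "P +>\<^bsub>M\<^esub> x = P \<longleftrightarrow> x \<in> P"
proof -
  have "P +>\<^bsub>M\<^esub> \<zero>\<^bsub>M\<^esub> = P" by (rule a_coset_add_zero) (use submoduleD[OF assms(1)] in auto)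
  moreover have "x \<ominus>\<^bsub>M\<^esub> \<zero>\<^bsub>M\<^esub> = x" using assms(2) by (simp add: a_minus_def)
  ultimately show ?thesis using coset_eq_iff[OF assms, of "\<zero>\<^bsub>M\<^esub>"] by simp
qed

lemma coset_add:
  assumes "submodule P R M" "x \<in> carrier M" "y \<in> carrier M"
  shows "(P +>\<^bsub>M\<^esub> x) <+>\<^bsub>M\<^esub> (P +>\<^bsub>M\<^esub> y) = P +>\<^bsub>M\<^esub> (x \<oplus>\<^bsub>M\<^esub> y)"
proof -
  interpret P: abelian_subgroup P M
    by (rule abelian_subgroupI3[OF submodule_additive[OF assms(1)]]) unfold_locales
  show ?thesis using assms P.a_rcos_sum by blast
qed

end

text \<open>The union in \<open>coset_map\<close> runs over all representatives. They differ by
  elements of \<open>Q\<close>, which \<open>g\<close> sends into \<open>P\<close>, so the cosets in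
  the union coincide; as a coset is not empty, the union is that single coset.\<close>

lemma coset_map_coset:
  assumes "module R A" "module R M" "submodule Q R A" "submodule P R M"
    and "\<And>x. x \<in> carrier A \<Longrightarrow> g x \<in> carrier M"
    and "\<And>x y. x \<in> carrier A \<Longrightarrow> y \<in> carrier A \<Longrightarrow> g (x \<oplus>\<^bsub>A\<^esub> y) = g x \<oplus>\<^bsub>M\<^esub> g y"
    and "\<And>x. x \<in> Q \<Longrightarrow> g x \<in> P" and "x \<in> carrier A"
  shows "coset_map M P g (Q +>\<^bsub>A\<^esub> x) = P +>\<^bsub>M\<^esub> g x"
proof -
  interpret A: module R A by fact
  interpret M: module R M by fact
  note Q = A.submoduleD[OF assms(3)] and P = M.submoduleD[OF assms(4)]
  have *: "P +>\<^bsub>M\<^esub> g u = P +>\<^bsub>M\<^esub> g x" if "u \<in> Q +>\<^bsub>A\<^esub> x" for u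
  proof -
    obtain q where q: "q \<in> Q" "u = q \<oplus>\<^bsub>A\<^esub> x" using \<open>u \<in> Q +>\<^bsub>A\<^esub> x\<close> by (auto simp: a_r_coset_def r_coset_def)
    then have "g u = g q \<oplus>\<^bsub>M\<^esub> g x" using assms(6,8) Q(1) by simp
    moreover have "g q \<in> P" using assms(7) q by simp
    ultimately have "g u \<ominus>\<^bsub>M\<^esub> g x \<in> P"
      using assms(5,8) q(1) Q(1) P(1) by (simp add: a_minus_def M.a_assoc M.r_neg)
    then show ?thesis using M.coset_eq_iff[OF assms(4)] assms(5,6,8) q Q(1)
      by (metis A.add.m_closed)
  qed
  have "\<zero>\<^bsub>A\<^esub> \<oplus>\<^bsub>A\<^esub> x \<in> Q +>\<^bsub>A\<^esub> x" using Q(2) by (auto simp: a_r_coset_def r_coset_def)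
  then have "Q +>\<^bsub>A\<^esub> x \<noteq> {}" by blast
  then show ?thesis using * by (auto simp: coset_map_def)
qed

context module
begin

lemma coset_smult:
  assumes "submodule P R M" "x \<in> carrier M" "r \<in> carrier R"
  shows "coset_map M P (\<lambda>x. r \<odot>\<^bsub>M\<^esub> x) (P +>\<^bsub>M\<^esub> x) = P +>\<^bsub>M\<^esub> (r \<odot>\<^bsub>M\<^esub> x)"
  by (rule coset_map_coset[OF module_axioms module_axioms assms(1,1)])
     (use assms submoduleD[OF assms(1)] smult_r_distr in auto)

lemma mem_a_rcosets: "c \<in> a_rcosets\<^bsub>M\<^esub> P \<longleftrightarrow> (\<exists>x\<in>carrier M. c = P +>\<^bsub>M\<^esub> x)"
  by (auto simp: A_RCOSETS_def')

lemma coset_zero: "submodule P R M \<Longrightarrow> P +>\<^bsub>M\<^esub> \<zero>\<^bsub>M\<^esub> = P"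
  by (rule a_coset_add_zero) (use submoduleD in auto)

lemma quotient_is_module:
  assumes "submodule P R M"
  shows "module R (quotient_module M P)"
proof -
  note c = coset_add[OF assms] coset_smult[OF assms] coset_zero[OF assms]
  have P: "P = P +>\<^bsub>M\<^esub> \<zero>\<^bsub>M\<^esub>" using c(3) by simp
  show ?thesis
  proof (rule moduleI)
    show "abelian_group (quotient_module M P)"
    proof (rule abelian_groupI)
      fix x assume "x \<in> carrier (quotient_module M P)"
      then obtain a where a: "a \<in> carrier M" "x = P +>\<^bsub>M\<^esub> a" by (auto simp: mem_a_rcosets)
      then have "(P +>\<^bsub>M\<^esub> (\<ominus>\<^bsub>M\<^esub> a)) \<oplus>\<^bsub>quotient_module M P\<^esub> x = \<zero>\<^bsub>quotient_module M P\<^esub>"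
        by (simp add: c M.l_neg)
      moreover have "P +>\<^bsub>M\<^esub> (\<ominus>\<^bsub>M\<^esub> a) \<in> carrier (quotient_module M P)"
        using a by (auto simp: mem_a_rcosets)
      ultimately show "\<exists>y\<in>carrier (quotient_module M P). y \<oplus>\<^bsub>quotient_module M P\<^esub> x = \<zero>\<^bsub>quotient_module M P\<^esub>"
        by blast
    next
      show "\<zero>\<^bsub>quotient_module M P\<^esub> \<in> carrier (quotient_module M P)"
        using P by (auto simp: mem_a_rcosets)
      fix x assume "x \<in> carrier (quotient_module M P)"
      then obtain a where a: "a \<in> carrier M" "x = P +>\<^bsub>M\<^esub> a" by (auto simp: mem_a_rcosets)
      then show "\<zero>\<^bsub>quotient_module M P\<^esub> \<oplus>\<^bsub>quotient_module M P\<^esub> x = x"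
        using c(1)[of "\<zero>\<^bsub>M\<^esub>" a] by (simp add: c(3))
    qed (auto simp: mem_a_rcosets c M.a_ac)
  qed (use R.is_cring in \<open>auto simp: mem_a_rcosets c smult_l_distr smult_r_distr smult_assoc1\<close>)
qed

lemma coset_linear:
  assumes "submodule P R M"
  shows "linear_map R M (quotient_module M P) (\<lambda>x. P +>\<^bsub>M\<^esub> x)"
  by (rule linear_mapI) (auto simp: mem_a_rcosets coset_add[OF assms] coset_smult[OF assms])

end

lemma coset_map_linear:
  assumes "module R A" "module R M" "submodule Q R A" "submodule P R M" "linear_map R A M g"
    and "\<And>x. x \<in> Q \<Longrightarrow> g x \<in> P"
  shows "linear_map R (quotient_module A Q) (quotient_module M P) (coset_map M P g)"
proof -
  interpret A: module R A by fact
  interpret M: module R M by fact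
  note g = linear_mapD[OF assms(5)]
  note cm = coset_map_coset[OF assms(1-4) g(1,2) assms(6)]
  show ?thesis
    by (rule linear_mapI)
       (auto simp: A.mem_a_rcosets M.mem_a_rcosets cm g A.coset_add[OF assms(3)] M.coset_add[OF assms(4)]
         A.coset_smult[OF assms(3)] M.coset_smult[OF assms(4)])
qed


section \<open>Noetherian modules\<close>

definition noetherian_module :: "('a, 'r) ring_scheme \<Rightarrow> ('a, 'b, 'z) module_scheme \<Rightarrow> bool" where
  "noetherian_module R M \<longleftrightarrow>
     (\<forall>P. submodule P R M \<longrightarrow> (\<exists>S\<subseteq>P. finite S \<and> P \<subseteq> span R M S))"

context module
begin

text \<open>Induction on the generators. When \<open>x\<close> is added, the coefficients at
  \<open>x\<close> of elements of \<open>P\<close> form an ideal, finitely generated by hypothesis;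
  what remains of \<open>P\<close> is its intersection with the span of \<open>S\<close>, covered by
  the induction hypothesis.\<close>

lemma noetherian_span:
  assumes "noetherian_ring R" "finite S" "S \<subseteq> carrier M" "submodule P R M" "P \<subseteq> span R M S"
  shows "\<exists>T\<subseteq>P. finite T \<and> P \<subseteq> span R M T"
  using assms(2-5)
proof (induction S arbitrary: P rule: finite_induct)
  case empty
  have "span R M {} \<subseteq> {\<zero>\<^bsub>M\<^esub>}" by (rule span_least[OF submodule_zero]) simp
  then have "P \<subseteq> span R M {}" using empty(3) by blast
  then show ?case by (intro exI[of _ "{}"]) auto
next
  case (insert x S)
  interpret N: noetherian_ring R by fact
  have xS: "x \<in> carrier M" "S \<subseteq> carrier M" using insert by auto
  note P = submoduleD[OF insert.prems(2)]
  note sS = span_submodule[OF xS(2)]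
  note Q = submoduleD[OF sS]
  have ideal: "ideal {r \<in> carrier R. \<exists>s\<in>span R M S. r \<odot>\<^bsub>M\<^esub> x \<oplus>\<^bsub>M\<^esub> s \<in> T} R"
    if T: "submodule T R M" for T
  proof (rule idealI_cring)
    note T = submoduleD[OF T]
    have "\<zero> \<odot>\<^bsub>M\<^esub> x \<oplus>\<^bsub>M\<^esub> \<zero>\<^bsub>M\<^esub> \<in> T" using xS T(2) by simp
    then show "\<zero> \<in> {r \<in> carrier R. \<exists>s\<in>span R M S. r \<odot>\<^bsub>M\<^esub> x \<oplus>\<^bsub>M\<^esub> s \<in> T}" using Q(2) by blast
    fix a b assume "a \<in> {r \<in> carrier R. \<exists>s\<in>span R M S. r \<odot>\<^bsub>M\<^esub> x \<oplus>\<^bsub>M\<^esub> s \<in> T}"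
      "b \<in> {r \<in> carrier R. \<exists>s\<in>span R M S. r \<odot>\<^bsub>M\<^esub> x \<oplus>\<^bsub>M\<^esub> s \<in> T}"
    then obtain s t where *: "a \<in> carrier R" "b \<in> carrier R" "s \<in> span R M S" "t \<in> span R M S"
      "a \<odot>\<^bsub>M\<^esub> x \<oplus>\<^bsub>M\<^esub> s \<in> T" "b \<odot>\<^bsub>M\<^esub> x \<oplus>\<^bsub>M\<^esub> t \<in> T" by auto
    have "(a \<oplus> b) \<odot>\<^bsub>M\<^esub> x \<oplus>\<^bsub>M\<^esub> (s \<oplus>\<^bsub>M\<^esub> t) = (a \<odot>\<^bsub>M\<^esub> x \<oplus>\<^bsub>M\<^esub> s) \<oplus>\<^bsub>M\<^esub> (b \<odot>\<^bsub>M\<^esub> x \<oplus>\<^bsub>M\<^esub> t)"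
      using * xS Q(1) by (simp add: smult_l_distr M.a_ac)
    then have "(a \<oplus> b) \<odot>\<^bsub>M\<^esub> x \<oplus>\<^bsub>M\<^esub> (s \<oplus>\<^bsub>M\<^esub> t) \<in> T" using * T(3) by simp
    then show "a \<oplus> b \<in> {r \<in> carrier R. \<exists>s\<in>span R M S. r \<odot>\<^bsub>M\<^esub> x \<oplus>\<^bsub>M\<^esub> s \<in> T}"
      using * Q(3) by blast
  next
    note T = submoduleD[OF T]
    fix r a assume r: "r \<in> carrier R" "a \<in> {r \<in> carrier R. \<exists>s\<in>span R M S. r \<odot>\<^bsub>M\<^esub> x \<oplus>\<^bsub>M\<^esub> s \<in> T}"
    then obtain s where *: "a \<in> carrier R" "s \<in> span R M S" "a \<odot>\<^bsub>M\<^esub> x \<oplus>\<^bsub>M\<^esub> s \<in> T" by auto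
    have "(r \<otimes> a) \<odot>\<^bsub>M\<^esub> x \<oplus>\<^bsub>M\<^esub> r \<odot>\<^bsub>M\<^esub> s = r \<odot>\<^bsub>M\<^esub> (a \<odot>\<^bsub>M\<^esub> x \<oplus>\<^bsub>M\<^esub> s)"
      using * r(1) xS Q(1) by (simp add: smult_r_distr smult_assoc1)
    then have "(r \<otimes> a) \<odot>\<^bsub>M\<^esub> x \<oplus>\<^bsub>M\<^esub> r \<odot>\<^bsub>M\<^esub> s \<in> T" using * T(4) r(1) by simp
    then show "r \<otimes> a \<in> {r \<in> carrier R. \<exists>s\<in>span R M S. r \<odot>\<^bsub>M\<^esub> x \<oplus>\<^bsub>M\<^esub> s \<in> T}"
      using * r(1) Q(4) by blast
  qed auto
  let ?I = "\<lambda>T. {r \<in> carrier R. \<exists>s\<in>span R M S. r \<odot>\<^bsub>M\<^esub> x \<oplus>\<^bsub>M\<^esub> s \<in> T}"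
  obtain A where A: "A \<subseteq> carrier R" "finite A" "?I P = Idl A"
    using N.finetely_gen[OF ideal[OF insert.prems(2)]] by auto
  have "A \<subseteq> ?I P" using A genideal_self[OF A(1)] by simp
  then have "\<forall>a\<in>A. \<exists>s. s \<in> span R M S \<and> a \<odot>\<^bsub>M\<^esub> x \<oplus>\<^bsub>M\<^esub> s \<in> P" by blast
  then obtain s where s: "\<And>a. a \<in> A \<Longrightarrow> s a \<in> span R M S" "\<And>a. a \<in> A \<Longrightarrow> a \<odot>\<^bsub>M\<^esub> x \<oplus>\<^bsub>M\<^esub> s a \<in> P"
    by metis
  obtain T' where T': "T' \<subseteq> P \<inter> span R M S" "finite T'" "P \<inter> span R M S \<subseteq> span R M T'"
    using insert.IH[OF xS(2) submodule_Int[OF insert.prems(2) sS]] by blast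
  \<comment> \<open>One element of \<open>P\<close> for each generator of the coefficient ideal,
    together with generators of the intersection.\<close>
  let ?T = "(\<lambda>a. a \<odot>\<^bsub>M\<^esub> x \<oplus>\<^bsub>M\<^esub> s a) ` A \<union> T'"
  have TP: "?T \<subseteq> P" using s T' by auto
  then have Tc: "?T \<subseteq> carrier M" using P(1) by blast
  note sT = span_submodule[OF Tc]
  have "A \<subseteq> ?I (span R M ?T)"
    using s(1) A(1) span_superset[of ?T] by fastforce
  then have IT: "?I P \<subseteq> ?I (span R M ?T)"
    using genideal_minimal[OF ideal[OF sT]] A(3) by simp
  have "p \<in> span R M ?T" if p: "p \<in> P" for p
  proof -
    obtain r t where rt: "r \<in> carrier R" "t \<in> span R M S" "p = r \<odot>\<^bsub>M\<^esub> x \<oplus>\<^bsub>M\<^esub> t"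
      using span_insert[OF xS, of p] insert.prems(3) p by blast
    then have "r \<in> ?I P" using p by auto
    then obtain t' where t': "t' \<in> span R M S" "r \<odot>\<^bsub>M\<^esub> x \<oplus>\<^bsub>M\<^esub> t' \<in> span R M ?T" using IT by blast
    let ?q = "r \<odot>\<^bsub>M\<^esub> x \<oplus>\<^bsub>M\<^esub> t'"
    have qP: "?q \<in> P" using t'(2) span_least[OF insert.prems(2) TP] by blast
    \<comment> \<open>Both vectors have the same coefficient \<open>r\<close> at \<open>x\<close>,
      so their difference falls into the intersection.\<close>
    have "p \<ominus>\<^bsub>M\<^esub> ?q = t \<ominus>\<^bsub>M\<^esub> t'"
      using rt t' xS Q(1)
      by (simp add: a_minus_def M.minus_add M.a_ac M.r_neg M.r_neg1)
    then have "p \<ominus>\<^bsub>M\<^esub> ?q \<in> P \<inter> span R M S"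
      using P(6)[OF p qP] Q(6)[OF rt(2) t'(1)] by simp
    then have "p \<ominus>\<^bsub>M\<^esub> ?q \<in> span R M ?T" using T'(3) span_mono[of T' ?T] by blast
    then show ?thesis
      using submodule_diff_iff[OF sT P(1)[OF p] P(1)[OF qP]] t'(2) by simp
  qed
  then show ?case using TP A(2) T'(2) by (intro exI[of _ ?T]) auto
qed

lemma fin_gen_imp_noetherian:
  assumes "noetherian_ring R" "fin_gen_module R M"
  shows "noetherian_module R M"
  unfolding noetherian_module_def
proof (intro allI impI)
  fix P assume "submodule P R M"
  then show "\<exists>S\<subseteq>P. finite S \<and> P \<subseteq> span R M S"
    using assms(2) noetherian_span[OF assms(1)] submoduleD(1) unfolding fin_gen_module_def
    by (metis subsetI)
qed

lemma submodule_chain_Union: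
  fixes P :: "nat \<Rightarrow> _"
  assumes "\<And>i. submodule (P i) R M" "\<And>i. P i \<subseteq> P (Suc i)"
  shows "submodule (\<Union>i. P i) R M"
proof (rule submoduleI')
  note D = submoduleD[OF assms(1)]
  have mono: "P i \<subseteq> P j" if "i \<le> j" for i j using lift_Suc_mono_le[of P, OF assms(2)] \<open>i \<le> j\<close> .
  fix x y assume "x \<in> (\<Union>i. P i)" "y \<in> (\<Union>i. P i)"
  then obtain i j where "x \<in> P i" "y \<in> P j" by auto
  then have "x \<in> P (max i j)" "y \<in> P (max i j)" using mono[of i "max i j"] mono[of j "max i j"] by auto
  then show "x \<oplus>\<^bsub>M\<^esub> y \<in> (\<Union>i. P i)" using D(3) by blast
next
  fix r x assume "r \<in> carrier R" "x \<in> (\<Union>i. P i)"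
  then show "r \<odot>\<^bsub>M\<^esub> x \<in> (\<Union>i. P i)" using submoduleD(4)[OF assms(1)] by blast
next
  show "(\<Union>i. P i) \<subseteq> carrier M" using submoduleD(1)[OF assms(1)] by blast
  show "\<zero>\<^bsub>M\<^esub> \<in> (\<Union>i. P i)" using submoduleD(2)[OF assms(1)] by blast
qed

lemma noetherian_chain:
  fixes P :: "nat \<Rightarrow> _"
  assumes "noetherian_module R M" "\<And>i. submodule (P i) R M" "\<And>i. P i \<subseteq> P (Suc i)"
  shows "\<exists>n. \<forall>m\<ge>n. P m = P n"
proof -
  have mono: "P i \<subseteq> P j" if "i \<le> j" for i j using lift_Suc_mono_le[of P, OF assms(3)] \<open>i \<le> j\<close> .
  obtain S where S: "S \<subseteq> (\<Union>i. P i)" "finite S" "(\<Union>i. P i) \<subseteq> span R M S"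
    using assms(1) submodule_chain_Union[of P, OF assms(2,3)] unfolding noetherian_module_def by blast
  then have "\<forall>x\<in>S. \<exists>i. x \<in> P i" by auto
  then obtain f where f: "\<And>x. x \<in> S \<Longrightarrow> x \<in> P (f x)" by metis
  define n where "n = Max (insert 0 (f ` S))"
  have "S \<subseteq> P n"
  proof
    fix x assume x: "x \<in> S"
    then have "f x \<le> n" using S(2) by (auto simp: n_def)
    then show "x \<in> P n" using f[OF x] mono by blast
  qed
  then have "(\<Union>i. P i) \<subseteq> P n" using span_least[OF assms(2)] S(3) by blast
  then show ?thesis using mono by (intro exI[of _ n]) auto
qed

end

text \<open>A nonempty chain of ideals of a Noetherian ring contains its own union, which is the
  upper bound that Zorn's lemma asks for. The maximal elements obtained here will be colon ideals
  and their relatives.\<close>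

lemma (in noetherian_ring) ideal_maximal:
  assumes "F \<noteq> {}" "\<And>A. A \<in> F \<Longrightarrow> ideal A R"
  shows "\<exists>A\<in>F. \<forall>B\<in>F. A \<subseteq> B \<longrightarrow> B = A"
proof (rule subset_Zorn)
  fix C assume C: "subset.chain F C"
  show "\<exists>U\<in>F. \<forall>D\<in>C. D \<subseteq> U"
  proof (cases "C = {}")
    case True then show ?thesis using assms(1) by auto
  next
    case False
    have "subset.chain {I. ideal I R} C"
      using C assms(2) by (auto simp: subset.chain_def)
    from ideal_chain_is_trivial[OF False this] have "\<Union>C \<in> C" .
    moreover have "C \<subseteq> F" using C by (auto simp: subset.chain_def)
    ultimately show ?thesis by blast
  qed
qed


section \<open>Homogeneous components\<close>

definition hcomp :: "('b, 'z) ring_scheme \<Rightarrow> ('i \<Rightarrow> 'b set) \<Rightarrow> 'b \<Rightarrow> 'i \<Rightarrow> 'b" where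
  "hcomp G C x = (SOME f. (\<forall>i. f i \<in> C i) \<and> finite {i. f i \<noteq> \<zero>\<^bsub>G\<^esub>} \<and>
     x = finsum G f {i. f i \<noteq> \<zero>\<^bsub>G\<^esub>})"

text \<open>Additive projections force uniqueness of decompositions: applied to a finite sum of
  homogeneous elements, \<open>p j\<close> extracts the \<open>j\<close>-th summand.\<close>

lemma (in abelian_group) internal_direct_sumI:
  assumes "\<And>i. additive_subgroup (C i) G"
    and "\<And>i x. x \<in> carrier G \<Longrightarrow> p i x \<in> C i"
    and "\<And>i x y. x \<in> carrier G \<Longrightarrow> y \<in> carrier G \<Longrightarrow> p i (x \<oplus> y) = p i x \<oplus> p i y"
    and "\<And>i j x. x \<in> C i \<Longrightarrow> p j x = (if j = i then x else \<zero>)"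
    and "\<And>x. x \<in> carrier G \<Longrightarrow> finite {i. p i x \<noteq> \<zero>}"
    and "\<And>x. x \<in> carrier G \<Longrightarrow> x = (\<Oplus>i\<in>{i. p i x \<noteq> \<zero>}. p i x)"
  shows "internal_direct_sum G C"
  unfolding internal_direct_sum_def
proof (intro conjI allI ballI ex_ex1I)
  fix x assume x: "x \<in> carrier G"
  show "\<exists>f. (\<forall>i. f i \<in> C i) \<and> finite {i. f i \<noteq> \<zero>} \<and> x = finsum G f {i. f i \<noteq> \<zero>}"
    using assms(2,5,6)[OF x] by (intro exI[of _ "\<lambda>i. p i x"]) auto
  have C: "C i \<subseteq> carrier G" for i using additive_subgroup.a_subset[OF assms(1)] .
  have sum: "p j (finsum G f A) = (if j \<in> A then f j else \<zero>)"
    if f: "\<And>i. f i \<in> C i" and "finite A" for f A j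
    using \<open>finite A\<close>
  proof (induction A rule: finite_induct)
    case empty
    show ?case using assms(4)[OF additive_subgroup.zero_closed[OF assms(1)], of j] by simp
  next
    case (insert a A)
    have fc: "f i \<in> carrier G" for i using f C by blast
    have "finsum G f (insert a A) = f a \<oplus> finsum G f A"
      using insert fc by (intro finsum_insert) auto
    also have "p j \<dots> = p j (f a) \<oplus> p j (finsum G f A)"
      using fc by (intro assms(3)) (auto intro: finsum_closed)
    also have "\<dots> = (if j \<in> insert a A then f j else \<zero>)"
      using insert assms(4)[OF f[of a], of j] fc by auto
    finally show ?case .
  qed
  fix f g
  assume f: "(\<forall>i. f i \<in> C i) \<and> finite {i. f i \<noteq> \<zero>} \<and> x = finsum G f {i. f i \<noteq> \<zero>}"
    and g: "(\<forall>i. g i \<in> C i) \<and> finite {i. g i \<noteq> \<zero>} \<and> x = finsum G g {i. g i \<noteq> \<zero>}"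
  show "f = g"
  proof
    fix j
    have "p j x = f j" using sum[of f "{i. f i \<noteq> \<zero>}" j] f by auto
    moreover have "p j x = g j" using sum[of g "{i. g i \<noteq> \<zero>}" j] g by auto
    ultimately show "f j = g j" by simp
  qed
qed (use assms(1) in auto)

locale graded_group = abelian_group G for G (structure) +
  fixes C :: "'i \<Rightarrow> _ set"
  assumes direct_sum: "internal_direct_sum G C"
begin

abbreviation "hc \<equiv> hcomp G C"

lemma part_subgroup: "additive_subgroup (C i) G"
  using direct_sum by (auto simp: internal_direct_sum_def)

lemma part_closed: "x \<in> C i \<Longrightarrow> x \<in> carrier G"
  using additive_subgroup.a_subset[OF part_subgroup] by blast

lemma part_zero: "\<zero> \<in> C i"
  using additive_subgroup.zero_closed[OF part_subgroup] .

lemma part_add: "x \<in> C i \<Longrightarrow> y \<in> C i \<Longrightarrow> x \<oplus> y \<in> C i"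
  using additive_subgroup.a_closed[OF part_subgroup] .

lemma part_finsum: "(\<And>a. a \<in> A \<Longrightarrow> f a \<in> C i) \<Longrightarrow> finsum G f A \<in> C i"
proof (induction A rule: infinite_finite_induct)
  case (insert a A)
  then show ?case by (subst finsum_insert) (auto intro: part_closed part_add)
qed (auto intro: part_zero)

lemma decomposition:
  "x \<in> carrier G \<Longrightarrow> \<exists>!f. (\<forall>i. f i \<in> C i) \<and> finite {i. f i \<noteq> \<zero>} \<and> x = finsum G f {i. f i \<noteq> \<zero>}"
  using direct_sum by (auto simp: internal_direct_sum_def)

lemma hc:
  assumes "x \<in> carrier G"
  shows hc_part: "hc x i \<in> C i" and hc_finite: "finite {i. hc x i \<noteq> \<zero>}"
    and hc_sum: "x = finsum G (hc x) {i. hc x i \<noteq> \<zero>}"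
  using someI_ex[OF ex1_implies_ex[OF decomposition[OF assms]]] unfolding hcomp_def by auto

lemma hc_closed: "x \<in> carrier G \<Longrightarrow> hc x i \<in> carrier G"
  using hc_part part_closed by blast

lemma hc_unique:
  assumes "\<And>i. f i \<in> C i" "finite A" "\<And>i. i \<notin> A \<Longrightarrow> f i = \<zero>" "x = finsum G f A"
  shows "hc x = f"
proof -
  have x: "x \<in> carrier G" using assms part_closed by (auto intro!: finsum_closed)
  have "{i. f i \<noteq> \<zero>} \<subseteq> A" using assms(3) by auto
  moreover from this have "finsum G f A = finsum G f {i. f i \<noteq> \<zero>}"
    using assms(1,2) part_closed by (intro add.finprod_mono_neutral_cong_right) auto
  ultimately have "(\<forall>i. f i \<in> C i) \<and> finite {i. f i \<noteq> \<zero>} \<and> x = finsum G f {i. f i \<noteq> \<zero>}"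
    using assms finite_subset by auto
  then show ?thesis using decomposition[OF x] hc[OF x] by blast
qed

lemma hc_sum_superset:
  assumes "x \<in> carrier G" "finite A" "{i. hc x i \<noteq> \<zero>} \<subseteq> A"
  shows "finsum G (hc x) A = x"
proof -
  have "finsum G (hc x) A = finsum G (hc x) {i. hc x i \<noteq> \<zero>}"
    using assms hc_closed by (intro add.finprod_mono_neutral_cong_right) auto
  then show ?thesis using hc_sum[OF assms(1)] by simp
qed

lemma hc_add:
  assumes "x \<in> carrier G" "y \<in> carrier G"
  shows "hc (x \<oplus> y) i = hc x i \<oplus> hc y i"
proof -
  let ?A = "{i. hc x i \<noteq> \<zero>} \<union> {i. hc y i \<noteq> \<zero>}"
  have fin: "finite ?A" using hc_finite assms by auto
  have "x \<oplus> y = finsum G (hc x) ?A \<oplus> finsum G (hc y) ?A"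
    using hc_sum_superset[OF assms(1) fin] hc_sum_superset[OF assms(2) fin] by simp
  also have "\<dots> = finsum G (\<lambda>i. hc x i \<oplus> hc y i) ?A"
    using hc_closed assms by (intro finsum_addf[symmetric]) auto
  finally have "hc (x \<oplus> y) = (\<lambda>i. hc x i \<oplus> hc y i)"
    using hc_part assms part_add fin by (intro hc_unique) auto
  then show ?thesis by simp
qed

lemma hc_homogeneous:
  assumes "x \<in> C i"
  shows "hc x j = (if j = i then x else \<zero>)"
proof -
  have "hc x = (\<lambda>j. if j = i then x else \<zero>)"
    by (rule hc_unique[of _ "{i}"]) (use assms part_zero part_closed in auto)
  then show ?thesis by simp
qed

lemma hc_zero: "hc \<zero> i = \<zero>"
  using hc_homogeneous[OF part_zero, of i i] by simp

text \<open>The last premise concerns the components of the given \<open>x\<close> only, not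
  arbitrary homogeneous elements; facts about \<open>x\<close>, such as membership in a homogeneous
  ideal, therefore remain usable there.\<close>

lemma homogeneous_induct [consumes 1, case_names zero add homogeneous]:
  assumes "x \<in> carrier G" "\<zero> \<in> P" "\<And>u v. u \<in> P \<Longrightarrow> v \<in> P \<Longrightarrow> u \<in> carrier G \<Longrightarrow> v \<in> carrier G \<Longrightarrow> u \<oplus> v \<in> P"
    and "\<And>i. hc x i \<in> P"
  shows "x \<in> P"
proof -
  have "finsum G (hc x) A \<in> P" for A
  proof (induction A rule: infinite_finite_induct)
    case (insert a A)
    then show ?case using assms hc_closed[OF assms(1)]
      by (subst finsum_insert) (auto intro!: assms(3) finsum_closed)
  qed (use assms(2) in auto)
  then show ?thesis using hc_sum[OF assms(1)] by metis
qed

end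

lemma finsum_cong_structure:
  assumes "carrier G = carrier H" "add G = add H" "\<zero>\<^bsub>G\<^esub> = \<zero>\<^bsub>H\<^esub>"
  shows "finsum G = finsum H"
  by (intro ext) (simp add: finsum_def finprod_def assms)

lemma (in abelian_group) finsum_carrier_update:
  assumes "abelian_group (G\<lparr>carrier := H\<rparr>)" "H \<subseteq> carrier G" "\<And>a. a \<in> A \<Longrightarrow> f a \<in> H"
  shows "finsum (G\<lparr>carrier := H\<rparr>) f A = finsum G f A"
proof -
  interpret H: abelian_group "G\<lparr>carrier := H\<rparr>" by fact
  show ?thesis using assms(3)
  proof (induction A rule: infinite_finite_induct)
    case (insert a A)
    then show ?case using assms(2)
      by (subst H.finsum_insert; simp) (subst finsum_insert; auto)
  qed auto
qed

text \<open>The decomposition taken inside \<open>H\<close> is also a decomposition in the whole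
  group, so uniqueness identifies the two.\<close>

lemma (in graded_group) graded_subset_hc:
  assumes "abelian_group (G\<lparr>carrier := H\<rparr>)" "H \<subseteq> carrier G"
    and "internal_direct_sum (G\<lparr>carrier := H\<rparr>) (\<lambda>n. H \<inter> C n)" and x: "x \<in> H"
  shows "hc x i \<in> H"
proof -
  interpret H: graded_group "G\<lparr>carrier := H\<rparr>" "\<lambda>n. H \<inter> C n"
    by (intro graded_group.intro graded_group_axioms.intro assms(1,3))
  have xc: "x \<in> carrier (G\<lparr>carrier := H\<rparr>)" using x by simp
  have f: "H.hc x i \<in> H \<inter> C i" for i using H.hc_part[OF xc] by simp
  have "x = finsum (G\<lparr>carrier := H\<rparr>) (H.hc x) {i. H.hc x i \<noteq> \<zero>}" using H.hc_sum[OF xc] by simp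
  also have "\<dots> = finsum G (H.hc x) {i. H.hc x i \<noteq> \<zero>}"
    by (rule finsum_carrier_update[OF assms(1,2)]) (use f in auto)
  finally have "hc x = H.hc x"
    using f H.hc_finite[OF xc] by (intro hc_unique) auto
  then show ?thesis using f by simp
qed


section \<open>Graded modules\<close>

locale graded_mod = module R M for R :: "'a gring" (structure) and M :: "('a, 'b) gmodule" (structure) +
  assumes gr: "graded_ring R" and gm: "graded_module R M"
begin

sublocale RG: graded_group R "ring_part R"
  by unfold_locales (use gr in \<open>auto simp: graded_ring_def\<close>)

sublocale MG: graded_group M "mod_part M"
  by unfold_locales (use gm in \<open>auto simp: graded_module_def\<close>)

text \<open>The working form of homogeneity for submodules: closure under components is inherited by
  intersections, images and sums more readily than a direct sum decomposition.\<close>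

definition hom_closed :: "'b set \<Rightarrow> bool" where
  "hom_closed P \<longleftrightarrow> (\<forall>x\<in>P. \<forall>i. MG.hc x i \<in> P)"

lemma part_smult: "r \<in> ring_part R a \<Longrightarrow> x \<in> mod_part M i \<Longrightarrow> r \<odot>\<^bsub>M\<^esub> x \<in> mod_part M (int a + i)"
  using gm by (auto simp: graded_module_def)

text \<open>Both sides are additive in \<open>x\<close>, so it suffices to look at homogeneous
  \<open>x\<close>.\<close>

lemma hc_smult:
  assumes "r \<in> ring_part R a" "x \<in> carrier M"
  shows "MG.hc (r \<odot>\<^bsub>M\<^esub> x) i = r \<odot>\<^bsub>M\<^esub> MG.hc x (i - int a)"
proof -
  have r: "r \<in> carrier R" using assms(1) RG.part_closed by blast
  let ?P = "{x \<in> carrier M. MG.hc (r \<odot>\<^bsub>M\<^esub> x) i = r \<odot>\<^bsub>M\<^esub> MG.hc x (i - int a)}"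
  have hom: "u \<in> ?P" if u: "u \<in> mod_part M j" for u j
  proof -
    have "MG.hc (r \<odot>\<^bsub>M\<^esub> u) i = (if i = int a + j then r \<odot>\<^bsub>M\<^esub> u else \<zero>\<^bsub>M\<^esub>)"
      by (rule MG.hc_homogeneous[OF part_smult[OF assms(1) u]])
    moreover have "MG.hc u (i - int a) = (if i - int a = j then u else \<zero>\<^bsub>M\<^esub>)"
      by (rule MG.hc_homogeneous[OF u])
    ultimately show ?thesis using r u MG.part_closed by auto
  qed
  have "x \<in> ?P"
    using assms(2)
  proof (induction rule: MG.homogeneous_induct)
    case zero
    show ?case using hom[OF MG.part_zero] .
  next
    case (add u v)
    then show ?case using r MG.hc_closed by (simp add: smult_r_distr MG.hc_add)
  next
    case (homogeneous j)
    show ?case using hom[OF MG.hc_part[OF assms(2)]] .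
  qed
  then show ?thesis by simp
qed

text \<open>A scalar is a finite sum of homogeneous ones. This form is needed for sets defined by
  conditions on components, where only homogeneous scalars act in a controlled way.\<close>

lemma submodule_homogeneousI:
  assumes "P \<subseteq> carrier M" "\<zero>\<^bsub>M\<^esub> \<in> P" "\<And>x y. x \<in> P \<Longrightarrow> y \<in> P \<Longrightarrow> x \<oplus>\<^bsub>M\<^esub> y \<in> P"
    and "\<And>r a x. r \<in> ring_part R a \<Longrightarrow> x \<in> P \<Longrightarrow> r \<odot>\<^bsub>M\<^esub> x \<in> P"
  shows "submodule P R M"
proof (rule submoduleI'[OF assms(1-3)])
  fix r x assume r: "r \<in> carrier R" and x: "x \<in> P"
  from r have "r \<in> {r \<in> carrier R. r \<odot>\<^bsub>M\<^esub> x \<in> P}"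
  proof (induction rule: RG.homogeneous_induct)
    case (add u v)
    then show ?case using x assms(1,3) by (auto simp: smult_l_distr)
  next
    case (homogeneous i)
    show ?case using assms(4)[OF RG.hc_part[OF r] x] RG.hc_closed[OF r] by simp
  qed (use x assms(1,2) in auto)
  then show "r \<odot>\<^bsub>M\<^esub> x \<in> P" by simp
qed

text \<open>This is the largest homogeneous submodule inside \<open>P\<close>; homogeneous scalars
  merely shift the components, by \<open>hc_smult\<close>.\<close>

lemma submodule_hc:
  assumes P: "submodule P R M"
  shows "submodule {x \<in> carrier M. \<forall>i. MG.hc x i \<in> P} R M"
proof (rule submodule_homogeneousI)
  note D = submoduleD[OF P]
  fix r a x assume r: "r \<in> ring_part R a" and x: "x \<in> {x \<in> carrier M. \<forall>i. MG.hc x i \<in> P}"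
  then show "r \<odot>\<^bsub>M\<^esub> x \<in> {x \<in> carrier M. \<forall>i. MG.hc x i \<in> P}"
    using D(4) RG.part_closed[OF r] by (simp add: hc_smult[OF r])
qed (use submoduleD[OF P] MG.hc_add MG.hc_zero in auto)

lemma hom_closed_span:
  assumes "S \<subseteq> carrier M" "\<And>x i. x \<in> S \<Longrightarrow> MG.hc x i \<in> span R M S"
  shows "hom_closed (span R M S)"
proof -
  have "span R M S \<subseteq> {x \<in> carrier M. \<forall>i. MG.hc x i \<in> span R M S}"
    by (rule span_least[OF submodule_hc[OF span_submodule[OF assms(1)]]]) (use assms in auto)
  then show ?thesis by (auto simp: hom_closed_def)
qed

lemma mem_span_hc:
  assumes "x \<in> carrier M" "submodule P R M" "\<And>i. MG.hc x i \<in> P"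
  shows "x \<in> P"
  using assms(1) by (induction rule: MG.homogeneous_induct) (use assms submoduleD[OF assms(2)] in auto)

text \<open>Each of finitely many generators is replaced by its finitely many nonzero components,
  which stay in \<open>P\<close> because \<open>P\<close> is homogeneous.\<close>

lemma homogeneous_generators:
  assumes "noetherian_module R M" "submodule P R M" "hom_closed P"
  shows "\<exists>S\<subseteq>P. finite S \<and> P = span R M S \<and> (\<forall>x\<in>S. \<exists>i. x \<in> mod_part M i)"
proof -
  note D = submoduleD[OF assms(2)]
  obtain T where T: "T \<subseteq> P" "finite T" "P \<subseteq> span R M T"
    using assms(1,2) by (auto simp: noetherian_module_def)
  let ?S = "\<Union>x\<in>T. MG.hc x ` {i. MG.hc x i \<noteq> \<zero>\<^bsub>M\<^esub>}"
  have TM: "T \<subseteq> carrier M" using T D(1) by auto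
  have SP: "?S \<subseteq> P" using T(1) assms(3) by (auto simp: hom_closed_def)
  then have SM: "?S \<subseteq> carrier M" using D(1) by blast
  note sub = span_submodule[OF SM]
  have "x \<in> span R M ?S" if x: "x \<in> T" for x
  proof (rule mem_span_hc[OF _ sub])
    fix i show "MG.hc x i \<in> span R M ?S"
      using span_superset[of ?S] x submoduleD(2)[OF sub] by (cases "MG.hc x i = \<zero>\<^bsub>M\<^esub>") auto
  qed (use x TM in auto)
  then have "P \<subseteq> span R M ?S" using span_least[OF sub] T(3) by blast
  moreover have "finite ?S" using T(2) MG.hc_finite TM by blast
  moreover have "\<forall>x\<in>?S. \<exists>i. x \<in> mod_part M i" using MG.hc_part TM by blast
  ultimately show ?thesis using span_least[OF assms(2) SP] SP by blast
qed

lemma graded_submodule_hom_closed: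
  assumes "graded_submodule R M P"
  shows "submodule P R M" "hom_closed P"
proof -
  show sub: "submodule P R M" using assms by (simp add: graded_submodule_def)
  interpret P: module R "M\<lparr>carrier := P\<rparr>" by (rule submodule.submodule_is_module[OF sub module_axioms])
  show "hom_closed P"
    unfolding hom_closed_def
    using MG.graded_subset_hc[OF P.abelian_group_axioms] submoduleD(1)[OF sub] assms
    by (simp add: graded_submodule_def subset_iff)
qed

end

lemma graded_modI: "graded_ring R \<Longrightarrow> graded_module R M \<Longrightarrow> graded_mod R M"
  by (simp add: graded_mod_def graded_mod_axioms_def graded_module_def)

lemma graded_hom_hc:
  assumes "graded_mod R A" "graded_mod R B" "graded_hom R A B f" and x: "x \<in> carrier A"
  shows "hcomp B (mod_part B) (f x) i = f (hcomp A (mod_part A) x i)"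
proof -
  interpret A: graded_mod R A by fact
  interpret B: graded_mod R B by fact
  note lin = graded_hom_linear[OF assms(3)]
  note f = linear_mapD[OF lin]
  have "x \<in> {x \<in> carrier A. B.MG.hc (f x) i = f (A.MG.hc x i)}"
    using x
  proof (induction rule: A.MG.homogeneous_induct)
    case (add u v)
    then show ?case using f A.MG.hc_closed by (auto simp: A.MG.hc_add B.MG.hc_add)
  next
    case (homogeneous j)
    have *: "A.MG.hc x j \<in> mod_part A j" by (rule A.MG.hc_part[OF x])
    then have "f (A.MG.hc x j) \<in> mod_part B j" using assms(3) unfolding graded_hom_def by blast
    from B.MG.hc_homogeneous[OF this, of i] A.MG.hc_homogeneous[OF *, of i] show ?case
      using A.MG.hc_closed[OF x] linear_map_zero[OF A.module_axioms B.module_axioms lin] by auto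
  qed (auto simp: A.MG.hc_zero B.MG.hc_zero linear_map_zero[OF A.module_axioms B.module_axioms lin])
  then show ?thesis by simp
qed

lemma graded_hom_kernel:
  assumes "graded_mod R A" "graded_mod R B" "graded_hom R A B f"
  shows "submodule (a_kernel A B f) R A" "graded_mod.hom_closed A (a_kernel A B f)"
proof -
  interpret A: graded_mod R A by fact
  interpret B: graded_mod R B by fact
  note lin = graded_hom_linear[OF assms(3)]
  note f = linear_mapD[OF lin]
  have ker: "a_kernel A B f = {x \<in> carrier A. f x \<in> {\<zero>\<^bsub>B\<^esub>}}"
    by (auto simp: a_kernel_def kernel_def)
  show "submodule (a_kernel A B f) R A"
    unfolding ker by (rule linear_map_preimage[OF A.module_axioms B.module_axioms lin B.submodule_zero])
  show "A.hom_closed (a_kernel A B f)"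
    unfolding A.hom_closed_def ker
    using A.MG.hc_closed B.MG.hc_zero by (auto simp: graded_hom_hc[OF assms, symmetric])
qed


section \<open>Powers of a graded module\<close>

text \<open>The ring viewed as a graded module over itself with vanishing negative degrees, so that
  graded free modules become an instance of the construction \<open>gpow\<close>.\<close>

definition rmod :: "'a gring \<Rightarrow> ('a, 'a) gmodule" where
  "rmod R = \<lparr>carrier = carrier R, monoid.mult = undefined, one = undefined,
     ring.zero = \<zero>\<^bsub>R\<^esub>, add = add R, smult = monoid.mult R,
     mod_part = (\<lambda>i. if 0 \<le> i then ring_part R (nat i) else {\<zero>\<^bsub>R\<^esub>})\<rparr>"

text \<open>The direct sum of shifted copies M(-e_j). With the ring in place of \<open>M\<close> it
  is a graded free module; with \<open>M\<close> itself it is that free module tensored with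
  \<open>M\<close>. Vectors vanish beyond the length of \<open>e\<close>, so that equality of
  functions is equality of vectors.\<close>

definition gpow :: "('a, 'b) gmodule \<Rightarrow> int list \<Rightarrow> ('a, nat \<Rightarrow> 'b) gmodule" where
  "gpow M e = \<lparr>
     carrier = {f. (\<forall>j<length e. f j \<in> carrier M) \<and> (\<forall>j\<ge>length e. f j = \<zero>\<^bsub>M\<^esub>)},
     monoid.mult = undefined, one = undefined,
     ring.zero = (\<lambda>j. \<zero>\<^bsub>M\<^esub>), add = (\<lambda>f g j. f j \<oplus>\<^bsub>M\<^esub> g j),
     smult = (\<lambda>r f j. r \<odot>\<^bsub>M\<^esub> f j),
     mod_part = (\<lambda>n. {f. (\<forall>j<length e. f j \<in> mod_part M (n - e ! j)) \<and> (\<forall>j\<ge>length e. f j = \<zero>\<^bsub>M\<^esub>)})\<rparr>"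

lemma gpow_simps [simp]:
  "carrier (gpow M e) = {f. (\<forall>j<length e. f j \<in> carrier M) \<and> (\<forall>j\<ge>length e. f j = \<zero>\<^bsub>M\<^esub>)}"
  "\<zero>\<^bsub>gpow M e\<^esub> = (\<lambda>j. \<zero>\<^bsub>M\<^esub>)" "add (gpow M e) = (\<lambda>f g j. f j \<oplus>\<^bsub>M\<^esub> g j)"
  "smult (gpow M e) = (\<lambda>r f j. r \<odot>\<^bsub>M\<^esub> f j)"
  "mod_part (gpow M e) n =
    {f. (\<forall>j<length e. f j \<in> mod_part M (n - e ! j)) \<and> (\<forall>j\<ge>length e. f j = \<zero>\<^bsub>M\<^esub>)}"
  by (simp_all add: gpow_def)

lemma rmod_simps [simp]:
  "carrier (rmod R) = carrier R" "\<zero>\<^bsub>rmod R\<^esub> = \<zero>\<^bsub>R\<^esub>" "add (rmod R) = add R" "smult (rmod R) = monoid.mult R"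
  "mod_part (rmod R) i = (if 0 \<le> i then ring_part R (nat i) else {\<zero>\<^bsub>R\<^esub>})"
  by (simp_all add: rmod_def)

lemma rmod_module:
  assumes "cring R"
  shows "module R (rmod R)"
proof -
  interpret R: cring R by fact
  show ?thesis
    by (rule moduleI)
       (use R.is_cring in \<open>auto intro!: abelian_groupI simp: R.l_distr R.r_distr R.m_assoc R.a_assoc
         intro: R.a_comm R.l_neg R.add.l_inv_ex\<close>)
qed

lemma rmod_graded:
  assumes "graded_ring R"
  shows "graded_mod R (rmod R)"
proof -
  interpret R: cring R using assms by (simp add: graded_ring_def)
  interpret M: module R "rmod R" by (rule rmod_module) unfold_locales
  interpret G: graded_group R "ring_part R"
    by unfold_locales (use assms in \<open>simp add: graded_ring_def\<close>)
  have fs: "finsum (rmod R) = finsum R" by (rule finsum_cong_structure) simp_all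
  have "internal_direct_sum (rmod R) (mod_part (rmod R))"
  proof (rule M.internal_direct_sumI)
    show "additive_subgroup (mod_part (rmod R) i) (rmod R)" for i
      using G.part_subgroup[of "nat i"] R.add.triv_subgroup
      by (auto simp: additive_subgroup_def subgroup_def m_inv_def)
    let ?p = "\<lambda>i x. if 0 \<le> i then G.hc x (nat i) else \<zero>\<^bsub>R\<^esub>"
    fix i j x
    show "x \<in> carrier (rmod R) \<Longrightarrow> ?p i x \<in> mod_part (rmod R) i" using G.hc_part by auto
    show "x \<in> mod_part (rmod R) i \<Longrightarrow> ?p j x = (if j = i then x else \<zero>\<^bsub>rmod R\<^esub>)"
      by (auto simp: G.hc_homogeneous G.hc_zero split: if_splits)
    assume x: "x \<in> carrier (rmod R)"
    have eq: "{i. ?p i x \<noteq> \<zero>\<^bsub>rmod R\<^esub>} = int ` {i. G.hc x i \<noteq> \<zero>\<^bsub>R\<^esub>}"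
      by (auto simp: image_iff) (metis int_nat_eq)
    show "finite {i. ?p i x \<noteq> \<zero>\<^bsub>rmod R\<^esub>}" unfolding eq using G.hc_finite x by simp
    have "finsum R (\<lambda>i. ?p i x) (int ` {i. G.hc x i \<noteq> \<zero>\<^bsub>R\<^esub>}) = finsum R (\<lambda>i. ?p (int i) x) {i. G.hc x i \<noteq> \<zero>\<^bsub>R\<^esub>}"
      by (rule R.finsum_reindex) (use x G.hc_closed in auto)
    also have "\<dots> = x" using G.hc_sum[of x] x by simp
    finally show "x = finsum (rmod R) (\<lambda>i. ?p i x) {i. ?p i x \<noteq> \<zero>\<^bsub>rmod R\<^esub>}"
      unfolding eq fs by simp
  next
    let ?p = "\<lambda>i x. if 0 \<le> i then G.hc x (nat i) else \<zero>\<^bsub>R\<^esub>"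
    show "x \<in> carrier (rmod R) \<Longrightarrow> y \<in> carrier (rmod R) \<Longrightarrow> ?p i (x \<oplus>\<^bsub>rmod R\<^esub> y) = ?p i x \<oplus>\<^bsub>rmod R\<^esub> ?p i y" for i x y
      by (auto simp: G.hc_add)
  qed
  moreover have "\<forall>i j. \<forall>a\<in>ring_part R i. \<forall>x\<in>mod_part (rmod R) j. a \<odot>\<^bsub>rmod R\<^esub> x \<in> mod_part (rmod R) (int i + j)"
  proof (intro allI ballI)
    fix i j a x assume a: "a \<in> ring_part R i" and x: "x \<in> mod_part (rmod R) j"
    show "a \<odot>\<^bsub>rmod R\<^esub> x \<in> mod_part (rmod R) (int i + j)"
    proof (cases "0 \<le> j")
      case True
      then have "a \<otimes>\<^bsub>R\<^esub> x \<in> ring_part R (i + nat j)"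
        using assms a x by (auto simp: graded_ring_def)
      then show ?thesis using True by (simp add: nat_add_distrib)
    next
      case False
      then show ?thesis using x G.part_closed[OF a] G.part_zero by auto
    qed
  qed
  ultimately show ?thesis
    using assms M.module_axioms by (intro graded_modI) (auto simp: graded_module_def)
qed

lemma gpow_module:
  assumes "module R M"
  shows "module R (gpow M e)"
proof -
  interpret module R M by fact
  show ?thesis
  proof (rule moduleI)
    show "abelian_group (gpow M e)"
    proof (rule abelian_groupI)
      fix f assume f: "f \<in> carrier (gpow M e)"
      let ?g = "\<lambda>j. if j < length e then \<ominus>\<^bsub>M\<^esub> f j else \<zero>\<^bsub>M\<^esub>"
      have "?g \<oplus>\<^bsub>gpow M e\<^esub> f = \<zero>\<^bsub>gpow M e\<^esub>" using f by (auto simp: M.l_neg)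
      moreover have "?g \<in> carrier (gpow M e)" using f by auto
      ultimately show "\<exists>g\<in>carrier (gpow M e). g \<oplus>\<^bsub>gpow M e\<^esub> f = \<zero>\<^bsub>gpow M e\<^esub>" by blast
    next
      fix f g assume fg: "f \<in> carrier (gpow M e)" "g \<in> carrier (gpow M e)"
      then have "f j \<in> carrier M" "g j \<in> carrier M" for j
        by (cases "j < length e"; auto)+
      then show "f \<oplus>\<^bsub>gpow M e\<^esub> g = g \<oplus>\<^bsub>gpow M e\<^esub> f" by (auto simp: M.a_comm)
      fix h assume "h \<in> carrier (gpow M e)"
      then have "h j \<in> carrier M" for j by (cases "j < length e"; auto)
      then show "f \<oplus>\<^bsub>gpow M e\<^esub> g \<oplus>\<^bsub>gpow M e\<^esub> h = f \<oplus>\<^bsub>gpow M e\<^esub> (g \<oplus>\<^bsub>gpow M e\<^esub> h)"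
        using \<open>\<And>j. f j \<in> carrier M\<close> \<open>\<And>j. g j \<in> carrier M\<close> by (auto simp: M.a_assoc)
    next
      fix f assume "f \<in> carrier (gpow M e)"
      then have "f j \<in> carrier M" for j by (cases "j < length e"; auto)
      then show "\<zero>\<^bsub>gpow M e\<^esub> \<oplus>\<^bsub>gpow M e\<^esub> f = f" by auto
    qed auto
    fix a b f g assume ab: "a \<in> carrier R" "b \<in> carrier R" "f \<in> carrier (gpow M e)" "g \<in> carrier (gpow M e)"
    then have "f j \<in> carrier M" "g j \<in> carrier M" for j
      by (cases "j < length e"; auto)+
    then show "(a \<oplus>\<^bsub>R\<^esub> b) \<odot>\<^bsub>gpow M e\<^esub> f = a \<odot>\<^bsub>gpow M e\<^esub> f \<oplus>\<^bsub>gpow M e\<^esub> b \<odot>\<^bsub>gpow M e\<^esub> f"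
      "a \<odot>\<^bsub>gpow M e\<^esub> (f \<oplus>\<^bsub>gpow M e\<^esub> g) = a \<odot>\<^bsub>gpow M e\<^esub> f \<oplus>\<^bsub>gpow M e\<^esub> a \<odot>\<^bsub>gpow M e\<^esub> g"
      "(a \<otimes>\<^bsub>R\<^esub> b) \<odot>\<^bsub>gpow M e\<^esub> f = a \<odot>\<^bsub>gpow M e\<^esub> (b \<odot>\<^bsub>gpow M e\<^esub> f)"
      using ab by (auto simp: smult_l_distr smult_r_distr smult_assoc1)
  next
    fix f assume f: "f \<in> carrier (gpow M e)"
    have "f j \<in> carrier M" for j using f by (cases "j < length e") auto
    then show "\<one>\<^bsub>R\<^esub> \<odot>\<^bsub>gpow M e\<^esub> f = f" by simp
  qed (use R.is_cring in auto)
qed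

lemma gpow_coord:
  assumes "module R M" "f \<in> carrier (gpow M e)"
  shows "f j \<in> carrier M"
proof -
  interpret module R M by fact
  show ?thesis using assms(2) by (cases "j < length e") auto
qed

lemma gpow_minus:
  assumes "module R M" "f \<in> carrier (gpow M e)" "g \<in> carrier (gpow M e)"
  shows "(f \<ominus>\<^bsub>gpow M e\<^esub> g) j = f j \<ominus>\<^bsub>M\<^esub> g j"
proof -
  interpret module R M by fact
  interpret P: module R "gpow M e" by (rule gpow_module) fact
  have "linear_map R (gpow M e) M (\<lambda>f. f j)"
    using gpow_coord[OF assms(1)] by (intro linear_mapI) auto
  from linear_map_minus[OF P.module_axioms module_axioms this assms(2,3)] show ?thesis .
qed

lemma gpow_finsum:
  assumes "module R M" "\<And>a. a \<in> A \<Longrightarrow> f a \<in> carrier (gpow M e)"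
  shows "finsum (gpow M e) f A j = finsum M (\<lambda>a. f a j) A"
proof -
  interpret module R M by fact
  interpret P: module R "gpow M e" by (rule gpow_module) fact
  have "linear_map R (gpow M e) M (\<lambda>f. f j)"
    using gpow_coord[OF assms(1)] by (intro linear_mapI) auto
  from linear_map_finsum[OF P.module_axioms module_axioms this assms(2)] show ?thesis .
qed

lemma gpow_graded:
  assumes "graded_mod R M"
  shows "graded_mod R (gpow M e)"
    and "\<And>f i j. f \<in> carrier (gpow M e) \<Longrightarrow> j < length e \<Longrightarrow>
      hcomp (gpow M e) (mod_part (gpow M e)) f i j = hcomp M (mod_part M) (f j) (i - e ! j)"
proof -
  interpret graded_mod R M by fact
  interpret P: module R "gpow M e" by (rule gpow_module) unfold_locales
  let ?p = "\<lambda>i f j. if j < length e then MG.hc (f j) (i - e ! j) else \<zero>\<^bsub>M\<^esub>"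
  have fin: "finite {i. ?p i f \<noteq> \<zero>\<^bsub>gpow M e\<^esub>}"
    and sum: "f = finsum (gpow M e) (\<lambda>i. ?p i f) {i. ?p i f \<noteq> \<zero>\<^bsub>gpow M e\<^esub>}"
    if f: "f \<in> carrier (gpow M e)" for f
  proof -
    have fc: "f j \<in> carrier M" for j using f by (rule gpow_coord[OF module_axioms])
    have pc: "?p i f \<in> carrier (gpow M e)" for i using MG.hc_closed[OF fc] by auto
    \<comment> \<open>A degree occurs in \<open>f\<close> only if, after undoing the shift, it
      occurs in some coordinate; there are finitely many coordinates with finitely many degrees
      each.\<close>
    have sub: "{i. ?p i f \<noteq> \<zero>\<^bsub>gpow M e\<^esub>} \<subseteq> (\<Union>j<length e. (\<lambda>i. i + e ! j) ` {i. MG.hc (f j) i \<noteq> \<zero>\<^bsub>M\<^esub>})"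
    proof
      fix i assume "i \<in> {i. ?p i f \<noteq> \<zero>\<^bsub>gpow M e\<^esub>}"
      then obtain j where "j < length e" "MG.hc (f j) (i - e ! j) \<noteq> \<zero>\<^bsub>M\<^esub>"
        by (auto simp: fun_eq_iff split: if_splits)
      then show "i \<in> (\<Union>j<length e. (\<lambda>i. i + e ! j) ` {i. MG.hc (f j) i \<noteq> \<zero>\<^bsub>M\<^esub>})"
        by (intro UN_I[of j] image_eqI[of _ _ "i - e ! j"]) auto
    qed
    show fin: "finite {i. ?p i f \<noteq> \<zero>\<^bsub>gpow M e\<^esub>}"
      by (rule finite_subset[OF sub]) (use MG.hc_finite[OF fc] in auto)
    show "f = finsum (gpow M e) (\<lambda>i. ?p i f) {i. ?p i f \<noteq> \<zero>\<^bsub>gpow M e\<^esub>}" (is "f = finsum _ _ ?A")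
    proof
      fix j
      show "f j = finsum (gpow M e) (\<lambda>i. ?p i f) ?A j"
      proof (cases "j < length e")
        case True
        have "finsum (gpow M e) (\<lambda>i. ?p i f) ?A j = finsum M (\<lambda>i. ?p i f j) ?A"
          by (rule gpow_finsum[OF module_axioms]) (use pc in auto)
        also have "\<dots> = finsum M (\<lambda>i. MG.hc (f j) (i - e ! j)) ?A" using True by simp
        also have "\<dots> = finsum M (MG.hc (f j)) ((\<lambda>i. i - e ! j) ` ?A)"
          using MG.hc_closed[OF fc] by (intro finsum_reindex[symmetric]) (auto simp: inj_on_def)
        also have "\<dots> = f j"
        proof (rule MG.hc_sum_superset[OF fc])
          show "{i. MG.hc (f j) i \<noteq> \<zero>\<^bsub>M\<^esub>} \<subseteq> (\<lambda>i. i - e ! j) ` ?A"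
          proof
            fix i assume i: "i \<in> {i. MG.hc (f j) i \<noteq> \<zero>\<^bsub>M\<^esub>}"
            have "?p (i + e ! j) f \<noteq> \<zero>\<^bsub>gpow M e\<^esub>"
            proof
              assume "?p (i + e ! j) f = \<zero>\<^bsub>gpow M e\<^esub>"
              from fun_cong[OF this, of j] show False using i True by simp
            qed
            then show "i \<in> (\<lambda>i. i - e ! j) ` ?A" by (intro image_eqI[of _ _ "i + e ! j"]) auto
          qed
        qed (use fin in auto)
        finally show ?thesis by simp
      next
        case False
        then have "finsum (gpow M e) (\<lambda>i. ?p i f) ?A j = finsum M (\<lambda>i. \<zero>\<^bsub>M\<^esub>) ?A"
          by (subst gpow_finsum[OF module_axioms]) (use pc in auto)
        then show ?thesis using False f by simp
      qed
    qed
  qed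
  have ids: "internal_direct_sum (gpow M e) (mod_part (gpow M e))"
  proof (rule P.internal_direct_sumI[of _ ?p])
    show "additive_subgroup (mod_part (gpow M e) i) (gpow M e)" for i
    proof (rule additive_subgroupI, rule P.add.subgroupI)
      fix f assume f: "f \<in> mod_part (gpow M e) i"
      then have fc: "f \<in> carrier (gpow M e)" using MG.part_closed by auto
      have "\<ominus>\<^bsub>gpow M e\<^esub> f = \<zero>\<^bsub>gpow M e\<^esub> \<ominus>\<^bsub>gpow M e\<^esub> f" using fc by (simp add: P.M.minus_eq P.M.l_zero del: gpow_simps)
      then have "(\<ominus>\<^bsub>gpow M e\<^esub> f) j = \<ominus>\<^bsub>M\<^esub> f j" for j
        using gpow_minus[OF module_axioms P.M.zero_closed fc, of j] gpow_coord[OF module_axioms fc]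
        by (simp add: a_minus_def)
      then show "\<ominus>\<^bsub>gpow M e\<^esub> f \<in> mod_part (gpow M e) i"
        using f additive_subgroup.a_inv_closed[OF MG.part_subgroup] by auto
    next
      show "mod_part (gpow M e) i \<noteq> {}" using MG.part_zero by (auto intro: exI[of _ "\<lambda>j. \<zero>\<^bsub>M\<^esub>"])
    qed (use MG.part_closed MG.part_add in auto)
    show "x \<in> carrier (gpow M e) \<Longrightarrow> ?p i x \<in> mod_part (gpow M e) i" for i x
      using MG.hc_part by auto
    show "x \<in> carrier (gpow M e) \<Longrightarrow> y \<in> carrier (gpow M e) \<Longrightarrow>
      ?p i (x \<oplus>\<^bsub>gpow M e\<^esub> y) = ?p i x \<oplus>\<^bsub>gpow M e\<^esub> ?p i y" for i x y
      using MG.hc_add by auto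
    show "x \<in> mod_part (gpow M e) i \<Longrightarrow> ?p j x = (if j = i then x else \<zero>\<^bsub>gpow M e\<^esub>)" for i j x
      by (auto simp: MG.hc_homogeneous fun_eq_iff)
  qed (use fin sum in auto)
  have "a \<odot>\<^bsub>gpow M e\<^esub> f \<in> mod_part (gpow M e) (int i + j)"
    if a: "a \<in> ring_part R i" and f: "f \<in> mod_part (gpow M e) j" for a f i j
    using part_smult[OF a, of "f l" "j - e ! l" for l] f RG.part_closed[OF a]
    by (simp add: algebra_simps)
  then show gm: "graded_mod R (gpow M e)"
    using gr P.module_axioms ids by (intro graded_modI) (simp_all add: graded_module_def del: gpow_simps)
  interpret PG: graded_mod R "gpow M e" by (rule gm)
  fix f i j assume f: "f \<in> carrier (gpow M e)" and j: "j < length e"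
  have "PG.MG.hc f = (\<lambda>i. ?p i f)"
    using f MG.hc_part[OF gpow_coord[OF module_axioms f]] by (intro PG.MG.hc_unique[OF _ fin[OF f] _ sum[OF f]]) auto
  then show "PG.MG.hc f i j = MG.hc (f j) (i - e ! j)" using j by simp
qed

lemma gpow_single_sum:
  assumes "module R M" "f \<in> carrier (gpow M e)"
  shows "f = finsum (gpow M e) (\<lambda>j i. if i = j then f j else \<zero>\<^bsub>M\<^esub>) {..<length e}"
proof -
  interpret module R M by fact
  show ?thesis
  proof
    fix i
    note fc = gpow_coord[OF assms]
    have "finsum (gpow M e) (\<lambda>j i. if i = j then f j else \<zero>\<^bsub>M\<^esub>) {..<length e} i
      = finsum M (\<lambda>j. if i = j then f j else \<zero>\<^bsub>M\<^esub>) {..<length e}"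
      by (rule gpow_finsum[OF assms(1)]) (use fc in auto)
    also have "\<dots> = f i"
    proof (cases "i < length e")
      case True
      then show ?thesis using M.finsum_singleton[of i "{..<length e}" f] fc by simp
    next
      case False
      then have "finsum M (\<lambda>j. if i = j then f j else \<zero>\<^bsub>M\<^esub>) {..<length e} = finsum M (\<lambda>j. \<zero>\<^bsub>M\<^esub>) {..<length e}"
        by (intro M.finsum_cong') auto
      then show ?thesis using False assms(2) by simp
    qed
    finally show "f i = finsum (gpow M e) (\<lambda>j i. if i = j then f j else \<zero>\<^bsub>M\<^esub>) {..<length e} i" by simp
  qed
qed

lemma gpow_submodule_memI:
  assumes "module R M" "submodule P R (gpow M e)" "f \<in> carrier (gpow M e)"
    and "\<And>j. j < length e \<Longrightarrow> (\<lambda>i. if i = j then f j else \<zero>\<^bsub>M\<^esub>) \<in> P"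
  shows "f \<in> P"
proof -
  interpret P: module R "gpow M e" by (rule gpow_module) fact
  show ?thesis
    by (subst gpow_single_sum[OF assms(1,3)], rule P.submodule_finsum[OF assms(2)]) (use assms(4) in auto)
qed

lemma gpow_single_linear:
  assumes "module R M" "j < length e"
  shows "linear_map R M (gpow M e) (\<lambda>x i. if i = j then x else \<zero>\<^bsub>M\<^esub>)"
proof -
  interpret module R M by fact
  show ?thesis using assms(2) by (intro linear_mapI) auto
qed

lemma gpow_fin_gen:
  assumes "module R M" "fin_gen_module R M"
  shows "fin_gen_module R (gpow M e)"
proof -
  interpret module R M by fact
  interpret P: module R "gpow M e" by (rule gpow_module) fact
  obtain S where S: "S \<subseteq> carrier M" "finite S" "span R M S = carrier M"
    using assms(2) by (auto simp: fin_gen_module_def)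
  let ?s = "\<lambda>j x i. if i = j then x else \<zero>\<^bsub>M\<^esub>"
  let ?T = "\<Union>j<length e. ?s j ` S"
  have T: "?T \<subseteq> carrier (gpow M e)" using S(1) by auto
  note sub = P.span_submodule[OF T]
  have "f \<in> span R (gpow M e) ?T" if f: "f \<in> carrier (gpow M e)" for f
  proof (rule gpow_submodule_memI[OF assms(1) sub f])
    fix j assume j: "j < length e"
    show "?s j (f j) \<in> span R (gpow M e) ?T"
    proof (rule linear_map_span[OF module_axioms P.module_axioms gpow_single_linear[OF assms(1) j] S(1) _ sub])
      show "f j \<in> span R M S" using S(3) gpow_coord[OF assms(1) f] by simp
      show "?s j ` S \<subseteq> span R (gpow M e) ?T" using P.span_superset[of ?T] j by blast
    qed
  qed
  then show ?thesis
    unfolding fin_gen_module_def using T S(2) P.submoduleD(1)[OF sub]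
    by (intro exI[of _ ?T]) blast
qed


section \<open>Existence of graded free resolutions\<close>

lemma graded_by_eq:
  "graded_by M G = \<lparr>carrier = carrier M, monoid.mult = monoid.mult M, one = one M,
     ring.zero = ring.zero M, add = add M, smult = smult M, mod_part = G\<rparr>"
  by (simp add: graded_by_def module.extend_def module.truncate_def gmodule.fields_def)

text \<open>A function supported on the indices below \<open>length e\<close> has finite support
  automatically, so the finiteness clause of \<open>free_module\<close> disappears.\<close>

lemma gfree_eq:
  assumes "graded_ring R"
  shows "gfree R e = gpow (rmod R) e"
proof -
  interpret R: cring R using assms by (simp add: graded_ring_def)
  interpret G: graded_group R "ring_part R"
    by unfold_locales (use assms in \<open>simp add: graded_ring_def\<close>)
  have fin: "finite {j. f j \<noteq> \<zero>\<^bsub>R\<^esub>}" if "\<forall>j\<ge>length e. f j = \<zero>\<^bsub>R\<^esub>" for f :: "nat \<Rightarrow> _"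
    by (rule finite_subset[of _ "{..<length e}"]) (use that in \<open>auto simp flip: not_le\<close>)
  have car: "carrier (free_module R {..<length e}) = carrier (gpow (rmod R) e)"
  proof (intro equalityI subsetI)
    fix f assume f: "f \<in> carrier (gpow (rmod R) e)"
    have "f j \<in> carrier R" for j using f by (cases "j < length e") auto
    then show "f \<in> carrier (free_module R {..<length e})"
      using f fin[of f] by (auto simp: free_module_def)
  qed (auto simp: free_module_def)
  have part: "{f \<in> carrier (gpow (rmod R) e). \<forall>j<length e.
      if e ! j \<le> n then f j \<in> ring_part R (nat (n - e ! j)) else f j = \<zero>\<^bsub>R\<^esub>} = mod_part (gpow (rmod R) e) n"
    for n
    by (force split: if_splits intro: G.part_closed)
  show ?thesis
    unfolding gfree_def graded_by_eq car part
    by (simp add: gpow_def free_module_def)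
qed

text \<open>One step of a resolution: homogeneous generators of \<open>P\<close> are the images of
  the basis vectors, and their degrees \<open>dg\<close> serve as the shifts, which makes the map
  homogeneous of degree zero.\<close>

lemma graded_cover:
  assumes "graded_mod R A" "noetherian_module R A" "submodule P R A" "graded_mod.hom_closed A P"
  shows "\<exists>e f. graded_hom R (gfree R e) A f \<and> f ` carrier (gfree R e) = P"
proof -
  interpret A: graded_mod R A by fact
  have gf: "gfree R e = gpow (rmod R) e" for e by (rule gfree_eq[OF A.gr])
  obtain S where S: "S \<subseteq> P" "finite S" "P = span R A S" "\<forall>x\<in>S. \<exists>i. x \<in> mod_part A i"
    using A.homogeneous_generators[OF assms(2-4)] by blast
  obtain g where g: "set g = S" using finite_list[OF S(2)] by blast
  obtain dg where dg: "\<And>x. x \<in> S \<Longrightarrow> x \<in> mod_part A (dg x)" using S(4) by metis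
  define e where "e = map dg g"
  define f where "f = (\<lambda>u. finsum A (\<lambda>j. u j \<odot>\<^bsub>A\<^esub> g ! j) {..<length e})"
  have gP: "g ! j \<in> P" if "j < length e" for j using that S(1) g nth_mem[of j g] by (auto simp: e_def)
  have gA: "g ! j \<in> carrier A" if "j < length e" for j using gP[OF that] A.submoduleD(1)[OF assms(3)] by simp
  have gdeg: "g ! j \<in> mod_part A (e ! j)" if "j < length e" for j
    using that dg g nth_mem[of j g] by (auto simp: e_def)
  interpret F: module R "gpow (rmod R) e" by (rule gpow_module[OF rmod_module]) unfold_locales
  have uR: "u j \<in> carrier R" if "u \<in> carrier (gpow (rmod R) e)" for u j
    using that by (cases "j < length e") auto
  have lin: "linear_map R (gpow (rmod R) e) A f"
  proof (rule linear_mapI)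
    fix u v r assume u: "u \<in> carrier (gpow (rmod R) e)"
    show "f u \<in> carrier A" unfolding f_def using uR[OF u] gA by (intro A.M.finsum_closed) auto
    show "f (u \<oplus>\<^bsub>gpow (rmod R) e\<^esub> v) = f u \<oplus>\<^bsub>A\<^esub> f v" if v: "v \<in> carrier (gpow (rmod R) e)"
    proof -
      have "f (u \<oplus>\<^bsub>gpow (rmod R) e\<^esub> v) = finsum A (\<lambda>j. u j \<odot>\<^bsub>A\<^esub> g ! j \<oplus>\<^bsub>A\<^esub> v j \<odot>\<^bsub>A\<^esub> g ! j) {..<length e}"
        unfolding f_def using uR[OF u] uR[OF v] gA by (intro A.M.finsum_cong') (auto simp: A.smult_l_distr)
      then show ?thesis
        unfolding f_def using uR[OF u] uR[OF v] gA by (subst A.M.finsum_addf[symmetric]) auto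
    qed
    show "f (r \<odot>\<^bsub>gpow (rmod R) e\<^esub> u) = r \<odot>\<^bsub>A\<^esub> f u" if r: "r \<in> carrier R"
    proof -
      have "f (r \<odot>\<^bsub>gpow (rmod R) e\<^esub> u) = finsum A (\<lambda>j. r \<odot>\<^bsub>A\<^esub> (u j \<odot>\<^bsub>A\<^esub> g ! j)) {..<length e}"
        unfolding f_def using uR[OF u] r gA by (intro A.M.finsum_cong') (auto simp: A.smult_assoc1)
      then show ?thesis
        unfolding f_def using uR[OF u] r gA by (subst A.finsum_smult_ldistr) auto
    qed
  qed
  note sub_img = linear_map_image[OF F.module_axioms A.module_axioms lin F.carrier_is_submodule]
  have "f ` carrier (gpow (rmod R) e) = P"
  proof
    show "f ` carrier (gpow (rmod R) e) \<subseteq> P"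
      unfolding f_def using uR A.submoduleD(4)[OF assms(3) _ gP]
      by (auto intro!: A.submodule_finsum[OF assms(3)] simp del: gpow_simps)
    have "x \<in> f ` carrier (gpow (rmod R) e)" if x: "x \<in> S" for x
    proof -
      obtain j where j: "j < length e" "x = g ! j" using x g by (auto simp: in_set_conv_nth e_def)
      let ?u = "\<lambda>i. if i = j then \<one>\<^bsub>R\<^esub> else \<zero>\<^bsub>R\<^esub>"
      have "f ?u = finsum A (\<lambda>i. if j = i then g ! i else \<zero>\<^bsub>A\<^esub>) {..<length e}"
        unfolding f_def using gA by (intro A.M.finsum_cong') auto
      also have "\<dots> = x" using A.M.finsum_singleton[of j "{..<length e}" "\<lambda>i. g ! i"] gA j by auto
      finally have "x = f ?u" by simp
      moreover have "?u \<in> carrier (gpow (rmod R) e)" using j by auto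
      ultimately show ?thesis by blast
    qed
    then show "P \<subseteq> f ` carrier (gpow (rmod R) e)"
      unfolding S(3) by (intro A.span_least[OF sub_img]) auto
  qed
  moreover have "f u \<in> mod_part A n" if u: "u \<in> mod_part (gpow (rmod R) e) n" for u n
    unfolding f_def
  proof (rule A.MG.part_finsum)
    fix j assume j: "j \<in> {..<length e}"
    then have uj: "u j \<in> mod_part (rmod R) (n - e ! j)" using u by simp
    show "u j \<odot>\<^bsub>A\<^esub> g ! j \<in> mod_part A n"
    proof (cases "0 \<le> n - e ! j")
      case True
      then show ?thesis using A.part_smult[of "u j" "nat (n - e ! j)" "g ! j" "e ! j"] uj gdeg j by simp
    next
      case False
      then show ?thesis using uj gA j A.MG.part_zero by simp
    qed
  qed
  ultimately show ?thesis
    using lin unfolding gf graded_hom_def linear_map_def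
    by (intro exI[of _ e] exI[of _ f]) (auto simp del: gpow_simps)
qed

lemma gfree_graded:
  assumes "graded_ring R"
  shows "graded_mod R (gfree R e)"
  using gpow_graded(1)[OF rmod_graded[OF assms]] assms by (simp add: gfree_eq)

lemma gfree_noetherian:
  assumes "graded_ring R" "noetherian_ring R"
  shows "noetherian_module R (gfree R e)"
proof -
  interpret M: graded_mod R "rmod R" by (rule rmod_graded) fact
  interpret F: graded_mod R "gfree R e" by (rule gfree_graded) fact
  have "span R (rmod R) {\<one>\<^bsub>R\<^esub>} = carrier (rmod R)"
  proof
    note D = M.submoduleD[OF M.span_submodule[of "{\<one>\<^bsub>R\<^esub>}"]]
    show "span R (rmod R) {\<one>\<^bsub>R\<^esub>} \<subseteq> carrier (rmod R)" using D(1) by auto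
    show "carrier (rmod R) \<subseteq> span R (rmod R) {\<one>\<^bsub>R\<^esub>}"
      using D(4)[of _ "\<one>\<^bsub>R\<^esub>"] M.span_superset[of "{\<one>\<^bsub>R\<^esub>}"] by auto
  qed
  then have "fin_gen_module R (rmod R)" by (auto simp: fin_gen_module_def intro!: exI[of _ "{\<one>\<^bsub>R\<^esub>}"])
  then have "fin_gen_module R (gfree R e)"
    unfolding gfree_eq[OF assms(1)] by (rule gpow_fin_gen[OF M.module_axioms])
  then show ?thesis by (rule F.fin_gen_imp_noetherian[OF assms(2)])
qed

text \<open>The resolution behind \<open>Tor\<close> is chosen by \<open>SOME\<close>, so nothing is
  known about it before existence is established. Kernels of graded maps are homogeneous and
  finitely generated, so they can be covered again and again.\<close>

lemma graded_free_resolution_exists: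
  assumes "graded_ring R" "noetherian_ring R" "graded_module R L" "fin_gen_module R L"
  shows "\<exists>F. graded_free_resolution R L F"
proof -
  interpret L: graded_mod R L by (rule graded_modI) fact+
  note gF = gfree_graded[OF assms(1)] and nF = gfree_noetherian[OF assms(1,2)]
  let ?ker = "\<lambda>e (K :: (nat \<Rightarrow> _) set). submodule K R (gfree R e) \<and> graded_mod.hom_closed (gfree R e) K"
  obtain e0 g where g: "graded_hom R (gfree R e0) L g" "g ` carrier (gfree R e0) = carrier L"
    using graded_cover[OF L.graded_mod_axioms L.fin_gen_imp_noetherian[OF assms(2,4)] L.carrier_is_submodule]
      L.MG.hc_closed by (auto simp: L.hom_closed_def)
  \<comment> \<open>A state is a list of shifts together with the kernel of the map leaving that
    free module, which the next free module has to cover. The clause for \<open>n = 0\<close> ties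
    the start to the augmentation.\<close>
  define P where "P n x \<longleftrightarrow> ?ker (fst x) (snd x) \<and> (n = 0 \<longrightarrow> x = (e0, a_kernel (gfree R e0) L g))" for n :: nat and x
  define Q where "Q x y f \<longleftrightarrow> graded_hom R (gfree R (fst y)) (gfree R (fst x)) f \<and>
    f ` carrier (gfree R (fst y)) = snd x \<and> snd y = a_kernel (gfree R (fst y)) (gfree R (fst x)) f" for x y f
  have "\<exists>x. P 0 x"
    using graded_hom_kernel[OF gF L.graded_mod_axioms g(1)] by (auto simp: P_def)
  moreover have "\<exists>y. P (Suc n) y \<and> (\<exists>f. Q x y f)" if Px: "P n x" for x n
  proof -
    obtain e f where ef: "graded_hom R (gfree R e) (gfree R (fst x)) f" "f ` carrier (gfree R e) = snd x"
      using graded_cover[OF gF[of "fst x"] nF, of "snd x"] Px by (auto simp: P_def)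
    then show ?thesis
      using graded_hom_kernel[OF gF gF ef(1)] Px
      by (intro exI[of _ "(e, a_kernel (gfree R e) (gfree R (fst x)) f)"]) (auto simp: P_def Q_def)
  qed
  ultimately obtain s where s: "\<And>n. P n (s n)" "\<And>n. \<exists>f. Q (s n) (s (Suc n)) f"
    using dependent_nat_choice[of P "\<lambda>n x y. \<exists>f. Q x y f"] by metis
  then obtain f where f: "\<And>n. Q (s n) (s (Suc n)) (f n)" by metis
  have s0: "s 0 = (e0, a_kernel (gfree R e0) L g)" using s(1)[of 0] by (simp add: P_def)
  define F where "F = \<lparr>shifts = (\<lambda>n. fst (s n)), diff = f, aug = g\<rparr>"
  have "graded_free_resolution R L F"
    unfolding graded_free_resolution_def res_module_def
    using f g s0 by (auto simp: F_def Q_def)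
  then show ?thesis by blast
qed


section \<open>Artin-Rees\<close>

text \<open>Take positions at which the minimum of the remaining tail is attained.\<close>

lemma nat_incseq_subseq:
  fixes g :: "nat \<Rightarrow> nat"
  shows "\<exists>f :: nat \<Rightarrow> nat. strict_mono f \<and> incseq (\<lambda>i. g (f i))"
proof -
  have min: "\<exists>m\<ge>n. \<forall>k\<ge>m. g m \<le> g k" for n
    using ex_has_least_nat[of "\<lambda>k. k \<ge> n" n g] by (meson le_trans order_refl)
  have "\<exists>f. \<forall>n. (\<forall>k\<ge>f n. g (f n) \<le> g k) \<and> f n < f (Suc n)"
  proof (rule dependent_nat_choice)
    show "\<exists>x. \<forall>k\<ge>x. g x \<le> g k" using min[of 0] by blast
    show "\<exists>y. (\<forall>k\<ge>y. g y \<le> g k) \<and> x < y" for x using min[of "Suc x"] by (meson Suc_le_eq)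
  qed
  then obtain f where f: "\<And>n. \<forall>k\<ge>f n. g (f n) \<le> g k" "\<And>n. f n < f (Suc n)" by blast
  then have "strict_mono f" by (simp add: strict_mono_Suc_iff)
  moreover have "incseq (\<lambda>i. g (f i))" using f by (intro incseq_SucI) (simp add: less_imp_le)
  ultimately show ?thesis by blast
qed

text \<open>Pass to subsequences one coordinate at a time; coordinates outside \<open>A\<close> are
  constantly zero.\<close>

lemma dickson:
  fixes s :: "nat \<Rightarrow> 'i multiset"
  assumes "finite A" "\<And>n. set_mset (s n) \<subseteq> A"
  shows "\<exists>f :: nat \<Rightarrow> nat. strict_mono f \<and> (\<forall>i j. i \<le> j \<longrightarrow> s (f i) \<subseteq># s (f j))"
proof -
  have "\<exists>f :: nat \<Rightarrow> nat. strict_mono f \<and> (\<forall>b\<in>B. incseq (\<lambda>i. count (s (f i)) b))" if "finite B" for B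
    using that
  proof (induction B rule: finite_induct)
    case empty
    show ?case by (intro exI[of _ id]) (auto simp: strict_mono_def)
  next
    case (insert b B)
    then obtain f where f: "strict_mono f" "\<forall>b\<in>B. incseq (\<lambda>i. count (s (f i)) b)" by blast
    obtain g where g: "strict_mono g" "incseq (\<lambda>i. count (s (f (g i))) b)"
      using nat_incseq_subseq[of "\<lambda>i. count (s (f i)) b"] by blast
    have "incseq (\<lambda>i. count (s (f (g i))) b')" if "b' \<in> B" for b'
      using f(2) that g(1) by (auto simp: incseq_def strict_mono_less_eq)
    then show ?case
      using f(1) g by (intro exI[of _ "f \<circ> g"]) (auto simp: strict_mono_def)
  qed
  from this[OF assms(1)] obtain f where f: "strict_mono f" "\<forall>b\<in>A. incseq (\<lambda>i. count (s (f i)) b)" by blast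
  have "s (f i) \<subseteq># s (f j)" if "i \<le> j" for i j
  proof (rule mset_subset_eqI)
    fix a show "count (s (f i)) a \<le> count (s (f j)) a"
    proof (cases "a \<in> A")
      case True then show ?thesis using f(2) that by (auto simp: incseq_def)
    next
      case False
      then have "a \<notin># s (f i)" using assms(2) by blast
      then show ?thesis by (simp add: not_in_iff)
    qed
  qed
  then show ?thesis using f(1) by blast
qed

section \<open>Monomials in given ring elements and multiplication by the ideal they
  generate\<close>

locale module_elements = module R M for R (structure) and M (structure) +
  fixes y :: "nat \<Rightarrow> 'a" and A :: "nat set"
  assumes finite_A: "finite A" and y_closed: "j \<in> A \<Longrightarrow> y j \<in> carrier R"
begin

text \<open>Exponents are multisets of indices: divisibility is then \<open>\<subseteq>#\<close>,
  the degree is \<open>size\<close>, and the multiset order is a linear order compatible with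
  addition, which is used as monomial order.\<close>

definition mon :: "nat multiset \<Rightarrow> 'a" where
  "mon \<alpha> = (\<Otimes>j\<in>A. y j [^] count \<alpha> j)"

definition exps :: "nat \<Rightarrow> nat multiset set" where
  "exps k = {\<alpha>. set_mset \<alpha> \<subseteq> A \<and> size \<alpha> = k}"

text \<open>For a submodule \<open>P\<close> this is \<open>J P\<close>, where \<open>J\<close> is
  the ideal generated by the \<open>y j\<close> with \<open>j \<in> A\<close>.\<close>

definition jspan :: "'c set \<Rightarrow> 'c set" where
  "jspan P = span R M {y j \<odot>\<^bsub>M\<^esub> u | j u. j \<in> A \<and> u \<in> P}"

lemma mon_closed [simp, intro]: "mon \<alpha> \<in> carrier R"
  unfolding mon_def using y_closed by (intro R.finprod_closed) auto

lemma mon_empty [simp]: "mon {#} = \<one>"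
  by (simp add: mon_def)

lemma mon_union: "mon (\<alpha> + \<beta>) = mon \<alpha> \<otimes> mon \<beta>"
proof -
  have "mon (\<alpha> + \<beta>) = (\<Otimes>j\<in>A. y j [^] count \<alpha> j \<otimes> y j [^] count \<beta> j)"
    unfolding mon_def using y_closed by (intro R.finprod_cong') (auto simp: R.nat_pow_mult)
  then show ?thesis unfolding mon_def using y_closed by (subst R.finprod_multf[symmetric]) auto
qed

lemma mon_replicate: "j \<in> A \<Longrightarrow> mon (replicate_mset m j) = y j [^] m"
proof -
  assume j: "j \<in> A"
  have "mon (replicate_mset m j) = (\<Otimes>i\<in>A. if j = i then y i [^] m else \<one>)"
    unfolding mon_def using y_closed by (intro R.finprod_cong') auto
  then show ?thesis
    using R.finprod_singleton[of j A "\<lambda>i. y i [^] m"] j finite_A y_closed by simp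
qed

lemma mon_add_mset: "j \<in> A \<Longrightarrow> mon (add_mset j \<alpha>) = y j \<otimes> mon \<alpha>"
  using mon_union[of "{#j#}" \<alpha>] mon_replicate[of j 1] y_closed by simp

lemma finite_exps: "finite (exps k)"
proof -
  have "exps k \<subseteq> mset ` {xs. set xs \<subseteq> A \<and> length xs = k}"
  proof
    fix \<alpha> assume "\<alpha> \<in> exps k"
    moreover obtain xs where "mset xs = \<alpha>" using ex_mset by blast
    ultimately show "\<alpha> \<in> mset ` {xs. set xs \<subseteq> A \<and> length xs = k}"
      by (intro image_eqI[of _ _ xs]) (auto simp: exps_def)
  qed
  then show ?thesis
    by (rule finite_subset) (rule finite_imageI[OF finite_lists_length_eq[OF finite_A]])
qed

lemma jspan_gens_closed: "P \<subseteq> carrier M \<Longrightarrow> {y j \<odot>\<^bsub>M\<^esub> u | j u. j \<in> A \<and> u \<in> P} \<subseteq> carrier M"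
  using y_closed by auto

lemma jspan_submodule: "P \<subseteq> carrier M \<Longrightarrow> submodule (jspan P) R M"
  unfolding jspan_def by (rule span_submodule[OF jspan_gens_closed])

lemma jspan_mem: "j \<in> A \<Longrightarrow> u \<in> P \<Longrightarrow> y j \<odot>\<^bsub>M\<^esub> u \<in> jspan P"
  unfolding jspan_def by (rule subsetD[OF span_superset]) blast

lemma jspan_least:
  "submodule Q R M \<Longrightarrow> (\<And>j u. j \<in> A \<Longrightarrow> u \<in> P \<Longrightarrow> y j \<odot>\<^bsub>M\<^esub> u \<in> Q) \<Longrightarrow> jspan P \<subseteq> Q"
  unfolding jspan_def by (rule span_least) auto

lemma jspan_mono: "P \<subseteq> Q \<Longrightarrow> jspan P \<subseteq> jspan Q"
  unfolding jspan_def by (rule span_mono) auto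

text \<open>Unrolls \<open>k\<close> multiplications by \<open>J\<close>: beyond stage
  \<open>m\<close> every element is a combination of monomials of degree \<open>k\<close> applied to
  the generators of that stage.\<close>

lemma mon_span:
  assumes "G \<subseteq> carrier M" "F m \<subseteq> span R M G" "\<And>n. n \<ge> m \<Longrightarrow> F (Suc n) \<subseteq> jspan (F n)"
  shows "F (m + k) \<subseteq> span R M {mon \<alpha> \<odot>\<^bsub>M\<^esub> x | \<alpha> x. \<alpha> \<in> exps k \<and> x \<in> G}"
proof (induction k)
  case 0
  have "G \<subseteq> {mon \<alpha> \<odot>\<^bsub>M\<^esub> x | \<alpha> x. \<alpha> \<in> exps 0 \<and> x \<in> G}"
  proof
    fix x assume x: "x \<in> G"
    then have "x = mon {#} \<odot>\<^bsub>M\<^esub> x" using assms(1) by auto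
    with x show "x \<in> {mon \<alpha> \<odot>\<^bsub>M\<^esub> x | \<alpha> x. \<alpha> \<in> exps 0 \<and> x \<in> G}"
      by (intro CollectI exI[of _ "{#}"] exI[of _ x]) (auto simp: exps_def)
  qed
  from span_mono[OF this] show ?case using assms(2) by auto
next
  case (Suc k)
  let ?S = "\<lambda>k. {mon \<alpha> \<odot>\<^bsub>M\<^esub> x | \<alpha> x. \<alpha> \<in> exps k \<and> x \<in> G}"
  have S: "?S k \<subseteq> carrier M" for k using assms(1) by auto
  have "F (m + Suc k) \<subseteq> jspan (F (m + k))" using assms(3)[of "m + k"] by simp
  also have "\<dots> \<subseteq> span R M (?S (Suc k))"
  proof (rule jspan_least[OF span_submodule[OF S]])
    fix j u assume j: "j \<in> A" and u: "u \<in> F (m + k)"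
    have "y j \<odot>\<^bsub>M\<^esub> u \<in> span R M ((\<lambda>x. y j \<odot>\<^bsub>M\<^esub> x) ` ?S k)"
      by (rule smult_span[OF S]) (use j u y_closed Suc.IH in auto)
    moreover have "(\<lambda>x. y j \<odot>\<^bsub>M\<^esub> x) ` ?S k \<subseteq> ?S (Suc k)"
    proof
      fix v assume "v \<in> (\<lambda>x. y j \<odot>\<^bsub>M\<^esub> x) ` ?S k"
      then obtain \<alpha> x where v: "v = y j \<odot>\<^bsub>M\<^esub> (mon \<alpha> \<odot>\<^bsub>M\<^esub> x)" "\<alpha> \<in> exps k" "x \<in> G" by auto
      then have "v = mon (add_mset j \<alpha>) \<odot>\<^bsub>M\<^esub> x" "add_mset j \<alpha> \<in> exps (Suc k)"
        using j y_closed assms(1) by (auto simp: mon_add_mset smult_assoc1 exps_def)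
      then show "v \<in> ?S (Suc k)" using v(3) by (intro CollectI exI[of _ "add_mset j \<alpha>"] exI[of _ x]) auto
    qed
    ultimately show "y j \<odot>\<^bsub>M\<^esub> u \<in> span R M (?S (Suc k))" using span_mono[of _ "?S (Suc k)"] by (meson subsetD)
  qed
  finally show ?case .
qed

text \<open>A Groebner style argument: \<open>L \<alpha>\<close> collects the leading coefficients, with respect to the
  monomial \<open>\<alpha>\<close>, of the elements of \<open>U\<close>; by Dickson's lemma and the ascending chain condition the
  leading coefficients of large exponents all come from smaller ones.\<close>

theorem artin_rees:
  assumes noeth: "noetherian_module R M"
    and F: "\<And>n. submodule (F n) R M" "\<And>n. n \<ge> m \<Longrightarrow> F (Suc n) \<subseteq> jspan (F n)"
    and U: "\<And>n. submodule (U n) R M" "\<And>n. U n \<subseteq> F n" "\<And>n j u. j \<in> A \<Longrightarrow> u \<in> U n \<Longrightarrow> y j \<odot>\<^bsub>M\<^esub> u \<in> U (Suc n)"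
  shows "\<exists>n0. \<forall>n\<ge>n0. U (Suc n) \<subseteq> jspan (U n)"
proof -
  note XD = submoduleD[OF F(1)] and UD = submoduleD[OF U(1)]
  define S where "S B = span R M {mon \<beta> \<odot>\<^bsub>M\<^esub> x | \<beta> x. \<beta> \<in> B \<and> x \<in> F m}" for B
  \<comment> \<open>\<open>V \<alpha>\<close> consists of combinations of strictly smaller monomials
    of the same degree; a difference \<open>u \<ominus> mon \<alpha> x\<close> in
    \<open>V \<alpha>\<close> says that \<open>x\<close> is the leading coefficient of
    \<open>u\<close> at \<open>\<alpha>\<close>.\<close>
  define V where "V \<alpha> = S {\<beta> \<in> exps (size \<alpha>). \<beta> < \<alpha>}" for \<alpha>
  define L where "L \<alpha> = {x \<in> F m. \<exists>u\<in>U (m + size \<alpha>). u \<ominus>\<^bsub>M\<^esub> mon \<alpha> \<odot>\<^bsub>M\<^esub> x \<in> V \<alpha>}" for \<alpha>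
  have Sc: "{mon \<beta> \<odot>\<^bsub>M\<^esub> x | \<beta> x. \<beta> \<in> B \<and> x \<in> F m} \<subseteq> carrier M" for B
    using XD(1) by auto
  have Ssub: "submodule (S B) R M" for B unfolding S_def by (rule span_submodule[OF Sc])
  then have Vsub: "submodule (V \<alpha>) R M" for \<alpha> by (simp add: V_def)
  note SD = submoduleD[OF Ssub] and VD = submoduleD[OF Vsub]
  \<comment> \<open>Multiplying by \<open>y j\<close> preserves the comparison of exponents.\<close>
  have yV: "y j \<odot>\<^bsub>M\<^esub> v \<in> V (add_mset j \<alpha>)" if j: "j \<in> A" and v: "v \<in> V \<alpha>" for j v \<alpha>
  proof -
    let ?G = "{mon \<beta> \<odot>\<^bsub>M\<^esub> x | \<beta> x. \<beta> \<in> {\<beta> \<in> exps (size \<alpha>). \<beta> < \<alpha>} \<and> x \<in> F m}"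
    have "y j \<odot>\<^bsub>M\<^esub> v \<in> span R M ((\<lambda>x. y j \<odot>\<^bsub>M\<^esub> x) ` ?G)"
      by (rule smult_span[OF Sc]) (use j v y_closed in \<open>auto simp: V_def S_def\<close>)
    moreover have "span R M ((\<lambda>x. y j \<odot>\<^bsub>M\<^esub> x) ` ?G) \<subseteq> V (add_mset j \<alpha>)"
      unfolding V_def S_def
    proof (rule span_mono, rule subsetI)
      fix w assume "w \<in> (\<lambda>x. y j \<odot>\<^bsub>M\<^esub> x) ` ?G"
      then obtain \<beta> x where w: "w = y j \<odot>\<^bsub>M\<^esub> (mon \<beta> \<odot>\<^bsub>M\<^esub> x)" "\<beta> \<in> exps (size \<alpha>)" "\<beta> < \<alpha>" "x \<in> F m"
        by auto
      moreover have "add_mset j \<beta> < add_mset j \<alpha>"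
        using add_strict_left_mono[OF w(3), of "{#j#}"] by simp
      ultimately show "w \<in> {mon \<beta> \<odot>\<^bsub>M\<^esub> x | \<beta> x. \<beta> \<in> {\<beta> \<in> exps (size (add_mset j \<alpha>)). \<beta> < add_mset j \<alpha>} \<and> x \<in> F m}"
        using j y_closed XD(1)
        by (intro CollectI exI[of _ "add_mset j \<beta>"] exI[of _ x])
           (auto simp: mon_add_mset smult_assoc1 exps_def)
    qed
    ultimately show ?thesis by blast
  qed
  have ylead: "y j \<odot>\<^bsub>M\<^esub> u \<ominus>\<^bsub>M\<^esub> mon (add_mset j \<alpha>) \<odot>\<^bsub>M\<^esub> x \<in> V (add_mset j \<alpha>)"
    if j: "j \<in> A" and "u \<in> carrier M" "x \<in> carrier M" "u \<ominus>\<^bsub>M\<^esub> mon \<alpha> \<odot>\<^bsub>M\<^esub> x \<in> V \<alpha>" for j u \<alpha> x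
  proof -
    have "y j \<odot>\<^bsub>M\<^esub> (u \<ominus>\<^bsub>M\<^esub> mon \<alpha> \<odot>\<^bsub>M\<^esub> x) = y j \<odot>\<^bsub>M\<^esub> u \<ominus>\<^bsub>M\<^esub> mon (add_mset j \<alpha>) \<odot>\<^bsub>M\<^esub> x"
      using that y_closed[OF j] by (simp add: mon_add_mset smult_assoc1 a_minus_def smult_r_distr smult_r_minus)
    then show ?thesis using yV[OF j that(4)] by simp
  qed
  have Lmono: "L \<alpha> \<subseteq> L (add_mset j \<alpha>)" if j: "j \<in> A" for j \<alpha>
  proof
    fix x assume "x \<in> L \<alpha>"
    then obtain u where u: "x \<in> F m" "u \<in> U (m + size \<alpha>)" "u \<ominus>\<^bsub>M\<^esub> mon \<alpha> \<odot>\<^bsub>M\<^esub> x \<in> V \<alpha>" by (auto simp: L_def)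
    then show "x \<in> L (add_mset j \<alpha>)"
      using ylead[OF j UD(1)[OF u(2)] XD(1)[OF u(1)] u(3)] U(3)[OF j u(2)] by (auto simp: L_def)
  qed
  have Lmono': "L \<alpha> \<subseteq> L (\<alpha> + \<gamma>)" if "set_mset \<gamma> \<subseteq> A" for \<alpha> \<gamma>
    using that
  proof (induction \<gamma>)
    case (add j \<gamma>)
    then show ?case using Lmono[of j "\<alpha> + \<gamma>"] by auto
  qed simp
  have Lsub: "submodule (L \<alpha>) R M" for \<alpha>
  proof (rule submoduleI')
    show "L \<alpha> \<subseteq> carrier M" using XD(1) by (auto simp: L_def)
    have "\<zero>\<^bsub>M\<^esub> \<ominus>\<^bsub>M\<^esub> mon \<alpha> \<odot>\<^bsub>M\<^esub> \<zero>\<^bsub>M\<^esub> = \<zero>\<^bsub>M\<^esub>" by (simp add: a_minus_def)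
    then show "\<zero>\<^bsub>M\<^esub> \<in> L \<alpha>" using XD(2) UD(2) VD(2) by (auto simp: L_def intro!: bexI[of _ "\<zero>\<^bsub>M\<^esub>"])
    fix x x' assume "x \<in> L \<alpha>" "x' \<in> L \<alpha>"
    then obtain u u' where u: "x \<in> F m" "u \<in> U (m + size \<alpha>)" "u \<ominus>\<^bsub>M\<^esub> mon \<alpha> \<odot>\<^bsub>M\<^esub> x \<in> V \<alpha>"
      "x' \<in> F m" "u' \<in> U (m + size \<alpha>)" "u' \<ominus>\<^bsub>M\<^esub> mon \<alpha> \<odot>\<^bsub>M\<^esub> x' \<in> V \<alpha>" by (auto simp: L_def)
    have "(u \<oplus>\<^bsub>M\<^esub> u') \<ominus>\<^bsub>M\<^esub> mon \<alpha> \<odot>\<^bsub>M\<^esub> (x \<oplus>\<^bsub>M\<^esub> x') = (u \<ominus>\<^bsub>M\<^esub> mon \<alpha> \<odot>\<^bsub>M\<^esub> x) \<oplus>\<^bsub>M\<^esub> (u' \<ominus>\<^bsub>M\<^esub> mon \<alpha> \<odot>\<^bsub>M\<^esub> x')"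
      using u UD(1) XD(1) by (simp add: a_minus_def smult_r_distr M.minus_add M.a_ac)
    then show "x \<oplus>\<^bsub>M\<^esub> x' \<in> L \<alpha>"
      using u XD(3) UD(3) VD(3) unfolding L_def by (metis (mono_tags, lifting) mem_Collect_eq)
  next
    fix r x assume r: "r \<in> carrier R" and "x \<in> L \<alpha>"
    then obtain u where u: "x \<in> F m" "u \<in> U (m + size \<alpha>)" "u \<ominus>\<^bsub>M\<^esub> mon \<alpha> \<odot>\<^bsub>M\<^esub> x \<in> V \<alpha>"
      by (auto simp: L_def)
    have "mon \<alpha> \<odot>\<^bsub>M\<^esub> (r \<odot>\<^bsub>M\<^esub> x) = r \<odot>\<^bsub>M\<^esub> (mon \<alpha> \<odot>\<^bsub>M\<^esub> x)"
      using u XD(1) r by (simp add: smult_assoc1[symmetric] R.m_comm)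
    then have "r \<odot>\<^bsub>M\<^esub> u \<ominus>\<^bsub>M\<^esub> mon \<alpha> \<odot>\<^bsub>M\<^esub> (r \<odot>\<^bsub>M\<^esub> x) = r \<odot>\<^bsub>M\<^esub> (u \<ominus>\<^bsub>M\<^esub> mon \<alpha> \<odot>\<^bsub>M\<^esub> x)"
      using u UD(1) XD(1) r by (simp add: a_minus_def smult_r_distr smult_r_minus)
    then show "r \<odot>\<^bsub>M\<^esub> x \<in> L \<alpha>"
      using u r XD(4) UD(4) VD(4) unfolding L_def by (metis (mono_tags, lifting) mem_Collect_eq)
  qed
  \<comment> \<open>If no exponent of size \<open>Suc k\<close> has a leading coefficient that is
    missing at all its immediate divisors, every element of \<open>U (Suc (m + k))\<close> can be
    reduced by elements of \<open>J U (m + k)\<close>.\<close>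
  have step: "U (Suc (m + k)) \<subseteq> jspan (U (m + k))"
    if good: "\<And>\<alpha>. \<alpha> \<in> exps (Suc k) \<Longrightarrow> \<exists>j\<in>#\<alpha>. L \<alpha> \<subseteq> L (\<alpha> - {#j#})" for k
  proof -
    have Uc: "U n \<subseteq> carrier M" for n using UD(1) by auto
    note Tsub = jspan_submodule[OF Uc[of "m + k"]]
    note TD = submoduleD[OF Tsub]
    let ?E = "exps (Suc k)"
    \<comment> \<open>Induction over down-closed sets \<open>B\<close> of exponents, extended each
      time by a new maximum: elements of \<open>U\<close> that involve only exponents of
      \<open>B\<close> are generated from the previous stage.\<close>
    have "B \<subseteq> ?E \<longrightarrow> (\<forall>\<beta>\<in>B. \<forall>\<gamma>\<in>?E. \<gamma> < \<beta> \<longrightarrow> \<gamma> \<in> B) \<longrightarrow> U (Suc (m + k)) \<inter> S B \<subseteq> jspan (U (m + k))"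
      if "finite B" for B
      using that
    proof (induction B rule: finite_linorder_max_induct)
      case empty
      have "S {} \<subseteq> {\<zero>\<^bsub>M\<^esub>}" unfolding S_def by (rule span_least[OF submodule_zero]) auto
      then show ?case using TD(2) by auto
    next
      case (insert b B)
      show ?case
      proof (intro impI subsetI)
        fix u assume BE: "insert b B \<subseteq> ?E" and down: "\<forall>\<beta>\<in>insert b B. \<forall>\<gamma>\<in>?E. \<gamma> < \<beta> \<longrightarrow> \<gamma> \<in> insert b B"
          and u: "u \<in> U (Suc (m + k)) \<inter> S (insert b B)"
        have uM: "u \<in> carrier M" using u UD(1) by blast
        have sizeb: "size b = Suc k" and bA: "set_mset b \<subseteq> A" using BE by (auto simp: exps_def)
        \<comment> \<open>Down-closure makes \<open>B\<close> the full set of exponents below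
          \<open>b\<close>, so membership in \<open>S B\<close> and in \<open>V b\<close>
          agree.\<close>
        have Beq: "B = {\<gamma> \<in> ?E. \<gamma> < b}" using BE down insert(2) by blast
        then have VB: "V b = S B" by (simp add: V_def sizeb)
        have IH: "U (Suc (m + k)) \<inter> S B \<subseteq> jspan (U (m + k))" using insert(3) Beq by auto
        let ?Q = "(\<lambda>x. mon b \<odot>\<^bsub>M\<^esub> x) ` F m"
        have lin: "linear_map R M M (\<lambda>x. mon b \<odot>\<^bsub>M\<^esub> x)"
          by (rule linear_mapI) (auto simp: smult_r_distr smult_assoc1[symmetric] R.m_comm)
        have Qsub: "submodule ?Q R M" by (rule linear_map_image[OF module_axioms module_axioms lin F(1)])
        have "S (insert b B) \<subseteq> {p \<oplus>\<^bsub>M\<^esub> v | p v. p \<in> ?Q \<and> v \<in> S B}" (is "_ \<subseteq> ?R")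
          unfolding S_def
        proof (rule span_least[OF submodule_sum[OF Qsub Ssub, unfolded S_def]], rule subsetI, fold S_def)
          fix w assume "w \<in> {mon \<beta> \<odot>\<^bsub>M\<^esub> x | \<beta> x. \<beta> \<in> insert b B \<and> x \<in> F m}"
          then obtain \<beta> x where w: "w = mon \<beta> \<odot>\<^bsub>M\<^esub> x" "\<beta> = b \<or> \<beta> \<in> B" "x \<in> F m" by auto
          have wM: "w \<in> carrier M" using w XD(1) by auto
          show "w \<in> ?R"
          proof (cases "\<beta> = b")
            case True
            then show ?thesis using w SD(2) wM by (intro CollectI exI[of _ w] exI[of _ "\<zero>\<^bsub>M\<^esub>"]) auto
          next
            case False
            then have "w \<in> {mon \<beta> \<odot>\<^bsub>M\<^esub> x | \<beta> x. \<beta> \<in> B \<and> x \<in> F m}" using w by auto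
            then have "w \<in> S B" unfolding S_def by (rule subsetD[OF span_superset])
            then show ?thesis using submoduleD(2)[OF Qsub] wM by (intro CollectI exI[of _ "\<zero>\<^bsub>M\<^esub>"] exI[of _ w]) auto
          qed
        qed
        then obtain x v where xv: "x \<in> F m" "v \<in> S B" "u = mon b \<odot>\<^bsub>M\<^esub> x \<oplus>\<^bsub>M\<^esub> v" using u by blast
        have xM: "x \<in> carrier M" and vM: "v \<in> carrier M" using xv XD(1) SD(1) by auto
        have lead_u: "u \<ominus>\<^bsub>M\<^esub> mon b \<odot>\<^bsub>M\<^esub> x = v"
          using xv(3) xM vM by (simp add: a_minus_def M.a_ac M.r_neg1 M.r_neg)
        then have "x \<in> L b" using xv(1,2) u VB sizeb by (auto simp: L_def)
        then obtain j where j: "j \<in># b" "x \<in> L (b - {#j#})" using good[of b] BE by blast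
        then obtain u' where u': "u' \<in> U (m + k)" "u' \<ominus>\<^bsub>M\<^esub> mon (b - {#j#}) \<odot>\<^bsub>M\<^esub> x \<in> V (b - {#j#})"
          using sizeb by (auto simp: L_def size_Diff_singleton)
        have jA: "j \<in> A" using j bA by auto
        have u'M: "u' \<in> carrier M" using u' UD(1) by blast
        \<comment> \<open>This multiple has the same leading term as \<open>u\<close>; subtracting
          it stays in \<open>U\<close> and leaves only exponents below \<open>b\<close>, to which
          the induction hypothesis applies.\<close>
        have "y j \<odot>\<^bsub>M\<^esub> u' \<ominus>\<^bsub>M\<^esub> mon b \<odot>\<^bsub>M\<^esub> x \<in> V b"
          using ylead[OF jA u'M xM u'(2)] j(1) by simp
        then have "v \<ominus>\<^bsub>M\<^esub> (y j \<odot>\<^bsub>M\<^esub> u' \<ominus>\<^bsub>M\<^esub> mon b \<odot>\<^bsub>M\<^esub> x) \<in> S B" using VB xv(2) SD(6) by simp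
        moreover have "v \<ominus>\<^bsub>M\<^esub> (y j \<odot>\<^bsub>M\<^esub> u' \<ominus>\<^bsub>M\<^esub> mon b \<odot>\<^bsub>M\<^esub> x) = u \<ominus>\<^bsub>M\<^esub> y j \<odot>\<^bsub>M\<^esub> u'"
          using xv(3) xM vM u'M y_closed[OF jA] by (simp add: a_minus_def M.minus_add M.a_ac)
        moreover have "u \<ominus>\<^bsub>M\<^esub> y j \<odot>\<^bsub>M\<^esub> u' \<in> U (Suc (m + k))"
          using u U(3)[OF jA u'(1)] UD(6) by auto
        ultimately have "u \<ominus>\<^bsub>M\<^esub> y j \<odot>\<^bsub>M\<^esub> u' \<in> jspan (U (m + k))" using IH by auto
        then show "u \<in> jspan (U (m + k))"
          using submodule_diff_iff[OF Tsub uM] y_closed[OF jA] u'M jspan_mem[OF jA u'(1)] by auto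
      qed
    qed
    from this[OF finite_exps[of "Suc k"]] have "U (Suc (m + k)) \<inter> S ?E \<subseteq> jspan (U (m + k))" by auto
    moreover have "F (m + Suc k) \<subseteq> S ?E"
      unfolding S_def by (rule mon_span[where m = m and F = F and G = "F m"]) (use XD(1) F(2) span_superset in auto)
    ultimately show ?thesis using U(2)[of "Suc (m + k)"] by auto
  qed
  have "\<exists>k0. \<forall>k\<ge>k0. \<forall>\<alpha>\<in>exps (Suc k). \<exists>j\<in>#\<alpha>. L \<alpha> \<subseteq> L (\<alpha> - {#j#})"
  proof (rule ccontr)
    assume "\<not> ?thesis"
    \<comment> \<open>Otherwise there are exponents of arbitrarily large size at which
      \<open>L\<close> is not contained in its value at any immediate divisor.\<close>
    then have bad: "\<exists>\<alpha>. set_mset \<alpha> \<subseteq> A \<and> size \<alpha> > k \<and> (\<forall>j\<in>#\<alpha>. \<not> L \<alpha> \<subseteq> L (\<alpha> - {#j#}))" for k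
      unfolding exps_def by (metis (mono_tags, lifting) le_imp_less_Suc mem_Collect_eq)
    let ?P = "\<lambda>\<alpha>. set_mset \<alpha> \<subseteq> A \<and> (\<forall>j\<in>#\<alpha>. \<not> L \<alpha> \<subseteq> L (\<alpha> - {#j#}))"
    have "\<exists>s. \<forall>n. ?P (s n) \<and> size (s n) < size (s (Suc n))"
      by (rule dependent_nat_choice) (use bad in blast)+
    then obtain s where s: "\<And>n. ?P (s n)" "\<And>n. size (s n) < size (s (Suc n))" by blast
    then have smono: "strict_mono (\<lambda>n. size (s n))" by (simp add: strict_mono_Suc_iff)
    obtain f :: "nat \<Rightarrow> nat" where f: "strict_mono f" "\<And>i j. i \<le> j \<Longrightarrow> s (f i) \<subseteq># s (f j)"
      using dickson[OF finite_A, of s] s(1) by blast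
    \<comment> \<open>Along a divisibility chain of such exponents \<open>L\<close> grows strictly:
      dropping one factor \<open>j\<close> of the quotient gives an exponent that is still a
      multiple of \<open>s (f i)\<close>, yet its \<open>L\<close> does not contain the next
      one.\<close>
    have strict: "L (s (f i)) \<subset> L (s (f (Suc i)))" for i
    proof -
      obtain \<gamma> where \<gamma>: "s (f (Suc i)) = s (f i) + \<gamma>" using f(2)[of i "Suc i"] by (auto simp: mset_subset_eq_exists_conv)
      have "size (s (f i)) < size (s (f (Suc i)))"
        using smono f(1) by (simp add: strict_mono_def)
      then have "\<gamma> \<noteq> {#}" using \<gamma> by auto
      then obtain j \<gamma>' where j: "\<gamma> = add_mset j \<gamma>'" by (meson multiset_cases)
      have A: "set_mset \<gamma> \<subseteq> A" "j \<in># s (f (Suc i))" using s(1)[of "f (Suc i)"] \<gamma> j by auto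
      have "s (f (Suc i)) - {#j#} = s (f i) + \<gamma>'" using \<gamma> j by simp
      then have "L (s (f i)) \<subseteq> L (s (f (Suc i)) - {#j#})" using Lmono'[of \<gamma>'] A(1) j by auto
      moreover have "\<not> L (s (f (Suc i))) \<subseteq> L (s (f (Suc i)) - {#j#})" using s(1) A(2) by blast
      moreover have "L (s (f i)) \<subseteq> L (s (f (Suc i)))" using Lmono'[OF A(1)] \<gamma> by metis
      ultimately show ?thesis by blast
    qed
    then obtain n where "\<forall>k\<ge>n. L (s (f k)) = L (s (f n))"
      using noetherian_chain[OF noeth, of "\<lambda>i. L (s (f i))"] Lsub by blast
    then show False using strict[of n] by (metis le_SucI order_refl psubset_eq)
  qed
  then obtain k0 where k0: "\<And>k \<alpha>. k \<ge> k0 \<Longrightarrow> \<alpha> \<in> exps (Suc k) \<Longrightarrow> \<exists>j\<in>#\<alpha>. L \<alpha> \<subseteq> L (\<alpha> - {#j#})" by blast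
  show ?thesis
  proof (intro exI[of _ "m + k0"] allI impI)
    fix n assume "n \<ge> m + k0"
    then obtain k where "n = m + k" "k \<ge> k0" by (metis add_leD1 le_iff_add nat_add_left_cancel_le)
    then show "U (Suc n) \<subseteq> jspan (U n)" using step[of k] k0 by simp
  qed
qed

end


section \<open>Initial degrees\<close>

lemma size_le_card_mult:
  fixes \<alpha> :: "'i multiset"
  assumes "finite A" "set_mset \<alpha> \<subseteq> A" "\<And>j. j \<in> A \<Longrightarrow> count \<alpha> j \<le> C"
  shows "size \<alpha> \<le> card A * C"
proof -
  have "size \<alpha> = (\<Sum>j\<in>set_mset \<alpha>. count \<alpha> j)" by (simp add: size_multiset_overloaded_eq)
  also have "\<dots> \<le> (\<Sum>j\<in>A. count \<alpha> j)" using assms(1,2) by (intro sum_mono2) auto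
  also have "\<dots> \<le> (\<Sum>j\<in>A. C)" by (intro sum_mono assms(3))
  finally show ?thesis by simp
qed

lemma submultiset_of_size:
  assumes "m \<le> size (z :: 'i multiset)"
  shows "\<exists>z'. z' \<subseteq># z \<and> size z' = m"
proof -
  obtain xs where xs: "mset xs = z" using ex_mset by blast
  then have "z = mset (take m xs) + mset (drop m xs)" by (metis append_take_drop_id mset_append)
  moreover have "size (mset (take m xs)) = m" using assms xs by auto
  ultimately show ?thesis by (intro exI[of _ "mset (take m xs)"]) auto
qed

text \<open>A pigeonhole principle stated through bounds: if \<open>f\<close> is unbounded on
  elements related to some \<open>b\<close>, then one single \<open>b\<close> accounts for unbounded
  values. It is applied to the values of a weight and to generators.\<close>

lemma uniform_bound:
  fixes f :: "'x \<Rightarrow> nat"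
  assumes "finite B" "\<And>b. b \<in> B \<Longrightarrow> \<exists>k. \<forall>x\<in>T. Q b x \<longrightarrow> f x < k"
  shows "\<exists>k. \<forall>b\<in>B. \<forall>x\<in>T. Q b x \<longrightarrow> f x < k"
proof -
  obtain h where h: "\<And>b. b \<in> B \<Longrightarrow> \<forall>x\<in>T. Q b x \<longrightarrow> f x < h b" using assms(2) by metis
  have "f x < Suc (Max (insert 0 (h ` B)))" if "b \<in> B" "x \<in> T" "Q b x" for b x
  proof -
    have "f x < h b" using h that by blast
    moreover have "h b \<le> Max (insert 0 (h ` B))" using assms(1) that by (intro Max_ge) auto
    ultimately show ?thesis by simp
  qed
  then show ?thesis by blast
qed

text \<open>What remains of a quotient P/K after choosing generators: the pairs of an exponent and a
  generator whose product is not in \<open>K\<close>, with the degrees \<open>d\<close> of the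
  variables and \<open>e\<close> of the generators. Closure under divisors reflects that
  \<open>K\<close> is stable.\<close>

locale exponent_family =
  fixes A :: "nat set" and G :: "'g set" and T :: "(nat multiset \<times> 'g) set"
    and d :: "nat \<Rightarrow> nat" and e :: "'g \<Rightarrow> int"
  assumes finite_A: "finite A" and finite_G: "finite G"
    and T_sub: "(\<alpha>, g) \<in> T \<Longrightarrow> set_mset \<alpha> \<subseteq> A \<and> g \<in> G"
    and T_down: "(\<alpha> + \<beta>, g) \<in> T \<Longrightarrow> (\<alpha>, g) \<in> T"
begin

definition unbounded :: "nat set" where
  "unbounded = {j \<in> A. \<forall>m. \<exists>\<alpha> g. (\<alpha>, g) \<in> T \<and> m \<le> count \<alpha> j}"

lemma T_down': "(\<alpha>, g) \<in> T \<Longrightarrow> \<beta> \<subseteq># \<alpha> \<Longrightarrow> (\<beta>, g) \<in> T"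
  using T_down by (metis mset_subset_eq_exists_conv)

lemma bounded_counts: "\<exists>C. \<forall>j\<in>A - unbounded. \<forall>\<alpha> g. (\<alpha>, g) \<in> T \<longrightarrow> count \<alpha> j < C"
proof -
  have "\<exists>k. \<forall>x\<in>T. True \<longrightarrow> count (fst x) j < k" if j: "j \<in> A - unbounded" for j
  proof -
    obtain m where "\<not> (\<exists>\<alpha> g. (\<alpha>, g) \<in> T \<and> m \<le> count \<alpha> j)" using j unfolding unbounded_def by blast
    then have "\<forall>x\<in>T. True \<longrightarrow> count (fst x) j < m" by (auto simp: not_le)
    then show ?thesis by blast
  qed
  then obtain h where h: "\<And>j. j \<in> A - unbounded \<Longrightarrow> \<forall>x\<in>T. True \<longrightarrow> count (fst x) j < h j" by metis
  have "count \<alpha> j < Suc (Max (insert 0 (h ` (A - unbounded))))" if "j \<in> A - unbounded" "(\<alpha>, g) \<in> T" for j \<alpha> g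
  proof -
    have "count \<alpha> j < h j" using h that by force
    moreover have "h j \<le> Max (insert 0 (h ` (A - unbounded)))" using finite_A that by (intro Max_ge) auto
    ultimately show ?thesis by simp
  qed
  then show ?thesis by blast
qed

lemma unbounded_empty: "unbounded = {} \<Longrightarrow> \<exists>k0. \<forall>\<alpha> g. (\<alpha>, g) \<in> T \<longrightarrow> size \<alpha> < k0"
proof -
  assume "unbounded = {}"
  then obtain C where C: "\<And>j \<alpha> g. j \<in> A \<Longrightarrow> (\<alpha>, g) \<in> T \<Longrightarrow> count \<alpha> j < C" using bounded_counts by blast
  have "size \<alpha> < Suc (card A * C)" if "(\<alpha>, g) \<in> T" for \<alpha> g
    using size_le_card_mult[OF finite_A, of \<alpha> C] T_sub[OF that] C[OF _ that] by (simp add: less_imp_le le_imp_less_Suc)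
  then show ?thesis by blast
qed

text \<open>Only exponents in the bounded directions can have negative weight \<open>w j = d j - d \<delta>\<close>, so the
  weights are bounded below; factors of weight zero can be deleted to reach any smaller size without
  changing the weight.\<close>

lemma eventually_linear:
  assumes "\<delta> \<in> unbounded" "\<And>j. j \<in> unbounded \<Longrightarrow> d \<delta> \<le> d j"
  shows "\<exists>b k0. \<forall>k\<ge>k0.
     (\<exists>\<alpha> g. (\<alpha>, g) \<in> T \<and> size \<alpha> = k \<and> (\<Sum>j\<in>#\<alpha>. int (d j)) + e g = int (d \<delta>) * int k + b) \<and>
     (\<forall>\<alpha> g. (\<alpha>, g) \<in> T \<longrightarrow> size \<alpha> = k \<longrightarrow> int (d \<delta>) * int k + b \<le> (\<Sum>j\<in>#\<alpha>. int (d j)) + e g)"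
proof -
  define w where "w j = int (d j) - int (d \<delta>)" for j
  \<comment> \<open>The degree minus \<open>d \<delta>\<close> times the size. The claim becomes
    that the minimum of \<open>val\<close> over pairs of size \<open>k\<close> is constant for large
    \<open>k\<close>.\<close>
  define val where "val x = (\<Sum>j\<in>#fst x. w j) + e (snd x)" for x
  have deg: "(\<Sum>j\<in>#\<alpha>. int (d j)) = (\<Sum>j\<in>#\<alpha>. w j) + int (d \<delta>) * int (size \<alpha>)" for \<alpha>
    by (induction \<alpha>) (auto simp: w_def algebra_simps)
  \<comment> \<open>A positive weight is at least 1, and a negative one at least
    \<open>- d \<delta>\<close> because degrees are natural numbers.\<close>
  have low: "int (size {#j \<in># \<alpha>. w j > 0#}) - int (d \<delta>) * int (size {#j \<in># \<alpha>. w j < 0#}) \<le> (\<Sum>j\<in>#\<alpha>. w j)" for \<alpha>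
    by (induction \<alpha>) (auto simp: w_def algebra_simps)
  have nz: "size {#j \<in># \<alpha>. w j \<noteq> 0#} = size {#j \<in># \<alpha>. w j > 0#} + size {#j \<in># \<alpha>. w j < 0#}" for \<alpha>
    by (induction \<alpha>) auto
  have wnz: "(\<Sum>j\<in>#\<alpha>. w j) = (\<Sum>j\<in>#{#j \<in># \<alpha>. w j \<noteq> 0#}. w j)" for \<alpha>
    by (induction \<alpha>) auto
  have wz: "(\<Sum>j\<in>#\<alpha>. w j) = 0" if "\<forall>j\<in>#\<alpha>. w j = 0" for \<alpha>
    using that by (induction \<alpha>) auto
  obtain C where C: "\<And>j \<alpha> g. j \<in> A - unbounded \<Longrightarrow> (\<alpha>, g) \<in> T \<Longrightarrow> count \<alpha> j < C"
    using bounded_counts by blast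
  \<comment> \<open>Every index of negative weight is a bounded direction, so \<open>N\<close>
    bounds the number of negative factors of any exponent in \<open>T\<close>.\<close>
  define N where "N = card A * C"
  have neg: "size {#j \<in># fst x. w j < 0#} \<le> N" if x: "x \<in> T" for x
    unfolding N_def
  proof (rule size_le_card_mult[OF finite_A])
    show "set_mset {#j \<in># fst x. w j < 0#} \<subseteq> A" using T_sub[of "fst x" "snd x"] x by auto
    fix j assume j: "j \<in> A"
    show "count {#j \<in># fst x. w j < 0#} j \<le> C"
    proof (cases "w j < 0")
      case True
      then have "j \<in> A - unbounded" using assms(2) j by (force simp: w_def)
      then show ?thesis using C[of j "fst x" "snd x"] x by simp
    qed simp
  qed
  define E where "E = Max (insert 0 ((\<lambda>g. \<bar>e g\<bar>) ` G))"
  have E: "\<bar>e (snd x)\<bar> \<le> E" if x: "x \<in> T" for x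
    unfolding E_def using finite_G T_sub[of "fst x" "snd x"] x by (intro Max_ge) auto
  define W where "W = int (d \<delta>) * int N"
  have negW: "int (d \<delta>) * int (size {#j \<in># fst x. w j < 0#}) \<le> W" if "x \<in> T" for x
    unfolding W_def using neg[OF that] by (intro mult_left_mono) auto
  have val_low: "- W - E \<le> val x" if "x \<in> T" for x
    using low[of "fst x"] negW[OF that] E[OF that] unfolding val_def by linarith
  have nz_bound: "int (size {#j \<in># fst x. w j \<noteq> 0#}) \<le> int N + val x + E + W" if "x \<in> T" for x
    using low[of "fst x"] negW[OF that] E[OF that] neg[OF that] nz[of "fst x"] unfolding val_def by linarith
  \<comment> \<open>Values taken by pairs of arbitrarily large size; the least of them will be the
    intercept.\<close>
  define often where "often v \<longleftrightarrow> (\<forall>k. \<exists>x\<in>T. val x = v \<and> k \<le> size (fst x))" for v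
  let ?V = "{- W - E..E}"
  have "\<exists>v\<in>?V. often v"
  proof (rule ccontr)
    assume "\<not> ?thesis"
    then have "\<exists>k. \<forall>x\<in>T. val x = v \<longrightarrow> size (fst x) < k" if "v \<in> ?V" for v
      using that unfolding often_def by (meson not_le)
    from uniform_bound[where B = ?V and T = T and Q = "\<lambda>v x. val x = v", OF _ this] obtain k where k: "\<And>v x. v \<in> ?V \<Longrightarrow> x \<in> T \<Longrightarrow> val x = v \<Longrightarrow> size (fst x) < k"
      by (metis finite_atLeastAtMost_int)
    \<comment> \<open>Pure powers of \<open>\<delta>\<close> have weight zero, so their values are
      the numbers \<open>e g\<close>, all inside the finite range \<open>?V\<close>, while their
      size is arbitrary.\<close>
    obtain \<alpha> g where \<alpha>: "(\<alpha>, g) \<in> T" "k \<le> count \<alpha> \<delta>" using assms(1) unfolding unbounded_def by blast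
    then have T: "(replicate_mset k \<delta>, g) \<in> T" using T_down' by (metis count_le_replicate_mset_subset_eq)
    have "val (replicate_mset k \<delta>, g) = e g" using wz[of "replicate_mset k \<delta>"] by (simp add: val_def w_def)
    then have "val (replicate_mset k \<delta>, g) \<in> ?V" using val_low[OF T] E[OF T] by auto
    from k[OF this T] show False by simp
  qed
  then have ne: "{v \<in> ?V. often v} \<noteq> {}" by blast
  have fin: "finite {v \<in> ?V. often v}" by (rule finite_subset[of _ ?V]) auto
  define b where "b = Min {v \<in> ?V. often v}"
  have b: "b \<in> ?V" "often b" using Min_in[OF fin ne] unfolding b_def by blast+
  have b_min: "b \<le> v" if "v \<in> ?V" "often v" for v unfolding b_def using that by (intro Min_le[OF fin]) blast
  \<comment> \<open>Each of the finitely many values below \<open>b\<close> occurs only up to some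
    size; from \<open>k1\<close> on none of them occurs.\<close>
  have "\<exists>k. \<forall>x\<in>T. val x = v \<longrightarrow> size (fst x) < k" if "v \<in> {- W - E..<b}" for v
  proof -
    have "\<not> often v" using b_min[of v] that b(1) by auto
    then show ?thesis unfolding often_def by (meson not_le)
  qed
  from uniform_bound[where B = "{- W - E..<b}" and T = T and Q = "\<lambda>v x. val x = v", OF _ this]
  obtain k1 where k1: "\<And>v x. v \<in> {- W - E..<b} \<Longrightarrow> x \<in> T \<Longrightarrow> val x = v \<Longrightarrow> size (fst x) < k1"
    by (metis finite_atLeastLessThan_int)
  \<comment> \<open>By \<open>nz_bound\<close>, a pair of value \<open>b\<close> has at most
    \<open>k2\<close> factors of nonzero weight, so for \<open>k \<ge> k2\<close> all of them fit
    into an exponent of size \<open>k\<close>.\<close>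
  define k2 where "k2 = nat (int N + b + E + W)"
  have "(\<exists>\<alpha> g. (\<alpha>, g) \<in> T \<and> size \<alpha> = k \<and> (\<Sum>j\<in>#\<alpha>. int (d j)) + e g = int (d \<delta>) * int k + b) \<and>
     (\<forall>\<alpha> g. (\<alpha>, g) \<in> T \<longrightarrow> size \<alpha> = k \<longrightarrow> int (d \<delta>) * int k + b \<le> (\<Sum>j\<in>#\<alpha>. int (d j)) + e g)"
    if k: "k \<ge> max k1 k2" for k
  proof
    obtain \<alpha> g where \<alpha>: "(\<alpha>, g) \<in> T" "val (\<alpha>, g) = b" "k \<le> size \<alpha>"
      using b(2) unfolding often_def by (metis fst_conv surj_pair)
    \<comment> \<open>Keep all factors of nonzero weight and fill up to size \<open>k\<close> with
      factors of weight zero.\<close>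
    let ?nz = "{#j \<in># \<alpha>. w j \<noteq> 0#}" and ?z = "{#j \<in># \<alpha>. \<not> w j \<noteq> 0#}"
    have split: "\<alpha> = ?nz + ?z" by (rule multiset_partition)
    have "int N + b + E + W \<le> int k" using k unfolding k2_def by linarith
    then have "size ?nz \<le> k" using nz_bound[OF \<alpha>(1)] \<alpha>(2) by simp
    moreover have "size \<alpha> = size ?nz + size ?z" using split by (metis size_union)
    ultimately have "k - size ?nz \<le> size ?z" using \<alpha>(3) by linarith
    from submultiset_of_size[OF this] obtain z where z: "z \<subseteq># ?z" "size z = k - size ?nz" by blast
    let ?\<beta> = "?nz + z"
    have "?\<beta> \<subseteq># \<alpha>" using z(1) split by (metis subset_mset.add_left_mono)
    then have T: "(?\<beta>, g) \<in> T" using T_down' \<alpha>(1) by blast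
    have size: "size ?\<beta> = k" using z(2) \<open>size ?nz \<le> k\<close> by simp
    have "\<forall>j\<in>#z. w j = 0" using z(1) mset_subset_eqD by fastforce
    then have eq: "(\<Sum>j\<in>#?\<beta>. w j) = (\<Sum>j\<in>#\<alpha>. w j)" using wz[of z] wnz[of \<alpha>] by simp
    have "(\<Sum>j\<in>#?\<beta>. int (d j)) = (\<Sum>j\<in>#\<alpha>. w j) + int (d \<delta>) * int k"
      unfolding deg[of ?\<beta>] size eq by (rule refl)
    moreover have "(\<Sum>j\<in>#\<alpha>. w j) + e g = b" using \<alpha>(2) by (simp add: val_def)
    ultimately have "(\<Sum>j\<in>#?\<beta>. int (d j)) + e g = int (d \<delta>) * int k + b" by linarith
    then show "\<exists>\<alpha> g. (\<alpha>, g) \<in> T \<and> size \<alpha> = k \<and> (\<Sum>j\<in>#\<alpha>. int (d j)) + e g = int (d \<delta>) * int k + b"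
      using T size by blast
    have "int (d \<delta>) * int k + b \<le> (\<Sum>j\<in>#\<alpha>. int (d j)) + e g" if T: "(\<alpha>, g) \<in> T" and s: "size \<alpha> = k" for \<alpha> g
    proof -
      have "b \<le> val (\<alpha>, g)"
      proof (rule ccontr)
        assume "\<not> b \<le> val (\<alpha>, g)"
        then have "val (\<alpha>, g) \<in> {- W - E..<b}" using val_low[OF T] by auto
        from k1[OF this T refl] show False using s k by simp
      qed
      then show ?thesis using deg[of \<alpha>] s by (simp add: val_def)
    qed
    then show "\<forall>\<alpha> g. (\<alpha>, g) \<in> T \<longrightarrow> size \<alpha> = k \<longrightarrow> int (d \<delta>) * int k + b \<le> (\<Sum>j\<in>#\<alpha>. int (d j)) + e g" by blast
  qed
  then show ?thesis by blast
qed

end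

section \<open>The initial degree of a quotient of stable families\<close>

locale graded_elements = graded_mod R M + module_elements R M y A
  for R :: "'a gring" (structure) and M :: "('a, 'b) gmodule" (structure) and y A +
  fixes d :: "nat \<Rightarrow> nat"
  assumes y_degree: "j \<in> A \<Longrightarrow> y j \<in> ring_part R (d j)"
begin

lemma mon_degree: "set_mset \<alpha> \<subseteq> A \<Longrightarrow> mon \<alpha> \<in> ring_part R (\<Sum>j\<in>#\<alpha>. d j)"
proof (induction \<alpha>)
  case empty
  show ?case using gr by (simp add: graded_ring_def)
next
  case (add j \<alpha>)
  have "y j \<otimes> mon \<alpha> \<in> ring_part R (d j + (\<Sum>j\<in>#\<alpha>. d j))"
    using gr add y_degree[of j] by (auto simp: graded_ring_def)
  then show ?case using add by (simp add: mon_add_mset)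
qed

text \<open>The initial degree of \<open>P/(K \<inter> P)\<close>.\<close>

definition quot_indeg :: "'b set \<Rightarrow> 'b set \<Rightarrow> ereal" where
  "quot_indeg P K = Inf {ereal (of_int i) | i. \<exists>x\<in>P \<inter> mod_part M i. x \<notin> K}"

text \<open>The indices whose \<open>y j\<close>, in Rees degree one, does not act nilpotently on
  the direct sum of the quotients P_n/K_n. A single \<open>m\<close> would have to work for all
  \<open>n\<close>, which matches the radical of an annihilator.\<close>

definition non_nilpotent :: "(nat \<Rightarrow> 'b set) \<Rightarrow> (nat \<Rightarrow> 'b set) \<Rightarrow> nat set" where
  "non_nilpotent P K = {j \<in> A. \<forall>m. \<exists>n. \<exists>z\<in>P n. (y j [^] m) \<odot>\<^bsub>M\<^esub> z \<notin> K (n + m)}"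

end

text \<open>Encodes a graded submodule, over the algebra generated by the \<open>y j\<close> in Rees
  degree one, of the direct sum of copies of \<open>M\<close> indexed by \<open>n\<close>.\<close>

definition (in module_elements) stable :: "(nat \<Rightarrow> 'c set) \<Rightarrow> bool" where
  "stable P \<longleftrightarrow> (\<forall>n. submodule (P n) R M) \<and> (\<forall>n. \<forall>j\<in>A. \<forall>x\<in>P n. y j \<odot>\<^bsub>M\<^esub> x \<in> P (Suc n))"

lemma (in module_elements) stable_mon:
  assumes "stable P" "set_mset \<alpha> \<subseteq> A" "x \<in> P n"
  shows "mon \<alpha> \<odot>\<^bsub>M\<^esub> x \<in> P (n + size \<alpha>)"
  using assms(2)
proof (induction \<alpha>)
  case empty
  have "x \<in> carrier M" using assms submoduleD(1) unfolding stable_def by blast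
  then show ?case using assms(3) by simp
next
  case (add j \<alpha>)
  have "x \<in> carrier M" using assms submoduleD(1) unfolding stable_def by blast
  then have "mon (add_mset j \<alpha>) \<odot>\<^bsub>M\<^esub> x = y j \<odot>\<^bsub>M\<^esub> (mon \<alpha> \<odot>\<^bsub>M\<^esub> x)"
    using add y_closed by (simp add: mon_add_mset smult_assoc1)
  then show ?case using add assms(1) by (simp add: stable_def)
qed

locale graded_family = graded_elements R M y A d
  for R :: "'a gring" (structure) and M :: "('a, 'b) gmodule" (structure) and y A d +
  fixes P K :: "nat \<Rightarrow> 'b set" and n0 :: nat
  assumes noeth: "noetherian_module R M"
    and P: "stable P" "\<And>n. hom_closed (P n)" "\<And>n. n \<ge> n0 \<Longrightarrow> P (Suc n) \<subseteq> jspan (P n)"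
    and K: "stable K"
begin

lemma P_sub: "submodule (P n) R M" and K_sub: "submodule (K n) R M"
  using P(1) K by (auto simp: stable_def)

text \<open>The bridge from modules to exponents. \<open>G\<close> is a finite set of homogeneous
  generators of \<open>P n0\<close> and \<open>T\<close> collects the pairs with
  \<open>mon \<alpha> g\<close> outside \<open>K\<close>. Nontrivial quotients, degrees of their
  elements and non-nilpotent indices can all be read off from \<open>T\<close>.\<close>

lemma initial_data:
  obtains G T and e :: "'b \<Rightarrow> int" where "exponent_family A G T" "G \<subseteq> P n0"
    "exponent_family.unbounded A T = non_nilpotent P K"
    "\<And>k. \<not> P (n0 + k) \<subseteq> K (n0 + k) \<Longrightarrow> \<exists>\<alpha> g. (\<alpha>, g) \<in> T \<and> size \<alpha> = k"
    "\<And>k i x. x \<in> P (n0 + k) \<Longrightarrow> x \<in> mod_part M i \<Longrightarrow> x \<notin> K (n0 + k) \<Longrightarrow>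
        \<exists>\<alpha> g. (\<alpha>, g) \<in> T \<and> size \<alpha> = k \<and> (\<Sum>j\<in>#\<alpha>. int (d j)) + e g \<le> i"
    "\<And>\<alpha> g. (\<alpha>, g) \<in> T \<Longrightarrow> mon \<alpha> \<odot>\<^bsub>M\<^esub> g \<in> P (n0 + size \<alpha>)"
    "\<And>\<alpha> g. (\<alpha>, g) \<in> T \<Longrightarrow> mon \<alpha> \<odot>\<^bsub>M\<^esub> g \<in> mod_part M ((\<Sum>j\<in>#\<alpha>. int (d j)) + e g)"
    "\<And>\<alpha> g. (\<alpha>, g) \<in> T \<Longrightarrow> mon \<alpha> \<odot>\<^bsub>M\<^esub> g \<notin> K (n0 + size \<alpha>)"
proof -
  obtain G where G: "G \<subseteq> P n0" "finite G" "P n0 = span R M G" "\<forall>x\<in>G. \<exists>i. x \<in> mod_part M i"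
    using homogeneous_generators[OF noeth P_sub P(2)] by blast
  then obtain e where e: "\<And>g. g \<in> G \<Longrightarrow> g \<in> mod_part M (e g)" by metis
  have GM: "G \<subseteq> carrier M" using G(1) submoduleD(1)[OF P_sub] by blast
  define T where "T = {(\<alpha>, g). set_mset \<alpha> \<subseteq> A \<and> g \<in> G \<and> mon \<alpha> \<odot>\<^bsub>M\<^esub> g \<notin> K (n0 + size \<alpha>)}"
  interpret E: exponent_family A G T d e
  proof
    fix \<alpha> \<beta> g assume "(\<alpha> + \<beta>, g) \<in> T"
    then have *: "set_mset (\<beta> + \<alpha>) \<subseteq> A" "g \<in> G" "mon (\<beta> + \<alpha>) \<odot>\<^bsub>M\<^esub> g \<notin> K (n0 + size (\<beta> + \<alpha>))"
      by (auto simp: T_def add.commute)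
    then have "mon (\<beta> + \<alpha>) \<odot>\<^bsub>M\<^esub> g = mon \<beta> \<odot>\<^bsub>M\<^esub> (mon \<alpha> \<odot>\<^bsub>M\<^esub> g)"
      using GM by (auto simp: mon_union smult_assoc1)
    \<comment> \<open>If \<open>mon \<alpha> g\<close> were in \<open>K\<close>, stability of
      \<open>K\<close> would put its multiple by \<open>mon \<beta>\<close> there as well.\<close>
    then show "(\<alpha>, g) \<in> T"
      using * stable_mon[OF K, of \<beta> "mon \<alpha> \<odot>\<^bsub>M\<^esub> g" "n0 + size \<alpha>"] by (auto simp: T_def ac_simps)
  qed (use finite_A G(2) in \<open>auto simp: T_def\<close>)
  have span: "P (n0 + k) \<subseteq> span R M {mon \<alpha> \<odot>\<^bsub>M\<^esub> x | \<alpha> x. \<alpha> \<in> exps k \<and> x \<in> G}" for k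
    by (rule mon_span[OF GM]) (use G(3) P(3) in auto)
  have gens: "{mon \<alpha> \<odot>\<^bsub>M\<^esub> x | \<alpha> x. \<alpha> \<in> exps k \<and> x \<in> G} \<subseteq> carrier M" for k
    using GM by auto
  have mon_deg: "mon \<alpha> \<odot>\<^bsub>M\<^esub> g \<in> mod_part M ((\<Sum>j\<in>#\<alpha>. int (d j)) + e g)"
    if "set_mset \<alpha> \<subseteq> A" "g \<in> G" for \<alpha> g
    using part_smult[OF mon_degree[OF that(1)] e[OF that(2)]] by (simp add: of_nat_sum_mset multiset.map_comp comp_def)
  \<comment> \<open>A linear map that does not send \<open>z\<close> into \<open>Q\<close> already
    fails on one of the monomial multiples spanning \<open>P (n0 + k)\<close>.\<close>
  have nonK: "\<exists>\<alpha> g. \<alpha> \<in> exps k \<and> g \<in> G \<and> h (mon \<alpha> \<odot>\<^bsub>M\<^esub> g) \<notin> Q"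
    if "z \<in> P (n0 + k)" "h z \<notin> Q" "submodule Q R M" "linear_map R M M h" for z k h Q
  proof (rule ccontr)
    assume *: "\<not> ?thesis"
    have "h z \<in> Q"
      by (rule linear_map_span[OF module_axioms module_axioms that(4) gens[of k] _ that(3)])
         (use * span[of k] that(1) in auto)
    then show False using that(2) by simp
  qed
  have id: "linear_map R M M (\<lambda>x. x)" by (rule linear_mapI) auto
  have smult: "linear_map R M M (\<lambda>x. r \<odot>\<^bsub>M\<^esub> x)" if "r \<in> carrier R" for r
    using that by (intro linear_mapI) (auto simp: smult_r_distr smult_assoc1[symmetric] R.m_comm)
  have 1: "\<exists>\<alpha> g. (\<alpha>, g) \<in> T \<and> size \<alpha> = k" if nsub: "\<not> P (n0 + k) \<subseteq> K (n0 + k)" for k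
  proof -
    obtain z where "z \<in> P (n0 + k)" "z \<notin> K (n0 + k)" using nsub by blast
    from nonK[OF this K_sub id] show ?thesis by (auto simp: T_def exps_def)
  qed
  have 2: "\<exists>\<alpha> g. (\<alpha>, g) \<in> T \<and> size \<alpha> = k \<and> (\<Sum>j\<in>#\<alpha>. int (d j)) + e g \<le> i"
    if x: "x \<in> P (n0 + k)" "x \<in> mod_part M i" "x \<notin> K (n0 + k)" for k i x
  proof (rule ccontr)
    assume no: "\<not> ?thesis"
    \<comment> \<open>The vectors whose components of degree at most \<open>i\<close> lie in
      \<open>K\<close>. This is a submodule because homogeneous scalars have nonnegative degree and
      move components upwards only.\<close>
    let ?Y = "{x \<in> carrier M. \<forall>i'\<le>i. MG.hc x i' \<in> K (n0 + k)}"
    note KD = submoduleD[OF K_sub[of "n0 + k"]]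
    have Y: "submodule ?Y R M"
    proof (rule submodule_homogeneousI)
      fix r a x assume "r \<in> ring_part R a" "x \<in> ?Y"
      then show "r \<odot>\<^bsub>M\<^esub> x \<in> ?Y"
        using KD(4) RG.part_closed by (auto simp: hc_smult)
    qed (use KD in \<open>auto simp: MG.hc_add MG.hc_zero\<close>)
    have "mon \<alpha> \<odot>\<^bsub>M\<^esub> g \<in> ?Y" if \<alpha>: "\<alpha> \<in> exps k" "g \<in> G" for \<alpha> g
    proof -
      have A: "set_mset \<alpha> \<subseteq> A" "size \<alpha> = k" using \<alpha> by (auto simp: exps_def)
      note hc = MG.hc_homogeneous[OF mon_deg[OF A(1) \<alpha>(2)]]
      have "mon \<alpha> \<odot>\<^bsub>M\<^esub> g \<in> K (n0 + k)" if "(\<Sum>j\<in>#\<alpha>. int (d j)) + e g \<le> i"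
        using no that A \<alpha>(2) by (auto simp: T_def)
      then show ?thesis using KD(2) GM \<alpha>(2) by (auto simp: hc)
    qed
    then have "span R M {mon \<alpha> \<odot>\<^bsub>M\<^esub> x | \<alpha> x. \<alpha> \<in> exps k \<and> x \<in> G} \<subseteq> ?Y"
      by (intro span_least[OF Y]) auto
    then have "x \<in> ?Y" using span[of k] x(1) by blast
    then show False using x(3) MG.hc_homogeneous[OF x(2), of i] by auto
  qed
  have 3: "E.unbounded = non_nilpotent P K"
  proof (intro equalityI subsetI)
    fix j assume j: "j \<in> E.unbounded"
    then have jA: "j \<in> A" by (simp add: E.unbounded_def)
    have "\<exists>n. \<exists>z\<in>P n. (y j [^] m) \<odot>\<^bsub>M\<^esub> z \<notin> K (n + m)" for m
    proof -
      obtain \<alpha> g where \<alpha>: "(\<alpha>, g) \<in> T" "m \<le> count \<alpha> j" using j unfolding E.unbounded_def by blast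
      then have "replicate_mset m j \<subseteq># \<alpha>" by (metis count_le_replicate_mset_subset_eq)
      then obtain \<beta> where \<beta>: "\<alpha> = replicate_mset m j + \<beta>" by (metis mset_subset_eq_exists_conv)
      have gG: "g \<in> G" "set_mset \<beta> \<subseteq> A" using \<alpha>(1) \<beta> by (auto simp: T_def)
      have "mon \<alpha> \<odot>\<^bsub>M\<^esub> g = (y j [^] m) \<odot>\<^bsub>M\<^esub> (mon \<beta> \<odot>\<^bsub>M\<^esub> g)"
        using gG GM \<beta> jA by (auto simp: mon_union mon_replicate smult_assoc1 y_closed)
      moreover have "mon \<beta> \<odot>\<^bsub>M\<^esub> g \<in> P (n0 + size \<beta>)"
        using stable_mon[OF P(1) gG(2)] G(1) gG(1) by blast
      moreover have "mon \<alpha> \<odot>\<^bsub>M\<^esub> g \<notin> K (n0 + size \<beta> + m)" using \<alpha>(1) \<beta> by (simp add: T_def ac_simps)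
      ultimately show ?thesis by metis
    qed
    then show "j \<in> non_nilpotent P K" using jA by (simp add: non_nilpotent_def)
  next
    fix j assume j: "j \<in> non_nilpotent P K"
    then have jA: "j \<in> A" by (simp add: non_nilpotent_def)
    have "\<exists>\<alpha> g. (\<alpha>, g) \<in> T \<and> m \<le> count \<alpha> j" for m
    proof -
      obtain n z where z: "z \<in> P n" "(y j [^] (m + n0)) \<odot>\<^bsub>M\<^esub> z \<notin> K (n + (m + n0))"
        using j unfolding non_nilpotent_def by blast
      have zM: "z \<in> carrier M" using z(1) submoduleD(1)[OF P_sub] by blast
      let ?z = "mon (replicate_mset n0 j) \<odot>\<^bsub>M\<^esub> z"
      have "?z \<in> P (n + n0)" using stable_mon[OF P(1) _ z(1), of "replicate_mset n0 j"] jA by auto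
      moreover have "(y j [^] m) \<odot>\<^bsub>M\<^esub> ?z = (y j [^] (m + n0)) \<odot>\<^bsub>M\<^esub> z"
        using jA zM y_closed by (simp add: mon_replicate smult_assoc1[symmetric] R.nat_pow_mult)
      ultimately obtain \<alpha> g where \<alpha>: "\<alpha> \<in> exps n" "g \<in> G" "(y j [^] m) \<odot>\<^bsub>M\<^esub> (mon \<alpha> \<odot>\<^bsub>M\<^esub> g) \<notin> K (n + (m + n0))"
        using nonK[of ?z n "\<lambda>x. (y j [^] m) \<odot>\<^bsub>M\<^esub> x" "K (n + (m + n0))"] z(2) K_sub smult y_closed[OF jA]
        by (auto simp: add.commute)
      have "mon (replicate_mset m j + \<alpha>) \<odot>\<^bsub>M\<^esub> g = (y j [^] m) \<odot>\<^bsub>M\<^esub> (mon \<alpha> \<odot>\<^bsub>M\<^esub> g)"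
        using jA GM y_closed \<alpha>(2) by (auto simp: mon_union mon_replicate smult_assoc1)
      moreover have "n + (m + n0) = n0 + size (replicate_mset m j + \<alpha>)" using \<alpha>(1) by (simp add: exps_def)
      ultimately have "mon (replicate_mset m j + \<alpha>) \<odot>\<^bsub>M\<^esub> g \<notin> K (n0 + size (replicate_mset m j + \<alpha>))"
        using \<alpha>(3) by metis
      moreover have "set_mset (replicate_mset m j + \<alpha>) \<subseteq> A" using \<alpha>(1) jA by (auto simp: exps_def)
      ultimately have "(replicate_mset m j + \<alpha>, g) \<in> T" using \<alpha>(2) unfolding T_def by blast
      then show ?thesis by force
    qed
    then show "j \<in> E.unbounded" using jA by (simp add: E.unbounded_def)
  qed
  show ?thesis
  proof (rule that[of G T e])
    show "exponent_family A G T" by (rule E.exponent_family_axioms)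
    show "mon \<alpha> \<odot>\<^bsub>M\<^esub> g \<in> P (n0 + size \<alpha>)" if "(\<alpha>, g) \<in> T" for \<alpha> g
      using stable_mon[OF P(1)] G(1) that by (auto simp: T_def)
  qed (use 1 2 3 G(1) mon_deg in \<open>auto simp: T_def\<close>)
qed

lemma nilpotent_imp_subset:
  assumes "non_nilpotent P K = {}"
  shows "eventually (\<lambda>n. P n \<subseteq> K n) sequentially"
proof (rule initial_data)
  fix G T and e :: "'b \<Rightarrow> int"
  assume G: "exponent_family A G T" and unb: "exponent_family.unbounded A T = non_nilpotent P K"
    and T: "\<And>k. \<not> P (n0 + k) \<subseteq> K (n0 + k) \<Longrightarrow> \<exists>\<alpha> g. (\<alpha>, g) \<in> T \<and> size \<alpha> = k"
  from exponent_family.unbounded_empty[OF G] obtain k0 where k0: "\<forall>\<alpha> g. (\<alpha>, g) \<in> T \<longrightarrow> size \<alpha> < k0"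
    using unb assms by auto
  have "P n \<subseteq> K n" if n: "n \<ge> n0 + k0" for n
  proof (rule ccontr)
    assume "\<not> P n \<subseteq> K n"
    then obtain \<alpha> g where "(\<alpha>, g) \<in> T" "size \<alpha> = n - n0" using T[of "n - n0"] n by auto
    then show False using k0 n by fastforce
  qed
  then show ?thesis unfolding eventually_sequentially by blast
qed

lemma quot_indeg_linear:
  assumes "\<delta> \<in> non_nilpotent P K" "\<And>j. j \<in> non_nilpotent P K \<Longrightarrow> d \<delta> \<le> d j"
  shows "\<exists>b. eventually (\<lambda>n. quot_indeg (P n) (K n) = ereal (of_int (int (d \<delta>) * int n + b))) sequentially"
proof (rule initial_data)
  fix G T and e :: "'b \<Rightarrow> int"
  assume G: "exponent_family A G T" and unb: "exponent_family.unbounded A T = non_nilpotent P K"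
    and low: "\<And>k i x. x \<in> P (n0 + k) \<Longrightarrow> x \<in> mod_part M i \<Longrightarrow> x \<notin> K (n0 + k) \<Longrightarrow>
        \<exists>\<alpha> g. (\<alpha>, g) \<in> T \<and> size \<alpha> = k \<and> (\<Sum>j\<in>#\<alpha>. int (d j)) + e g \<le> i"
    and T: "\<And>\<alpha> g. (\<alpha>, g) \<in> T \<Longrightarrow> mon \<alpha> \<odot>\<^bsub>M\<^esub> g \<in> P (n0 + size \<alpha>)"
    "\<And>\<alpha> g. (\<alpha>, g) \<in> T \<Longrightarrow> mon \<alpha> \<odot>\<^bsub>M\<^esub> g \<in> mod_part M ((\<Sum>j\<in>#\<alpha>. int (d j)) + e g)"
    "\<And>\<alpha> g. (\<alpha>, g) \<in> T \<Longrightarrow> mon \<alpha> \<odot>\<^bsub>M\<^esub> g \<notin> K (n0 + size \<alpha>)"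
  interpret E: exponent_family A G T d e by fact
  have min: "\<delta> \<in> E.unbounded" "j \<in> E.unbounded \<Longrightarrow> d \<delta> \<le> d j" for j using assms unb by auto
  have "\<exists>b k0. \<forall>k\<ge>k0.
     (\<exists>\<alpha> g. (\<alpha>, g) \<in> T \<and> size \<alpha> = k \<and> (\<Sum>j\<in>#\<alpha>. int (d j)) + e g = int (d \<delta>) * int k + b) \<and>
     (\<forall>\<alpha> g. (\<alpha>, g) \<in> T \<longrightarrow> size \<alpha> = k \<longrightarrow> int (d \<delta>) * int k + b \<le> (\<Sum>j\<in>#\<alpha>. int (d j)) + e g)"
    by (rule E.eventually_linear) (fact min)+
  then obtain b k0 where *: "\<And>k. k \<ge> k0 \<Longrightarrow>
     (\<exists>\<alpha> g. (\<alpha>, g) \<in> T \<and> size \<alpha> = k \<and> (\<Sum>j\<in>#\<alpha>. int (d j)) + e g = int (d \<delta>) * int k + b) \<and>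
     (\<forall>\<alpha> g. (\<alpha>, g) \<in> T \<longrightarrow> size \<alpha> = k \<longrightarrow> int (d \<delta>) * int k + b \<le> (\<Sum>j\<in>#\<alpha>. int (d j)) + e g)"
    by auto
  have b: "\<exists>\<alpha> g. (\<alpha>, g) \<in> T \<and> size \<alpha> = k \<and> (\<Sum>j\<in>#\<alpha>. int (d j)) + e g = int (d \<delta>) * int k + b"
     "(\<alpha>, g) \<in> T \<Longrightarrow> size \<alpha> = k \<Longrightarrow> int (d \<delta>) * int k + b \<le> (\<Sum>j\<in>#\<alpha>. int (d j)) + e g"
     if "k \<ge> k0" for k \<alpha> g
    using *[OF that] by auto
  \<comment> \<open>Exponents of size \<open>k\<close> belong to stage \<open>n0 + k\<close>, which
    shifts the intercept by \<open>d \<delta> * n0\<close>.\<close>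
  have "quot_indeg (P n) (K n) = ereal (of_int (int (d \<delta>) * int n + (b - int (d \<delta>) * int n0)))" if n: "n \<ge> n0 + k0" for n
  proof -
    define k where "k = n - n0"
    have k: "n = n0 + k" "k \<ge> k0" using n by (auto simp: k_def)
    let ?v = "int (d \<delta>) * int k + b"
    have v: "int (d \<delta>) * int n + (b - int (d \<delta>) * int n0) = ?v" using k by (simp add: algebra_simps)
    obtain \<alpha> g where \<alpha>: "(\<alpha>, g) \<in> T" "size \<alpha> = k" "(\<Sum>j\<in>#\<alpha>. int (d j)) + e g = ?v" using b(1)[OF k(2)] by blast
    show ?thesis
      unfolding quot_indeg_def v
    proof (rule Inf_eqI)
      fix s assume "s \<in> {ereal (of_int i) | i. \<exists>x\<in>P n \<inter> mod_part M i. x \<notin> K n}"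
      then obtain i x where i: "s = ereal (of_int i)" "x \<in> P (n0 + k)" "x \<in> mod_part M i" "x \<notin> K (n0 + k)" using k by auto
      from low[OF i(2-4)] obtain \<beta> h where "(\<beta>, h) \<in> T" "size \<beta> = k" "(\<Sum>j\<in>#\<beta>. int (d j)) + e h \<le> i" by blast
      then have "?v \<le> i" using b(2)[OF k(2)] by force
      then show "ereal (of_int ?v) \<le> s" using i(1) by (metis ereal_less_eq(3) of_int_le_iff)
    next
      fix s assume s: "\<And>t. t \<in> {ereal (of_int i) | i. \<exists>x\<in>P n \<inter> mod_part M i. x \<notin> K n} \<Longrightarrow> s \<le> t"
      show "s \<le> ereal (of_int ?v)"
      proof (rule s, rule CollectI, intro exI conjI)
        show "\<exists>x\<in>P n \<inter> mod_part M ?v. x \<notin> K n"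
          using T[OF \<alpha>(1)] \<alpha>(2,3) k(1) by (metis IntI)
      qed simp
    qed
  qed
  then show ?thesis unfolding eventually_sequentially by blast
qed

text \<open>Non-nilpotency alone allows every single element to be killed by some power of
  \<open>y \<delta>\<close>. Since there are only finitely many generators, powers of unbounded size
  must survive on one and the same generator.\<close>

lemma non_torsion_element:
  assumes "\<delta> \<in> non_nilpotent P K"
  shows "\<exists>g\<in>P n0. \<forall>m. (y \<delta> [^] m) \<odot>\<^bsub>M\<^esub> g \<notin> K (n0 + m)"
proof (rule initial_data)
  fix G T and e :: "'b \<Rightarrow> int"
  assume G: "exponent_family A G T" "G \<subseteq> P n0" and unb: "exponent_family.unbounded A T = non_nilpotent P K"
    and T: "\<And>\<alpha> g. (\<alpha>, g) \<in> T \<Longrightarrow> mon \<alpha> \<odot>\<^bsub>M\<^esub> g \<notin> K (n0 + size \<alpha>)"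
  interpret E: exponent_family A G T by fact
  have \<delta>: "\<delta> \<in> A" "\<And>m. \<exists>\<alpha> g. (\<alpha>, g) \<in> T \<and> m \<le> count \<alpha> \<delta>"
    using assms unfolding unb[symmetric] E.unbounded_def by blast+
  show ?thesis
  proof (rule ccontr)
    assume no: "\<not> ?thesis"
    have "\<exists>k. \<forall>x\<in>T. snd x = g \<longrightarrow> count (fst x) \<delta> < k" if g: "g \<in> G" for g
    proof -
      obtain m where m: "(y \<delta> [^] m) \<odot>\<^bsub>M\<^esub> g \<in> K (n0 + m)" using no subsetD[OF G(2) g] by blast
      have "count \<alpha> \<delta> < m" if "(\<alpha>, g) \<in> T" for \<alpha>
      proof (rule ccontr)
        assume "\<not> count \<alpha> \<delta> < m"
        then have "replicate_mset m \<delta> \<subseteq># \<alpha>" by (metis count_le_replicate_mset_subset_eq not_less)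
        then have "(replicate_mset m \<delta>, g) \<in> T" using E.T_down' that by blast
        from T[OF this] show False using m \<delta>(1) by (simp add: mon_replicate)
      qed
      then have "\<forall>x\<in>T. snd x = g \<longrightarrow> count (fst x) \<delta> < m" by auto
      then show ?thesis by (rule exI)
    qed
    from uniform_bound[where T = T and Q = "\<lambda>g x. snd x = g", OF E.finite_G this]
    obtain k where "\<And>g x. g \<in> G \<Longrightarrow> x \<in> T \<Longrightarrow> snd x = g \<Longrightarrow> count (fst x) \<delta> < k" by metis
    moreover obtain \<alpha> g where "(\<alpha>, g) \<in> T" "k \<le> count \<alpha> \<delta>" using \<delta>(2)[of k] by blast
    ultimately show False using E.T_sub[of \<alpha> g] by fastforce
  qed
qed

end


section \<open>Associated primes of a stable family of quotients\<close>

text \<open>The smallest slope wins eventually, and among the functions of that slope the smallest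
  intercept \<open>c\<close>.\<close>

lemma min_of_linear:
  fixes a :: "'p \<Rightarrow> nat" and b :: "'p \<Rightarrow> int"
  assumes "finite Q" "q \<in> Q" "\<And>p. p \<in> Q \<Longrightarrow> a q \<le> a p"
  shows "\<exists>c. \<forall>\<^sub>F n in sequentially. Inf ((\<lambda>p. ereal (of_int (int (a p) * int n + b p))) ` Q) = ereal (of_int (int (a q) * int n + c))"
proof -
  let ?Q = "{p \<in> Q. a p = a q}"
  have fin: "finite (b ` ?Q)" "b ` ?Q \<noteq> {}" using assms(1,2) by auto
  define c where "c = Min (b ` ?Q)"
  obtain p0 where p0: "p0 \<in> ?Q" "b p0 = c" using Min_in[OF fin] unfolding c_def by auto
  \<comment> \<open>A function of larger slope gains at least 1 per step, so after
    \<open>c - b p\<close> steps it has made up for its smaller intercept.\<close>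
  define N where "N = Max ((\<lambda>p. nat (c - b p)) ` Q)"
  have "Inf ((\<lambda>p. ereal (of_int (int (a p) * int n + b p))) ` Q) = ereal (of_int (int (a q) * int n + c))" if n: "n \<ge> N" for n
  proof (rule Inf_eqI)
    fix s assume "s \<in> (\<lambda>p. ereal (of_int (int (a p) * int n + b p))) ` Q"
    then obtain p where p: "p \<in> Q" "s = ereal (of_int (int (a p) * int n + b p))" by auto
    have "int (a q) * int n + c \<le> int (a p) * int n + b p"
    proof (cases "a p = a q")
      case True
      then have "c \<le> b p" unfolding c_def using fin(1) p(1) by (intro Min_le) auto
      then show ?thesis using True by simp
    next
      case False
      then have "int (a q) + 1 \<le> int (a p)" using assms(3)[OF p(1)] by simp
      then have "(int (a q) + 1) * int n \<le> int (a p) * int n" by (rule mult_right_mono) simp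
      moreover have "nat (c - b p) \<le> N" unfolding N_def using assms(1) p(1) by (intro Max_ge) auto
      ultimately show ?thesis using n by (simp add: algebra_simps)
    qed
    then show "ereal (of_int (int (a q) * int n + c)) \<le> s" unfolding p(2) ereal_less_eq(3) of_int_le_iff .
  next
    fix s assume s: "\<And>t. t \<in> (\<lambda>p. ereal (of_int (int (a p) * int n + b p))) ` Q \<Longrightarrow> s \<le> t"
    show "s \<le> ereal (of_int (int (a q) * int n + c))"
      by (rule s, rule image_eqI[of _ _ p0]) (use p0 in auto)
  qed
  then show ?thesis unfolding eventually_sequentially by blast
qed

text \<open>The setting after translation: \<open>Z n\<close> modulo \<open>B n\<close> plays the
  role of \<open>Tor\<close>. Generation by the \<open>y j\<close> is assumed for the ambient family
  \<open>F\<close>; Artin-Rees passes it on to every stable family inside \<open>Z\<close>.\<close>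

locale quotient_family = graded_elements R M y A d
  for R :: "'a gring" (structure) and M :: "('a, 'b) gmodule" (structure) and y A d +
  fixes Z B F :: "nat \<Rightarrow> 'b set" and m0 :: nat
  assumes noeth_ring: "noetherian_ring R" and noeth: "noetherian_module R M"
    and F: "\<And>n. submodule (F n) R M" "\<And>n. n \<ge> m0 \<Longrightarrow> F (Suc n) \<subseteq> jspan (F n)"
    and Z: "stable Z" "\<And>n. Z n \<subseteq> F n" "\<And>n. hom_closed (Z n)"
    and B: "stable B" "\<And>n. B n \<subseteq> Z n" "\<And>n. hom_closed (B n)"
    and d_mono: "mono_on A d"
begin

lemma Z_sub: "submodule (Z n) R M" and B_sub: "submodule (B n) R M"
  using Z(1) B(1) by (auto simp: stable_def)

lemmas ZD = submoduleD[OF Z_sub] and BD = submoduleD[OF B_sub]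

lemma stableD:
  assumes "stable W"
  shows "submodule (W n) R M" "j \<in> A \<Longrightarrow> x \<in> W n \<Longrightarrow> y j \<odot>\<^bsub>M\<^esub> x \<in> W (Suc n)"
  using assms by (auto simp: stable_def)

lemma artin_rees_family:
  assumes "stable W" "\<And>n. W n \<subseteq> Z n"
  shows "\<exists>n0. \<forall>n\<ge>n0. W (Suc n) \<subseteq> jspan (W n)"
proof (rule artin_rees[where F = F and m = m0, OF noeth])
  show "W n \<subseteq> F n" for n using assms(2)[of n] Z(2)[of n] by (rule subset_trans)
qed (use F stableD[OF assms(1)] in auto)

text \<open>The chain condition for graded modules over the Rees algebra. The union of the chain is
  a stable family and hence generated from some stage \<open>n0\<close> on; the finitely many stages
  up to \<open>n0\<close> become stationary, and generation carries equality to all later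
  ones.\<close>

lemma stable_chain:
  assumes "\<And>i. stable (W i)" "\<And>i n. W i n \<subseteq> Z n" "\<And>i n. W i n \<subseteq> W (Suc i) n"
  shows "\<exists>k. \<forall>i\<ge>k. \<forall>n. W i n = W k n"
proof -
  note W = stableD[OF assms(1)]
  have mono: "W i n \<subseteq> W j n" if "i \<le> j" for i j n
    using lift_Suc_mono_le[of "\<lambda>i. W i n", OF assms(3)] that .
  define U where "U n = (\<Union>i. W i n)" for n
  have "stable U"
    unfolding stable_def
  proof (intro conjI allI ballI)
    show "submodule (U n) R M" for n
      unfolding U_def by (rule submodule_chain_Union[of "\<lambda>i. W i n"]) (use W(1) assms(3) in auto)
    fix n j x assume "j \<in> A" "x \<in> U n"
    then show "y j \<odot>\<^bsub>M\<^esub> x \<in> U (Suc n)" using W(2) unfolding U_def by blast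
  qed
  moreover have "U n \<subseteq> Z n" for n unfolding U_def using assms(2) by blast
  ultimately obtain n0 where n0: "\<And>n. n \<ge> n0 \<Longrightarrow> U (Suc n) \<subseteq> jspan (U n)" using artin_rees_family by blast
  have "\<exists>k. \<forall>i\<ge>k. W i n = W k n" for n
    by (rule noetherian_chain[OF noeth, of "\<lambda>i. W i n"]) (use W(1) assms(3) in auto)
  then obtain h where h: "\<And>n i. i \<ge> h n \<Longrightarrow> W i n = W (h n) n" by metis
  \<comment> \<open>Beyond \<open>k\<close> all stages up to \<open>n0\<close> are stationary
    simultaneously.\<close>
  define k where "k = Max (h ` {..n0})"
  have hk: "h n \<le> k" if "n \<le> n0" for n unfolding k_def using that by (intro Max_ge) auto
  have Uk: "U n \<subseteq> W k n" for n
  proof (induction n)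
    case 0
    have "W i 0 \<subseteq> W k 0" for i
      using mono[of i "max i k" 0] h[of 0 "max i k"] h[of 0 k] hk[of 0] by (metis le0 max.cobounded1 max.cobounded2 order_trans)
    then show ?case unfolding U_def by blast
  next
    case (Suc n)
    show ?case
    proof (cases "Suc n \<le> n0")
      case True
      have "W i (Suc n) \<subseteq> W k (Suc n)" for i
        using mono[of i "max i k" "Suc n"] h[of "Suc n" "max i k"] h[of "Suc n" k] hk[OF True]
        by (metis max.cobounded1 max.cobounded2 order_trans)
      then show ?thesis unfolding U_def by blast
    next
      case False
      then have "U (Suc n) \<subseteq> jspan (U n)" by (intro n0) simp
      also have "\<dots> \<subseteq> jspan (W k n)" by (rule jspan_mono[OF Suc.IH])
      also have "\<dots> \<subseteq> W k (Suc n)" by (rule jspan_least) (use W in auto)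
      finally show ?thesis .
    qed
  qed
  have "W i n = W k n" if "i \<ge> k" for i n
  proof
    show "W k n \<subseteq> W i n" by (rule mono[OF that])
    show "W i n \<subseteq> W k n" using Uk[of n] unfolding U_def by blast
  qed
  then show ?thesis by blast
qed

section \<open>Colon ideals and associated primes of the family of quotients\<close>

definition colon :: "'b set \<Rightarrow> 'b \<Rightarrow> 'a set" where
  "colon Q z = {r \<in> carrier R. r \<odot>\<^bsub>M\<^esub> z \<in> Q}"

definition ass :: "nat \<Rightarrow> 'a set set" where
  "ass n = {p. primeideal p R \<and> (\<exists>z\<in>Z n. p = colon (B n) z)}"

lemma colon_ideal:
  assumes "submodule Q R M" "z \<in> carrier M"
  shows "ideal (colon Q z) R"
  by (rule idealI_cring)
     (use assms submoduleD[OF assms(1)] in \<open>auto simp: colon_def smult_l_distr smult_assoc1\<close>)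

lemma primeidealD:
  assumes "primeideal p R"
  shows "\<one> \<notin> p" "a \<in> carrier R \<Longrightarrow> b \<in> carrier R \<Longrightarrow> a \<otimes> b \<in> p \<Longrightarrow> a \<in> p \<or> b \<in> p"
    "r \<in> p \<Longrightarrow> r \<in> carrier R" "r \<in> p \<Longrightarrow> a \<in> carrier R \<Longrightarrow> a \<otimes> r \<in> p"
    "a \<in> p \<Longrightarrow> b \<in> p \<Longrightarrow> a \<oplus> b \<in> p" "\<zero> \<in> p" "a \<in> p \<Longrightarrow> b \<in> p \<Longrightarrow> a \<ominus> b \<in> p"
proof -
  interpret primeideal p R by fact
  show "\<one> \<notin> p" using I_notcarr one_imp_carrier by auto
  show "a \<in> carrier R \<Longrightarrow> b \<in> carrier R \<Longrightarrow> a \<otimes> b \<in> p \<Longrightarrow> a \<in> p \<or> b \<in> p" by (rule I_prime)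
  show "r \<in> p \<Longrightarrow> r \<in> carrier R" using a_subset by blast
  show "r \<in> p \<Longrightarrow> a \<in> carrier R \<Longrightarrow> a \<otimes> r \<in> p" by (rule I_l_closed)
  show "a \<in> p \<Longrightarrow> b \<in> p \<Longrightarrow> a \<oplus> b \<in> p" "\<zero> \<in> p" "a \<in> p \<Longrightarrow> b \<in> p \<Longrightarrow> a \<ominus> b \<in> p"
    by (auto simp: a_minus_def)
qed

text \<open>If \<open>s\<close> kills \<open>r z\<close> then \<open>s r\<close> lies in
  \<open>p\<close>, and primality puts \<open>s\<close> there. Multiplying by a scalar outside
  \<open>p\<close> thus changes the representing element but not its annihilator.\<close>

lemma colon_smult_prime:
  assumes p: "primeideal p R" "p = colon Q z" and z: "z \<in> carrier M" and r: "r \<in> carrier R" "r \<notin> p"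
  shows "colon Q (r \<odot>\<^bsub>M\<^esub> z) = p"
proof (intro equalityI subsetI)
  fix s assume s: "s \<in> colon Q (r \<odot>\<^bsub>M\<^esub> z)"
  then have "s \<otimes> r \<in> p" using z r p(2) by (auto simp: colon_def smult_assoc1)
  then show "s \<in> p" using primeidealD(2)[OF p(1)] r s by (auto simp: colon_def)
next
  fix s assume s: "s \<in> p"
  then have "r \<otimes> s \<in> p" "s \<in> carrier R" using primeidealD(3,4)[OF p(1)] r by auto
  then show "s \<in> colon Q (r \<odot>\<^bsub>M\<^esub> z)"
    using z r p(2) by (auto simp: colon_def smult_assoc1[symmetric] R.m_comm)
qed

text \<open>The degree \<open>k\<close> part of the Rees algebra, described by its action on stable families.\<close>

definition shifting :: "nat \<Rightarrow> 'a set" where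
  "shifting k = {t \<in> carrier R. \<forall>W. stable W \<longrightarrow> (\<forall>n. \<forall>x\<in>W n. t \<odot>\<^bsub>M\<^esub> x \<in> W (n + k))}"

lemma shiftingD: "t \<in> shifting k \<Longrightarrow> stable W \<Longrightarrow> x \<in> W n \<Longrightarrow> t \<odot>\<^bsub>M\<^esub> x \<in> W (n + k)"
  "t \<in> shifting k \<Longrightarrow> t \<in> carrier R"
  by (auto simp: shifting_def)

lemma stable_carrier: "stable W \<Longrightarrow> x \<in> W n \<Longrightarrow> x \<in> carrier M"
  using submoduleD(1) stableD(1) by blast

lemma shifting_add: "s \<in> shifting k \<Longrightarrow> t \<in> shifting k \<Longrightarrow> s \<oplus> t \<in> shifting k"
  by (auto simp: shifting_def smult_l_distr stable_carrier intro!: submoduleD(3)[OF stableD(1)])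

lemma shifting_mult:
  assumes "r \<in> carrier R" "t \<in> shifting k"
  shows "r \<otimes> t \<in> shifting k"
proof -
  have "(r \<otimes> t) \<odot>\<^bsub>M\<^esub> x \<in> W (n + k)" if "stable W" "x \<in> W n" for W n x
    using submoduleD(4)[OF stableD(1)[OF that(1)] assms(1) shiftingD(1)[OF assms(2) that]]
      assms(1) shiftingD(2)[OF assms(2)] stable_carrier[OF that] by (simp add: smult_assoc1)
  then show ?thesis using assms(1) shiftingD(2)[OF assms(2)] by (simp add: shifting_def)
qed

lemma shifting_y: "j \<in> A \<Longrightarrow> t \<in> shifting k \<Longrightarrow> y j \<otimes> t \<in> shifting (Suc k)"
  using y_closed stableD(2) by (auto simp: shifting_def smult_assoc1 stable_carrier)

lemma zero_shifting: "\<zero> \<in> shifting k"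
  by (auto simp: shifting_def stable_carrier intro!: submoduleD(2)[OF stableD(1)])

lemma one_shifting: "\<one> \<in> shifting 0"
  by (auto simp: shifting_def stable_carrier)

text \<open>A prime filtration: as long as \<open>W\<close> is a stable family between \<open>B\<close> and \<open>Z\<close> with finitely many
  associated primes, a maximal colon ideal of \<open>Z/W\<close> yields a larger one with at most one more prime,
  which contradicts the chain condition on stable families.\<close>

lemma finite_ass: "finite (\<Union>n. ass n)"
proof (rule ccontr)
  assume inf: "infinite (\<Union>n. ass n)"
  \<comment> \<open>The primes associated to W/B in any degree; for \<open>W = Z\<close> this is the
    set in question, and for \<open>W = B\<close> it is empty.\<close>
  define assW where "assW W = {p. primeideal p R \<and> (\<exists>n. \<exists>z\<in>W n. p = colon (B n) z)}" for W :: "nat \<Rightarrow> 'b set"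
  have assZ: "assW Z = (\<Union>n. ass n)" by (auto simp: assW_def ass_def)
  let ?P = "\<lambda>W. stable W \<and> (\<forall>n. B n \<subseteq> W n) \<and> (\<forall>n. W n \<subseteq> Z n) \<and> finite (assW W)"
  let ?Q = "\<lambda>W W'. (\<forall>n. W n \<subseteq> W' n) \<and> (\<exists>n. W n \<noteq> W' n)"
  have "p \<notin> assW B" for p
  proof
    assume "p \<in> assW B"
    then obtain n z where p: "primeideal p R" "z \<in> B n" "p = colon (B n) z" by (auto simp: assW_def)
    then have "\<one> \<in> p" using BD(1)[OF p(2)] by (auto simp: colon_def)
    then show False using primeidealD(1)[OF p(1)] by simp
  qed
  then have "assW B = {}" by auto
  then have base: "?P B" using B by auto
  have step: "\<exists>W'. ?P W' \<and> ?Q W W'" if W: "?P W" for W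
  proof -
    note WD = submoduleD[OF stableD(1)[OF conjunct1[OF W]]] and Wsub = stableD(1)[OF conjunct1[OF W]]
      and Wst = conjunct1[OF W]
    have BW: "x \<in> B n \<Longrightarrow> x \<in> W n" and WZ: "x \<in> W n \<Longrightarrow> x \<in> Z n" for x n using W by blast+
    let ?S = "{colon (W n) z | n z. z \<in> Z n \<and> z \<notin> W n}"
    have "\<exists>n z. z \<in> Z n \<and> z \<notin> W n"
    proof (rule ccontr)
      assume "\<not> ?thesis"
      then have "Z = W" using WZ by (intro ext) blast
      then show False using inf W assZ by simp
    qed
    then have "?S \<noteq> {}" by blast
    then have "\<exists>q\<in>?S. \<forall>q'\<in>?S. q \<subseteq> q' \<longrightarrow> q' = q"
      by (rule noetherian_ring.ideal_maximal[OF noeth_ring]) (use colon_ideal[OF Wsub] ZD(1) in auto)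
    then obtain q where q: "q \<in> ?S" "\<forall>q'\<in>?S. q \<subseteq> q' \<longrightarrow> q' = q" by blast
    then obtain n z where z: "z \<in> Z n" "z \<notin> W n" and qz: "q = colon (W n) z" by auto
    have max: "colon (W l) u = colon (W n) z" if "u \<in> Z l" "u \<notin> W l" "colon (W n) z \<subseteq> colon (W l) u" for l u
    proof -
      have "colon (W l) u \<in> ?S" using that(1,2) by blast
      then show ?thesis using q(2) that(3) qz by blast
    qed
    have zM: "z \<in> carrier M" using ZD(1) z(1) by blast
    have tz: "t \<odot>\<^bsub>M\<^esub> z \<in> Z l" if "t \<in> shifting (l - n)" "n \<le> l" for t l
      using shiftingD(1)[OF that(1) Z(1) z(1)] that(2) by simp
    \<comment> \<open>\<open>W\<close> enlarged by the Rees multiples of \<open>z\<close>, which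
      lives in degree \<open>n\<close>. Degrees below \<open>n\<close> contain no such multiples,
      hence the default value zero.\<close>
    define V where "V l = {w \<oplus>\<^bsub>M\<^esub> t \<odot>\<^bsub>M\<^esub> z | w t. w \<in> W l \<and> (if n \<le> l then t \<in> shifting (l - n) else t = \<zero>)}" for l
    have VI: "w \<oplus>\<^bsub>M\<^esub> t \<odot>\<^bsub>M\<^esub> z \<in> V l" if "w \<in> W l" "if n \<le> l then t \<in> shifting (l - n) else t = \<zero>" for w t l
      using that unfolding V_def by blast
    have VE: "\<exists>w t. v = w \<oplus>\<^bsub>M\<^esub> t \<odot>\<^bsub>M\<^esub> z \<and> w \<in> W l \<and> (if n \<le> l then t \<in> shifting (l - n) else t = \<zero>) \<and> t \<in> carrier R \<and> w \<in> carrier M"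
      if v: "v \<in> V l" for v l
    proof -
      obtain w t where wt: "v = w \<oplus>\<^bsub>M\<^esub> t \<odot>\<^bsub>M\<^esub> z" "w \<in> W l" "if n \<le> l then t \<in> shifting (l - n) else t = \<zero>"
        using v unfolding V_def by auto
      then have "t \<in> carrier R" using shiftingD(2) by (auto split: if_splits)
      then show ?thesis using wt WD(1) by blast
    qed
    have WV: "W l \<subseteq> V l" for l
    proof
      fix w assume w: "w \<in> W l"
      have "w \<oplus>\<^bsub>M\<^esub> \<zero> \<odot>\<^bsub>M\<^esub> z \<in> V l" by (rule VI[OF w]) (simp add: zero_shifting)
      then show "w \<in> V l" using zM WD(1)[OF w] by simp
    qed
    have VZ: "V l \<subseteq> Z l" for l
    proof
      fix v assume "v \<in> V l"
      then obtain w t where *: "v = w \<oplus>\<^bsub>M\<^esub> t \<odot>\<^bsub>M\<^esub> z" "w \<in> W l" "if n \<le> l then t \<in> shifting (l - n) else t = \<zero>" using VE by blast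
      then show "v \<in> Z l" using tz[of t l] ZD(2,3) WZ zM by (auto split: if_splits)
    qed
    have Vst: "stable V"
      unfolding stable_def
    proof (intro conjI allI ballI)
      show "submodule (V l) R M" for l
      proof (rule submoduleI')
        show "V l \<subseteq> carrier M" using VZ[of l] ZD(1) by blast
        show "\<zero>\<^bsub>M\<^esub> \<in> V l" using WV[of l] WD(2) by blast
        fix u v assume "u \<in> V l" "v \<in> V l"
        then obtain w t w' t' where *: "u = w \<oplus>\<^bsub>M\<^esub> t \<odot>\<^bsub>M\<^esub> z" "w \<in> W l" "if n \<le> l then t \<in> shifting (l - n) else t = \<zero>"
          "t \<in> carrier R" "w \<in> carrier M"
          "v = w' \<oplus>\<^bsub>M\<^esub> t' \<odot>\<^bsub>M\<^esub> z" "w' \<in> W l" "if n \<le> l then t' \<in> shifting (l - n) else t' = \<zero>" "t' \<in> carrier R" "w' \<in> carrier M"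
          using VE by metis
        have "u \<oplus>\<^bsub>M\<^esub> v = (w \<oplus>\<^bsub>M\<^esub> w') \<oplus>\<^bsub>M\<^esub> (t \<oplus> t') \<odot>\<^bsub>M\<^esub> z"
          using * zM by (simp add: smult_l_distr M.a_ac)
        moreover have "if n \<le> l then t \<oplus> t' \<in> shifting (l - n) else t \<oplus> t' = \<zero>"
          using * shifting_add by (auto split: if_splits)
        ultimately show "u \<oplus>\<^bsub>M\<^esub> v \<in> V l" using VI[OF WD(3)[OF *(2) *(7)]] by metis
      next
        fix r u assume r: "r \<in> carrier R" and "u \<in> V l"
        then obtain w t where *: "u = w \<oplus>\<^bsub>M\<^esub> t \<odot>\<^bsub>M\<^esub> z" "w \<in> W l" "if n \<le> l then t \<in> shifting (l - n) else t = \<zero>"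
          "t \<in> carrier R" "w \<in> carrier M" using VE by metis
        have "r \<odot>\<^bsub>M\<^esub> u = r \<odot>\<^bsub>M\<^esub> w \<oplus>\<^bsub>M\<^esub> (r \<otimes> t) \<odot>\<^bsub>M\<^esub> z"
          using * zM r by (simp add: smult_r_distr smult_assoc1)
        moreover have "if n \<le> l then r \<otimes> t \<in> shifting (l - n) else r \<otimes> t = \<zero>"
          using * shifting_mult[OF r] r by (auto split: if_splits)
        ultimately show "r \<odot>\<^bsub>M\<^esub> u \<in> V l" using VI[OF WD(4)[OF r *(2)]] by metis
      qed
      fix l j u assume j: "j \<in> A" and "u \<in> V l"
      then obtain w t where *: "u = w \<oplus>\<^bsub>M\<^esub> t \<odot>\<^bsub>M\<^esub> z" "w \<in> W l" "if n \<le> l then t \<in> shifting (l - n) else t = \<zero>"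
        "t \<in> carrier R" "w \<in> carrier M" using VE by metis
      have "y j \<odot>\<^bsub>M\<^esub> u = y j \<odot>\<^bsub>M\<^esub> w \<oplus>\<^bsub>M\<^esub> (y j \<otimes> t) \<odot>\<^bsub>M\<^esub> z"
        using * zM y_closed[OF j] by (simp add: smult_r_distr smult_assoc1)
      moreover have "if n \<le> Suc l then y j \<otimes> t \<in> shifting (Suc l - n) else y j \<otimes> t = \<zero>"
        using * shifting_y[OF j] y_closed[OF j] zero_shifting by (auto split: if_splits simp: Suc_diff_le)
      ultimately show "y j \<odot>\<^bsub>M\<^esub> u \<in> V (Suc l)" using VI[OF stableD(2)[OF Wst j *(2)]] by metis
    qed
    have "assW V \<subseteq> insert (colon (W n) z) (assW W)"
    proof
      fix p assume "p \<in> assW V"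
      then obtain l v where p: "primeideal p R" "v \<in> V l" "p = colon (B l) v" by (auto simp: assW_def)
      note pD = primeidealD[OF p(1)]
      obtain w t where *: "v = w \<oplus>\<^bsub>M\<^esub> t \<odot>\<^bsub>M\<^esub> z" "w \<in> W l" "if n \<le> l then t \<in> shifting (l - n) else t = \<zero>"
        "t \<in> carrier R" "w \<in> carrier M" using VE[OF p(2)] by metis
      have vM: "v \<in> carrier M" using * zM by simp
      have assI: "p \<in> assW W" if "v' \<in> W l" "p = colon (B l) v'" for v'
        using that p(1) by (auto simp: assW_def)
      show "p \<in> insert (colon (W n) z) (assW W)"
      proof (cases "t \<odot>\<^bsub>M\<^esub> z \<in> W l")
        case True
        then have "v \<in> W l" using * WD(3) by simp
        then show ?thesis using assI p(3) by blast
      next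
        case False
        then have nl: "n \<le> l" "t \<in> shifting (l - n)" using *(3) zM WD(2) by (auto split: if_splits)
        \<comment> \<open>The colon ideal of \<open>t z\<close> contains that of \<open>z\<close>,
          and \<open>t z\<close> is not in \<open>W\<close>; maximality gives equality.\<close>
        have q: "colon (W l) (t \<odot>\<^bsub>M\<^esub> z) = colon (W n) z"
        proof (rule max[OF tz[OF nl(2,1)] False], rule subsetI)
          fix r assume r: "r \<in> colon (W n) z"
          then have "t \<odot>\<^bsub>M\<^esub> (r \<odot>\<^bsub>M\<^esub> z) \<in> W (n + (l - n))" by (intro shiftingD(1)[OF nl(2) Wst]) (auto simp: colon_def)
          moreover have "t \<odot>\<^bsub>M\<^esub> (r \<odot>\<^bsub>M\<^esub> z) = r \<odot>\<^bsub>M\<^esub> (t \<odot>\<^bsub>M\<^esub> z)"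
            using r *(4) zM by (simp add: colon_def smult_assoc1[symmetric] R.m_comm)
          ultimately show "r \<in> colon (W l) (t \<odot>\<^bsub>M\<^esub> z)" using r nl(1) by (simp add: colon_def)
        qed
        have rv: "r \<odot>\<^bsub>M\<^esub> v = r \<odot>\<^bsub>M\<^esub> w \<oplus>\<^bsub>M\<^esub> r \<odot>\<^bsub>M\<^esub> (t \<odot>\<^bsub>M\<^esub> z)" if "r \<in> carrier R" for r
          using that * zM by (simp add: smult_r_distr)
        have pq: "p \<subseteq> colon (W n) z"
        proof
          fix r assume r: "r \<in> p"
          then have rR: "r \<in> carrier R" and "r \<odot>\<^bsub>M\<^esub> v \<in> W l" using p(3) BW by (auto simp: colon_def)
          moreover have "r \<odot>\<^bsub>M\<^esub> w \<in> W l" using WD(4)[OF rR *(2)] .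
          ultimately have "r \<odot>\<^bsub>M\<^esub> v \<ominus>\<^bsub>M\<^esub> r \<odot>\<^bsub>M\<^esub> w \<in> W l" using WD(6) by blast
          moreover have "r \<odot>\<^bsub>M\<^esub> v \<ominus>\<^bsub>M\<^esub> r \<odot>\<^bsub>M\<^esub> w = r \<odot>\<^bsub>M\<^esub> (t \<odot>\<^bsub>M\<^esub> z)"
            using rv[OF rR] rR * zM by (simp add: a_minus_def M.a_ac M.r_neg1 M.r_neg2 M.r_neg)
          ultimately have "r \<in> colon (W l) (t \<odot>\<^bsub>M\<^esub> z)" using rR by (simp add: colon_def)
          then show "r \<in> colon (W n) z" by (simp only: q)
        qed
        show ?thesis
        proof (cases "p = colon (W n) z")
          case False
          \<comment> \<open>Such an \<open>r\<close> moves \<open>v\<close> into \<open>W\<close>,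
            since it kills the contribution of \<open>z\<close> modulo \<open>W\<close>, and being
            outside \<open>p\<close> it keeps the annihilator. Hence \<open>p\<close> is already
            counted for \<open>W\<close>.\<close>
          then obtain r where r: "r \<in> colon (W n) z" "r \<notin> p" using pq by blast
          then have rR: "r \<in> carrier R" and "r \<odot>\<^bsub>M\<^esub> (t \<odot>\<^bsub>M\<^esub> z) \<in> W l" using q by (auto simp: colon_def)
          then have "r \<odot>\<^bsub>M\<^esub> v \<in> W l" using rv[OF rR] WD(3) WD(4)[OF rR *(2)] by simp
          then show ?thesis using assI colon_smult_prime[OF p(1,3) vM rR r(2)] by blast
        qed simp
      qed
    qed
    then have "finite (assW V)" using W by (meson finite_insert finite_subset)
    moreover have "z \<in> V n"
    proof -
      have "\<zero>\<^bsub>M\<^esub> \<oplus>\<^bsub>M\<^esub> \<one> \<odot>\<^bsub>M\<^esub> z \<in> V n" by (rule VI[OF WD(2)]) (simp add: one_shifting)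
      then show ?thesis using zM by simp
    qed
    ultimately have "?P V \<and> ?Q W V" using Vst WV VZ BW z(2) by blast
    then show ?thesis by blast
  qed
  have "\<exists>W. \<forall>i. ?P (W i) \<and> ?Q (W i) (W (Suc i))"
    by (rule dependent_nat_choice) (use base step in blast)+
  then obtain W where W: "\<And>i. ?P (W i)" "\<And>i. ?Q (W i) (W (Suc i))" by blast
  have "\<exists>k. \<forall>i\<ge>k. \<forall>n. W i n = W k n"
    by (rule stable_chain) (use W in auto)
  then obtain k where k: "\<And>i n. i \<ge> k \<Longrightarrow> W i n = W k n" by blast
  have "W (Suc k) n = W k n" for n by (rule k) simp
  then show False using W(2)[of k] by auto
qed

text \<open>Represent \<open>p\<close> by an element \<open>z\<close> with the least number of homogeneous components outside \<open>B n\<close>;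
  a lowest component of an element of \<open>p\<close> that is not in \<open>p\<close> would kill the lowest component of \<open>z\<close>.\<close>

lemma ass_homogeneous:
  assumes "p \<in> ass n" "r \<in> p"
  shows "RG.hc r a \<in> p"
proof -
  have p: "primeideal p R" using assms(1) by (simp add: ass_def)
  note pD = primeidealD[OF p]
  define N where "N z = {i. MG.hc z i \<notin> B n}" for z
  have finN: "finite (N z)" if "z \<in> carrier M" for z
    by (rule finite_subset[OF _ MG.hc_finite[OF that]]) (use BD(2) in \<open>auto simp: N_def\<close>)
  have "\<exists>z. (z \<in> Z n \<and> p = colon (B n) z) \<and> (\<forall>z'. z' \<in> Z n \<and> p = colon (B n) z' \<longrightarrow> card (N z) \<le> card (N z'))"
    using ex_has_least_nat[of "\<lambda>z. z \<in> Z n \<and> p = colon (B n) z" _ "\<lambda>z. card (N z)"] assms(1)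
    by (auto simp: ass_def)
  then obtain z where z: "z \<in> Z n" "p = colon (B n) z"
    and min: "\<And>z'. z' \<in> Z n \<Longrightarrow> p = colon (B n) z' \<Longrightarrow> card (N z) \<le> card (N z')" by auto
  have zM: "z \<in> carrier M" using z ZD(1) by blast
  have "z \<notin> B n" using pD(1) z(2) zM by (auto simp: colon_def)
  then have "N z \<noteq> {}" using mem_span_hc[OF zM B_sub] by (auto simp: N_def)
  define s where "s = Min (N z)"
  have s: "s \<in> N z" "\<And>i. i < s \<Longrightarrow> MG.hc z i \<in> B n"
    using Min_in[OF finN[OF zM] \<open>N z \<noteq> {}\<close>] Min_le[OF finN[OF zM]] unfolding s_def by (auto simp: N_def) (meson not_le)
  \<comment> \<open>Concerns a component of \<open>r\<close> below which \<open>r\<close> vanishes;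
    arbitrary components are reached afterwards by removing lowest ones.\<close>
  have lead: "RG.hc r a \<in> p" if r: "r \<in> p" and a: "\<And>i. i < a \<Longrightarrow> RG.hc r i = \<zero>" for r a
  proof -
    have rR: "r \<in> carrier R" using pD(3) r .
    let ?P = "{u \<in> carrier R. MG.hc (u \<odot>\<^bsub>M\<^esub> z) (int a + s) \<ominus>\<^bsub>M\<^esub> RG.hc u a \<odot>\<^bsub>M\<^esub> MG.hc z s \<in> B n}"
    have "r \<in> ?P"
      using rR
    proof (induction rule: RG.homogeneous_induct)
      case zero
      show ?case using zM BD(2) BD(6)[OF BD(2) BD(2), of n] by (simp add: MG.hc_zero RG.hc_zero MG.hc_closed)
    next
      case (add u v)
      have "MG.hc ((u \<oplus> v) \<odot>\<^bsub>M\<^esub> z) (int a + s) \<ominus>\<^bsub>M\<^esub> RG.hc (u \<oplus> v) a \<odot>\<^bsub>M\<^esub> MG.hc z s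
        = (MG.hc (u \<odot>\<^bsub>M\<^esub> z) (int a + s) \<ominus>\<^bsub>M\<^esub> RG.hc u a \<odot>\<^bsub>M\<^esub> MG.hc z s) \<oplus>\<^bsub>M\<^esub>
          (MG.hc (v \<odot>\<^bsub>M\<^esub> z) (int a + s) \<ominus>\<^bsub>M\<^esub> RG.hc v a \<odot>\<^bsub>M\<^esub> MG.hc z s)"
        using add(3,4) zM
        by (simp add: smult_l_distr MG.hc_add RG.hc_add MG.hc_closed RG.hc_closed a_minus_def M.minus_add M.a_ac)
      then show ?case using add BD(3) by simp
    next
      case (homogeneous i)
      have hi: "RG.hc r i \<in> ring_part R i" "RG.hc r i \<in> carrier R" using RG.hc_part RG.hc_closed rR by auto
      have eq: "MG.hc (RG.hc r i \<odot>\<^bsub>M\<^esub> z) (int a + s) = RG.hc r i \<odot>\<^bsub>M\<^esub> MG.hc z (int a + s - int i)"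
        by (rule hc_smult[OF hi(1) zM])
      show ?case
      proof (cases "i = a")
        case True
        then show ?thesis using eq hi zM BD(2) RG.hc_homogeneous[OF hi(1), of i] MG.hc_closed
          by (simp add: a_minus_def M.r_neg)
      next
        case ne: False
        then have 0: "RG.hc (RG.hc r i) a = \<zero>" using RG.hc_homogeneous[OF hi(1), of a] by simp
        have "RG.hc r i \<odot>\<^bsub>M\<^esub> MG.hc z (int a + s - int i) \<in> B n"
        proof (cases "i < a")
          case True
          then show ?thesis using a[OF True] BD(2) MG.hc_closed[OF zM] by simp
        next
          case False
          then show ?thesis using ne s(2)[of "int a + s - int i"] BD(4)[OF hi(2)] by simp
        qed
        then show ?thesis using eq hi zM MG.hc_closed 0 by (simp add: BD(2,6))
      qed
    qed
    moreover have "MG.hc (r \<odot>\<^bsub>M\<^esub> z) (int a + s) \<in> B n"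
      using r z(2) B(3) by (auto simp: colon_def hom_closed_def)
    ultimately have rz: "RG.hc r a \<odot>\<^bsub>M\<^esub> MG.hc z s \<in> B n"
      using submodule_diff_iff[OF B_sub] zM rR MG.hc_closed RG.hc_closed by (metis (no_types, lifting) mem_Collect_eq smult_closed)
    have ra: "RG.hc r a \<in> ring_part R a" "RG.hc r a \<in> carrier R" using RG.hc_part RG.hc_closed rR by auto
    show ?thesis
    proof (rule ccontr)
      assume no: "RG.hc r a \<notin> p"
      let ?z = "RG.hc r a \<odot>\<^bsub>M\<^esub> z"
      have "?z \<in> Z n" "p = colon (B n) ?z"
        using ZD(4)[OF ra(2) z(1)] colon_smult_prime[OF p z(2) zM ra(2) no] by auto
      from min[OF this] have "card (N z) \<le> card (N ?z)" .
      \<comment> \<open>Multiplication by the component of degree \<open>a\<close> shifts degrees by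
        \<open>a\<close> and sends the component of degree \<open>s\<close> into \<open>B n\<close>,
        so strictly fewer components stay outside.\<close>
      also have "N ?z \<subseteq> (\<lambda>i. i + int a) ` (N z - {s})"
      proof
        fix i assume i: "i \<in> N ?z"
        have "MG.hc ?z i = RG.hc r a \<odot>\<^bsub>M\<^esub> MG.hc z (i - int a)" by (rule hc_smult[OF ra(1) zM])
        then have "i - int a \<in> N z" "i - int a \<noteq> s" using i BD(4)[OF ra(2)] rz by (auto simp: N_def)
        then show "i \<in> (\<lambda>i. i + int a) ` (N z - {s})" by (intro image_eqI[of _ _ "i - int a"]) auto
      qed
      then have "card (N ?z) \<le> card ((\<lambda>i. i + int a) ` (N z - {s}))"
        using finN[OF zM] by (intro card_mono) auto
      also have "\<dots> \<le> card (N z - {s})" using finN[OF zM] by (intro card_image_le) auto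
      also have "\<dots> < card (N z)" using finN[OF zM] s(1) by (intro card_Diff1_less)
      finally show False by simp
    qed
  qed
  \<comment> \<open>Induction on the number of nonzero components: the lowest one lies in
    \<open>p\<close>, and subtracting it leaves an element of \<open>p\<close> with one component
    fewer.\<close>
  show ?thesis using assms(2)
  proof (induction "card {i. RG.hc r i \<noteq> \<zero>}" arbitrary: r rule: less_induct)
    case less
    have rR: "r \<in> carrier R" using pD(3) less(2) .
    have fin: "finite {i. RG.hc r i \<noteq> \<zero>}" by (rule RG.hc_finite[OF rR])
    show ?case
    proof (cases "{i. RG.hc r i \<noteq> \<zero>} = {}")
      case True
      then show ?thesis using pD(6) by auto
    next
      case False
      define b where "b = Min {i. RG.hc r i \<noteq> \<zero>}"
      have b: "RG.hc r b \<noteq> \<zero>" "\<And>i. i < b \<Longrightarrow> RG.hc r i = \<zero>"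
        using Min_in[OF fin False] Min_le[OF fin] unfolding b_def by auto (meson not_le)
      have bp: "RG.hc r b \<in> p" by (rule lead[OF less(2) b(2)])
      let ?r = "r \<ominus> RG.hc r b"
      have rp: "?r \<in> p" using pD(7)[OF less(2) bp] .
      have bR: "RG.hc r b \<in> carrier R" using RG.hc_closed rR .
      have hc: "RG.hc r i = RG.hc ?r i \<oplus> (if i = b then RG.hc r b else \<zero>)" for i
      proof -
        have "r = ?r \<oplus> RG.hc r b" using rR bR by (simp add: a_minus_def R.a_assoc R.l_neg)
        then have "RG.hc r i = RG.hc (?r \<oplus> RG.hc r b) i" by simp
        then show ?thesis
          using RG.hc_add[of ?r "RG.hc r b" i] RG.hc_homogeneous[OF RG.hc_part[OF rR], of b i] rR bR by simp
      qed
      have c: "RG.hc ?r i \<in> carrier R" for i using RG.hc_closed rR bR by simp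
      have "RG.hc ?r b = \<zero>" using hc[of b] c[of b] bR by (metis R.add.r_cancel_one' R.a_comm)
      moreover have other: "RG.hc ?r i = RG.hc r i" if "i \<noteq> b" for i using hc[of i] that c[of i] by simp
      ultimately have "{i. RG.hc ?r i \<noteq> \<zero>} = {i. RG.hc r i \<noteq> \<zero>} - {b}" by auto metis
      then have "card {i. RG.hc ?r i \<noteq> \<zero>} < card {i. RG.hc r i \<noteq> \<zero>}"
        using fin b(1) by (metis card_Diff1_less mem_Collect_eq)
      from less(1)[OF this rp] show ?thesis using other[of a] bp by (cases "a = b") auto
    qed
  qed
qed

section \<open>The part killed by a prime and its torsion\<close>

definition killed :: "'a set \<Rightarrow> nat \<Rightarrow> 'b set" where
  "killed p n = {z \<in> Z n. \<forall>r\<in>p. r \<odot>\<^bsub>M\<^esub> z \<in> B n}"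

text \<open>For prime \<open>p\<close>, modulo \<open>B n\<close>, this is the kernel of
  localisation at \<open>p\<close> on the part killed by \<open>p\<close>.\<close>

definition torsion :: "'a set \<Rightarrow> nat \<Rightarrow> 'b set" where
  "torsion p n = {z \<in> killed p n. \<exists>s\<in>carrier R - p. s \<odot>\<^bsub>M\<^esub> z \<in> B n}"

lemma colon_iff:
  assumes "p \<subseteq> carrier R" "z \<in> Z n"
  shows "p = colon (B n) z \<longleftrightarrow> z \<in> killed p n \<and> z \<notin> torsion p n"
  using assms by (auto simp: killed_def torsion_def colon_def)

lemma killed_submodule:
  assumes "p \<subseteq> carrier R"
  shows "submodule (killed p n) R M"
proof (rule submoduleI')
  fix u v assume u: "u \<in> killed p n" and v: "v \<in> killed p n"
  have "r \<odot>\<^bsub>M\<^esub> (u \<oplus>\<^bsub>M\<^esub> v) \<in> B n" if "r \<in> p" for r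
    using u v that assms ZD(1) BD(3) by (auto simp: killed_def smult_r_distr subset_iff)
  then show "u \<oplus>\<^bsub>M\<^esub> v \<in> killed p n" using u v ZD(3) by (auto simp: killed_def)
next
  fix r u assume r: "r \<in> carrier R" and u: "u \<in> killed p n"
  have "s \<odot>\<^bsub>M\<^esub> (r \<odot>\<^bsub>M\<^esub> u) \<in> B n" if s: "s \<in> p" for s
  proof -
    have "s \<odot>\<^bsub>M\<^esub> (r \<odot>\<^bsub>M\<^esub> u) = r \<odot>\<^bsub>M\<^esub> (s \<odot>\<^bsub>M\<^esub> u)"
      using u s r assms ZD(1) by (auto simp: killed_def smult_assoc1[symmetric] R.m_comm subset_iff)
    then show ?thesis using u s BD(4)[OF r] by (auto simp: killed_def)
  qed
  then show "r \<odot>\<^bsub>M\<^esub> u \<in> killed p n" using u r ZD(4) by (auto simp: killed_def)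
qed (use ZD(1,2) BD(2) assms in \<open>auto simp: killed_def subset_iff\<close>)

lemma killed_stable:
  assumes "p \<subseteq> carrier R"
  shows "stable (killed p)"
  unfolding stable_def
proof (intro conjI allI ballI)
  fix n j x assume j: "j \<in> A" and x: "x \<in> killed p n"
  have "s \<odot>\<^bsub>M\<^esub> (y j \<odot>\<^bsub>M\<^esub> x) \<in> B (Suc n)" if s: "s \<in> p" for s
  proof -
    have "s \<odot>\<^bsub>M\<^esub> (y j \<odot>\<^bsub>M\<^esub> x) = y j \<odot>\<^bsub>M\<^esub> (s \<odot>\<^bsub>M\<^esub> x)"
      using x s y_closed[OF j] assms ZD(1) by (auto simp: killed_def smult_assoc1[symmetric] R.m_comm subset_iff)
    then show ?thesis using x s stableD(2)[OF B(1) j] by (auto simp: killed_def)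
  qed
  then show "y j \<odot>\<^bsub>M\<^esub> x \<in> killed p (Suc n)" using x stableD(2)[OF Z(1) j] by (auto simp: killed_def)
qed (rule killed_submodule[OF assms])

text \<open>Closure under addition is where primality enters: if \<open>s\<close> and
  \<open>t\<close> outside \<open>p\<close> kill the two summands, their product kills the sum and
  is still outside \<open>p\<close>.\<close>

lemma torsion_stable:
  assumes "primeideal p R"
  shows "stable (torsion p)"
proof -
  note pD = primeidealD[OF assms]
  have pR: "p \<subseteq> carrier R" using pD(3) by blast
  note k = killed_stable[OF pR]
  note kD = submoduleD[OF stableD(1)[OF k]]
  show ?thesis
    unfolding stable_def
  proof (intro conjI allI ballI)
    show "submodule (torsion p n) R M" for n
    proof (rule submoduleI')
      show "torsion p n \<subseteq> carrier M" using kD(1) by (auto simp: torsion_def)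
      show "\<zero>\<^bsub>M\<^esub> \<in> torsion p n" using kD(2) pD(1) BD(2) by (auto simp: torsion_def intro!: bexI[of _ "\<one>"])
      fix u v assume u: "u \<in> torsion p n" and v: "v \<in> torsion p n"
      obtain s t where st: "s \<in> carrier R" "s \<notin> p" "s \<odot>\<^bsub>M\<^esub> u \<in> B n" "t \<in> carrier R" "t \<notin> p" "t \<odot>\<^bsub>M\<^esub> v \<in> B n"
        using u v by (auto simp: torsion_def)
      have uv: "u \<in> carrier M" "v \<in> carrier M" using u v kD(1) by (auto simp: torsion_def)
      have "(s \<otimes> t) \<odot>\<^bsub>M\<^esub> (u \<oplus>\<^bsub>M\<^esub> v) = t \<odot>\<^bsub>M\<^esub> (s \<odot>\<^bsub>M\<^esub> u) \<oplus>\<^bsub>M\<^esub> s \<odot>\<^bsub>M\<^esub> (t \<odot>\<^bsub>M\<^esub> v)"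
        using st uv by (simp add: smult_r_distr smult_assoc1[symmetric] R.m_comm)
      then have "(s \<otimes> t) \<odot>\<^bsub>M\<^esub> (u \<oplus>\<^bsub>M\<^esub> v) \<in> B n" using st BD(3,4) by simp
      moreover have "s \<otimes> t \<in> carrier R - p" using st pD(2) by blast
      moreover have "u \<oplus>\<^bsub>M\<^esub> v \<in> killed p n" using u v kD(3) by (auto simp: torsion_def)
      ultimately show "u \<oplus>\<^bsub>M\<^esub> v \<in> torsion p n" unfolding torsion_def by blast
    next
      fix r u assume r: "r \<in> carrier R" and u: "u \<in> torsion p n"
      then obtain s where s: "s \<in> carrier R" "s \<notin> p" "s \<odot>\<^bsub>M\<^esub> u \<in> B n" "u \<in> killed p n" by (auto simp: torsion_def)
      then have "s \<odot>\<^bsub>M\<^esub> (r \<odot>\<^bsub>M\<^esub> u) = r \<odot>\<^bsub>M\<^esub> (s \<odot>\<^bsub>M\<^esub> u)"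
        using r kD(1) by (simp add: smult_assoc1[symmetric] R.m_comm)
      then show "r \<odot>\<^bsub>M\<^esub> u \<in> torsion p n" using s r kD(4) BD(4) by (auto simp: torsion_def intro!: bexI[of _ s])
    qed
    fix n j u assume j: "j \<in> A" and u: "u \<in> torsion p n"
    then obtain s where s: "s \<in> carrier R" "s \<notin> p" "s \<odot>\<^bsub>M\<^esub> u \<in> B n" "u \<in> killed p n" by (auto simp: torsion_def)
    then have "s \<odot>\<^bsub>M\<^esub> (y j \<odot>\<^bsub>M\<^esub> u) = y j \<odot>\<^bsub>M\<^esub> (s \<odot>\<^bsub>M\<^esub> u)"
      using y_closed[OF j] kD(1) by (simp add: smult_assoc1[symmetric] R.m_comm)
    then show "y j \<odot>\<^bsub>M\<^esub> u \<in> torsion p (Suc n)"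
      using s stableD(2)[OF k j] stableD(2)[OF B(1) j] by (auto simp: torsion_def intro!: bexI[of _ s])
  qed
qed

text \<open>By \<open>ass_homogeneous\<close> every component of an element \<open>r\<close> of
  \<open>p\<close> lies in \<open>p\<close> and kills \<open>z\<close>; being homogeneous, it kills
  each component of \<open>z\<close> separately, and so does \<open>r\<close>.\<close>

lemma killed_hom_closed:
  assumes "p \<in> ass l"
  shows "hom_closed (killed p n)"
  unfolding hom_closed_def
proof (intro ballI allI)
  have "primeideal p R" using assms by (simp add: ass_def)
  note pD = primeidealD[OF this]
  fix z i assume z: "z \<in> killed p n"
  then have zM: "z \<in> carrier M" using ZD(1) by (auto simp: killed_def)
  have "r \<odot>\<^bsub>M\<^esub> MG.hc z i \<in> B n" if r: "r \<in> p" for r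
  proof -
    have rR: "r \<in> carrier R" using pD(3) r .
    then have "r \<in> {r \<in> carrier R. r \<odot>\<^bsub>M\<^esub> MG.hc z i \<in> B n}"
    proof (induction rule: RG.homogeneous_induct)
      case (homogeneous a)
      have "RG.hc r a \<odot>\<^bsub>M\<^esub> z \<in> B n" using z ass_homogeneous[OF assms r] by (auto simp: killed_def)
      then have "MG.hc (RG.hc r a \<odot>\<^bsub>M\<^esub> z) (i + int a) \<in> B n" using B(3) by (auto simp: hom_closed_def)
      then show ?case using hc_smult[OF RG.hc_part[OF rR] zM] RG.hc_closed[OF rR] by simp
    qed (use MG.hc_closed[OF zM] BD(2,3) in \<open>auto simp: smult_l_distr\<close>)
    then show ?thesis by simp
  qed
  then show "MG.hc z i \<in> killed p n" using z Z(3) by (auto simp: killed_def hom_closed_def)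
qed

section \<open>Slopes of the families and the primes that attain them\<close>

lemma Z_B_family: "\<exists>n0. graded_family R M y A d Z B n0"
proof -
  obtain n0 where "\<And>n. n \<ge> n0 \<Longrightarrow> Z (Suc n) \<subseteq> jspan (Z n)" using artin_rees_family[OF Z(1)] by blast
  then have "graded_family R M y A d Z B n0"
    by unfold_locales (use noeth Z B in auto)
  then show ?thesis by blast
qed

lemma killed_family:
  assumes "p \<in> ass l"
  shows "\<exists>n0. graded_family R M y A d (killed p) (torsion p) n0"
proof -
  have prime: "primeideal p R" using assms by (simp add: ass_def)
  then have pR: "p \<subseteq> carrier R" using primeidealD(3) by blast
  have "killed p n \<subseteq> Z n" for n by (auto simp: killed_def)
  then obtain n0 where "\<And>n. n \<ge> n0 \<Longrightarrow> killed p (Suc n) \<subseteq> jspan (killed p n)"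
    using artin_rees_family[OF killed_stable[OF pR]] by blast
  then have "graded_family R M y A d (killed p) (torsion p) n0"
    by unfold_locales (use noeth killed_stable[OF pR] killed_hom_closed[OF assms] torsion_stable[OF prime] in auto)
  then show ?thesis by blast
qed

text \<open>The statement selects the least index, while linearity requires an index of least
  degree; monotonicity of \<open>d\<close> reconciles the two.\<close>

lemma least_index:
  assumes "D \<subseteq> A" "D \<noteq> {}"
  shows "Inf D \<in> D" "j \<in> D \<Longrightarrow> Inf D \<le> j" "j \<in> D \<Longrightarrow> d (Inf D) \<le> d j"
proof -
  show D: "Inf D \<in> D" by (rule Inf_nat_def1[OF assms(2)])
  show le: "Inf D \<le> j" if "j \<in> D" for j by (rule cInf_lower[OF that]) simp
  show "j \<in> D \<Longrightarrow> d (Inf D) \<le> d j" using d_mono D le assms(1) by (auto simp: mono_on_def subset_iff)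
qed

lemma family_dichotomy:
  assumes "graded_family R M y A d P K n0"
  shows "non_nilpotent P K = {} \<Longrightarrow> eventually (\<lambda>n. P n \<subseteq> K n) sequentially"
    and "non_nilpotent P K \<noteq> {} \<Longrightarrow> \<exists>b. eventually (\<lambda>n. quot_indeg (P n) (K n) =
      ereal (of_int (int (d (Inf (non_nilpotent P K))) * int n + b))) sequentially"
proof -
  interpret graded_family R M y A d P K n0 by fact
  have sub: "non_nilpotent P K \<subseteq> A" by (auto simp: non_nilpotent_def)
  show "non_nilpotent P K = {} \<Longrightarrow> eventually (\<lambda>n. P n \<subseteq> K n) sequentially" by (rule nilpotent_imp_subset)
  show "non_nilpotent P K \<noteq> {} \<Longrightarrow> \<exists>b. eventually (\<lambda>n. quot_indeg (P n) (K n) =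
      ereal (of_int (int (d (Inf (non_nilpotent P K))) * int n + b))) sequentially"
    by (rule quot_indeg_linear) (use least_index[OF sub] in auto)
qed

abbreviation "lead \<equiv> non_nilpotent Z B"
abbreviation "lead_at p \<equiv> non_nilpotent (killed p) (torsion p)"

text \<open>Elements of \<open>B\<close> that are killed by \<open>p\<close> are torsion, witnessed
  by 1, which is not in \<open>p\<close>. So what is not torsion is not in \<open>B\<close>.\<close>

lemma lead_at_subset:
  assumes "p \<in> ass l"
  shows "lead_at p \<subseteq> lead"
proof
  have prime: "primeideal p R" using assms by (simp add: ass_def)
  note pD = primeidealD[OF prime]
  fix j assume j: "j \<in> lead_at p"
  have jA: "j \<in> A" using j by (simp add: non_nilpotent_def)
  have "\<exists>n. \<exists>z\<in>Z n. (y j [^] m) \<odot>\<^bsub>M\<^esub> z \<notin> B (n + m)" for m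
  proof -
    obtain n z where z: "z \<in> killed p n" "(y j [^] m) \<odot>\<^bsub>M\<^esub> z \<notin> torsion p (n + m)"
      using j unfolding non_nilpotent_def by blast
    have "(y j [^] m) \<odot>\<^bsub>M\<^esub> z \<in> killed p (n + m)"
      using stable_mon[OF killed_stable, of p "replicate_mset m j" z n] jA z(1) pD(3)
      by (auto simp: mon_replicate subset_iff split: if_splits)
    moreover have "(y j [^] m) \<odot>\<^bsub>M\<^esub> z \<in> carrier M" using z ZD(1) y_closed[OF jA] by (auto simp: killed_def)
    ultimately have "(y j [^] m) \<odot>\<^bsub>M\<^esub> z \<notin> B (n + m)"
      using z(2) pD(1) by (auto simp: torsion_def) (metis R.one_closed DiffI smult_one)
    then show ?thesis using z(1) by (auto simp: killed_def)
  qed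
  then show "j \<in> lead" using jA by (simp add: non_nilpotent_def)
qed

lemma y_pow_mem: "stable W \<Longrightarrow> j \<in> A \<Longrightarrow> z \<in> W n \<Longrightarrow> (y j [^] m) \<odot>\<^bsub>M\<^esub> z \<in> W (n + m)"
  using stable_mon[of W "replicate_mset m j" z n] by (auto simp: mon_replicate split: if_splits)

text \<open>The prime is a maximal element among the ideals of those \<open>r\<close> for which \<open>r h\<close> is killed by a
  power of \<open>y \<delta>\<close>.\<close>

lemma lead_prime:
  assumes "\<delta> \<in> lead"
  shows "\<exists>p l. p \<in> ass l \<and> \<delta> \<in> lead_at p"
proof -
  obtain n0 where fam: "graded_family R M y A d Z B n0" using Z_B_family by blast
  have \<delta>: "\<delta> \<in> A" using assms by (simp add: non_nilpotent_def)
  note yR = y_closed[OF \<delta>]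
  let ?y = "\<lambda>m. y \<delta> [^] (m :: nat)"
  define tors where "tors n h = {r \<in> carrier R. \<exists>m. ?y m \<odot>\<^bsub>M\<^esub> (r \<odot>\<^bsub>M\<^esub> h) \<in> B (n + m)}" for n h
  have yy: "?y (m + k) \<odot>\<^bsub>M\<^esub> x = ?y k \<odot>\<^bsub>M\<^esub> (?y m \<odot>\<^bsub>M\<^esub> x)" if "x \<in> carrier M" for m k x
    using that yR by (simp add: smult_assoc1[symmetric] R.nat_pow_mult add.commute)
  have up: "?y k \<odot>\<^bsub>M\<^esub> x \<in> B (n + k)" if "?y m \<odot>\<^bsub>M\<^esub> x \<in> B (n + m)" "m \<le> k" "x \<in> carrier M" for x n m k
    using y_pow_mem[OF B(1) \<delta> that(1), of "k - m"] yy[OF that(3), of m "k - m"] that(2) by simp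
  have ideal: "ideal (tors n h) R" if h: "h \<in> carrier M" for n h
  proof (rule idealI_cring)
    show "\<zero> \<in> tors n h" using h BD(2) yR by (auto simp: tors_def)
    fix a b assume a: "a \<in> tors n h" and b: "b \<in> tors n h"
    then obtain m k where mk: "?y m \<odot>\<^bsub>M\<^esub> (a \<odot>\<^bsub>M\<^esub> h) \<in> B (n + m)" "?y k \<odot>\<^bsub>M\<^esub> (b \<odot>\<^bsub>M\<^esub> h) \<in> B (n + k)"
      "a \<in> carrier R" "b \<in> carrier R" by (auto simp: tors_def)
    have "?y (max m k) \<odot>\<^bsub>M\<^esub> (a \<odot>\<^bsub>M\<^esub> h) \<oplus>\<^bsub>M\<^esub> ?y (max m k) \<odot>\<^bsub>M\<^esub> (b \<odot>\<^bsub>M\<^esub> h) \<in> B (n + max m k)"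
      using up[OF mk(1), of "max m k"] up[OF mk(2), of "max m k"] mk(3,4) h BD(3) by simp
    then have "?y (max m k) \<odot>\<^bsub>M\<^esub> ((a \<oplus> b) \<odot>\<^bsub>M\<^esub> h) \<in> B (n + max m k)"
      using mk(3,4) h yR by (simp add: smult_l_distr smult_r_distr)
    then show "a \<oplus> b \<in> tors n h" using mk(3,4) unfolding tors_def by blast
  next
    fix r a assume r: "r \<in> carrier R" and a: "a \<in> tors n h"
    then obtain m where m: "?y m \<odot>\<^bsub>M\<^esub> (a \<odot>\<^bsub>M\<^esub> h) \<in> B (n + m)" "a \<in> carrier R" by (auto simp: tors_def)
    have "?y m \<odot>\<^bsub>M\<^esub> ((r \<otimes> a) \<odot>\<^bsub>M\<^esub> h) = r \<odot>\<^bsub>M\<^esub> (?y m \<odot>\<^bsub>M\<^esub> (a \<odot>\<^bsub>M\<^esub> h))"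
      using r m(2) h yR by (simp add: smult_assoc1[symmetric] R.m_ac)
    then have "?y m \<odot>\<^bsub>M\<^esub> ((r \<otimes> a) \<odot>\<^bsub>M\<^esub> h) \<in> B (n + m)" using BD(4)[OF r m(1)] by simp
    then show "r \<otimes> a \<in> tors n h" using r m(2) unfolding tors_def by blast
  qed (auto simp: tors_def)
  let ?S = "{tors n h | n h. h \<in> Z n \<and> \<one> \<notin> tors n h}"
  \<comment> \<open>No power of \<open>y \<delta>\<close> kills this element, so its ideal is proper
    and the collection to maximise over is not empty.\<close>
  obtain g where g: "g \<in> Z n0" "\<And>m. ?y m \<odot>\<^bsub>M\<^esub> g \<notin> B (n0 + m)"
    using graded_family.non_torsion_element[OF fam assms] by blast
  then have "\<one> \<notin> tors n0 g" using ZD(1)[OF g(1)] by (auto simp: tors_def)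
  then have "?S \<noteq> {}" using g(1) by blast
  then have "\<exists>q\<in>?S. \<forall>q'\<in>?S. q \<subseteq> q' \<longrightarrow> q' = q"
    by (rule noetherian_ring.ideal_maximal[OF noeth_ring]) (use ideal ZD(1) in auto)
  then obtain q where q: "q \<in> ?S" "\<forall>q'\<in>?S. q \<subseteq> q' \<longrightarrow> q' = q" by blast
  then obtain n h where h: "h \<in> Z n" "\<one> \<notin> tors n h" and qh: "q = tors n h" by auto
  have max: "tors l u = tors n h" if "u \<in> Z l" "\<one> \<notin> tors l u" "tors n h \<subseteq> tors l u" for l u
  proof -
    have "tors l u \<in> ?S" using that(1,2) by blast
    then show ?thesis using q(2) that(3) qh by blast
  qed
  have hM: "h \<in> carrier M" using ZD(1) h(1) by blast
  define p where "p = tors n h"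
  have prime: "primeideal p R"
  proof (rule primeidealI)
    show "ideal p R" unfolding p_def by (rule ideal[OF hM])
    show "cring R" by (rule R.is_cring)
    show "carrier R \<noteq> p" using h(2) unfolding p_def by blast
    fix a b assume ab: "a \<in> carrier R" "b \<in> carrier R" "a \<otimes> b \<in> p"
    \<comment> \<open>For \<open>b\<close> outside \<open>p\<close> the element \<open>b h\<close>
      competes as well and its ideal contains \<open>p\<close>, so by maximality the two agree; and
      \<open>a\<close> lies in the ideal of \<open>b h\<close>.\<close>
    show "a \<in> p \<or> b \<in> p"
    proof (rule disjCI)
      assume b: "b \<notin> p"
      have bh: "b \<odot>\<^bsub>M\<^esub> h \<in> Z n" using ZD(4) ab h by simp
      have one: "\<one> \<notin> tors n (b \<odot>\<^bsub>M\<^esub> h)" using b ab(2) hM by (auto simp: p_def tors_def)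
      have "tors n h \<subseteq> tors n (b \<odot>\<^bsub>M\<^esub> h)"
      proof
        fix r assume "r \<in> tors n h"
        then have "b \<otimes> r \<in> tors n h" "r \<in> carrier R" using ideal.I_l_closed[OF ideal[OF hM]] ab(2) by (auto simp: tors_def)
        then show "r \<in> tors n (b \<odot>\<^bsub>M\<^esub> h)" using ab(2) hM by (auto simp: tors_def smult_assoc1[symmetric] R.m_comm)
      qed
      from max[OF bh one this] have "p = tors n (b \<odot>\<^bsub>M\<^esub> h)" by (simp add: p_def)
      moreover have "a \<in> tors n (b \<odot>\<^bsub>M\<^esub> h)" using ab hM by (auto simp: p_def tors_def smult_assoc1)
      ultimately show "a \<in> p" by simp
    qed
  qed
  have yhM: "?y m \<odot>\<^bsub>M\<^esub> h \<in> carrier M" for m using yR hM by simp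
  \<comment> \<open>\<open>p\<close> is the union of the ascending colon ideals of the powers of
    \<open>y \<delta>\<close> applied to \<open>h\<close>. Once they stop growing, \<open>p\<close>
    is itself a colon ideal and hence associated.\<close>
  let ?C = "\<lambda>m. colon (B (n + m)) (?y m \<odot>\<^bsub>M\<^esub> h)"
  have comm: "?y m \<odot>\<^bsub>M\<^esub> (r \<odot>\<^bsub>M\<^esub> h) = r \<odot>\<^bsub>M\<^esub> (?y m \<odot>\<^bsub>M\<^esub> h)" if "r \<in> carrier R" for r m
    using that yR hM by (simp add: smult_assoc1[symmetric] R.m_comm)
  have Cup: "?C m \<subseteq> ?C k" if "m \<le> k" for m k
  proof
    fix r assume r: "r \<in> ?C m"
    then have "?y m \<odot>\<^bsub>M\<^esub> (r \<odot>\<^bsub>M\<^esub> h) \<in> B (n + m)" using comm by (auto simp: colon_def)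
    then have "?y k \<odot>\<^bsub>M\<^esub> (r \<odot>\<^bsub>M\<^esub> h) \<in> B (n + k)" by (rule up) (use that r hM in \<open>auto simp: colon_def\<close>)
    then show "r \<in> ?C k" using r comm by (auto simp: colon_def)
  qed
  have "\<exists>q\<in>range ?C. \<forall>q'\<in>range ?C. q \<subseteq> q' \<longrightarrow> q' = q"
    by (rule noetherian_ring.ideal_maximal[OF noeth_ring]) (use colon_ideal[OF B_sub yhM] in auto)
  then obtain m1 where m1: "\<And>m. ?C m1 \<subseteq> ?C m \<Longrightarrow> ?C m = ?C m1" by auto
  have pC: "p = ?C m" if m: "m \<ge> m1" for m
  proof
    show "?C m \<subseteq> p" using comm by (auto simp: p_def tors_def colon_def)
    show "p \<subseteq> ?C m"
    proof
      fix r assume r: "r \<in> p"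
      then obtain k where k: "?y k \<odot>\<^bsub>M\<^esub> (r \<odot>\<^bsub>M\<^esub> h) \<in> B (n + k)" "r \<in> carrier R" by (auto simp: p_def tors_def)
      then have "r \<in> ?C k" using comm by (auto simp: colon_def)
      then have "r \<in> ?C (max k m1)" using Cup[of k "max k m1"] by auto
      then have "r \<in> ?C m1" using m1[OF Cup[of m1 "max k m1"]] by simp
      then show "r \<in> ?C m" using Cup[OF m] by blast
    qed
  qed
  have pR: "p \<subseteq> carrier R" by (auto simp: p_def tors_def)
  have yhZ: "?y m \<odot>\<^bsub>M\<^esub> h \<in> Z (n + m)" for m by (rule y_pow_mem[OF Z(1) \<delta> h(1)])
  have "p \<in> ass (n + m1)" using prime pC[of m1] yhZ[of m1] by (auto simp: ass_def)
  \<comment> \<open>From the power \<open>m1\<close> on, further powers of \<open>y \<delta>\<close>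
    produce elements with annihilator exactly \<open>p\<close>, and such elements are never
    torsion.\<close>
  moreover have "\<exists>l. \<exists>z\<in>killed p l. ?y m \<odot>\<^bsub>M\<^esub> z \<notin> torsion p (l + m)" for m
  proof (intro exI bexI)
    show "?y m1 \<odot>\<^bsub>M\<^esub> h \<in> killed p (n + m1)"
      using colon_iff[OF pR yhZ[of m1]] pC[of m1] by simp
    show "?y m \<odot>\<^bsub>M\<^esub> (?y m1 \<odot>\<^bsub>M\<^esub> h) \<notin> torsion p (n + m1 + m)"
      using colon_iff[OF pR yhZ[of "m1 + m"]] pC[of "m1 + m"] yy[OF hM, of m1 m] by (simp add: add.assoc)
  qed
  then have "\<delta> \<in> lead_at p" using \<delta> by (simp add: non_nilpotent_def)
  ultimately show ?thesis by blast
qed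

text \<open>A prime associated for all large \<open>n\<close> must see a non-nilpotent
  \<open>y j\<close>, so \<open>lead\<close> is not empty. For the last claim, \<open>ass n\<close>
  is shown to be, for large \<open>n\<close>, the fixed finite set of primes with nonempty
  \<open>lead_at\<close>, which turns the v-number into a minimum of finitely many linear
  functions.\<close>

theorem stable_v_numbers:
  assumes p: "eventually (\<lambda>n. p \<in> ass n) sequentially"
  shows "lead \<noteq> {}"
    and "\<exists>a\<in>d ` {j \<in> A. Inf lead \<le> j}. \<exists>b. eventually (\<lambda>n. quot_indeg (killed p n) (torsion p n) = ereal (of_int (int a * int n + b))) sequentially"
    and "\<exists>b. eventually (\<lambda>n. quot_indeg (Z n) (B n) = ereal (of_int (int (d (Inf lead)) * int n + b))) sequentially"
    and "\<exists>b. eventually (\<lambda>n. Inf {quot_indeg (killed q n) (torsion q n) | q. q \<in> ass n} =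
       ereal (of_int (int (d (Inf lead)) * int n + b))) sequentially"
proof -
  have leadA: "lead \<subseteq> A" and lead_atA: "lead_at q \<subseteq> A" for q by (auto simp: non_nilpotent_def)
  obtain n1 where n1: "\<And>n. n \<ge> n1 \<Longrightarrow> p \<in> ass n" using p by (auto simp: eventually_sequentially)
  obtain n0 where fam: "graded_family R M y A d Z B n0" using Z_B_family by blast
  \<comment> \<open>If no \<open>y j\<close> were non-nilpotent for \<open>q\<close>, the killed
    part would finally be torsion and \<open>q\<close> could not be associated again.\<close>
  have lead_at_ne: "lead_at q \<noteq> {}" if q: "\<exists>\<^sub>F n in sequentially. q \<in> ass n" for q
  proof
    assume "lead_at q = {}"
    moreover obtain l where l: "q \<in> ass l" using q frequently_ex by blast
    moreover obtain k where "graded_family R M y A d (killed q) (torsion q) k" using killed_family[OF l] by blast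
    ultimately have ev: "eventually (\<lambda>n. killed q n \<subseteq> torsion q n) sequentially" using family_dichotomy(1) by blast
    have "\<exists>\<^sub>F n in sequentially. False"
      using q
    proof (rule frequently_rev_mp)
      show "\<forall>\<^sub>F n in sequentially. q \<in> ass n \<longrightarrow> False"
        using ev
      proof eventually_elim
        case (elim n)
        show ?case
        proof
          assume "q \<in> ass n"
          then obtain z where z: "primeideal q R" "z \<in> Z n" "q = colon (B n) z" by (auto simp: ass_def)
          have "q \<subseteq> carrier R" using z(3) by (auto simp: colon_def)
          from colon_iff[OF this z(2)] z(3) elim show False by blast
        qed
      qed
    qed
    then show False by simp
  qed
  have freq: "\<exists>\<^sub>F n in sequentially. p \<in> ass n"
    by (rule eventually_frequently[OF _ p]) simp
  have pa: "p \<in> ass n1" using n1 by simp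
  have pne: "lead_at p \<noteq> {}" by (rule lead_at_ne[OF freq])
  then show ne: "lead \<noteq> {}" using lead_at_subset[OF pa] by blast
  note L = least_index[OF leadA ne]
  show "\<exists>b. eventually (\<lambda>n. quot_indeg (Z n) (B n) = ereal (of_int (int (d (Inf lead)) * int n + b))) sequentially"
    by (rule family_dichotomy(2)[OF fam ne])
  have lin: "\<exists>b. eventually (\<lambda>n. quot_indeg (killed q n) (torsion q n) = ereal (of_int (int (d (Inf (lead_at q))) * int n + b))) sequentially"
    if q: "q \<in> ass l" "lead_at q \<noteq> {}" for q l
  proof -
    obtain k where "graded_family R M y A d (killed q) (torsion q) k" using killed_family[OF q(1)] by blast
    from family_dichotomy(2)[OF this q(2)] show ?thesis .
  qed
  have lead_le: "Inf lead \<le> Inf (lead_at q)" "Inf (lead_at q) \<in> lead" if q: "q \<in> ass l" "lead_at q \<noteq> {}" for q l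
  proof -
    show "Inf (lead_at q) \<in> lead" using least_index(1)[OF lead_atA q(2)] lead_at_subset[OF q(1)] by blast
    then show "Inf lead \<le> Inf (lead_at q)" by (rule L(2))
  qed
  show "\<exists>a\<in>d ` {j \<in> A. Inf lead \<le> j}. \<exists>b. eventually (\<lambda>n. quot_indeg (killed p n) (torsion p n) = ereal (of_int (int a * int n + b))) sequentially"
  proof (rule bexI)
    show "\<exists>b. eventually (\<lambda>n. quot_indeg (killed p n) (torsion p n) = ereal (of_int (int (d (Inf (lead_at p))) * int n + b))) sequentially"
      by (rule lin[OF pa pne])
    show "d (Inf (lead_at p)) \<in> d ` {j \<in> A. Inf lead \<le> j}"
      using lead_le[OF pa pne] leadA by (intro imageI) auto
  qed
  obtain p0 l0 where p0: "p0 \<in> ass l0" "Inf lead \<in> lead_at p0" using lead_prime[OF L(1)] by blast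
  let ?Q = "{q \<in> (\<Union>n. ass n). lead_at q \<noteq> {}}"
  have finQ: "finite ?Q" by (rule finite_subset[OF _ finite_ass]) blast
  have "\<forall>q\<in>?Q. \<exists>b. eventually (\<lambda>n. quot_indeg (killed q n) (torsion q n) = ereal (of_int (int (d (Inf (lead_at q))) * int n + b))) sequentially"
    using lin by auto
  from bchoice[OF this] obtain b where b: "\<forall>q\<in>?Q. eventually (\<lambda>n. quot_indeg (killed q n) (torsion q n) = ereal (of_int (int (d (Inf (lead_at q))) * int n + b q))) sequentially" ..
  have p0Q: "p0 \<in> ?Q" using p0 by blast
  \<comment> \<open>\<open>lead_at p0\<close> lies inside \<open>lead\<close> and contains its least
    index, so the minimal slope is attained at \<open>p0\<close>.\<close>
  have inf_p0: "Inf (lead_at p0) = Inf lead"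
    using least_index(2)[OF lead_atA, of p0] p0 lead_le(1)[OF p0(1)] by (metis antisym empty_iff)
  have "d (Inf (lead_at p0)) \<le> d (Inf (lead_at q))" if "q \<in> ?Q" for q
    unfolding inf_p0 using lead_le(2) that L(3) by blast
  from min_of_linear[where a = "\<lambda>q. d (Inf (lead_at q))" and b = b, OF finQ p0Q this]
  obtain c where c: "\<forall>\<^sub>F n in sequentially. Inf ((\<lambda>q. ereal (of_int (int (d (Inf (lead_at q))) * int n + b q))) ` ?Q) = ereal (of_int (int (d (Inf lead)) * int n + c))"
    unfolding inf_p0 by blast
  have ev1: "\<forall>\<^sub>F n in sequentially. \<forall>q\<in>?Q. quot_indeg (killed q n) (torsion q n) = ereal (of_int (int (d (Inf (lead_at q))) * int n + b q))"
    by (rule eventually_ball_finite[OF finQ b])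
  \<comment> \<open>A prime outside \<open>?Q\<close> drops out from some point on; as there are
    finitely many primes altogether, one bound serves them all.\<close>
  have ev2: "\<forall>\<^sub>F n in sequentially. \<forall>q\<in>(\<Union>n. ass n) - ?Q. q \<notin> ass n"
  proof (rule eventually_ball_finite)
    show "finite ((\<Union>n. ass n) - ?Q)" using finite_ass by simp
    show "\<forall>q\<in>(\<Union>n. ass n) - ?Q. \<forall>\<^sub>F n in sequentially. q \<notin> ass n"
      using lead_at_ne by (auto simp: not_frequently[symmetric] simp del: not_frequently)
  qed
  have "\<forall>\<^sub>F n in sequentially. Inf {quot_indeg (killed q n) (torsion q n) | q. q \<in> ass n} = ereal (of_int (int (d (Inf lead)) * int n + c))"
    using c ev1 ev2
  proof eventually_elim
    case (elim n)
    have "ass n = ?Q"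
    proof
      show "ass n \<subseteq> ?Q" using elim(3) by blast
      show "?Q \<subseteq> ass n"
      proof
        fix q assume q: "q \<in> ?Q"
        \<comment> \<open>The initial degree is given by a linear function at this \<open>n\<close>
          and hence finite, so the quotient cannot vanish.\<close>
        have "\<exists>x\<in>killed q n. x \<notin> torsion q n"
        proof (rule ccontr)
          assume no: "\<not> ?thesis"
          then have "{ereal (of_int i) | i. \<exists>x\<in>killed q n \<inter> mod_part M i. x \<notin> torsion q n} = {}" by auto
          then have "quot_indeg (killed q n) (torsion q n) = \<infinity>" by (simp only: quot_indeg_def Inf_empty top_ereal_def)
          then show False using elim(2) q by auto
        qed
        then obtain x where x: "x \<in> killed q n" "x \<notin> torsion q n" by blast
        obtain l where prime: "primeideal q R" using q by (auto simp: ass_def)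
        then have "q \<subseteq> carrier R" using primeidealD(3) by blast
        moreover have "x \<in> Z n" using x(1) by (simp add: killed_def)
        ultimately have "q = colon (B n) x" using colon_iff x by blast
        then show "q \<in> ass n" using prime \<open>x \<in> Z n\<close> by (auto simp: ass_def)
      qed
    qed
    then have "{quot_indeg (killed q n) (torsion q n) | q. q \<in> ass n} = (\<lambda>q. quot_indeg (killed q n) (torsion q n)) ` ?Q"
      by (simp only: setcompr_eq_image Collect_mem_eq)
    also have "\<dots> = (\<lambda>q. ereal (of_int (int (d (Inf (lead_at q))) * int n + b q))) ` ?Q"
      by (rule image_cong[OF refl]) (use elim(2) in blast)
    finally show ?case using elim(1) by simp
  qed
  then show "\<exists>b. eventually (\<lambda>n. Inf {quot_indeg (killed q n) (torsion q n) | q. q \<in> ass n} =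
       ereal (of_int (int (d (Inf lead)) * int n + b))) sequentially" by blast
qed

end


section \<open>Free modules and tensor products\<close>

text \<open>Passing between plain and graded records changes the record type but none of the four
  fields that the module axioms mention.\<close>

lemma module_transfer:
  assumes "module R A" "carrier B = carrier A" "add B = add A" "\<zero>\<^bsub>B\<^esub> = \<zero>\<^bsub>A\<^esub>" "smult B = smult A"
  shows "module R B"
proof -
  interpret A: module R A by fact
  show ?thesis
  proof (rule moduleI)
    show "abelian_group B"
    proof (rule abelian_groupI)
      fix x assume "x \<in> carrier B"
      then show "\<exists>y\<in>carrier B. y \<oplus>\<^bsub>B\<^esub> x = \<zero>\<^bsub>B\<^esub>" using A.M.l_neg A.M.a_inv_closed assms(2-4) by metis
    qed (use assms A.M.a_assoc A.M.a_comm in auto)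
  qed (use assms A.R.is_cring A.smult_l_distr A.smult_r_distr A.smult_assoc1 in auto)
qed

lemma linear_map_transfer:
  assumes "linear_map R A B f" "carrier A' = carrier A" "add A' = add A" "smult A' = smult A"
    "carrier B' = carrier B" "add B' = add B" "smult B' = smult B"
  shows "linear_map R A' B' f"
  using assms by (simp add: linear_map_def)

lemma free_module_simps [simp]:
  "carrier (free_module R B) =
    {f. (\<forall>x. f x \<in> carrier R) \<and> (\<forall>x. x \<notin> B \<longrightarrow> f x = \<zero>\<^bsub>R\<^esub>) \<and> finite {x. f x \<noteq> \<zero>\<^bsub>R\<^esub>}}"
  "\<zero>\<^bsub>free_module R B\<^esub> = (\<lambda>x. \<zero>\<^bsub>R\<^esub>)"
  "add (free_module R B) = (\<lambda>f g x. f x \<oplus>\<^bsub>R\<^esub> g x)"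
  "smult (free_module R B) = (\<lambda>r f x. r \<otimes>\<^bsub>R\<^esub> f x)"
  by (simp_all add: free_module_def)

context cring
begin

lemma free_module_module: "module R (free_module R B)"
proof (rule moduleI)
  have add: "finite {x. f x \<oplus> g x \<noteq> \<zero>}" if "finite {x. f x \<noteq> \<zero>}" "finite {x. g x \<noteq> \<zero>}" for f g :: "'c \<Rightarrow> 'a"
    by (rule finite_subset[of _ "{x. f x \<noteq> \<zero>} \<union> {x. g x \<noteq> \<zero>}"]) (use that in auto)
  show "abelian_group (free_module R B)"
  proof (rule abelian_groupI)
    fix f assume f: "f \<in> carrier (free_module R B)"
    have "finite {x. \<ominus> f x \<noteq> \<zero>}" by (rule finite_subset[of _ "{x. f x \<noteq> \<zero>}"]) (use f in auto)
    then show "\<exists>g\<in>carrier (free_module R B). g \<oplus>\<^bsub>free_module R B\<^esub> f = \<zero>\<^bsub>free_module R B\<^esub>"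
      using f by (intro bexI[of _ "\<lambda>x. \<ominus> f x"]) (auto simp: l_neg)
  qed (use add in \<open>auto simp: a_ac\<close>)
  fix r f assume "r \<in> carrier R" "f \<in> carrier (free_module R B)"
  moreover from this have "finite {x. r \<otimes> f x \<noteq> \<zero>}"
    by - (rule finite_subset[of _ "{x. f x \<noteq> \<zero>}"], auto)
  ultimately show "r \<odot>\<^bsub>free_module R B\<^esub> f \<in> carrier (free_module R B)" by auto
qed (use is_cring in \<open>auto simp: l_distr r_distr m_assoc\<close>)

lemma basis_vec_closed: "x \<in> B \<Longrightarrow> basis_vec R x \<in> carrier (free_module R B)"
  by (auto simp: basis_vec_def)

lemma free_module_finsum:
  assumes "\<And>a. a \<in> S \<Longrightarrow> g a \<in> carrier (free_module R B)"
  shows "finsum (free_module R B) g S x = finsum R (\<lambda>a. g a x) S"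
proof -
  interpret F: module R "free_module R B" by (rule free_module_module)
  show ?thesis using assms
  proof (induction S rule: infinite_finite_induct)
    case (insert a S)
    have c: "g b x \<in> carrier R" if "b \<in> insert a S" for b using insert.prems[OF that] by simp
    have "finsum (free_module R B) g (insert a S) = g a \<oplus>\<^bsub>free_module R B\<^esub> finsum (free_module R B) g S"
      by (rule F.M.finsum_insert) (use insert.hyps insert.prems in \<open>auto simp del: free_module_simps\<close>)
    then show ?case using insert c by (subst finsum_insert) auto
  qed auto
qed

lemma free_module_expand:
  assumes "f \<in> carrier (free_module R B)"
  shows "f = finsum (free_module R B) (\<lambda>x. f x \<odot>\<^bsub>free_module R B\<^esub> basis_vec R x) {x. f x \<noteq> \<zero>}"
proof
  interpret F: module R "free_module R B" by (rule free_module_module)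
  fix z
  have c: "f x \<odot>\<^bsub>free_module R B\<^esub> basis_vec R x \<in> carrier (free_module R B)" if "x \<in> {x. f x \<noteq> \<zero>}" for x
    by (rule F.smult_closed) (use assms that basis_vec_closed[of x B] in auto)
  have "finsum (free_module R B) (\<lambda>x. f x \<odot>\<^bsub>free_module R B\<^esub> basis_vec R x) {x. f x \<noteq> \<zero>} z
    = finsum R (\<lambda>x. f x \<otimes> basis_vec R x z) {x. f x \<noteq> \<zero>}"
    by (subst free_module_finsum[OF c]) auto
  also have "\<dots> = finsum R (\<lambda>x. if z = x then f x else \<zero>) {x. f x \<noteq> \<zero>}"
    by (rule finsum_cong') (use assms in \<open>auto simp: basis_vec_def\<close>)
  also have "\<dots> = f z"
  proof (cases "f z = \<zero>")
    case True
    then have "finsum R (\<lambda>x. if z = x then f x else \<zero>) {x. f x \<noteq> \<zero>} = finsum R (\<lambda>x. \<zero>) {x. f x \<noteq> \<zero>}"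
      by (intro finsum_cong') auto
    then show ?thesis using True by simp
  next
    case False
    then show ?thesis using finsum_singleton[of z "{x. f x \<noteq> \<zero>}" f] assms by auto
  qed
  finally show "f z = finsum (free_module R B) (\<lambda>x. f x \<odot>\<^bsub>free_module R B\<^esub> basis_vec R x) {x. f x \<noteq> \<zero>} z" by simp
qed

lemma free_module_span: "f \<in> carrier (free_module R B) \<Longrightarrow> f \<in> span R (free_module R B) (basis_vec R ` B)"
proof -
  interpret F: module R "free_module R B" by (rule free_module_module)
  assume f: "f \<in> carrier (free_module R B)"
  have sub: "submodule (span R (free_module R B) (basis_vec R ` B)) R (free_module R B)"
    by (rule F.span_submodule) (rule image_subsetI, rule basis_vec_closed)
  have b: "basis_vec R x \<in> span R (free_module R B) (basis_vec R ` B)" if "x \<in> B" for x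
    by (rule subsetD[OF F.span_superset imageI[OF that]])
  have "finsum (free_module R B) (\<lambda>x. f x \<odot>\<^bsub>free_module R B\<^esub> basis_vec R x) {x. f x \<noteq> \<zero>}
    \<in> span R (free_module R B) (basis_vec R ` B)"
  proof (rule F.submodule_finsum[OF sub], rule F.submoduleD(4)[OF sub])
    fix x assume "x \<in> {x. f x \<noteq> \<zero>}"
    then have "x \<in> B" using f by auto
    then show "basis_vec R x \<in> span R (free_module R B) (basis_vec R ` B)" by (rule b)
    show "f x \<in> carrier R" using f by simp
  qed
  then show ?thesis using free_module_expand[OF f] by simp
qed

text \<open>The linear extension of values prescribed on a basis; \<open>free_map\<close> is the
  instance whose target is again free.\<close>

definition lift :: "('a, 'n, 'z) module_scheme \<Rightarrow> ('x \<Rightarrow> 'n) \<Rightarrow> ('x \<Rightarrow> 'a) \<Rightarrow> 'n" where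
  "lift N t f = finsum N (\<lambda>x. f x \<odot>\<^bsub>N\<^esub> t x) {x. f x \<noteq> \<zero>}"

lemma lift_linear:
  assumes "module R N" "\<And>x. x \<in> B \<Longrightarrow> t x \<in> carrier N"
  shows "linear_map R (free_module R B) N (lift N t)"
    and "\<And>x. x \<in> B \<Longrightarrow> lift N t (basis_vec R x) = t x"
proof -
  interpret N: module R N by fact
  have sup: "lift N t f = finsum N (\<lambda>x. f x \<odot>\<^bsub>N\<^esub> t x) S"
    if "f \<in> carrier (free_module R B)" "finite S" "{x. f x \<noteq> \<zero>} \<subseteq> S" "S \<subseteq> B" for f S
    unfolding lift_def using that assms(2)
    by (intro N.add.finprod_mono_neutral_cong_left) (auto simp: subset_iff)
  have B: "{x. f x \<noteq> \<zero>} \<subseteq> B" if "f \<in> carrier (free_module R B)" for f using that by auto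
  show "linear_map R (free_module R B) N (lift N t)"
  proof (rule linear_mapI)
    fix f g r assume f: "f \<in> carrier (free_module R B)"
    show "lift N t f \<in> carrier N" unfolding lift_def
      by (rule N.M.finsum_closed) (use f B[OF f] assms(2) in auto)
    show "lift N t (f \<oplus>\<^bsub>free_module R B\<^esub> g) = lift N t f \<oplus>\<^bsub>N\<^esub> lift N t g" if g: "g \<in> carrier (free_module R B)"
    proof -
      let ?S = "{x. f x \<noteq> \<zero>} \<union> {x. g x \<noteq> \<zero>}"
      interpret F: module R "free_module R B" by (rule free_module_module)
      have fg: "f \<oplus>\<^bsub>free_module R B\<^esub> g \<in> carrier (free_module R B)" using f g by (rule F.M.a_closed)
      have S: "finite ?S" "?S \<subseteq> B" using f g by auto
      have sub: "{x. (f \<oplus>\<^bsub>free_module R B\<^esub> g) x \<noteq> \<zero>} \<subseteq> ?S" using f g by auto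
      have "lift N t (f \<oplus>\<^bsub>free_module R B\<^esub> g) = finsum N (\<lambda>x. (f x \<oplus> g x) \<odot>\<^bsub>N\<^esub> t x) ?S"
        using sup[OF fg S(1) sub S(2)] by simp
      also have "\<dots> = finsum N (\<lambda>x. f x \<odot>\<^bsub>N\<^esub> t x \<oplus>\<^bsub>N\<^esub> g x \<odot>\<^bsub>N\<^esub> t x) ?S"
        using f g S(2) assms(2) by (intro N.M.finsum_cong') (auto simp: N.smult_l_distr subset_iff)
      also have "\<dots> = finsum N (\<lambda>x. f x \<odot>\<^bsub>N\<^esub> t x) ?S \<oplus>\<^bsub>N\<^esub> finsum N (\<lambda>x. g x \<odot>\<^bsub>N\<^esub> t x) ?S"
        using f g S(2) assms(2) by (intro N.M.finsum_addf) (auto simp: subset_iff)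
      finally show ?thesis using sup[OF f S(1) _ S(2)] sup[OF g S(1) _ S(2)] by auto
    qed
    show "lift N t (r \<odot>\<^bsub>free_module R B\<^esub> f) = r \<odot>\<^bsub>N\<^esub> lift N t f" if r: "r \<in> carrier R"
    proof -
      interpret F: module R "free_module R B" by (rule free_module_module)
      let ?S = "{x. f x \<noteq> \<zero>}"
      have rf: "r \<odot>\<^bsub>free_module R B\<^esub> f \<in> carrier (free_module R B)" using r f by (rule F.smult_closed)
      have S: "finite ?S" "?S \<subseteq> B" using f by auto
      have sub: "{x. (r \<odot>\<^bsub>free_module R B\<^esub> f) x \<noteq> \<zero>} \<subseteq> ?S" using r f by auto
      have "lift N t (r \<odot>\<^bsub>free_module R B\<^esub> f) = finsum N (\<lambda>x. (r \<otimes> f x) \<odot>\<^bsub>N\<^esub> t x) ?S"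
        using sup[OF rf S(1) sub S(2)] by simp
      also have "\<dots> = finsum N (\<lambda>x. r \<odot>\<^bsub>N\<^esub> (f x \<odot>\<^bsub>N\<^esub> t x)) ?S"
        using f r S(2) assms(2) by (intro N.M.finsum_cong') (auto simp: N.smult_assoc1 subset_iff)
      also have "\<dots> = r \<odot>\<^bsub>N\<^esub> lift N t f"
        unfolding lift_def using f r S assms(2) by (intro N.finsum_smult_ldistr[symmetric]) (auto simp: subset_iff)
      finally show ?thesis .
    qed
  qed
  fix x assume x: "x \<in> B"
  have "lift N t (basis_vec R x) = finsum N (\<lambda>z. basis_vec R x z \<odot>\<^bsub>N\<^esub> t z) {x}"
    by (rule sup) (use x in \<open>auto simp: basis_vec_def\<close>)
  also have "\<dots> = t x" using x assms(2) by (simp add: basis_vec_def)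
  finally show "lift N t (basis_vec R x) = t x" .
qed

lemma free_map_eq_lift: "free_map R Y h = lift (free_module R Y) (\<lambda>x. basis_vec R (h x))"
  by (simp add: free_map_def lift_def fun_eq_iff)

end

section \<open>Tensor products by generators and relations\<close>

locale tensor = A?: module R A + B?: module R B for R (structure) and A and B
begin

abbreviation "FAB \<equiv> free_module R (carrier A \<times> carrier B)"
abbreviation "KAB \<equiv> tensor_kernel R A B"
abbreviation "TAB \<equiv> tensor_module R A B"
abbreviation "pure \<equiv> pure_tensor R A B"

sublocale FM: module R FAB by (rule A.R.free_module_module)

lemma e_closed: "x \<in> carrier A \<Longrightarrow> y \<in> carrier B \<Longrightarrow> basis_vec R (x, y) \<in> carrier FAB"
  by (rule A.R.basis_vec_closed) simp

lemma relations_closed: "bilinear_relations R A B \<subseteq> carrier FAB"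
  unfolding bilinear_relations_def Let_def
  by (auto intro!: FM.M.minus_closed FM.M.a_closed FM.smult_closed e_closed simp del: free_module_simps)

lemma kernel_submodule: "submodule KAB R FAB"
  unfolding tensor_kernel_def by (rule FM.span_submodule[OF relations_closed])

lemma relations_in_kernel:
  shows "x \<in> carrier A \<Longrightarrow> x' \<in> carrier A \<Longrightarrow> y \<in> carrier B \<Longrightarrow>
      basis_vec R (x \<oplus>\<^bsub>A\<^esub> x', y) \<ominus>\<^bsub>FAB\<^esub> (basis_vec R (x, y) \<oplus>\<^bsub>FAB\<^esub> basis_vec R (x', y)) \<in> KAB"
    and "x \<in> carrier A \<Longrightarrow> y \<in> carrier B \<Longrightarrow> y' \<in> carrier B \<Longrightarrow>
      basis_vec R (x, y \<oplus>\<^bsub>B\<^esub> y') \<ominus>\<^bsub>FAB\<^esub> (basis_vec R (x, y) \<oplus>\<^bsub>FAB\<^esub> basis_vec R (x, y')) \<in> KAB"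
    and "r \<in> carrier R \<Longrightarrow> x \<in> carrier A \<Longrightarrow> y \<in> carrier B \<Longrightarrow>
      basis_vec R (r \<odot>\<^bsub>A\<^esub> x, y) \<ominus>\<^bsub>FAB\<^esub> r \<odot>\<^bsub>FAB\<^esub> basis_vec R (x, y) \<in> KAB"
    and "r \<in> carrier R \<Longrightarrow> x \<in> carrier A \<Longrightarrow> y \<in> carrier B \<Longrightarrow>
      basis_vec R (x, r \<odot>\<^bsub>B\<^esub> y) \<ominus>\<^bsub>FAB\<^esub> r \<odot>\<^bsub>FAB\<^esub> basis_vec R (x, y) \<in> KAB"
proof -
  note rel = subsetD[OF FM.span_superset, of _ "bilinear_relations R A B", folded tensor_kernel_def]
  show "x \<in> carrier A \<Longrightarrow> x' \<in> carrier A \<Longrightarrow> y \<in> carrier B \<Longrightarrow>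
      basis_vec R (x \<oplus>\<^bsub>A\<^esub> x', y) \<ominus>\<^bsub>FAB\<^esub> (basis_vec R (x, y) \<oplus>\<^bsub>FAB\<^esub> basis_vec R (x', y)) \<in> KAB"
    by (rule rel, unfold bilinear_relations_def Let_def, rule UnI1, rule UnI1, rule UnI1, rule CollectI,
        (rule exI)+, intro conjI, rule refl, assumption+)
  show "x \<in> carrier A \<Longrightarrow> y \<in> carrier B \<Longrightarrow> y' \<in> carrier B \<Longrightarrow>
      basis_vec R (x, y \<oplus>\<^bsub>B\<^esub> y') \<ominus>\<^bsub>FAB\<^esub> (basis_vec R (x, y) \<oplus>\<^bsub>FAB\<^esub> basis_vec R (x, y')) \<in> KAB"
    by (rule rel, unfold bilinear_relations_def Let_def, rule UnI1, rule UnI1, rule UnI2, rule CollectI,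
        (rule exI)+, intro conjI, rule refl, assumption+)
  show "r \<in> carrier R \<Longrightarrow> x \<in> carrier A \<Longrightarrow> y \<in> carrier B \<Longrightarrow>
      basis_vec R (r \<odot>\<^bsub>A\<^esub> x, y) \<ominus>\<^bsub>FAB\<^esub> r \<odot>\<^bsub>FAB\<^esub> basis_vec R (x, y) \<in> KAB"
    by (rule rel, unfold bilinear_relations_def Let_def, rule UnI1, rule UnI2, rule CollectI,
        (rule exI)+, intro conjI, rule refl, assumption+)
  show "r \<in> carrier R \<Longrightarrow> x \<in> carrier A \<Longrightarrow> y \<in> carrier B \<Longrightarrow>
      basis_vec R (x, r \<odot>\<^bsub>B\<^esub> y) \<ominus>\<^bsub>FAB\<^esub> r \<odot>\<^bsub>FAB\<^esub> basis_vec R (x, y) \<in> KAB"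
    by (rule rel, unfold bilinear_relations_def Let_def, rule UnI2, rule CollectI,
        (rule exI)+, intro conjI, rule refl, assumption+)
qed

lemma kernel_least:
  assumes "submodule Q R FAB"
    and "\<And>x x' y. x \<in> carrier A \<Longrightarrow> x' \<in> carrier A \<Longrightarrow> y \<in> carrier B \<Longrightarrow>
      basis_vec R (x \<oplus>\<^bsub>A\<^esub> x', y) \<ominus>\<^bsub>FAB\<^esub> (basis_vec R (x, y) \<oplus>\<^bsub>FAB\<^esub> basis_vec R (x', y)) \<in> Q"
    and "\<And>x y y'. x \<in> carrier A \<Longrightarrow> y \<in> carrier B \<Longrightarrow> y' \<in> carrier B \<Longrightarrow>
      basis_vec R (x, y \<oplus>\<^bsub>B\<^esub> y') \<ominus>\<^bsub>FAB\<^esub> (basis_vec R (x, y) \<oplus>\<^bsub>FAB\<^esub> basis_vec R (x, y')) \<in> Q"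
    and "\<And>r x y. r \<in> carrier R \<Longrightarrow> x \<in> carrier A \<Longrightarrow> y \<in> carrier B \<Longrightarrow>
      basis_vec R (r \<odot>\<^bsub>A\<^esub> x, y) \<ominus>\<^bsub>FAB\<^esub> r \<odot>\<^bsub>FAB\<^esub> basis_vec R (x, y) \<in> Q"
    and "\<And>r x y. r \<in> carrier R \<Longrightarrow> x \<in> carrier A \<Longrightarrow> y \<in> carrier B \<Longrightarrow>
      basis_vec R (x, r \<odot>\<^bsub>B\<^esub> y) \<ominus>\<^bsub>FAB\<^esub> r \<odot>\<^bsub>FAB\<^esub> basis_vec R (x, y) \<in> Q"
  shows "KAB \<subseteq> Q"
  unfolding tensor_kernel_def
proof (rule FM.span_least[OF assms(1)], rule subsetI)
  fix u assume "u \<in> bilinear_relations R A B"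
  then show "u \<in> Q"
    unfolding bilinear_relations_def Let_def using assms(2-5) by (elim UnE CollectE exE conjE) auto
qed

sublocale T: module R TAB
  unfolding tensor_module_def by (rule FM.quotient_is_module[OF kernel_submodule])

lemma coset_linear: "linear_map R FAB TAB (\<lambda>f. KAB +>\<^bsub>FAB\<^esub> f)"
  unfolding tensor_module_def by (rule FM.coset_linear[OF kernel_submodule])

lemma pure_closed: "x \<in> carrier A \<Longrightarrow> y \<in> carrier B \<Longrightarrow> pure x y \<in> carrier TAB"
  unfolding pure_tensor_def by (rule linear_mapD(1)[OF coset_linear e_closed])

lemma coset_eqI:
  assumes "f \<in> carrier FAB" "g \<in> carrier FAB" "f \<ominus>\<^bsub>FAB\<^esub> g \<in> KAB"
  shows "KAB +>\<^bsub>FAB\<^esub> f = KAB +>\<^bsub>FAB\<^esub> g"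
  using FM.coset_eq_iff[OF kernel_submodule assms(1,2)] assms(3) by simp

lemma pure_left_linear:
  assumes "y \<in> carrier B"
  shows "linear_map R A TAB (\<lambda>x. pure x y)"
proof (rule linear_mapI)
  note c = linear_mapD[OF coset_linear]
  fix x x' assume x: "x \<in> carrier A"
  show "pure x y \<in> carrier TAB" by (rule pure_closed[OF x assms])
  show "pure (x \<oplus>\<^bsub>A\<^esub> x') y = pure x y \<oplus>\<^bsub>TAB\<^esub> pure x' y" if x': "x' \<in> carrier A"
    unfolding pure_tensor_def c(2)[OF e_closed[OF x assms] e_closed[OF x' assms], symmetric]
    by (rule coset_eqI[OF _ _ relations_in_kernel(1)[OF x x' assms]])
       (use x x' assms e_closed FM.M.a_closed in \<open>auto simp del: free_module_simps\<close>)
  show "pure (r \<odot>\<^bsub>A\<^esub> x) y = r \<odot>\<^bsub>TAB\<^esub> pure x y" if r: "r \<in> carrier R" for r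
    unfolding pure_tensor_def c(3)[OF r e_closed[OF x assms], symmetric]
    by (rule coset_eqI[OF _ _ relations_in_kernel(3)[OF r x assms]])
       (use r x assms e_closed FM.smult_closed in \<open>auto simp del: free_module_simps\<close>)
qed

lemma pure_right_linear:
  assumes "x \<in> carrier A"
  shows "linear_map R B TAB (\<lambda>y. pure x y)"
proof (rule linear_mapI)
  note c = linear_mapD[OF coset_linear]
  fix y y' assume y: "y \<in> carrier B"
  show "pure x y \<in> carrier TAB" by (rule pure_closed[OF assms y])
  show "pure x (y \<oplus>\<^bsub>B\<^esub> y') = pure x y \<oplus>\<^bsub>TAB\<^esub> pure x y'" if y': "y' \<in> carrier B"
    unfolding pure_tensor_def c(2)[OF e_closed[OF assms y] e_closed[OF assms y'], symmetric]
    by (rule coset_eqI[OF _ _ relations_in_kernel(2)[OF assms y y']])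
       (use y y' assms e_closed FM.M.a_closed in \<open>auto simp del: free_module_simps\<close>)
  show "pure x (r \<odot>\<^bsub>B\<^esub> y) = r \<odot>\<^bsub>TAB\<^esub> pure x y" if r: "r \<in> carrier R" for r
    unfolding pure_tensor_def c(3)[OF r e_closed[OF assms y], symmetric]
    by (rule coset_eqI[OF _ _ relations_in_kernel(4)[OF r assms y]])
       (use r y assms e_closed FM.smult_closed in \<open>auto simp del: free_module_simps\<close>)
qed

lemma tensor_induct:
  assumes "submodule P R TAB" "\<And>x y. x \<in> carrier A \<Longrightarrow> y \<in> carrier B \<Longrightarrow> pure x y \<in> P" "c \<in> carrier TAB"
  shows "c \<in> P"
proof -
  obtain f where f: "f \<in> carrier FAB" "c = KAB +>\<^bsub>FAB\<^esub> f"
    using assms(3) by (auto simp: tensor_module_def FM.mem_a_rcosets simp del: free_module_simps)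
  show ?thesis
    unfolding f(2)
  proof (rule linear_map_span[OF FM.module_axioms T.module_axioms coset_linear _ A.R.free_module_span[OF f(1)] assms(1)])
    show "basis_vec R ` (carrier A \<times> carrier B) \<subseteq> carrier FAB" by (rule image_subsetI) (rule A.R.basis_vec_closed)
    show "(\<lambda>f. KAB +>\<^bsub>FAB\<^esub> f) ` basis_vec R ` (carrier A \<times> carrier B) \<subseteq> P"
      using assms(2) unfolding pure_tensor_def by (auto simp del: free_module_simps)
  qed
qed

text \<open>The universal property of the tensor product, phrased as vanishing on the relations. It
  supplies a map out of a tensor product when elements have to be shown nonzero there.\<close>

lemma lift_kernel:
  assumes "module R N" "\<And>y. y \<in> carrier B \<Longrightarrow> linear_map R A N (\<lambda>x. \<beta> (x, y))"
    and "\<And>x. x \<in> carrier A \<Longrightarrow> linear_map R B N (\<lambda>y. \<beta> (x, y))" and "f \<in> KAB"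
  shows "A.R.lift N \<beta> f = \<zero>\<^bsub>N\<^esub>"
proof -
  interpret N: module R N by fact
  note l = linear_mapD[OF assms(2)] and r = linear_mapD[OF assms(3)]
  have t: "\<beta> p \<in> carrier N" if "p \<in> carrier A \<times> carrier B" for p using that l(1) by auto
  note lin = A.R.lift_linear(1)[where N = N and t = \<beta> and B = "carrier A \<times> carrier B", OF assms(1) t]
    and basis = A.R.lift_linear(2)[where N = N and t = \<beta> and B = "carrier A \<times> carrier B", OF assms(1) t]
  note L = linear_mapD[OF lin] and Lm = linear_map_minus[OF FM.module_axioms N.module_axioms lin]
  have b: "A.R.lift N \<beta> (basis_vec R (x, y)) = \<beta> (x, y)" if "x \<in> carrier A" "y \<in> carrier B" for x y
    by (rule basis) (use that in auto)
  have self: "u \<ominus>\<^bsub>N\<^esub> u = \<zero>\<^bsub>N\<^esub>" if "u \<in> carrier N" for u using that by (simp add: a_minus_def N.M.r_neg)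
  have "KAB \<subseteq> {f \<in> carrier FAB. A.R.lift N \<beta> f \<in> {\<zero>\<^bsub>N\<^esub>}}"
  proof (rule kernel_least[OF linear_map_preimage[OF FM.module_axioms N.module_axioms lin N.submodule_zero]])
    fix x x' y assume *: "x \<in> carrier A" "x' \<in> carrier A" "y \<in> carrier B"
    note e = e_closed[OF *(1,3)] e_closed[OF *(2,3)] e_closed[OF A.M.a_closed[OF *(1,2)] *(3)]
    show "basis_vec R (x \<oplus>\<^bsub>A\<^esub> x', y) \<ominus>\<^bsub>FAB\<^esub> (basis_vec R (x, y) \<oplus>\<^bsub>FAB\<^esub> basis_vec R (x', y)) \<in> {f \<in> carrier FAB. A.R.lift N \<beta> f \<in> {\<zero>\<^bsub>N\<^esub>}}"
      using e * FM.M.a_closed[OF e(1,2)] FM.M.minus_closed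
      by (simp add: Lm L(2) b l(2) self t del: free_module_simps)
  next
    fix x y y' assume *: "x \<in> carrier A" "y \<in> carrier B" "y' \<in> carrier B"
    note e = e_closed[OF *(1,2)] e_closed[OF *(1,3)] e_closed[OF *(1) B.M.a_closed[OF *(2,3)]]
    show "basis_vec R (x, y \<oplus>\<^bsub>B\<^esub> y') \<ominus>\<^bsub>FAB\<^esub> (basis_vec R (x, y) \<oplus>\<^bsub>FAB\<^esub> basis_vec R (x, y')) \<in> {f \<in> carrier FAB. A.R.lift N \<beta> f \<in> {\<zero>\<^bsub>N\<^esub>}}"
      using e * FM.M.a_closed[OF e(1,2)] FM.M.minus_closed
      by (simp add: Lm L(2) b r(2) self t del: free_module_simps)
  next
    fix s x y assume *: "s \<in> carrier R" "x \<in> carrier A" "y \<in> carrier B"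
    note e = e_closed[OF *(2,3)] e_closed[OF A.smult_closed[OF *(1,2)] *(3)] e_closed[OF *(2) B.smult_closed[OF *(1,3)]]
    show "basis_vec R (s \<odot>\<^bsub>A\<^esub> x, y) \<ominus>\<^bsub>FAB\<^esub> s \<odot>\<^bsub>FAB\<^esub> basis_vec R (x, y) \<in> {f \<in> carrier FAB. A.R.lift N \<beta> f \<in> {\<zero>\<^bsub>N\<^esub>}}"
      using e * FM.smult_closed[OF *(1) e(1)] FM.M.minus_closed
      by (simp add: Lm L(3) b l(3) self t del: free_module_simps)
    show "basis_vec R (x, s \<odot>\<^bsub>B\<^esub> y) \<ominus>\<^bsub>FAB\<^esub> s \<odot>\<^bsub>FAB\<^esub> basis_vec R (x, y) \<in> {f \<in> carrier FAB. A.R.lift N \<beta> f \<in> {\<zero>\<^bsub>N\<^esub>}}"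
      using e * FM.smult_closed[OF *(1) e(1)] FM.M.minus_closed
      by (simp add: Lm L(3) b r(3) self t del: free_module_simps)
  qed
  then show ?thesis using assms(4) by blast
qed

end

text \<open>The map of free modules sends each bilinear relation to a bilinear relation of the same
  kind, hence kernel into kernel, and descends to cosets.\<close>

lemma tensor_map_linear:
  assumes "tensor R A B" "tensor R A' B'" "linear_map R A A' f" "linear_map R B B' g"
  shows "linear_map R (tensor_module R A B) (tensor_module R A' B') (tensor_map R A' B' f g)"
    and "\<And>x y. x \<in> carrier A \<Longrightarrow> y \<in> carrier B \<Longrightarrow>
      tensor_map R A' B' f g (pure_tensor R A B x y) = pure_tensor R A' B' (f x) (g y)"
proof -
  interpret S: tensor R A B by fact
  interpret S': tensor R A' B' by fact
  note f = linear_mapD[OF assms(3)] and g = linear_mapD[OF assms(4)]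
  let ?h = "free_map R (carrier A' \<times> carrier B') (map_prod f g)"
  let ?t = "\<lambda>x. basis_vec R (map_prod f g x)"
  have t: "?t p \<in> carrier S'.FAB" if "p \<in> carrier A \<times> carrier B" for p
    using that f(1) g(1) S'.e_closed by auto
  note lin = S.A.R.lift_linear(1)[where N = S'.FAB and t = ?t and B = "carrier A \<times> carrier B", OF S'.FM.module_axioms t,
      folded S.A.R.free_map_eq_lift]
    and basis = S.A.R.lift_linear(2)[where N = S'.FAB and t = ?t and B = "carrier A \<times> carrier B", OF S'.FM.module_axioms t,
      folded S.A.R.free_map_eq_lift]
  have b: "?h (basis_vec R (x, y)) = basis_vec R (f x, g y)" if "x \<in> carrier A" "y \<in> carrier B" for x y
    using basis[of "(x, y)"] that by simp
  note L = linear_mapD[OF lin] and Lm = linear_map_minus[OF S.FM.module_axioms S'.FM.module_axioms lin]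
  have "S.KAB \<subseteq> {u \<in> carrier S.FAB. ?h u \<in> S'.KAB}"
  proof (rule S.kernel_least[OF linear_map_preimage[OF S.FM.module_axioms S'.FM.module_axioms lin S'.kernel_submodule]])
    fix x x' y assume *: "x \<in> carrier A" "x' \<in> carrier A" "y \<in> carrier B"
    note e = S.e_closed[OF *(1,3)] S.e_closed[OF *(2,3)] S.e_closed[OF S.A.M.a_closed[OF *(1,2)] *(3)]
    show "basis_vec R (x \<oplus>\<^bsub>A\<^esub> x', y) \<ominus>\<^bsub>S.FAB\<^esub> (basis_vec R (x, y) \<oplus>\<^bsub>S.FAB\<^esub> basis_vec R (x', y)) \<in> {u \<in> carrier S.FAB. ?h u \<in> S'.KAB}"
      using e * S.FM.M.a_closed[OF e(1,2)] S.FM.M.minus_closed S'.relations_in_kernel(1)[OF f(1)[OF *(1)] f(1)[OF *(2)] g(1)[OF *(3)]]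
      by (simp add: Lm L(2) b f(2) del: free_module_simps)
  next
    fix x y y' assume *: "x \<in> carrier A" "y \<in> carrier B" "y' \<in> carrier B"
    note e = S.e_closed[OF *(1,2)] S.e_closed[OF *(1,3)] S.e_closed[OF *(1) S.B.M.a_closed[OF *(2,3)]]
    show "basis_vec R (x, y \<oplus>\<^bsub>B\<^esub> y') \<ominus>\<^bsub>S.FAB\<^esub> (basis_vec R (x, y) \<oplus>\<^bsub>S.FAB\<^esub> basis_vec R (x, y')) \<in> {u \<in> carrier S.FAB. ?h u \<in> S'.KAB}"
      using e * S.FM.M.a_closed[OF e(1,2)] S.FM.M.minus_closed S'.relations_in_kernel(2)[OF f(1)[OF *(1)] g(1)[OF *(2)] g(1)[OF *(3)]]
      by (simp add: Lm L(2) b g(2) del: free_module_simps)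
  next
    fix s x y assume *: "s \<in> carrier R" "x \<in> carrier A" "y \<in> carrier B"
    note e = S.e_closed[OF *(2,3)] S.e_closed[OF S.A.smult_closed[OF *(1,2)] *(3)] S.e_closed[OF *(2) S.B.smult_closed[OF *(1,3)]]
    show "basis_vec R (s \<odot>\<^bsub>A\<^esub> x, y) \<ominus>\<^bsub>S.FAB\<^esub> s \<odot>\<^bsub>S.FAB\<^esub> basis_vec R (x, y) \<in> {u \<in> carrier S.FAB. ?h u \<in> S'.KAB}"
      using e * S.FM.smult_closed[OF *(1) e(1)] S.FM.M.minus_closed S'.relations_in_kernel(3)[OF *(1) f(1)[OF *(2)] g(1)[OF *(3)]]
      by (simp add: Lm L(3) b f(3) del: free_module_simps)
    show "basis_vec R (x, s \<odot>\<^bsub>B\<^esub> y) \<ominus>\<^bsub>S.FAB\<^esub> s \<odot>\<^bsub>S.FAB\<^esub> basis_vec R (x, y) \<in> {u \<in> carrier S.FAB. ?h u \<in> S'.KAB}"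
      using e * S.FM.smult_closed[OF *(1) e(1)] S.FM.M.minus_closed S'.relations_in_kernel(4)[OF *(1) f(1)[OF *(2)] g(1)[OF *(3)]]
      by (simp add: Lm L(3) b g(3) del: free_module_simps)
  qed
  then have K: "?h u \<in> S'.KAB" if "u \<in> S.KAB" for u using that by blast
  show "linear_map R (tensor_module R A B) (tensor_module R A' B') (tensor_map R A' B' f g)"
    unfolding tensor_module_def tensor_map_def
    by (rule coset_map_linear[OF S.FM.module_axioms S'.FM.module_axioms S.kernel_submodule S'.kernel_submodule lin K])
  fix x y assume xy: "x \<in> carrier A" "y \<in> carrier B"
  have "tensor_map R A' B' f g (pure_tensor R A B x y) = S'.KAB +>\<^bsub>S'.FAB\<^esub> ?h (basis_vec R (x, y))"
    unfolding tensor_map_def pure_tensor_def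
    by (rule coset_map_coset[OF S.FM.module_axioms S'.FM.module_axioms S.kernel_submodule S'.kernel_submodule L(1,2) K S.e_closed[OF xy]])
  then show "tensor_map R A' B' f g (pure_tensor R A B x y) = pure_tensor R A' B' (f x) (g y)"
    unfolding b[OF xy] pure_tensor_def .
qed


section \<open>Tor of a quotient of submodules\<close>

lemma gsub_simps [simp]:
  "carrier (gsub M P) = P" "add (gsub M P) = add M" "\<zero>\<^bsub>gsub M P\<^esub> = \<zero>\<^bsub>M\<^esub>" "smult (gsub M P) = smult M"
  "mod_part (gsub M P) n = P \<inter> mod_part M n" "a_r_coset (gsub M P) = a_r_coset M" "set_add (gsub M P) = set_add M"
  by (simp_all add: gsub_def a_r_coset_def r_coset_def set_add_def set_mult_def fun_eq_iff)

lemma gquotient_simps [simp]: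
  "carrier (gquotient M P) = a_rcosets\<^bsub>M\<^esub> P" "\<zero>\<^bsub>gquotient M P\<^esub> = P" "add (gquotient M P) = set_add M"
  "smult (gquotient M P) = (\<lambda>r. coset_map M P (\<lambda>x. r \<odot>\<^bsub>M\<^esub> x))"
  "mod_part (gquotient M P) n = (\<lambda>x. P +>\<^bsub>M\<^esub> x) ` mod_part M n"
  by (simp_all add: gquotient_def graded_by_eq)

lemma gsub_module:
  assumes "module R M" "submodule P R M"
  shows "module R (gsub M P)"
  by (rule module_transfer[OF submodule.submodule_is_module[OF assms(2,1)]]) simp_all

lemma gsub_submodule:
  assumes "module R M" "submodule P R M" "submodule Q R M" "Q \<subseteq> P"
  shows "submodule Q R (gsub M P)"
proof -
  interpret M: module R M by fact
  interpret S: module R "gsub M P" by (rule gsub_module) fact+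
  show ?thesis by (rule S.submoduleI') (use M.submoduleD[OF assms(3)] assms(4) in auto)
qed

lemma gquotient_module:
  assumes "module R M" "submodule P R M"
  shows "module R (gquotient M P)"
  by (rule module_transfer[OF module.quotient_is_module[OF assms]]) simp_all

lemma gquotient_coset_linear:
  assumes "module R M" "submodule P R M"
  shows "linear_map R M (gquotient M P) (\<lambda>x. P +>\<^bsub>M\<^esub> x)"
  by (rule linear_map_transfer[OF module.coset_linear[OF assms]]) simp_all

lemma (in module) minus_eq_zero_iff:
  assumes "x \<in> carrier M" "y \<in> carrier M"
  shows "x \<ominus>\<^bsub>M\<^esub> y = \<zero>\<^bsub>M\<^esub> \<longleftrightarrow> x = y"
proof
  assume "x \<ominus>\<^bsub>M\<^esub> y = \<zero>\<^bsub>M\<^esub>"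
  then have "(x \<ominus>\<^bsub>M\<^esub> y) \<oplus>\<^bsub>M\<^esub> y = y" using assms by simp
  then show "x = y" using assms by (simp add: a_minus_def M.a_assoc M.l_neg)
qed (use assms in \<open>simp add: a_minus_def M.r_neg\<close>)

lemma linear_map_finsum_fun:
  assumes "module R A" "module R B" "\<And>j. j \<in> J \<Longrightarrow> linear_map R A B (f j)"
  shows "linear_map R A B (\<lambda>x. finsum B (\<lambda>j. f j x) J)"
proof -
  interpret A: module R A by fact
  interpret B: module R B by fact
  note f = linear_mapD[OF assms(3)]
  show ?thesis
  proof (cases "finite J")
    case True
    show ?thesis
    proof (rule linear_mapI)
      fix x x' r assume x: "x \<in> carrier A"
      show "finsum B (\<lambda>j. f j x) J \<in> carrier B" using f(1) x by (intro B.M.finsum_closed) auto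
      show "finsum B (\<lambda>j. f j (x \<oplus>\<^bsub>A\<^esub> x')) J = finsum B (\<lambda>j. f j x) J \<oplus>\<^bsub>B\<^esub> finsum B (\<lambda>j. f j x') J"
        if x': "x' \<in> carrier A"
      proof -
        have "finsum B (\<lambda>j. f j (x \<oplus>\<^bsub>A\<^esub> x')) J = finsum B (\<lambda>j. f j x \<oplus>\<^bsub>B\<^esub> f j x') J"
          using f x x' by (intro B.M.finsum_cong') auto
        also have "\<dots> = finsum B (\<lambda>j. f j x) J \<oplus>\<^bsub>B\<^esub> finsum B (\<lambda>j. f j x') J"
          using f x x' by (intro B.M.finsum_addf) auto
        finally show ?thesis .
      qed
      show "finsum B (\<lambda>j. f j (r \<odot>\<^bsub>A\<^esub> x)) J = r \<odot>\<^bsub>B\<^esub> finsum B (\<lambda>j. f j x) J" if r: "r \<in> carrier R"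
      proof -
        have "finsum B (\<lambda>j. f j (r \<odot>\<^bsub>A\<^esub> x)) J = finsum B (\<lambda>j. r \<odot>\<^bsub>B\<^esub> f j x) J"
          using f x r by (intro B.M.finsum_cong') auto
        also have "\<dots> = r \<odot>\<^bsub>B\<^esub> finsum B (\<lambda>j. f j x) J"
          by (rule B.finsum_smult_ldistr[symmetric]) (use True f x r in auto)
        finally show ?thesis .
      qed
    qed
  qed (rule linear_mapI, auto)
qed

lemma gpow_coord_linear:
  assumes "module R M"
  shows "linear_map R (gpow M e) M (\<lambda>w. w j)"
  using gpow_coord[OF assms] by (intro linear_mapI) auto

lemma finsum_gsub:
  assumes "module R M" "submodule P R M" "\<And>a. a \<in> A \<Longrightarrow> f a \<in> P"
  shows "finsum (gsub M P) f A = finsum M f A"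
proof -
  interpret M: module R M by fact
  interpret P: module R "M\<lparr>carrier := P\<rparr>" by (rule submodule.submodule_is_module) fact+
  have "finsum (gsub M P) f A = finsum (M\<lparr>carrier := P\<rparr>) f A"
    by (subst finsum_cong_structure[of "gsub M P" "M\<lparr>carrier := P\<rparr>"]) auto
  also have "\<dots> = finsum M f A"
    by (rule M.finsum_carrier_update[OF P.M.abelian_group_axioms]) (use M.submoduleD(1)[OF assms(2)] assms(3) in auto)
  finally show ?thesis .
qed

section \<open>A free module tensored with a quotient of submodules\<close>

locale free_tensor = graded_mod R M for R :: "'a gring" (structure) and M :: "('a, 'm) gmodule" (structure) +
  fixes e :: "int list" and P Q :: "'m set"
  assumes P_sub: "submodule P R M" and Q_sub: "submodule Q R M" and QP: "Q \<subseteq> P"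
begin

abbreviation "F \<equiv> gfree R e"
abbreviation "E \<equiv> gquotient (gsub M P) Q"
abbreviation "W \<equiv> gpow (gsub M P) e"
abbreviation "q x \<equiv> Q +>\<^bsub>M\<^esub> x"

sublocale SP: module R "gsub M P" by (rule gsub_module[OF module_axioms P_sub])
sublocale WM: module R W by (rule gpow_module) (rule SP.module_axioms)
sublocale GF: graded_mod R F by (rule gfree_graded[OF gr])

lemma Q_sub': "submodule Q R (gsub M P)"
  by (rule gsub_submodule[OF module_axioms P_sub Q_sub QP])

sublocale EM: module R E by (rule gquotient_module[OF SP.module_axioms Q_sub'])
sublocale tensor R F E ..

lemma F_eq: "F = gpow (rmod R) e" by (rule gfree_eq[OF gr])

lemma rmod_mod: "module R (rmod R)" by (rule rmod_module[OF R.is_cring])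

lemma q_linear: "linear_map R (gsub M P) E q"
  using gquotient_coset_linear[OF SP.module_axioms Q_sub'] by simp

lemma q_zero: "x \<in> P \<Longrightarrow> q x = \<zero>\<^bsub>E\<^esub> \<longleftrightarrow> x \<in> Q"
  using coset_zero_iff[OF Q_sub] submoduleD(1)[OF P_sub] by simp

lemma E_carrier: "z \<in> carrier E \<longleftrightarrow> (\<exists>x\<in>P. z = q x)"
  using SP.mem_a_rcosets[of z Q] by simp

lemma basis_closed: "j < length e \<Longrightarrow> basis_vec R j \<in> carrier F"
  by (auto simp: F_eq basis_vec_def)

lemma W_coord: "w \<in> carrier W \<Longrightarrow> w j \<in> P"
  using gpow_coord[OF SP.module_axioms, of w e j] by simp

text \<open>Sends a vector w over \<open>P\<close> to the sum of e_j \<otimes> [w_j]. It is onto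
  with kernel the vectors over \<open>Q\<close>, so the tensor product is P^r/Q^r; this is what
  allows chains for all \<open>n\<close> to be read inside one power of \<open>M\<close>.\<close>

definition psi :: "(nat \<Rightarrow> 'm) \<Rightarrow> ((nat \<Rightarrow> 'a) \<times> 'm set \<Rightarrow> 'a) set" where
  "psi w = finsum TAB (\<lambda>j. pure (basis_vec R j) (q (w j))) {..<length e}"

lemma psi_linear: "linear_map R W TAB psi"
proof -
  have "linear_map R W TAB (\<lambda>w. pure (basis_vec R j) (q (w j)))" if "j \<in> {..<length e}" for j
  proof (rule linear_map_comp[OF _ pure_right_linear])
    show "linear_map R W E (\<lambda>w. q (w j))"
      by (rule linear_map_comp[OF gpow_coord_linear[OF SP.module_axioms] q_linear])
    show "basis_vec R j \<in> carrier F" using that basis_closed by simp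
  qed
  from linear_map_finsum_fun[OF WM.module_axioms T.module_axioms this, of "{..<length e}"]
  show ?thesis unfolding psi_def by simp
qed

lemma psi_term_closed: "j < length e \<Longrightarrow> x \<in> P \<Longrightarrow> pure (basis_vec R j) (q x) \<in> carrier TAB"
  using pure_closed[OF basis_closed] E_carrier by blast

text \<open>Expand \<open>v\<close> in the basis and move its coefficients across the tensor
  sign.\<close>

lemma pure_eq_psi:
  assumes v: "v \<in> carrier F" and x: "x \<in> P"
  shows "(\<lambda>l. v l \<odot>\<^bsub>M\<^esub> x) \<in> carrier W" "pure v (q x) = psi (\<lambda>l. v l \<odot>\<^bsub>M\<^esub> x)"
proof -
  have xM: "x \<in> carrier M" using submoduleD(1)[OF P_sub x] .
  have vR: "v l \<in> carrier R" for l using gpow_coord[OF rmod_mod, of v e l] v by (simp add: F_eq)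
  have v0: "v l = \<zero>" if "\<not> l < length e" for l using v that by (simp add: F_eq)
  show "(\<lambda>l. v l \<odot>\<^bsub>M\<^esub> x) \<in> carrier W" using vR v0 x xM submoduleD(4)[OF P_sub] by simp
  have qx: "q x \<in> carrier E" using E_carrier x by blast
  let ?s = "\<lambda>j i. if i = j then v j else \<zero>"
  have s: "?s j = v j \<odot>\<^bsub>F\<^esub> basis_vec R j" if "j < length e" for j
    using vR by (auto simp: F_eq basis_vec_def)
  have sc: "?s j \<in> carrier F" if "j < length e" for j using that vR by (simp add: F_eq)
  have "v \<in> carrier (gpow (rmod R) e)" using v by (simp only: F_eq)
  from gpow_single_sum[OF rmod_mod this] have "v = finsum F ?s {..<length e}" by (simp only: F_eq rmod_simps)
  then have "pure v (q x) = pure (finsum F ?s {..<length e}) (q x)" by simp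
  also have "\<dots> = finsum TAB (\<lambda>j. pure (?s j) (q x)) {..<length e}"
    by (rule linear_map_finsum[OF GF.module_axioms T.module_axioms pure_left_linear[OF qx]]) (use sc in auto)
  also have "\<dots> = psi (\<lambda>l. v l \<odot>\<^bsub>M\<^esub> x)"
    unfolding psi_def
  proof (rule T.M.finsum_cong'[OF refl])
    show "(\<lambda>j. pure (basis_vec R j) (q (v j \<odot>\<^bsub>M\<^esub> x))) \<in> {..<length e} \<rightarrow> carrier TAB"
      using psi_term_closed submoduleD(4)[OF P_sub vR x] by blast
    fix j assume "j \<in> {..<length e}"
    then have j: "j < length e" by simp
    have "pure (?s j) (q x) = v j \<odot>\<^bsub>TAB\<^esub> pure (basis_vec R j) (q x)"
      unfolding s[OF j] by (rule linear_mapD(3)[OF pure_left_linear[OF qx] vR basis_closed[OF j]])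
    also have "\<dots> = pure (basis_vec R j) (v j \<odot>\<^bsub>E\<^esub> q x)"
      by (rule linear_mapD(3)[OF pure_right_linear[OF basis_closed[OF j]] vR qx, symmetric])
    also have "v j \<odot>\<^bsub>E\<^esub> q x = q (v j \<odot>\<^bsub>M\<^esub> x)"
      using linear_mapD(3)[OF q_linear vR, of x j] x by simp
    finally show "pure (?s j) (q x) = pure (basis_vec R j) (q (v j \<odot>\<^bsub>M\<^esub> x))" .
  qed
  finally show "pure v (q x) = psi (\<lambda>l. v l \<odot>\<^bsub>M\<^esub> x)" .
qed

lemma psi_surj: "psi ` carrier W = carrier TAB"
proof
  show "psi ` carrier W \<subseteq> carrier TAB" using linear_mapD(1)[OF psi_linear] by blast
  note sub = linear_map_image[OF WM.module_axioms T.module_axioms psi_linear WM.carrier_is_submodule]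
  show "carrier TAB \<subseteq> psi ` carrier W"
  proof
    fix c assume "c \<in> carrier TAB"
    then show "c \<in> psi ` carrier W"
    proof (rule tensor_induct[OF sub, rotated])
      fix v z assume v: "v \<in> carrier F" and "z \<in> carrier E"
      then obtain x where x: "x \<in> P" "z = q x" using E_carrier by blast
      show "pure v z \<in> psi ` carrier W"
        unfolding x(2) pure_eq_psi(2)[OF v x(1)] by (rule imageI[OF pure_eq_psi(1)[OF v x(1)]])
    qed
  qed
qed

text \<open>The nontrivial direction uses the inverse map, which sends v \<otimes> z to the vector
  of all v_j z and exists by the universal property.\<close>

lemma psi_zero_iff:
  assumes w: "w \<in> carrier W"
  shows "psi w = \<zero>\<^bsub>TAB\<^esub> \<longleftrightarrow> (\<forall>j. w j \<in> Q)"
proof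
  assume Qw: "\<forall>j. w j \<in> Q"
  have "psi w = finsum TAB (\<lambda>j. \<zero>\<^bsub>TAB\<^esub>) {..<length e}"
    unfolding psi_def
  proof (rule T.M.finsum_cong'[OF refl])
    fix j assume j: "j \<in> {..<length e}"
    have "q (w j) = \<zero>\<^bsub>E\<^esub>" using q_zero[OF W_coord[OF w]] Qw by blast
    then show "pure (basis_vec R j) (q (w j)) = \<zero>\<^bsub>TAB\<^esub>"
      using linear_map_zero[OF EM.module_axioms T.module_axioms pure_right_linear[OF basis_closed]] j by simp
  qed auto
  then show "psi w = \<zero>\<^bsub>TAB\<^esub>" by simp
next
  assume zero: "psi w = \<zero>\<^bsub>TAB\<^esub>"
  interpret N: module R "gpow E e" by (rule gpow_module[OF EM.module_axioms])
  define \<beta> where "\<beta> p = (\<lambda>j. fst p j \<odot>\<^bsub>E\<^esub> snd p)" for p :: "(nat \<Rightarrow> 'a) \<times> 'm set"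
  have vR: "v l \<in> carrier R" if "v \<in> carrier F" for v l using gpow_coord[OF rmod_mod, of v e l] that by (simp add: F_eq)
  have v0: "v l = \<zero>" if "v \<in> carrier F" "l \<ge> length e" for v l using that by (simp add: F_eq)
  have \<beta>c: "\<beta> (v, z) \<in> carrier (gpow E e)" if "v \<in> carrier F" "z \<in> carrier E" for v z
    using vR[OF that(1)] v0[OF that(1)] that(2) EM.smult_closed EM.smult_l_null by (simp add: \<beta>_def del: gquotient_simps)
  have l: "linear_map R F (gpow E e) (\<lambda>v. \<beta> (v, z))" if z: "z \<in> carrier E" for z
  proof (rule linear_mapI)
    fix v v' assume v: "v \<in> carrier F"
    show "\<beta> (v, z) \<in> carrier (gpow E e)" by (rule \<beta>c[OF v z])
    show "\<beta> (v \<oplus>\<^bsub>F\<^esub> v', z) = \<beta> (v, z) \<oplus>\<^bsub>gpow E e\<^esub> \<beta> (v', z)" if v': "v' \<in> carrier F"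
      using vR[OF v] vR[OF v'] z EM.smult_l_distr by (simp add: \<beta>_def F_eq del: gquotient_simps)
    show "\<beta> (r \<odot>\<^bsub>F\<^esub> v, z) = r \<odot>\<^bsub>gpow E e\<^esub> \<beta> (v, z)" if r: "r \<in> carrier R" for r
      using vR[OF v] r z EM.smult_assoc1 by (simp add: \<beta>_def F_eq del: gquotient_simps)
  qed
  have r: "linear_map R E (gpow E e) (\<lambda>z. \<beta> (v, z))" if v: "v \<in> carrier F" for v
  proof (rule linear_mapI)
    fix z z' assume z: "z \<in> carrier E"
    show "\<beta> (v, z) \<in> carrier (gpow E e)" by (rule \<beta>c[OF v z])
    show "\<beta> (v, z \<oplus>\<^bsub>E\<^esub> z') = \<beta> (v, z) \<oplus>\<^bsub>gpow E e\<^esub> \<beta> (v, z')" if z': "z' \<in> carrier E"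
      using vR[OF v] z z' EM.smult_r_distr by (simp add: \<beta>_def del: gquotient_simps)
    show "\<beta> (v, s \<odot>\<^bsub>E\<^esub> z) = s \<odot>\<^bsub>gpow E e\<^esub> \<beta> (v, z)" if s: "s \<in> carrier R" for s
      using vR[OF v] s z by (simp add: \<beta>_def EM.smult_assoc1[symmetric] R.m_comm del: gquotient_simps)
  qed
  have qw: "q (w j) \<in> carrier E" for j using E_carrier W_coord[OF w] by blast
  \<comment> \<open>Representatives of the summands of \<open>psi w\<close> in the free module on
    pairs. Their sum lies in the span of the relations, on which the lift of \<open>\<beta>\<close>
    vanishes; reading off coordinate \<open>i\<close> gives the class of \<open>w i\<close>.\<close>
  let ?b = "\<lambda>j. basis_vec R (basis_vec R j, q (w j)) :: (nat \<Rightarrow> 'a) \<times> 'm set \<Rightarrow> 'a"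
  have bc: "?b j \<in> carrier FAB" if "j \<in> {..<length e}" for j
    using e_closed[OF basis_closed qw] that by blast
  have sumc: "finsum FAB ?b {..<length e} \<in> carrier FAB"
    by (rule FM.M.finsum_closed) (use bc in blast)
  have "psi w = KAB +>\<^bsub>FAB\<^esub> finsum FAB ?b {..<length e}"
    unfolding psi_def pure_tensor_def
    by (rule linear_map_finsum[OF FM.module_axioms T.module_axioms coset_linear bc, symmetric])
  then have "KAB +>\<^bsub>FAB\<^esub> finsum FAB ?b {..<length e} = KAB" using zero by (simp add: tensor_module_def)
  then have inK: "finsum FAB ?b {..<length e} \<in> KAB" using FM.coset_zero_iff[OF kernel_submodule sumc] by blast
  have \<beta>t: "\<beta> p \<in> carrier (gpow E e)" if "p \<in> carrier F \<times> carrier E" for p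
    using \<beta>c[of "fst p" "snd p"] that by (cases p) auto
  have lin: "linear_map R FAB (gpow E e) (R.lift (gpow E e) \<beta>)"
    by (rule R.lift_linear(1)[OF N.module_axioms]) (rule \<beta>t)
  have basis: "R.lift (gpow E e) \<beta> (basis_vec R p) = \<beta> p" if "p \<in> carrier F \<times> carrier E" for p
    by (rule R.lift_linear(2)[OF N.module_axioms _ that]) (rule \<beta>t)
  have "\<zero>\<^bsub>gpow E e\<^esub> = R.lift (gpow E e) \<beta> (finsum FAB ?b {..<length e})"
    by (rule lift_kernel[OF N.module_axioms l r inK, symmetric])
  also have "\<dots> = finsum (gpow E e) (\<lambda>j. R.lift (gpow E e) \<beta> (?b j)) {..<length e}"
    by (rule linear_map_finsum[OF FM.module_axioms N.module_axioms lin bc])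
  also have "\<dots> = finsum (gpow E e) (\<lambda>j. \<beta> (basis_vec R j, q (w j))) {..<length e}"
  proof (rule N.M.finsum_cong'[OF refl])
    show "(\<lambda>j. \<beta> (basis_vec R j, q (w j))) \<in> {..<length e} \<rightarrow> carrier (gpow E e)"
      using \<beta>c[OF basis_closed qw] by blast
    fix j assume j: "j \<in> {..<length e}"
    show "R.lift (gpow E e) \<beta> (?b j) = \<beta> (basis_vec R j, q (w j))"
      by (rule basis, rule SigmaI[OF basis_closed qw]) (use j in simp)
  qed
  finally have sum0: "\<zero>\<^bsub>gpow E e\<^esub> = finsum (gpow E e) (\<lambda>j. \<beta> (basis_vec R j, q (w j))) {..<length e}" .
  show "\<forall>j. w j \<in> Q"
  proof
    fix i
    show "w i \<in> Q"
    proof (cases "i < length e")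
      case True
      have "\<zero>\<^bsub>E\<^esub> = finsum (gpow E e) (\<lambda>j. \<beta> (basis_vec R j, q (w j))) {..<length e} i"
        using fun_cong[OF sum0, of i] by simp
      also have "\<dots> = finsum E (\<lambda>j. \<beta> (basis_vec R j, q (w j)) i) {..<length e}"
        by (rule gpow_finsum[OF EM.module_axioms]) (use \<beta>c[OF basis_closed qw] in blast)
      also have "\<dots> = finsum E (\<lambda>j. if i = j then q (w j) else \<zero>\<^bsub>E\<^esub>) {..<length e}"
        using qw EM.smult_one EM.smult_l_null
        by (intro EM.M.finsum_cong') (auto simp: \<beta>_def basis_vec_def simp del: gquotient_simps)
      also have "\<dots> = q (w i)"
        by (rule EM.M.finsum_singleton) (use True qw in auto)
      finally show ?thesis using q_zero[OF W_coord[OF w]] by metis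
    next
      case False
      then show ?thesis using w submoduleD(2)[OF Q_sub] by simp
    qed
  qed
qed

lemma psi_eq_iff:
  assumes "w \<in> carrier W" "w' \<in> carrier W"
  shows "psi w = psi w' \<longleftrightarrow> (\<forall>j. w j \<ominus>\<^bsub>M\<^esub> w' j \<in> Q)"
proof -
  have d: "w \<ominus>\<^bsub>W\<^esub> w' \<in> carrier W" using assms by (rule WM.M.minus_closed)
  have "psi w = psi w' \<longleftrightarrow> psi w \<ominus>\<^bsub>TAB\<^esub> psi w' = \<zero>\<^bsub>TAB\<^esub>"
    using T.minus_eq_zero_iff linear_mapD(1)[OF psi_linear assms(1)] linear_mapD(1)[OF psi_linear assms(2)] by simp
  also have "psi w \<ominus>\<^bsub>TAB\<^esub> psi w' = psi (w \<ominus>\<^bsub>W\<^esub> w')"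
    by (rule linear_map_minus[OF WM.module_axioms T.module_axioms psi_linear assms, symmetric])
  also have "psi (w \<ominus>\<^bsub>W\<^esub> w') = \<zero>\<^bsub>TAB\<^esub> \<longleftrightarrow> (\<forall>j. (w \<ominus>\<^bsub>W\<^esub> w') j \<in> Q)" by (rule psi_zero_iff[OF d])
  also have "\<dots> \<longleftrightarrow> (\<forall>j. w j \<ominus>\<^bsub>M\<^esub> w' j \<in> Q)"
  proof -
    have "(w \<ominus>\<^bsub>W\<^esub> w') j = w j \<ominus>\<^bsub>M\<^esub> w' j" for j
    proof -
      have "linear_map R (gsub M P) M (\<lambda>x. x)" by (rule linear_mapI) (use submoduleD(1)[OF P_sub] in auto)
      then have "w j \<ominus>\<^bsub>gsub M P\<^esub> w' j = w j \<ominus>\<^bsub>M\<^esub> w' j"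
        by (rule linear_map_minus[OF SP.module_axioms module_axioms, where f = "\<lambda>x. x"])
           (simp_all only: gsub_simps W_coord[OF assms(1)] W_coord[OF assms(2)])
      then show ?thesis by (simp only: gpow_minus[OF SP.module_axioms assms])
    qed
    then show ?thesis by simp
  qed
  finally show ?thesis .
qed

lemma smult_part:
  assumes "r \<in> ring_part R 0" "w \<in> mod_part W n"
  shows "r \<odot>\<^bsub>W\<^esub> w \<in> mod_part W n"
proof -
  have r: "r \<in> carrier R" using RG.part_closed[OF assms(1)] .
  show ?thesis
    using assms(2) submoduleD(4)[OF P_sub r] part_smult[OF assms(1)] r by auto
qed

lemma part_W: "w \<in> mod_part W n \<Longrightarrow> w \<in> carrier W"
  by auto

text \<open>The graded part of a tensor product is merely generated as an additive group by pure
  tensors of the right degree. By \<open>pure_eq_psi\<close> these come from homogeneous vectors,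
  whose images already form a group.\<close>

lemma psi_part: "mod_part (gtensor R F E) n = psi ` mod_part W n"
proof -
  note psi = linear_mapD[OF psi_linear]
  let ?S = "{pure v z | v z i j. v \<in> mod_part F i \<and> z \<in> mod_part E j \<and> i + j = n}"
  have part: "mod_part (gtensor R F E) n = generate (add_monoid TAB) ?S"
    by (simp add: gtensor_def graded_by_eq)
  have Epart: "z \<in> mod_part E j \<longleftrightarrow> (\<exists>x. x \<in> P \<and> x \<in> mod_part M j \<and> z = q x)" for z j by auto
  have Fpart: "v \<in> carrier F" if "v \<in> mod_part F i" for v i using GF.MG.part_closed[OF that] .
  have S: "?S \<subseteq> carrier TAB"
  proof
    fix c assume "c \<in> ?S"
    then obtain v z i j where c: "c = pure v z" "v \<in> mod_part F i" "z \<in> mod_part E j" by blast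
    then have "z \<in> carrier E" using Epart E_carrier by blast
    then show "c \<in> carrier TAB" using c Fpart pure_closed by blast
  qed
  have sub: "subgroup (psi ` mod_part W n) (add_monoid TAB)"
  proof (rule T.M.add.subgroupI)
    show "psi ` mod_part W n \<subseteq> carrier TAB" using psi(1) part_W by blast
    have "\<zero>\<^bsub>W\<^esub> \<in> mod_part W n" using submoduleD(2)[OF P_sub] MG.part_zero by auto
    then show "psi ` mod_part W n \<noteq> {}" by blast
    fix c assume "c \<in> psi ` mod_part W n"
    then obtain w where w: "w \<in> mod_part W n" "c = psi w" by blast
    \<comment> \<open>Negatives are obtained by multiplying with \<open>\<ominus> \<one>\<close>,
      which has degree zero and so preserves degrees.\<close>
    have m1: "\<ominus> \<one> \<in> ring_part R 0"
      using additive_subgroup.a_inv_closed[OF RG.part_subgroup] gr by (simp add: graded_ring_def)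
    have "\<ominus>\<^bsub>TAB\<^esub> c = (\<ominus> \<one>) \<odot>\<^bsub>TAB\<^esub> c"
      using psi(1)[OF part_W[OF w(1)]] w(2) by (simp add: T.smult_l_minus)
    also have "\<dots> = psi ((\<ominus> \<one>) \<odot>\<^bsub>W\<^esub> w)"
      unfolding w(2) by (rule psi(3)[OF _ part_W[OF w(1)], symmetric]) simp
    finally show "\<ominus>\<^bsub>TAB\<^esub> c \<in> psi ` mod_part W n" using smult_part[OF m1 w(1)] by blast
    fix c' assume "c' \<in> psi ` mod_part W n"
    then obtain w' where w': "w' \<in> mod_part W n" "c' = psi w'" by blast
    have "c \<oplus>\<^bsub>TAB\<^esub> c' = psi (w \<oplus>\<^bsub>W\<^esub> w')" unfolding w(2) w'(2) by (rule psi(2)[OF part_W[OF w(1)] part_W[OF w'(1)], symmetric])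
    moreover have "w \<oplus>\<^bsub>W\<^esub> w' \<in> mod_part W n"
      using w(1) w'(1) submoduleD(3)[OF P_sub] MG.part_add by auto
    ultimately show "c \<oplus>\<^bsub>TAB\<^esub> c' \<in> psi ` mod_part W n" by blast
  qed
  have "generate (add_monoid TAB) ?S \<subseteq> psi ` mod_part W n"
  proof (rule T.M.add.generate_subgroup_incl[OF _ sub], rule subsetI)
    fix c assume "c \<in> ?S"
    then obtain v z i j where c: "c = pure v z" "v \<in> mod_part F i" "z \<in> mod_part E j" "i + j = n" by blast
    then obtain x where x: "x \<in> P" "x \<in> mod_part M j" "z = q x" using Epart by blast
    have xM: "x \<in> carrier M" using MG.part_closed[OF x(2)] .
    have "(\<lambda>l. v l \<odot>\<^bsub>M\<^esub> x) \<in> mod_part W n"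
    proof -
      have "v l \<odot>\<^bsub>M\<^esub> x \<in> P \<inter> mod_part M (n - e ! l)" if l: "l < length e" for l
      proof -
        have vl: "v l \<in> mod_part (rmod R) (i - e ! l)" using c(2) l by (simp add: F_eq)
        show ?thesis
        proof (cases "0 \<le> i - e ! l")
          case True
          then have vl: "v l \<in> ring_part R (nat (i - e ! l))" using vl by simp
          from part_smult[OF this x(2)] have "v l \<odot>\<^bsub>M\<^esub> x \<in> mod_part M (n - e ! l)" using True c(4) by (simp add: algebra_simps)
          then show ?thesis using submoduleD(4)[OF P_sub RG.part_closed[OF vl] x(1)] by simp
        next
          case False
          then have "v l = \<zero>" using vl by simp
          then show ?thesis using xM submoduleD(2)[OF P_sub] MG.part_zero by simp
        qed
      qed
      moreover have "v l \<odot>\<^bsub>M\<^esub> x = \<zero>\<^bsub>M\<^esub>" if "l \<ge> length e" for l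
        using c(2) that xM by (simp add: F_eq)
      ultimately show ?thesis by simp
    qed
    then show "c \<in> psi ` mod_part W n"
      unfolding c(1) x(3) pure_eq_psi(2)[OF Fpart[OF c(2)] x(1)] by (rule imageI)
  qed
  moreover have "psi ` mod_part W n \<subseteq> generate (add_monoid TAB) ?S"
  proof
    fix c assume "c \<in> psi ` mod_part W n"
    then obtain w where w: "w \<in> mod_part W n" "c = psi w" by blast
    interpret G: subgroup "generate (add_monoid TAB) ?S" "add_monoid TAB"
      by (rule T.M.add.generate_is_subgroup[OF S])
    have mem: "pure (basis_vec R j) (q (w j)) \<in> generate (add_monoid TAB) ?S" if j: "j < length e" for j
    proof (rule generate.incl)
      have "basis_vec R j \<in> mod_part F (e ! j)"
        using j gr by (auto simp: F_eq basis_vec_def graded_ring_def RG.part_zero)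
      moreover have "q (w j) \<in> mod_part E (n - e ! j)" using w(1) j Epart by auto
      ultimately show "pure (basis_vec R j) (q (w j)) \<in> ?S"
        by (intro CollectI exI[of _ "basis_vec R j"] exI[of _ "q (w j)"] exI[of _ "e ! j"] exI[of _ "n - e ! j"]) simp
    qed
    have "finsum TAB (\<lambda>j. pure (basis_vec R j) (q (w j))) J \<in> generate (add_monoid TAB) ?S" if "J \<subseteq> {..<length e}" for J
      using that
    proof (induction J rule: infinite_finite_induct)
      case (insert j J)
      have "finsum TAB (\<lambda>j. pure (basis_vec R j) (q (w j))) (insert j J)
        = pure (basis_vec R j) (q (w j)) \<oplus>\<^bsub>TAB\<^esub> finsum TAB (\<lambda>j. pure (basis_vec R j) (q (w j))) J"
        using insert psi_term_closed[OF _ W_coord[OF part_W[OF w(1)]]]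
        by (intro T.M.finsum_insert) (auto simp: Pi_iff subset_iff)
      then show ?case using G.m_closed[OF mem[of j]] insert by auto
    qed (use G.one_closed in auto)
    from this[OF order_refl] show "c \<in> generate (add_monoid TAB) ?S" unfolding w(2) psi_def .
  qed
  ultimately show ?thesis unfolding part by blast
qed

end


section \<open>Differentials acting as matrices on powers of the module\<close>

context graded_mod
begin

text \<open>The map between powers of \<open>M\<close> obtained from a map of free modules by tensoring with \<open>M\<close>.\<close>

definition dmap :: "((nat \<Rightarrow> 'a) \<Rightarrow> nat \<Rightarrow> 'a) \<Rightarrow> int list \<Rightarrow> int list \<Rightarrow> (nat \<Rightarrow> 'b) \<Rightarrow> nat \<Rightarrow> 'b" where
  "dmap f e e' w = (\<lambda>l. if l < length e' then \<Oplus>\<^bsub>M\<^esub>j\<in>{..<length e}. f (basis_vec R j) l \<odot>\<^bsub>M\<^esub> w j else \<zero>\<^bsub>M\<^esub>)"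

lemma free_basis_part: "j < length e \<Longrightarrow> basis_vec R j \<in> mod_part (gfree R e) (e ! j)"
  using gr by (auto simp: gfree_eq basis_vec_def graded_ring_def RG.part_zero)

lemma free_coord:
  assumes "v \<in> carrier (gfree R e)"
  shows "v l \<in> carrier R"
  using gpow_coord[OF rmod_module[OF R.is_cring], of v e l] assms by (simp add: gfree_eq[OF gr])

lemma dmap_entry:
  assumes "graded_hom R (gfree R e) (gfree R e') f" "j < length e"
  shows "f (basis_vec R j) \<in> mod_part (gfree R e') (e ! j)" "f (basis_vec R j) \<in> carrier (gfree R e')"
    "f (basis_vec R j) l \<in> carrier R"
proof -
  interpret F: graded_mod R "gfree R e'" by (rule gfree_graded[OF gr])
  show 1: "f (basis_vec R j) \<in> mod_part (gfree R e') (e ! j)"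
    using assms(1) free_basis_part[OF assms(2)] unfolding graded_hom_def by blast
  show 2: "f (basis_vec R j) \<in> carrier (gfree R e')" by (rule F.MG.part_closed[OF 1])
  show "f (basis_vec R j) l \<in> carrier R" by (rule free_coord[OF 2])
qed

text \<open>The matrix entry from basis vector \<open>j\<close> to coordinate \<open>l\<close> is
  homogeneous of degree \<open>e ! j - e' ! l\<close>, and zero if this is negative; it compensates
  the difference of the shifts.\<close>

lemma dmap_graded:
  assumes "graded_hom R (gfree R e) (gfree R e') f"
  shows "graded_hom R (gpow M e) (gpow M e') (dmap f e e')"
proof -
  note entry = dmap_entry[OF assms]
  have coord: "linear_map R (gpow M e) M (\<lambda>w. \<Oplus>\<^bsub>M\<^esub>j\<in>{..<length e}. f (basis_vec R j) l \<odot>\<^bsub>M\<^esub> w j)" for l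
  proof (rule linear_map_finsum_fun[OF gpow_module[OF module_axioms] module_axioms])
    fix j assume j: "j \<in> {..<length e}"
    have "linear_map R M M (\<lambda>x. f (basis_vec R j) l \<odot>\<^bsub>M\<^esub> x)"
      using entry(3)[of j l] j by (intro linear_mapI) (auto simp: smult_r_distr smult_assoc1[symmetric] R.m_comm)
    from linear_map_comp[OF gpow_coord_linear[OF module_axioms] this]
    show "linear_map R (gpow M e) M (\<lambda>w. f (basis_vec R j) l \<odot>\<^bsub>M\<^esub> w j)" .
  qed
  note c = linear_mapD[OF coord]
  have "linear_map R (gpow M e) (gpow M e') (dmap f e e')"
  proof (rule linear_mapI)
    fix w v r assume w: "w \<in> carrier (gpow M e)"
    show "dmap f e e' w \<in> carrier (gpow M e')" using c(1)[OF w] by (simp add: dmap_def)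
    show "dmap f e e' (w \<oplus>\<^bsub>gpow M e\<^esub> v) = dmap f e e' w \<oplus>\<^bsub>gpow M e'\<^esub> dmap f e e' v" if v: "v \<in> carrier (gpow M e)"
      using c(2)[OF w v] by (auto simp: dmap_def fun_eq_iff)
    show "dmap f e e' (r \<odot>\<^bsub>gpow M e\<^esub> w) = r \<odot>\<^bsub>gpow M e'\<^esub> dmap f e e' w" if r: "r \<in> carrier R"
      using c(3)[OF r w] r by (auto simp: dmap_def fun_eq_iff)
  qed
  moreover have "dmap f e e' w \<in> mod_part (gpow M e') n" if w: "w \<in> mod_part (gpow M e) n" for w n
  proof -
    have "(\<Oplus>\<^bsub>M\<^esub>j\<in>{..<length e}. f (basis_vec R j) l \<odot>\<^bsub>M\<^esub> w j) \<in> mod_part M (n - e' ! l)" if l: "l < length e'" for l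
    proof (rule MG.part_finsum)
      fix j assume "j \<in> {..<length e}"
      then have j: "j < length e" by simp
      have wj: "w j \<in> mod_part M (n - e ! j)" using w j by simp
      have fj: "f (basis_vec R j) l \<in> mod_part (rmod R) (e ! j - e' ! l)"
        using entry(1)[OF j] l by (simp add: gfree_eq[OF gr])
      show "f (basis_vec R j) l \<odot>\<^bsub>M\<^esub> w j \<in> mod_part M (n - e' ! l)"
      proof (cases "0 \<le> e ! j - e' ! l")
        case True
        then have "f (basis_vec R j) l \<in> ring_part R (nat (e ! j - e' ! l))" using fj by simp
        from part_smult[OF this wj] show ?thesis using True by (simp add: algebra_simps)
      next
        case False
        then have "f (basis_vec R j) l = \<zero>" using fj by simp
        then show ?thesis using MG.part_closed[OF wj] MG.part_zero by simp
      qed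
    qed
    then show ?thesis by (simp add: dmap_def)
  qed
  ultimately show ?thesis by (auto simp: graded_hom_def linear_map_def simp del: gpow_simps)
qed

lemma dmap_submodule:
  assumes "graded_hom R (gfree R e) (gfree R e') f" "submodule P R M" "\<And>j. w j \<in> P"
  shows "dmap f e e' w l \<in> P" "l \<ge> length e' \<Longrightarrow> dmap f e e' w l = \<zero>\<^bsub>M\<^esub>"
proof -
  have "(\<Oplus>\<^bsub>M\<^esub>j\<in>{..<length e}. f (basis_vec R j) l \<odot>\<^bsub>M\<^esub> w j) \<in> P"
    by (rule submodule_finsum[OF assms(2)], rule submoduleD(4)[OF assms(2) _ assms(3)])
       (use dmap_entry(3)[OF assms(1)] in auto)
  then show "dmap f e e' w l \<in> P" using submoduleD(2)[OF assms(2)] by (simp add: dmap_def)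
qed (simp add: dmap_def)

end

text \<open>Under \<open>psi\<close>, the map \<open>f\<close> tensored with the identity becomes
  the matrix of \<open>f\<close>. The matrix does not depend on \<open>P\<close> and
  \<open>Q\<close>, so one differential serves all \<open>n\<close>.\<close>

lemma tensor_map_psi:
  assumes "free_tensor R M P Q" "graded_hom R (gfree R e) (gfree R e') f"
    and "w \<in> carrier (gpow (gsub M P) e)"
  shows "graded_mod.dmap R M f e e' w \<in> carrier (gpow (gsub M P) e')"
    and "tensor_map R (gfree R e') (gquotient (gsub M P) Q) f id (free_tensor.psi R M e P Q w) =
      free_tensor.psi R M e' P Q (graded_mod.dmap R M f e e' w)"
proof -
  interpret S: free_tensor R M e P Q by fact
  interpret S': free_tensor R M e' P Q by fact
  note entry = S.dmap_entry[OF assms(2)]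
  have wP: "w j \<in> P" for j using S.W_coord[OF assms(3)] .
  show dc: "S.dmap f e e' w \<in> carrier (gpow (gsub M P) e')"
    using S.dmap_submodule[OF assms(2) S.P_sub wP] by simp
  have id: "linear_map R S.E S.E id" by (rule linear_mapI) auto
  have t: "tensor R S.F S.E" "tensor R S'.F S.E" by unfold_locales
  note tm = tensor_map_linear[OF t graded_hom_linear[OF assms(2)] id]
  let ?t = "\<lambda>j l. f (basis_vec R j) l \<odot>\<^bsub>M\<^esub> w j"
  have tc: "?t j \<in> carrier S'.W" if "j \<in> {..<length e}" for j
    using S'.pure_eq_psi(1)[OF entry(2) wP] that by blast
  have "tensor_map R S'.F S.E f id (S.psi w) =
      finsum S'.TAB (\<lambda>j. tensor_map R S'.F S.E f id (S.pure (basis_vec R j) (S.q (w j)))) {..<length e}"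
    unfolding S.psi_def
    by (rule linear_map_finsum[OF S.T.module_axioms S'.T.module_axioms tm(1)]) (use S.psi_term_closed wP in auto)
  also have "\<dots> = finsum S'.TAB (\<lambda>j. S'.psi (?t j)) {..<length e}"
  proof (rule S'.T.M.finsum_cong'[OF refl])
    show "(\<lambda>j. S'.psi (?t j)) \<in> {..<length e} \<rightarrow> carrier S'.TAB"
      using linear_mapD(1)[OF S'.psi_linear tc] by blast
    fix j assume "j \<in> {..<length e}"
    then have j: "j < length e" by simp
    have "S.q (w j) \<in> carrier S.E" using S.E_carrier wP by blast
    then show "tensor_map R S'.F S.E f id (S.pure (basis_vec R j) (S.q (w j))) = S'.psi (?t j)"
      using tm(2)[OF S.basis_closed[OF j]] S'.pure_eq_psi(2)[OF entry(2)[OF j] wP] by simp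
  qed
  also have "\<dots> = S'.psi (finsum S'.W ?t {..<length e})"
    by (rule linear_map_finsum[OF S'.WM.module_axioms S'.T.module_axioms S'.psi_linear tc, symmetric])
  also have "finsum S'.W ?t {..<length e} = S.dmap f e e' w"
  proof
    fix l
    have eq: "finsum S'.W ?t {..<length e} l = finsum (gsub M P) (\<lambda>j. ?t j l) {..<length e}"
      by (rule gpow_finsum[OF S.SP.module_axioms tc])
    show "finsum S'.W ?t {..<length e} l = S.dmap f e e' w l"
    proof (cases "l < length e'")
      case True
      have "finsum (gsub M P) (\<lambda>j. ?t j l) {..<length e} = finsum M (\<lambda>j. ?t j l) {..<length e}"
        by (rule finsum_gsub[OF S.module_axioms S.P_sub]) (use S.submoduleD(4)[OF S.P_sub entry(3) wP] in auto)
      then show ?thesis using eq True by (simp add: S.dmap_def)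
    next
      case False
      have "finsum S'.W ?t {..<length e} \<in> carrier S'.W" by (rule S'.WM.M.finsum_closed) (use tc in blast)
      then show ?thesis using False by (simp add: S.dmap_def)
    qed
  qed
  finally show "tensor_map R S'.F S.E f id (S.psi w) = S'.psi (S.dmap f e e' w)" .
qed

text \<open>Under \<open>psi\<close>, the map induced by multiplication with \<open>a\<close>
  between two quotients becomes coordinatewise multiplication by \<open>a\<close>.\<close>

lemma tensor_map_change:
  assumes "free_tensor R M P Q" "free_tensor R M P' Q'" "a \<in> carrier R"
    and "\<And>x. x \<in> P \<Longrightarrow> a \<odot>\<^bsub>M\<^esub> x \<in> P'" "\<And>x. x \<in> Q \<Longrightarrow> a \<odot>\<^bsub>M\<^esub> x \<in> Q'"
  shows "linear_map R (tensor_module R (gfree R e) (gquotient (gsub M P) Q)) (tensor_module R (gfree R e) (gquotient (gsub M P') Q'))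
      (tensor_map R (gfree R e) (gquotient (gsub M P') Q') id (coset_map M Q' (\<lambda>x. a \<odot>\<^bsub>M\<^esub> x)))"
    and "\<And>w. w \<in> carrier (gpow (gsub M P) e) \<Longrightarrow>
      tensor_map R (gfree R e) (gquotient (gsub M P') Q') id (coset_map M Q' (\<lambda>x. a \<odot>\<^bsub>M\<^esub> x)) (free_tensor.psi R M e P Q w) =
      free_tensor.psi R M e P' Q' (\<lambda>j. a \<odot>\<^bsub>M\<^esub> w j)"
proof -
  interpret S: free_tensor R M e P Q by fact
  interpret S': free_tensor R M e P' Q' by fact
  let ?g = "coset_map M Q' (\<lambda>x. a \<odot>\<^bsub>M\<^esub> x)"
  have PM: "x \<in> carrier M" if "x \<in> P" for x using S.submoduleD(1)[OF S.P_sub that] .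
  have alin: "linear_map R (gsub M P) (gsub M P') (\<lambda>x. a \<odot>\<^bsub>M\<^esub> x)"
    by (rule linear_mapI) (use assms(3,4) PM in \<open>auto simp: S.smult_r_distr S.smult_assoc1[symmetric] S.R.m_comm\<close>)
  have geq: "coset_map (gsub M P') Q' (\<lambda>x. a \<odot>\<^bsub>M\<^esub> x) = ?g" by (simp add: coset_map_def fun_eq_iff)
  have glin: "linear_map R S.E S'.E ?g"
    using linear_map_transfer[OF coset_map_linear[OF S.SP.module_axioms S'.SP.module_axioms S.Q_sub' S'.Q_sub' alin assms(5)],
        of S.E S'.E] unfolding geq by simp
  have gq: "?g (S.q x) = S'.q (a \<odot>\<^bsub>M\<^esub> x)" if "x \<in> P" for x
    using coset_map_coset[OF S.SP.module_axioms S'.SP.module_axioms S.Q_sub' S'.Q_sub' linear_mapD(1,2)[OF alin] assms(5), of x] that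
    unfolding geq by simp
  have id: "linear_map R S.F S.F id" by (rule linear_mapI) auto
  have t: "tensor R S.F S.E" "tensor R S.F S'.E" by unfold_locales
  note tm = tensor_map_linear[OF t id glin]
  show "linear_map R S.TAB S'.TAB (tensor_map R S.F S'.E id ?g)" by (rule tm(1))
  fix w assume w: "w \<in> carrier S.W"
  have wP: "w j \<in> P" for j using S.W_coord[OF w] .
  have "tensor_map R S.F S'.E id ?g (S.psi w) =
      finsum S'.TAB (\<lambda>j. tensor_map R S.F S'.E id ?g (S.pure (basis_vec R j) (S.q (w j)))) {..<length e}"
    unfolding S.psi_def
    by (rule linear_map_finsum[OF S.T.module_axioms S'.T.module_axioms tm(1)]) (use S.psi_term_closed wP in auto)
  also have "\<dots> = S'.psi (\<lambda>j. a \<odot>\<^bsub>M\<^esub> w j)"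
    unfolding S'.psi_def
  proof (rule S'.T.M.finsum_cong'[OF refl])
    show "(\<lambda>j. S'.pure (basis_vec R j) (S'.q (a \<odot>\<^bsub>M\<^esub> w j))) \<in> {..<length e} \<rightarrow> carrier S'.TAB"
      using S'.psi_term_closed assms(4)[OF wP] by blast
    fix j assume "j \<in> {..<length e}"
    then have j: "j < length e" by simp
    have "S.q (w j) \<in> carrier S.E" using S.E_carrier wP by blast
    then show "tensor_map R S.F S'.E id ?g (S.pure (basis_vec R j) (S.q (w j))) = S'.pure (basis_vec R j) (S'.q (a \<odot>\<^bsub>M\<^esub> w j))"
      using tm(2)[OF S.basis_closed[OF j]] gq[OF wP] by simp
  qed
  finally show "tensor_map R S.F S'.E id ?g (S.psi w) = S'.psi (\<lambda>j. a \<odot>\<^bsub>M\<^esub> w j)" .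
qed

section \<open>Cycles and boundaries as submodules of a power of the module\<close>

locale tor_context = graded_mod R M for R :: "'a gring" (structure) and M :: "('a, 'm) gmodule" (structure) +
  fixes L :: "('a, 'l) gmodule"
  assumes noeth_ring: "noetherian_ring R" and L: "graded_module R L" "fin_gen_module R L"
begin

abbreviation "sh \<equiv> shifts (resolution R L)"
abbreviation "df \<equiv> diff (resolution R L)"
abbreviation "D i \<equiv> dmap (df i) (sh (Suc i)) (sh i)"
abbreviation "vecs P i \<equiv> carrier (gpow (gsub M P) (sh i))"

text \<open>\<open>cyc\<close> and \<open>bnd\<close> are the preimages under \<open>psi\<close> of
  the cycles and boundaries in homological degree \<open>k\<close>. For \<open>k = 0\<close> there
  is no outgoing differential and the condition is void. As \<open>psi\<close> forgets vectors over
  \<open>Q\<close>, conditions hold only modulo \<open>Q\<close>.\<close>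

definition cyc :: "nat \<Rightarrow> 'm set \<Rightarrow> 'm set \<Rightarrow> (nat \<Rightarrow> 'm) set" where
  "cyc k P Q = {w \<in> vecs P k. \<forall>i. k = Suc i \<longrightarrow> (\<forall>l. D i w l \<in> Q)}"

definition bnd :: "nat \<Rightarrow> 'm set \<Rightarrow> 'm set \<Rightarrow> (nat \<Rightarrow> 'm) set" where
  "bnd k P Q = {w \<in> vecs P k. \<exists>v\<in>vecs P (Suc k). \<forall>l. w l \<ominus>\<^bsub>M\<^esub> D k v l \<in> Q}"

lemma resolution: "graded_free_resolution R L (resolution R L)"
  unfolding resolution_def by (rule someI_ex[OF graded_free_resolution_exists[OF gr noeth_ring L]])

lemma df_hom: "graded_hom R (gfree R (sh (Suc i))) (gfree R (sh i)) (df i)"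
  using resolution by (simp add: graded_free_resolution_def res_module_def)

lemma df_df:
  assumes "v \<in> carrier (gfree R (sh (Suc (Suc i))))"
  shows "df i (df (Suc i) v) = \<zero>\<^bsub>gfree R (sh i)\<^esub>"
proof -
  have "df (Suc i) ` carrier (gfree R (sh (Suc (Suc i)))) = a_kernel (gfree R (sh (Suc i))) (gfree R (sh i)) (df i)"
    using resolution by (simp add: graded_free_resolution_def res_module_def)
  then have "df (Suc i) v \<in> a_kernel (gfree R (sh (Suc i))) (gfree R (sh i)) (df i)" using assms by blast
  then show ?thesis by (simp add: a_kernel_def kernel_def)
qed

end

locale tor_pair = tor_context R M L for R :: "'a gring" (structure) and M :: "('a, 'm) gmodule" (structure)
    and L :: "('a, 'l) gmodule" +
  fixes P Q :: "'m set"
  assumes P_sub: "submodule P R M" and Q_sub: "submodule Q R M" and QP: "Q \<subseteq> P"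
begin

abbreviation "E \<equiv> gquotient (gsub M P) Q"
abbreviation "C k \<equiv> tor_chain R k L E"
abbreviation "ps k \<equiv> free_tensor.psi R M (sh k) P Q"

lemma ft: "free_tensor R M P Q"
  by (intro free_tensor.intro free_tensor_axioms.intro graded_mod_axioms P_sub Q_sub QP)

lemma chain_simps:
  "carrier (C k) = carrier (tensor_module R (gfree R (sh k)) E)"
  "add (C k) = add (tensor_module R (gfree R (sh k)) E)"
  "\<zero>\<^bsub>C k\<^esub> = \<zero>\<^bsub>tensor_module R (gfree R (sh k)) E\<^esub>"
  "smult (C k) = smult (tensor_module R (gfree R (sh k)) E)"
  by (simp_all add: tor_chain_def gtensor_def graded_by_eq res_module_def)

lemma chain_part: "mod_part (C k) n = ps k ` mod_part (gpow (gsub M P) (sh k)) n"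
proof -
  interpret S: free_tensor R M "sh k" P Q by (rule ft)
  show ?thesis using S.psi_part by (simp add: tor_chain_def res_module_def del: gpow_simps)
qed

lemma chain_module: "module R (C k)"
proof -
  interpret S: free_tensor R M "sh k" P Q by (rule ft)
  show ?thesis by (rule module_transfer[OF S.T.module_axioms]) (simp_all only: chain_simps)
qed

lemma ps_linear: "linear_map R (gpow (gsub M P) (sh k)) (C k) (ps k)"
proof -
  interpret S: free_tensor R M "sh k" P Q by (rule ft)
  show ?thesis by (rule linear_map_transfer[OF S.psi_linear]) (simp_all only: chain_simps)
qed

lemma ps_surj: "c \<in> carrier (C k) \<longleftrightarrow> (\<exists>w\<in>vecs P k. c = ps k w)"
proof -
  interpret S: free_tensor R M "sh k" P Q by (rule ft)
  show ?thesis using S.psi_surj by (auto simp: chain_simps simp del: gpow_simps)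
qed

lemma ps_eq_iff: "w \<in> vecs P k \<Longrightarrow> w' \<in> vecs P k \<Longrightarrow> ps k w = ps k w' \<longleftrightarrow> (\<forall>j. w j \<ominus>\<^bsub>M\<^esub> w' j \<in> Q)"
  by (rule free_tensor.psi_eq_iff[OF ft])

lemma ps_zero_iff: "w \<in> vecs P k \<Longrightarrow> ps k w = \<zero>\<^bsub>C k\<^esub> \<longleftrightarrow> (\<forall>j. w j \<in> Q)"
  unfolding chain_simps by (rule free_tensor.psi_zero_iff[OF ft])

lemma tor_diff_ps:
  assumes "w \<in> vecs P (Suc k)"
  shows "D k w \<in> vecs P k" "tor_diff R k L E (ps (Suc k) w) = ps k (D k w)"
  using tensor_map_psi[OF ft df_hom assms] by (simp_all add: tor_diff_def res_module_def del: gpow_simps)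

lemma tor_diff_linear: "linear_map R (C (Suc k)) (C k) (tor_diff R k L E)"
proof -
  interpret S: free_tensor R M "sh (Suc k)" P Q by (rule ft)
  interpret S': free_tensor R M "sh k" P Q by (rule ft)
  have t: "tensor R S.F S.E" "tensor R S'.F S.E" by unfold_locales
  have id: "linear_map R S.E S.E id" by (rule linear_mapI) auto
  from tensor_map_linear(1)[OF t graded_hom_linear[OF df_hom] id]
  have "linear_map R S.TAB S'.TAB (tor_diff R k L E)" by (simp add: tor_diff_def res_module_def)
  then show ?thesis by (rule linear_map_transfer) (simp_all only: chain_simps)
qed

lemma cycles_eq: "tor_cycles R k L E = ps k ` cyc k P Q"
proof (cases k)
  case 0
  then show ?thesis using ps_surj[of _ 0] by (auto simp: tor_cycles_def cyc_def simp del: gpow_simps)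
next
  case (Suc i)
  have "tor_cycles R k L E = {c \<in> carrier (C (Suc i)). tor_diff R i L E c = \<zero>\<^bsub>C i\<^esub>}"
    by (simp add: Suc tor_cycles_def a_kernel_def kernel_def)
  also have "\<dots> = ps k ` cyc k P Q"
  proof (intro equalityI subsetI)
    fix c assume c: "c \<in> {c \<in> carrier (C (Suc i)). tor_diff R i L E c = \<zero>\<^bsub>C i\<^esub>}"
    then have "c \<in> carrier (C (Suc i))" by (simp only: mem_Collect_eq)
    then obtain w where w: "w \<in> vecs P (Suc i)" "c = ps (Suc i) w" unfolding ps_surj by blast
    have "ps i (D i w) = \<zero>\<^bsub>C i\<^esub>" using c tor_diff_ps(2)[OF w(1)] w(2) by simp
    then have "\<forall>l. D i w l \<in> Q" using ps_zero_iff[OF tor_diff_ps(1)[OF w(1)]] by blast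
    then show "c \<in> ps k ` cyc k P Q" using w(1,2) Suc unfolding cyc_def by blast
  next
    fix c assume "c \<in> ps k ` cyc k P Q"
    then obtain w where w: "w \<in> vecs P (Suc i)" "c = ps (Suc i) w" "\<forall>l. D i w l \<in> Q"
      using Suc unfolding cyc_def by blast
    then show "c \<in> {c \<in> carrier (C (Suc i)). tor_diff R i L E c = \<zero>\<^bsub>C i\<^esub>}"
      using ps_surj[of c "Suc i"] tor_diff_ps(2)[OF w(1)] ps_zero_iff[OF tor_diff_ps(1)[OF w(1)]]
      by (auto simp del: gpow_simps)
  qed
  finally show ?thesis .
qed

lemma cycles_sub: "submodule (tor_cycles R k L E) R (C k)"
proof (cases k)
  case 0
  then show ?thesis using module.carrier_is_submodule[OF chain_module[of 0]] by (simp add: tor_cycles_def)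
next
  case (Suc i)
  have "tor_cycles R k L E = {c \<in> carrier (C (Suc i)). tor_diff R i L E c \<in> {\<zero>\<^bsub>C i\<^esub>}}"
    by (simp add: Suc tor_cycles_def a_kernel_def kernel_def)
  then show ?thesis
    using linear_map_preimage[OF chain_module chain_module tor_diff_linear module.submodule_zero[OF chain_module]] Suc
    by simp
qed

lemma boundaries_sub: "submodule (tor_boundaries R k L E) R (C k)"
  unfolding tor_boundaries_def
  by (rule linear_map_image[OF chain_module chain_module tor_diff_linear module.carrier_is_submodule[OF chain_module]])

text \<open>Two consecutive differentials compose to zero; this is checked on pure tensors, where it
  reduces to exactness of the resolution.\<close>

lemma boundaries_cycles: "tor_boundaries R k L E \<subseteq> tor_cycles R k L E"
proof (cases k)
  case 0
  then show ?thesis using module.submoduleD(1)[OF chain_module boundaries_sub, of _ 0] by (auto simp: tor_cycles_def)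
next
  case (Suc i)
  interpret S: free_tensor R M "sh (Suc (Suc i))" P Q by (rule ft)
  interpret S': free_tensor R M "sh (Suc i)" P Q by (rule ft)
  interpret S'': free_tensor R M "sh i" P Q by (rule ft)
  have t: "tensor R S.F S.E" "tensor R S'.F S.E" "tensor R S''.F S.E" by unfold_locales
  have id: "linear_map R S.E S.E id" by (rule linear_mapI) auto
  note t1 = tensor_map_linear[OF t(1,2) graded_hom_linear[OF df_hom] id]
    and t2 = tensor_map_linear[OF t(2,3) graded_hom_linear[OF df_hom] id]
  let ?f = "\<lambda>c. tor_diff R i L E (tor_diff R (Suc i) L E c)"
  have lin: "linear_map R S.TAB S''.TAB ?f"
    using linear_map_comp[OF t1(1) t2(1)] by (simp add: tor_diff_def res_module_def)
  have "c \<in> {c \<in> carrier S.TAB. ?f c \<in> {\<zero>\<^bsub>S''.TAB\<^esub>}}" if c: "c \<in> carrier S.TAB" for c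
    using c
  proof (rule S.tensor_induct[OF linear_map_preimage[OF S.T.module_axioms S''.T.module_axioms lin S''.T.submodule_zero], rotated])
    fix v z assume v: "v \<in> carrier S.F" and z: "z \<in> carrier S.E"
    have dv: "df (Suc i) v \<in> carrier S'.F" using linear_mapD(1)[OF graded_hom_linear[OF df_hom] v] .
    have "?f (S.pure v z) = S''.pure (df i (df (Suc i) v)) z"
      using t1(2)[OF v z] t2(2)[OF dv z] by (simp add: tor_diff_def res_module_def)
    also have "\<dots> = \<zero>\<^bsub>S''.TAB\<^esub>"
      unfolding df_df[OF v] by (rule linear_map_zero[OF S''.GF.module_axioms S''.T.module_axioms S''.pure_left_linear[OF z]])
    finally show "S.pure v z \<in> {c \<in> carrier S.TAB. ?f c \<in> {\<zero>\<^bsub>S''.TAB\<^esub>}}"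
      using S.pure_closed[OF v z] by simp
  qed
  then have zero: "?f c = \<zero>\<^bsub>C i\<^esub>" if "c \<in> carrier (C (Suc (Suc i)))" for c
    using that unfolding chain_simps by blast
  then show ?thesis
    using linear_mapD(1)[OF tor_diff_linear[of "Suc i"]]
    by (auto simp: Suc tor_boundaries_def tor_cycles_def a_kernel_def kernel_def)
qed

lemma ps_boundary_iff:
  assumes "w \<in> vecs P k"
  shows "ps k w \<in> tor_boundaries R k L E \<longleftrightarrow> w \<in> bnd k P Q"
proof -
  have "ps k w \<in> tor_boundaries R k L E \<longleftrightarrow> (\<exists>v\<in>vecs P (Suc k). ps k w = ps k (D k v))"
  proof
    assume "ps k w \<in> tor_boundaries R k L E"
    then obtain c where c: "c \<in> carrier (C (Suc k))" "ps k w = tor_diff R k L E c" unfolding tor_boundaries_def by blast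
    then obtain v where v: "v \<in> vecs P (Suc k)" "c = ps (Suc k) v" unfolding ps_surj by blast
    show "\<exists>v\<in>vecs P (Suc k). ps k w = ps k (D k v)"
      by (rule bexI[OF _ v(1)]) (simp only: c(2) v(2) tor_diff_ps(2)[OF v(1)])
  next
    assume "\<exists>v\<in>vecs P (Suc k). ps k w = ps k (D k v)"
    then obtain v where v: "v \<in> vecs P (Suc k)" "ps k w = ps k (D k v)" by blast
    have "ps (Suc k) v \<in> carrier (C (Suc k))" unfolding ps_surj using v(1) by blast
    then show "ps k w \<in> tor_boundaries R k L E"
      unfolding tor_boundaries_def v(2) tor_diff_ps(2)[OF v(1), symmetric] by (rule imageI)
  qed
  also have "\<dots> \<longleftrightarrow> (\<exists>v\<in>vecs P (Suc k). \<forall>l. w l \<ominus>\<^bsub>M\<^esub> D k v l \<in> Q)"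
    using ps_eq_iff[OF assms tor_diff_ps(1)] by blast
  finally show ?thesis using assms unfolding bnd_def by blast
qed

text \<open>Read off from the inclusion in the chain modules through \<open>psi\<close>, which
  avoids multiplying matrices.\<close>

lemma bnd_cyc: "bnd k P Q \<subseteq> cyc k P Q"
proof
  fix w assume w: "w \<in> bnd k P Q"
  then have wP: "w \<in> vecs P k" by (simp add: bnd_def)
  then have "ps k w \<in> tor_cycles R k L E" using ps_boundary_iff w boundaries_cycles by blast
  then obtain w' where w': "w' \<in> cyc k P Q" "ps k w = ps k w'" unfolding cycles_eq by blast
  have "\<forall>l. D i w l \<in> Q" if k: "k = Suc i" for i
  proof -
    have "tor_diff R i L E (ps k w') = \<zero>\<^bsub>C i\<^esub>"
      using w'(1) tor_diff_ps[of w' i] ps_zero_iff[of "D i w'" i] k unfolding cyc_def by auto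
    then have "ps i (D i w) = \<zero>\<^bsub>C i\<^esub>" using w'(2) tor_diff_ps(2)[of w i] wP k by simp
    then show ?thesis using ps_zero_iff[of "D i w" i] tor_diff_ps(1)[of w i] wP k by simp
  qed
  then show "w \<in> cyc k P Q" using wP by (simp add: cyc_def)
qed

abbreviation "H k \<equiv> Tor R k L E"

text \<open>Vectors stand for \<open>Tor\<close> classes: the map is onto from \<open>cyc\<close>,
  linear there, and its kernel is \<open>bnd\<close>.\<close>

definition tor_class :: "nat \<Rightarrow> (nat \<Rightarrow> 'm) \<Rightarrow> ('a, 'm set) tor" where
  "tor_class k w = tor_boundaries R k L E +>\<^bsub>C k\<^esub> ps k w"

lemma cycles_module: "module R (gsub (C k) (tor_cycles R k L E))"
  by (rule gsub_module[OF chain_module cycles_sub])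

lemma boundaries_sub': "submodule (tor_boundaries R k L E) R (gsub (C k) (tor_cycles R k L E))"
  by (rule gsub_submodule[OF chain_module cycles_sub boundaries_sub boundaries_cycles])

lemma Tor_module: "module R (H k)"
  unfolding Tor_def by (rule gquotient_module[OF cycles_module boundaries_sub'])

lemma class_linear: "linear_map R (gsub (C k) (tor_cycles R k L E)) (H k) (\<lambda>c. tor_boundaries R k L E +>\<^bsub>C k\<^esub> c)"
  using gquotient_coset_linear[OF cycles_module boundaries_sub', of k] unfolding Tor_def by simp

lemma cyc_pow: "w \<in> cyc k P Q \<Longrightarrow> w \<in> vecs P k"
  by (simp add: cyc_def)

lemma ps_cycle: "w \<in> cyc k P Q \<Longrightarrow> ps k w \<in> tor_cycles R k L E"
  unfolding cycles_eq by blast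

lemma tor_class_closed: "w \<in> cyc k P Q \<Longrightarrow> tor_class k w \<in> carrier (H k)"
  unfolding tor_class_def by (rule linear_mapD(1)[OF class_linear]) (simp add: ps_cycle)

lemma tor_class_surj:
  assumes "h \<in> carrier (H k)"
  shows "\<exists>w\<in>cyc k P Q. h = tor_class k w"
proof -
  have "\<exists>c\<in>tor_cycles R k L E. h = tor_boundaries R k L E +>\<^bsub>C k\<^esub> c"
    using assms module.mem_a_rcosets[OF cycles_module, of h k "tor_boundaries R k L E" ] unfolding Tor_def by simp
  then show ?thesis unfolding cycles_eq tor_class_def by blast
qed

lemma tor_class_zero_iff:
  assumes "w \<in> cyc k P Q"
  shows "tor_class k w = \<zero>\<^bsub>H k\<^esub> \<longleftrightarrow> w \<in> bnd k P Q"
proof -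
  have "tor_class k w = \<zero>\<^bsub>H k\<^esub> \<longleftrightarrow> ps k w \<in> tor_boundaries R k L E"
    unfolding tor_class_def Tor_def gquotient_simps
    by (rule module.coset_zero_iff[OF chain_module boundaries_sub module.submoduleD(1)[OF chain_module cycles_sub ps_cycle[OF assms]]])
  then show ?thesis using ps_boundary_iff[OF cyc_pow[OF assms]] by simp
qed

lemma tor_class_smult:
  assumes "w \<in> cyc k P Q" "r \<in> carrier R"
  shows "tor_class k (\<lambda>j. r \<odot>\<^bsub>M\<^esub> w j) = r \<odot>\<^bsub>H k\<^esub> tor_class k w"
proof -
  have "ps k (\<lambda>j. r \<odot>\<^bsub>M\<^esub> w j) = r \<odot>\<^bsub>C k\<^esub> ps k w"
    using linear_mapD(3)[OF ps_linear assms(2) cyc_pow[OF assms(1)]] by simp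
  then show ?thesis
    unfolding tor_class_def using linear_mapD(3)[OF class_linear assms(2), of "ps k w" k] ps_cycle[OF assms(1)] by simp
qed

text \<open>A homogeneous cycle of the chain module comes from some homogeneous vector, and this
  vector satisfies the cycle condition because that condition depends only on its image under
  \<open>psi\<close>. So homogeneous classes have homogeneous representing cycles.\<close>

lemma Tor_part: "mod_part (H k) i = tor_class k ` (cyc k P Q \<inter> mod_part (gpow M (sh k)) i)"
proof -
  have "mod_part (H k) i = (\<lambda>c. tor_boundaries R k L E +>\<^bsub>C k\<^esub> c) ` (tor_cycles R k L E \<inter> mod_part (C k) i)"
    unfolding Tor_def by simp
  also have "tor_cycles R k L E \<inter> mod_part (C k) i = ps k ` (cyc k P Q \<inter> mod_part (gpow M (sh k)) i)"
  proof (intro equalityI subsetI)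
    fix c assume c: "c \<in> tor_cycles R k L E \<inter> mod_part (C k) i"
    then obtain w where w: "w \<in> mod_part (gpow (gsub M P) (sh k)) i" "c = ps k w" unfolding chain_part by blast
    have wP: "w \<in> vecs P k" using w(1) by auto
    obtain w' where w': "w' \<in> cyc k P Q" "c = ps k w'" using c unfolding cycles_eq by blast
    have "w \<in> cyc k P Q"
    proof -
      have "\<forall>l. D j w l \<in> Q" if k: "k = Suc j" for j
      proof -
        have "tor_diff R j L E c = \<zero>\<^bsub>C j\<^esub>"
          using w' tor_diff_ps[of w' j] ps_zero_iff[of "D j w'" j] k unfolding cyc_def by auto
        then have "ps j (D j w) = \<zero>\<^bsub>C j\<^esub>" using w(2) tor_diff_ps(2)[of w j] wP k by simp
        then show ?thesis using ps_zero_iff[of "D j w" j] tor_diff_ps(1)[of w j] wP k by simp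
      qed
      then show ?thesis using wP by (simp add: cyc_def)
    qed
    moreover have "w \<in> mod_part (gpow M (sh k)) i" using w(1) by simp
    ultimately show "c \<in> ps k ` (cyc k P Q \<inter> mod_part (gpow M (sh k)) i)" using w(2) by blast
  next
    fix c assume "c \<in> ps k ` (cyc k P Q \<inter> mod_part (gpow M (sh k)) i)"
    then obtain w where w: "w \<in> cyc k P Q" "w \<in> mod_part (gpow M (sh k)) i" "c = ps k w" by blast
    have "w \<in> mod_part (gpow (gsub M P) (sh k)) i" using w(2) cyc_pow[OF w(1)] by simp
    then show "c \<in> tor_cycles R k L E \<inter> mod_part (C k) i"
      using ps_cycle[OF w(1)] w(3) unfolding chain_part by blast
  qed
  finally show ?thesis by (simp add: image_image tor_class_def)
qed

lemma D_graded: "graded_hom R (gpow M (sh (Suc i))) (gpow M (sh i)) (D i)"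
  by (rule dmap_graded[OF df_hom])

lemma gpow_M: "graded_mod R (gpow M (sh k))"
  by (rule gpow_graded(1)[OF graded_mod_axioms])

lemma vecs_submodule:
  assumes "submodule U R M"
  shows "submodule (vecs U k) R (gpow M (sh k))"
proof -
  interpret W: graded_mod R "gpow M (sh k)" by (rule gpow_M)
  show ?thesis by (rule W.submoduleI') (use submoduleD[OF assms] in auto)
qed

lemma vecs_iff:
  assumes "submodule U R M" "w \<in> carrier (gpow M (sh k))"
  shows "w \<in> vecs U k \<longleftrightarrow> (\<forall>l. w l \<in> U)"
proof
  assume w: "w \<in> vecs U k"
  show "\<forall>l. w l \<in> U"
  proof
    fix l show "w l \<in> U" using w submoduleD(2)[OF assms(1)] by (cases "l < length (sh k)") auto
  qed
qed (use assms(2) in auto)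

lemma vecs_hom_closed:
  assumes U: "submodule U R M" "hom_closed U" and w: "w \<in> vecs U k"
  shows "hcomp (gpow M (sh k)) (mod_part (gpow M (sh k))) w i \<in> vecs U k"
proof -
  interpret W: graded_mod R "gpow M (sh k)" by (rule gpow_M)
  have wM: "w \<in> carrier (gpow M (sh k))" using W.submoduleD(1)[OF vecs_submodule[OF U(1)] w] .
  show ?thesis
    using W.MG.hc_closed[OF wM, of i] gpow_graded(2)[OF graded_mod_axioms wM] w U(2)
    by (simp add: hom_closed_def)
qed

lemma cyc_eq: "cyc k P Q = vecs P k \<inter> {w \<in> carrier (gpow M (sh k)). \<forall>i. k = Suc i \<longrightarrow> D i w \<in> vecs Q i}"
proof -
  have D: "D i w \<in> vecs Q i \<longleftrightarrow> (\<forall>l. D i w l \<in> Q)" if "w \<in> carrier (gpow M (sh (Suc i)))" for i w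
    by (rule vecs_iff[OF Q_sub linear_mapD(1)[OF graded_hom_linear[OF D_graded] that]])
  have sub: "w \<in> carrier (gpow M (sh k))" if "w \<in> vecs P k" for w
    using module.submoduleD(1)[OF gpow_module[OF module_axioms] vecs_submodule[OF P_sub] that] .
  show ?thesis unfolding cyc_def using D sub by blast
qed

lemma cyc_submodule: "submodule (cyc k P Q) R (gpow M (sh k))"
proof -
  interpret W: graded_mod R "gpow M (sh k)" by (rule gpow_M)
  show ?thesis
  proof (cases k)
    case 0
    then show ?thesis using vecs_submodule[OF P_sub, of 0] by (simp add: cyc_def del: gpow_simps)
  next
    case (Suc i)
    interpret W': graded_mod R "gpow M (sh i)" by (rule gpow_M)
    have "submodule {w \<in> carrier (gpow M (sh (Suc i))). D i w \<in> vecs Q i} R (gpow M (sh (Suc i)))"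
      using linear_map_preimage[OF _ W'.module_axioms graded_hom_linear[OF D_graded] vecs_submodule[OF Q_sub]]
        W.module_axioms Suc by blast
    then have "submodule (vecs P (Suc i) \<inter> {w \<in> carrier (gpow M (sh (Suc i))). D i w \<in> vecs Q i}) R (gpow M (sh (Suc i)))"
      using W.submodule_Int[OF vecs_submodule[OF P_sub]] Suc by blast
    then show ?thesis unfolding cyc_eq Suc by (simp del: gpow_simps)
  qed
qed

lemma cyc_hom_closed:
  assumes "hom_closed P" "hom_closed Q"
  shows "graded_mod.hom_closed (gpow M (sh k)) (cyc k P Q)"
proof -
  interpret W: graded_mod R "gpow M (sh k)" by (rule gpow_M)
  show ?thesis
    unfolding W.hom_closed_def
  proof (intro ballI allI)
    fix w n assume w: "w \<in> cyc k P Q"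
    then have wP: "w \<in> vecs P k" and wM: "w \<in> carrier (gpow M (sh k))" unfolding cyc_eq by blast+
    have "D i (W.MG.hc w n) \<in> vecs Q i" if k: "k = Suc i" for i
    proof -
      have "D i w \<in> vecs Q i" using w k unfolding cyc_eq by blast
      from vecs_hom_closed[OF Q_sub assms(2) this, of n] show ?thesis
        using graded_hom_hc[OF gpow_M gpow_M D_graded, of w i n] wM k by simp
    qed
    then show "W.MG.hc w n \<in> cyc k P Q"
      using vecs_hom_closed[OF P_sub assms(1) wP] W.MG.hc_closed[OF wM] unfolding cyc_eq by blast
  qed
qed

text \<open>In this form \<open>bnd\<close> is the sum of an image and a power of \<open>Q\<close>,
  from which the submodule property and homogeneity follow at once.\<close>

lemma bnd_eq: "bnd k P Q = {D k v \<oplus>\<^bsub>gpow M (sh k)\<^esub> u | v u. v \<in> vecs P (Suc k) \<and> u \<in> vecs Q k}"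
proof -
  interpret W: graded_mod R "gpow M (sh k)" by (rule gpow_M)
  note vP = W.submoduleD[OF vecs_submodule[OF P_sub]] and vQ = W.submoduleD[OF vecs_submodule[OF Q_sub]]
  have QP': "u \<in> vecs P k" if "u \<in> vecs Q k" for u using that QP by auto
  show ?thesis
  proof (intro equalityI subsetI)
    fix w assume "w \<in> bnd k P Q"
    then obtain v where v: "w \<in> vecs P k" "v \<in> vecs P (Suc k)" "\<forall>l. w l \<ominus>\<^bsub>M\<^esub> D k v l \<in> Q" unfolding bnd_def by blast
    have wM: "w \<in> carrier (gpow M (sh k))" by (rule vP(1)[OF v(1)])
    have DM: "D k v \<in> carrier (gpow M (sh k))" by (rule vP(1)[OF tor_diff_ps(1)[OF v(2)]])
    have "w \<ominus>\<^bsub>gpow M (sh k)\<^esub> D k v \<in> vecs Q k"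
      unfolding vecs_iff[OF Q_sub W.M.minus_closed[OF wM DM]] gpow_minus[OF module_axioms wM DM] by (rule v(3))
    moreover have "w = D k v \<oplus>\<^bsub>gpow M (sh k)\<^esub> (w \<ominus>\<^bsub>gpow M (sh k)\<^esub> D k v)"
      using wM DM by (simp add: a_minus_def W.M.a_ac W.M.r_neg2 W.M.r_neg del: gpow_simps)
    ultimately show "w \<in> {D k v \<oplus>\<^bsub>gpow M (sh k)\<^esub> u | v u. v \<in> vecs P (Suc k) \<and> u \<in> vecs Q k}" using v(2) by blast
  next
    fix w assume "w \<in> {D k v \<oplus>\<^bsub>gpow M (sh k)\<^esub> u | v u. v \<in> vecs P (Suc k) \<and> u \<in> vecs Q k}"
    then obtain v u where v: "w = D k v \<oplus>\<^bsub>gpow M (sh k)\<^esub> u" "v \<in> vecs P (Suc k)" "u \<in> vecs Q k" by blast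
    note Dv = tor_diff_ps(1)[OF v(2)]
    have DM: "D k v \<in> carrier (gpow M (sh k))" by (rule vP(1)[OF Dv])
    have uM: "u \<in> carrier (gpow M (sh k))" by (rule vQ(1)[OF v(3)])
    have "w l \<ominus>\<^bsub>M\<^esub> D k v l \<in> Q" for l
    proof -
      have eq: "w l \<ominus>\<^bsub>M\<^esub> D k v l = u l"
        using v(1) gpow_coord[OF module_axioms DM, of l] gpow_coord[OF module_axioms uM, of l]
        by (simp add: a_minus_def M.a_ac M.r_neg2 M.r_neg M.r_neg1)
      have "\<forall>l. u l \<in> Q" using v(3) unfolding vecs_iff[OF Q_sub uM] .
      then show ?thesis unfolding eq by (rule spec)
    qed
    moreover have "w \<in> vecs P k" unfolding v(1) by (rule vP(3)[OF Dv QP'[OF v(3)]])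
    ultimately show "w \<in> bnd k P Q" using v(2) unfolding bnd_def by blast
  qed
qed

lemma bnd_submodule: "submodule (bnd k P Q) R (gpow M (sh k))"
proof -
  interpret W: graded_mod R "gpow M (sh k)" by (rule gpow_M)
  have "submodule (D k ` vecs P (Suc k)) R (gpow M (sh k))"
    by (rule linear_map_image[OF gpow_module[OF module_axioms] W.module_axioms graded_hom_linear[OF D_graded] vecs_submodule[OF P_sub]])
  from W.submodule_sum[OF this vecs_submodule[OF Q_sub]]
  have "submodule {x \<oplus>\<^bsub>gpow M (sh k)\<^esub> u | x u. x \<in> D k ` vecs P (Suc k) \<and> u \<in> vecs Q k} R (gpow M (sh k))" .
  moreover have "{x \<oplus>\<^bsub>gpow M (sh k)\<^esub> u | x u. x \<in> D k ` vecs P (Suc k) \<and> u \<in> vecs Q k} = bnd k P Q"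
    unfolding bnd_eq by blast
  ultimately show ?thesis by simp
qed

lemma bnd_hom_closed:
  assumes "hom_closed P" "hom_closed Q"
  shows "graded_mod.hom_closed (gpow M (sh k)) (bnd k P Q)"
proof -
  interpret W: graded_mod R "gpow M (sh k)" by (rule gpow_M)
  interpret W': graded_mod R "gpow M (sh (Suc k))" by (rule gpow_M)
  show ?thesis
    unfolding W.hom_closed_def
  proof (intro ballI allI)
    fix w n assume "w \<in> bnd k P Q"
    then obtain v u where v: "w = D k v \<oplus>\<^bsub>gpow M (sh k)\<^esub> u" "v \<in> vecs P (Suc k)" "u \<in> vecs Q k" unfolding bnd_eq by blast
    have vM: "v \<in> carrier (gpow M (sh (Suc k)))" by (rule W'.submoduleD(1)[OF vecs_submodule[OF P_sub] v(2)])
    have uM: "u \<in> carrier (gpow M (sh k))" by (rule W.submoduleD(1)[OF vecs_submodule[OF Q_sub] v(3)])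
    have "W.MG.hc w n = W.MG.hc (D k v) n \<oplus>\<^bsub>gpow M (sh k)\<^esub> W.MG.hc u n"
      unfolding v(1) by (rule W.MG.hc_add[OF linear_mapD(1)[OF graded_hom_linear[OF D_graded] vM] uM])
    also have "W.MG.hc (D k v) n = D k (W'.MG.hc v n)" by (rule graded_hom_hc[OF gpow_M gpow_M D_graded vM])
    finally show "W.MG.hc w n \<in> bnd k P Q"
      unfolding bnd_eq using vecs_hom_closed[OF P_sub assms(1) v(2)] vecs_hom_closed[OF Q_sub assms(2) v(3)] by blast
  qed
qed

end

text \<open>Makes the action of Rees elements on \<open>Tor\<close> explicit: on representing
  vectors it is multiplication by \<open>a\<close>. The first two parts give stability of cycles and
  boundaries, the third identifies the induced map.\<close>

lemma (in tor_context) Tor_map_class: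
  assumes PQ: "tor_pair R M L P Q" "tor_pair R M L P' Q'" and a: "a \<in> carrier R"
    and aP: "\<And>x. x \<in> P \<Longrightarrow> a \<odot>\<^bsub>M\<^esub> x \<in> P'" and aQ: "\<And>x. x \<in> Q \<Longrightarrow> a \<odot>\<^bsub>M\<^esub> x \<in> Q'"
  shows "w \<in> cyc k P Q \<Longrightarrow> (\<lambda>j. a \<odot>\<^bsub>M\<^esub> w j) \<in> cyc k P' Q'"
    and "w \<in> bnd k P Q \<Longrightarrow> (\<lambda>j. a \<odot>\<^bsub>M\<^esub> w j) \<in> bnd k P' Q'"
    and "w \<in> cyc k P Q \<Longrightarrow> Tor_map R k L (gquotient (gsub M P') Q') (coset_map M Q' (\<lambda>x. a \<odot>\<^bsub>M\<^esub> x)) (tor_pair.tor_class R M L P Q k w) =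
      tor_pair.tor_class R M L P' Q' k (\<lambda>j. a \<odot>\<^bsub>M\<^esub> w j)"
proof -
  interpret S: tor_pair R M L P Q by fact
  interpret S': tor_pair R M L P' Q' by fact
  have av: "(\<lambda>j. a \<odot>\<^bsub>M\<^esub> v j) \<in> vecs P' i" if "v \<in> vecs P i" for v i
    using that aP a by auto
  have vM: "v \<in> carrier (gpow M (sh i))" if "v \<in> vecs P i" for v i
    using module.submoduleD(1)[OF gpow_module[OF module_axioms] S.vecs_submodule[OF S.P_sub] that] .
  have aD: "D i (\<lambda>j. a \<odot>\<^bsub>M\<^esub> v j) = (\<lambda>l. a \<odot>\<^bsub>M\<^esub> D i v l)" if "v \<in> vecs P (Suc i)" for v i
    using linear_mapD(3)[OF graded_hom_linear[OF S.D_graded] a vM[OF that]] by simp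
  show cyc: "(\<lambda>j. a \<odot>\<^bsub>M\<^esub> w j) \<in> cyc k P' Q'" if w: "w \<in> cyc k P Q" for w
    using w av[of w k] aD[of w] aQ unfolding cyc_def by (auto simp del: gpow_simps)
  show bnd: "(\<lambda>j. a \<odot>\<^bsub>M\<^esub> w j) \<in> bnd k P' Q'" if w: "w \<in> bnd k P Q" for w
  proof -
    obtain v where v: "w \<in> vecs P k" "v \<in> vecs P (Suc k)" "\<forall>l. w l \<ominus>\<^bsub>M\<^esub> D k v l \<in> Q" using w unfolding bnd_def by blast
    have "a \<odot>\<^bsub>M\<^esub> w l \<ominus>\<^bsub>M\<^esub> a \<odot>\<^bsub>M\<^esub> D k v l = a \<odot>\<^bsub>M\<^esub> (w l \<ominus>\<^bsub>M\<^esub> D k v l)" for l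
      using a gpow_coord[OF module_axioms vM[OF v(1)]] gpow_coord[OF module_axioms vM[OF S.tor_diff_ps(1)[OF v(2)]]]
      by (simp add: a_minus_def smult_r_distr smult_r_minus)
    then have "\<forall>l. a \<odot>\<^bsub>M\<^esub> w l \<ominus>\<^bsub>M\<^esub> D k (\<lambda>j. a \<odot>\<^bsub>M\<^esub> v j) l \<in> Q'" using aQ v(3) aD[OF v(2)] by simp
    then show ?thesis using av[OF v(1)] av[OF v(2)] unfolding bnd_def by blast
  qed
  let ?t = "tensor_map R (gfree R (sh k)) S'.E id (coset_map M Q' (\<lambda>x. a \<odot>\<^bsub>M\<^esub> x))"
  have tp: "?t (S.ps k w) = S'.ps k (\<lambda>j. a \<odot>\<^bsub>M\<^esub> w j)" if "w \<in> vecs P k" for w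
    by (rule tensor_map_change(2)[OF S.ft S'.ft a aP aQ that])
  have lin: "linear_map R (S.C k) (S'.C k) ?t"
    by (rule linear_map_transfer[OF tensor_map_change(1)[OF S.ft S'.ft a aP aQ, of "sh k"]])
       (simp_all only: S.chain_simps S'.chain_simps)
  note t = linear_mapD[OF lin]
  fix w assume w: "w \<in> cyc k P Q"
  have cycC: "x \<in> carrier (S.C k)" if "x \<in> tor_cycles R k L S.E" for x
    by (rule module.submoduleD(1)[OF S.chain_module S.cycles_sub that])
  have "Tor_map R k L S'.E (coset_map M Q' (\<lambda>x. a \<odot>\<^bsub>M\<^esub> x)) (S.tor_class k w)
    = coset_map (S'.C k) (tor_boundaries R k L S'.E) ?t (tor_boundaries R k L S.E +>\<^bsub>gsub (S.C k) (tor_cycles R k L S.E)\<^esub> S.ps k w)"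
    by (simp add: Tor_map_def S.tor_class_def res_module_def)
  also have "\<dots> = tor_boundaries R k L S'.E +>\<^bsub>S'.C k\<^esub> ?t (S.ps k w)"
  proof (rule coset_map_coset[OF S.cycles_module S'.chain_module S.boundaries_sub' S'.boundaries_sub])
    fix x assume "x \<in> tor_boundaries R k L S.E"
    then have "x \<in> tor_cycles R k L S.E" "x \<in> tor_boundaries R k L S.E" using S.boundaries_cycles by blast+
    then obtain u where u: "u \<in> cyc k P Q" "x = S.ps k u" unfolding S.cycles_eq by blast
    then have "u \<in> bnd k P Q" using S.ps_boundary_iff[OF S.cyc_pow[OF u(1)]] \<open>x \<in> tor_boundaries R k L S.E\<close> by blast
    then have "S'.ps k (\<lambda>j. a \<odot>\<^bsub>M\<^esub> u j) \<in> tor_boundaries R k L S'.E"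
      using S'.ps_boundary_iff[OF S'.cyc_pow[OF cyc[OF u(1)]]] bnd by blast
    then show "?t x \<in> tor_boundaries R k L S'.E" using tp[OF S.cyc_pow[OF u(1)]] u(2) by simp
  qed (use t(1,2) cycC S.ps_cycle[OF w] in auto)
  also have "?t (S.ps k w) = S'.ps k (\<lambda>j. a \<odot>\<^bsub>M\<^esub> w j)" by (rule tp[OF S.cyc_pow[OF w]])
  finally show "Tor_map R k L S'.E (coset_map M Q' (\<lambda>x. a \<odot>\<^bsub>M\<^esub> x)) (S.tor_class k w) = S'.tor_class k (\<lambda>j. a \<odot>\<^bsub>M\<^esub> w j)"
    unfolding S'.tor_class_def .
qed


section \<open>Rees modules\<close>

lemma homogeneous_ideal_hc:
  assumes "graded_ring R" "homogeneous_ideal R I" "a \<in> I"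
  shows "hcomp R (ring_part R) a i \<in> I"
proof -
  interpret R: cring R using assms(1) by (simp add: graded_ring_def)
  interpret G: graded_group R "ring_part R"
    by unfold_locales (use assms(1) in \<open>simp add: graded_ring_def\<close>)
  interpret I: ideal I R using assms(2) by (simp add: homogeneous_ideal_def)
  have grp: "abelian_group (R\<lparr>carrier := I\<rparr>)"
  proof (rule abelian_groupI)
    fix x assume x: "x \<in> carrier (R\<lparr>carrier := I\<rparr>)"
    then have "\<ominus>\<^bsub>R\<^esub> x \<in> I" "\<ominus>\<^bsub>R\<^esub> x \<oplus>\<^bsub>R\<^esub> x = \<zero>\<^bsub>R\<^esub>" using I.a_subset R.l_neg by auto
    then show "\<exists>y\<in>carrier (R\<lparr>carrier := I\<rparr>). y \<oplus>\<^bsub>R\<lparr>carrier := I\<rparr>\<^esub> x = \<zero>\<^bsub>R\<lparr>carrier := I\<rparr>\<^esub>" by auto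
  qed (use I.a_subset R.a_assoc R.a_comm in \<open>auto simp: subset_iff\<close>)
  show ?thesis
    by (rule G.graded_subset_hc[OF grp I.a_subset _ assms(3)]) (use assms(2) in \<open>simp add: homogeneous_ideal_def\<close>)
qed

context module
begin

lemma ideal_smult_gens:
  assumes "ideal A R" "submodule U R M"
  shows "{a \<odot>\<^bsub>M\<^esub> x | a x. a \<in> A \<and> x \<in> U} \<subseteq> carrier M"
proof -
  interpret ideal A R by fact
  show ?thesis using a_subset submoduleD(1)[OF assms(2)] by auto
qed

lemma ideal_smult_submodule:
  assumes "ideal A R" "submodule U R M"
  shows "submodule (ideal_smult R M A U) R M"
  unfolding ideal_smult_def by (rule span_submodule[OF ideal_smult_gens[OF assms]])

lemma ideal_smult_mem: "a \<in> A \<Longrightarrow> x \<in> U \<Longrightarrow> a \<odot>\<^bsub>M\<^esub> x \<in> ideal_smult R M A U"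
  unfolding ideal_smult_def by (rule subsetD[OF span_superset]) blast

lemma ideal_smult_least:
  assumes "submodule V R M" "\<And>a x. a \<in> A \<Longrightarrow> x \<in> U \<Longrightarrow> a \<odot>\<^bsub>M\<^esub> x \<in> V"
  shows "ideal_smult R M A U \<subseteq> V"
  unfolding ideal_smult_def by (rule span_least[OF assms(1)]) (use assms(2) in auto)

lemma ideal_smult_one:
  assumes "submodule U R M"
  shows "ideal_smult R M (carrier R) U = U"
proof
  show "ideal_smult R M (carrier R) U \<subseteq> U" by (rule ideal_smult_least[OF assms submoduleD(4)[OF assms]])
  show "U \<subseteq> ideal_smult R M (carrier R) U"
    using ideal_smult_mem[of \<one> "carrier R" _ U] submoduleD(1)[OF assms] by auto
qed

text \<open>The second factor is outermost because powers of ideals are extended on the right, so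
  that I^(n+1) U appears as I (I^n U).\<close>

lemma ideal_smult_prod:
  assumes "ideal A R" "ideal B R" "submodule U R M"
  shows "ideal_smult R M (ideal_prod R A B) U = ideal_smult R M B (ideal_smult R M A U)"
proof
  interpret A: ideal A R by fact
  interpret B: ideal B R by fact
  note AU = ideal_smult_submodule[OF assms(1,3)]
  note BAU = ideal_smult_submodule[OF assms(2) AU]
  note D = submoduleD[OF BAU]
  have AR: "a \<in> carrier R" if "a \<in> A" for a using that A.a_subset by blast
  have BR: "b \<in> carrier R" if "b \<in> B" for b using that B.a_subset by blast
  have UM: "x \<in> carrier M" if "x \<in> U" for x using submoduleD(1)[OF assms(3) that] .
  show "ideal_smult R M (ideal_prod R A B) U \<subseteq> ideal_smult R M B (ideal_smult R M A U)"
  proof (rule ideal_smult_least[OF BAU])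
    fix c x assume c: "c \<in> ideal_prod R A B" and x: "x \<in> U"
    then show "c \<odot>\<^bsub>M\<^esub> x \<in> ideal_smult R M B (ideal_smult R M A U)"
    proof (induction c rule: ideal_prod.induct)
      case (prod a b)
      have "(a \<otimes> b) \<odot>\<^bsub>M\<^esub> x = b \<odot>\<^bsub>M\<^esub> (a \<odot>\<^bsub>M\<^esub> x)"
        using AR[OF prod(1)] BR[OF prod(2)] UM[OF x] by (simp add: smult_assoc1[symmetric] R.m_comm)
      then show ?case using ideal_smult_mem[OF prod(2) ideal_smult_mem[OF prod(1) x]] by simp
    next
      case (sum s t)
      have "s \<in> carrier R" "t \<in> carrier R" using sum(1,2) R.ideal_prod_in_carrier[OF assms(1,2)] by auto
      then show ?case using sum D(3) UM[OF x] by (simp add: smult_l_distr)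
    qed
  qed
  have IP: "ideal (ideal_prod R A B) R" by (rule R.ideal_prod_is_ideal[OF assms(1,2)])
  note ABU = ideal_smult_submodule[OF IP assms(3)]
  show "ideal_smult R M B (ideal_smult R M A U) \<subseteq> ideal_smult R M (ideal_prod R A B) U"
  proof (rule ideal_smult_least[OF ABU])
    fix b v assume b: "b \<in> B" and v: "v \<in> ideal_smult R M A U"
    have lin: "linear_map R M M (\<lambda>x. b \<odot>\<^bsub>M\<^esub> x)"
      using BR[OF b] by (intro linear_mapI) (auto simp: smult_r_distr smult_assoc1[symmetric] R.m_comm)
    show "b \<odot>\<^bsub>M\<^esub> v \<in> ideal_smult R M (ideal_prod R A B) U"
    proof (rule linear_map_span[OF module_axioms module_axioms lin ideal_smult_gens[OF assms(1,3)] _ ABU])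
      show "v \<in> span R M {a \<odot>\<^bsub>M\<^esub> x | a x. a \<in> A \<and> x \<in> U}" using v unfolding ideal_smult_def .
      show "(\<lambda>x. b \<odot>\<^bsub>M\<^esub> x) ` {a \<odot>\<^bsub>M\<^esub> x | a x. a \<in> A \<and> x \<in> U} \<subseteq> ideal_smult R M (ideal_prod R A B) U"
      proof (rule image_subsetI)
        fix w assume "w \<in> {a \<odot>\<^bsub>M\<^esub> x | a x. a \<in> A \<and> x \<in> U}"
        then obtain a x where w: "w = a \<odot>\<^bsub>M\<^esub> x" "a \<in> A" "x \<in> U" by blast
        have "b \<odot>\<^bsub>M\<^esub> w = (a \<otimes> b) \<odot>\<^bsub>M\<^esub> x"
          using AR[OF w(2)] BR[OF b] UM[OF w(3)] w(1) by (simp add: smult_assoc1[symmetric] R.m_comm)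
        then show "b \<odot>\<^bsub>M\<^esub> w \<in> ideal_smult R M (ideal_prod R A B) U"
          using ideal_smult_mem[OF ideal_prod.prod[OF w(2) b] w(3)] by simp
      qed
    qed
  qed
qed

end

lemma (in graded_mod) ideal_smult_hom_closed:
  assumes "ideal A R" "\<And>a i. a \<in> A \<Longrightarrow> RG.hc a i \<in> A" "submodule U R M" "hom_closed U"
  shows "hom_closed (ideal_smult R M A U)"
  unfolding ideal_smult_def
proof (rule hom_closed_span[OF ideal_smult_gens[OF assms(1,3)]], fold ideal_smult_def)
  interpret A: ideal A R by fact
  note D = submoduleD[OF ideal_smult_submodule[OF assms(1,3)]]
  fix w i assume "w \<in> {a \<odot>\<^bsub>M\<^esub> x | a x. a \<in> A \<and> x \<in> U}"
  then obtain a x where w: "w = a \<odot>\<^bsub>M\<^esub> x" "a \<in> A" "x \<in> U" by blast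
  have aR: "a \<in> carrier R" using w(2) A.a_subset by blast
  have xM: "x \<in> carrier M" using submoduleD(1)[OF assms(3) w(3)] .
  from aR have "a \<in> {a \<in> carrier R. MG.hc (a \<odot>\<^bsub>M\<^esub> x) i \<in> ideal_smult R M A U}"
  proof (induction rule: RG.homogeneous_induct)
    case zero
    show ?case using xM D(2) by (simp add: MG.hc_zero)
  next
    case (add u v)
    then show ?case using xM D(3) by (simp add: smult_l_distr MG.hc_add)
  next
    case (homogeneous l)
    have "MG.hc (RG.hc a l \<odot>\<^bsub>M\<^esub> x) i = RG.hc a l \<odot>\<^bsub>M\<^esub> MG.hc x (i - int l)"
      by (rule hc_smult[OF RG.hc_part[OF aR] xM])
    moreover have "MG.hc x (i - int l) \<in> U" using assms(4) w(3) by (simp add: hom_closed_def)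
    ultimately show ?case using ideal_smult_mem[OF assms(2)[OF w(2)], of _ U l] RG.hc_closed[OF aR] by simp
  qed
  then show "MG.hc w i \<in> ideal_smult R M A U" using w(1) by simp
qed

section \<open>Powers of ideals and reductions\<close>

context cring
begin

lemma ideal_pow_ideal:
  assumes "ideal A R"
  shows "ideal (ideal_pow R A n) R"
proof -
  interpret S: comm_monoid "ideals_set R" by (rule ideals_set_is_comm_monoid)
  show ?thesis using S.nat_pow_closed[of A n] assms by (simp add: ideals_set_def)
qed

lemma ideal_pow_0: "ideal_pow R A 0 = carrier R"
  by (simp add: ideals_set_def)

lemma ideal_pow_Suc: "ideal_pow R A (Suc n) = ideal_prod R (ideal_pow R A n) A"
proof -
  have "monoid.mult (ideals_set R) = ideal_prod R" by (simp add: ideals_set_def)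
  then show ?thesis by simp
qed

lemma pow_mem_ideal_pow:
  assumes "ideal A R" "a \<in> A"
  shows "a [^] m \<in> ideal_pow R A m"
proof (induction m)
  case 0
  show ?case by (simp add: ideals_set_def)
next
  case (Suc m)
  then show ?case unfolding ideal_pow_Suc nat_pow_Suc by (intro ideal_prod.prod assms(2))
qed

text \<open>Multiplying the reduction equation by the larger ideal carries it from one exponent to
  the next.\<close>

lemma reduction_Suc:
  assumes "ideal J R" "ideal A R" "ideal_prod R J (ideal_pow R A m) = ideal_pow R A (Suc m)" "n \<ge> m"
  shows "ideal_pow R A (Suc n) = ideal_prod R J (ideal_pow R A n)"
  using assms(4)
proof (induction n rule: dec_induct)
  case base
  show ?case using assms(3) by simp
next
  case (step n)
  have "ideal_pow R A (Suc (Suc n)) = ideal_prod R (ideal_prod R J (ideal_pow R A n)) A"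
    unfolding ideal_pow_Suc[of A "Suc n"] step.IH ..
  also have "\<dots> = ideal_prod R J (ideal_prod R (ideal_pow R A n) A)"
    by (rule ideal_prod_assoc[OF assms(1) ideal_pow_ideal[OF assms(2)] assms(2)])
  finally show ?case unfolding ideal_pow_Suc[of A n] .
qed

end

lemma subset_Bex: "A \<subseteq> B \<Longrightarrow> Bex A P \<Longrightarrow> Bex B P"
  by blast

section \<open>Cycles and boundaries for the Rees pieces as stable families\<close>

locale rees_tor = tor_context R M L for R :: "'a gring" (structure) and M :: "('a, 'm) gmodule" (structure)
    and L :: "('a, 'l) gmodule" +
  fixes N :: "'m set" and I J :: "'a set" and y :: "nat \<Rightarrow> 'a" and d :: "nat \<Rightarrow> nat" and c k :: nat
  assumes fgM: "fin_gen_module R M" and N: "graded_submodule R M N" and I: "homogeneous_ideal R I"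
    and red: "reduction R J I" and y_deg: "j \<in> {1..c} \<Longrightarrow> y j \<in> ring_part R (d j)"
    and d_mono: "mono_on {1..c} d" and J: "J = genideal R (y ` {1..c})"
begin

abbreviation "P n \<equiv> ideal_smult R M (ideal_pow R I n) (carrier M)"
abbreviation "Q n \<equiv> ideal_smult R M (ideal_pow R I n) N"
abbreviation "W \<equiv> gpow M (sh k)"
abbreviation "Z n \<equiv> cyc k (P n) (Q n)"
abbreviation "B n \<equiv> bnd k (P n) (Q n)"

lemma I_ideal: "ideal I R" and J_ideal: "ideal J R" and JI: "J \<subseteq> I"
  using red by (auto simp: reduction_def)

lemma Ip_ideal: "ideal (ideal_pow R I n) R"
  by (rule R.ideal_pow_ideal[OF I_ideal])

lemma N_sub: "submodule N R M" "hom_closed N"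
  using graded_submodule_hom_closed[OF N] by auto

lemma y_closed: "j \<in> {1..c} \<Longrightarrow> y j \<in> carrier R"
  using y_deg RG.part_closed by blast

lemma y_J: "j \<in> {1..c} \<Longrightarrow> y j \<in> J"
  unfolding J using R.genideal_self[of "y ` {1..c}"] y_closed by blast

lemma Suc_smult:
  assumes "submodule U R M"
  shows "ideal_smult R M (ideal_pow R I (Suc n)) U = ideal_smult R M I (ideal_smult R M (ideal_pow R I n) U)"
  unfolding R.ideal_pow_Suc by (rule ideal_smult_prod[OF Ip_ideal I_ideal assms])

lemma pow_hom_closed:
  assumes "submodule U R M" "hom_closed U"
  shows "hom_closed (ideal_smult R M (ideal_pow R I n) U)"
proof (induction n)
  case 0
  show ?case using assms by (simp only: R.ideal_pow_0 ideal_smult_one)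
next
  case (Suc n)
  show ?case
    unfolding Suc_smult[OF assms(1)]
    by (rule ideal_smult_hom_closed[OF I_ideal homogeneous_ideal_hc[OF gr I] ideal_smult_submodule[OF Ip_ideal assms(1)] Suc.IH])
qed

lemma P_sub: "submodule (P n) R M" and Q_sub: "submodule (Q n) R M"
  by (rule ideal_smult_submodule[OF Ip_ideal carrier_is_submodule] ideal_smult_submodule[OF Ip_ideal N_sub(1)])+

lemma QP: "Q n \<subseteq> P n"
  by (rule ideal_smult_least[OF P_sub ideal_smult_mem]) (use submoduleD(1)[OF N_sub(1)] in auto)

lemma P_hom: "hom_closed (P n)" and Q_hom: "hom_closed (Q n)"
  by (rule pow_hom_closed[OF carrier_is_submodule]) (use MG.hc_closed in \<open>simp add: hom_closed_def\<close>,
      rule pow_hom_closed[OF N_sub])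

lemma y_step:
  assumes "j \<in> {1..c}" "submodule U R M" "x \<in> ideal_smult R M (ideal_pow R I n) U"
  shows "y j \<odot>\<^bsub>M\<^esub> x \<in> ideal_smult R M (ideal_pow R I (Suc n)) U"
  unfolding Suc_smult[OF assms(2)] by (rule ideal_smult_mem[OF _ assms(3)]) (use y_J[OF assms(1)] JI in blast)

lemma y_steps:
  assumes "j \<in> {1..c}" "submodule U R M" "x \<in> ideal_smult R M (ideal_pow R I n) U"
  shows "(y j [^] m) \<odot>\<^bsub>M\<^esub> x \<in> ideal_smult R M (ideal_pow R I (n + m)) U"
proof (induction m)
  case 0
  show ?case using assms(3) submoduleD(1)[OF ideal_smult_submodule[OF Ip_ideal assms(2)] assms(3)] by simp
next
  case (Suc m)
  have xM: "x \<in> carrier M" using submoduleD(1)[OF ideal_smult_submodule[OF Ip_ideal assms(2)] assms(3)] .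
  have "(y j [^] Suc m) \<odot>\<^bsub>M\<^esub> x = y j \<odot>\<^bsub>M\<^esub> ((y j [^] m) \<odot>\<^bsub>M\<^esub> x)"
    using y_closed[OF assms(1)] xM by (simp add: smult_assoc1[symmetric] R.m_comm)
  then show ?case using y_step[OF assms(1,2) Suc.IH] by simp
qed

text \<open>Beyond the exponent of the reduction, I^(n+1) M is J I^n M. The scalars that carry
  \<open>P n\<close> into the span form an ideal containing every \<open>y j\<close>, hence all of
  \<open>J\<close>.\<close>

lemma P_reduction: "\<exists>m. \<forall>n\<ge>m. P (Suc n) \<subseteq> span R M {y j \<odot>\<^bsub>M\<^esub> u | j u. j \<in> {1..c} \<and> u \<in> P n}"
proof -
  obtain m where m: "ideal_prod R J (ideal_pow R I m) = ideal_pow R I (Suc m)" using red by (auto simp: reduction_def)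
  have "P (Suc n) \<subseteq> span R M {y j \<odot>\<^bsub>M\<^esub> u | j u. j \<in> {1..c} \<and> u \<in> P n}" if n: "n \<ge> m" for n
  proof -
    let ?S = "{y j \<odot>\<^bsub>M\<^esub> u | j u. j \<in> {1..c} \<and> u \<in> P n}"
    have S: "?S \<subseteq> carrier M" using y_closed submoduleD(1)[OF P_sub] by auto
    note sub = span_submodule[OF S]
    note D = submoduleD[OF sub]
    have PM: "x \<in> carrier M" if "x \<in> P n" for x using submoduleD(1)[OF P_sub that] .
    have "ideal {a \<in> carrier R. \<forall>x\<in>P n. a \<odot>\<^bsub>M\<^esub> x \<in> span R M ?S} R"
      by (rule R.idealI_cring) (use D PM in \<open>auto simp: smult_l_distr smult_assoc1\<close>)
    moreover have "y ` {1..c} \<subseteq> {a \<in> carrier R. \<forall>x\<in>P n. a \<odot>\<^bsub>M\<^esub> x \<in> span R M ?S}"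
    proof (rule image_subsetI, rule CollectI, intro conjI ballI)
      fix j x assume j: "j \<in> {1..c}" and x: "x \<in> P n"
      show "y j \<odot>\<^bsub>M\<^esub> x \<in> span R M ?S" by (rule subsetD[OF span_superset]) (use j x in blast)
    qed (rule y_closed)
    ultimately have J': "J \<subseteq> {a \<in> carrier R. \<forall>x\<in>P n. a \<odot>\<^bsub>M\<^esub> x \<in> span R M ?S}"
      unfolding J by (rule R.genideal_minimal)
    have "ideal_pow R I (Suc n) = ideal_prod R (ideal_pow R I n) J"
      unfolding R.reduction_Suc[OF J_ideal I_ideal m n] by (rule R.ideal_prod_commute[OF J_ideal Ip_ideal])
    then have "P (Suc n) = ideal_smult R M J (P n)"
      using ideal_smult_prod[OF Ip_ideal J_ideal carrier_is_submodule] by simp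
    also have "\<dots> \<subseteq> span R M ?S" by (rule ideal_smult_least[OF sub]) (use J' in auto)
    finally show ?thesis .
  qed
  then show ?thesis by blast
qed

lemma tp: "tor_pair R M L (P n) (Q n)"
  by (intro tor_pair.intro tor_pair_axioms.intro tor_context_axioms P_sub Q_sub QP)

sublocale W: graded_mod R W
  by (rule gpow_graded(1)[OF graded_mod_axioms])

lemma W_smult: "r \<odot>\<^bsub>W\<^esub> w = (\<lambda>j. r \<odot>\<^bsub>M\<^esub> w j)"
  by simp

lemma y_power_Z:
  assumes "j \<in> {1..c}"
  shows "w \<in> Z n \<Longrightarrow> (y j [^] m) \<odot>\<^bsub>W\<^esub> w \<in> Z (n + m)" "w \<in> B n \<Longrightarrow> (y j [^] m) \<odot>\<^bsub>W\<^esub> w \<in> B (n + m)"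
  unfolding W_smult
  by (rule Tor_map_class(1)[OF tp tp _ y_steps[OF assms carrier_is_submodule] y_steps[OF assms N_sub(1)]];
      use y_closed[OF assms] in simp)
     (rule Tor_map_class(2)[OF tp tp _ y_steps[OF assms carrier_is_submodule] y_steps[OF assms N_sub(1)]];
      use y_closed[OF assms] in simp)

text \<open>The ambient family consists of the vectors over I^n M; its generation by the
  \<open>y j\<close> is inherited from that of I^n M coordinate by coordinate.\<close>

lemma quotient_family: "\<exists>m. quotient_family R W y {1..c} d Z B (\<lambda>n. vecs (P n) k) m"
proof -
  obtain m where m: "\<And>n. n \<ge> m \<Longrightarrow> P (Suc n) \<subseteq> span R M {y j \<odot>\<^bsub>M\<^esub> u | j u. j \<in> {1..c} \<and> u \<in> P n}"
    using P_reduction by blast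
  interpret G: graded_elements R W y "{1..c}" d
    by unfold_locales (use y_closed y_deg in auto)
  have vsub: "submodule (vecs (P n) k) R W" for n by (rule tor_pair.vecs_submodule[OF tp P_sub])
  have "vecs (P (Suc n)) k \<subseteq> G.jspan (vecs (P n) k)" if n: "n \<ge> m" for n
  proof
    fix w assume w: "w \<in> vecs (P (Suc n)) k"
    note js = G.jspan_submodule[OF subsetI[OF W.submoduleD(1)[OF vsub]]]
    have wM: "w \<in> carrier W" by (rule W.submoduleD(1)[OF vsub w])
    show "w \<in> G.jspan (vecs (P n) k)"
    \<comment> \<open>A vector is the sum of vectors with one nonzero entry, and such an entry is a
      combination of products \<open>y i u\<close>.\<close>
    proof (rule gpow_submodule_memI[OF module_axioms js wM])
      fix j assume j: "j < length (sh k)"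
      let ?S = "{y i \<odot>\<^bsub>M\<^esub> u | i u. i \<in> {1..c} \<and> u \<in> P n}"
      let ?s = "\<lambda>x i. if i = j then x else \<zero>\<^bsub>M\<^esub>"
      note lin = gpow_single_linear[OF module_axioms j]
      show "?s (w j) \<in> G.jspan (vecs (P n) k)"
      proof (rule linear_map_span[OF module_axioms W.module_axioms lin _ _ js])
        show "?S \<subseteq> carrier M" using y_closed submoduleD(1)[OF P_sub] by auto
        show "w j \<in> span R M ?S" using m[OF n] w j by auto
        show "?s ` ?S \<subseteq> G.jspan (vecs (P n) k)"
        proof (rule image_subsetI)
          fix v assume "v \<in> ?S"
          then obtain i u where v: "v = y i \<odot>\<^bsub>M\<^esub> u" "i \<in> {1..c}" "u \<in> P n" by blast
          have "?s v = y i \<odot>\<^bsub>W\<^esub> ?s u"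
            unfolding v(1) by (rule linear_mapD(3)[OF lin y_closed[OF v(2)] submoduleD(1)[OF P_sub v(3)]])
          moreover have "?s u \<in> vecs (P n) k" using v(3) j submoduleD(2)[OF P_sub] by simp
          ultimately show "?s v \<in> G.jspan (vecs (P n) k)" using G.jspan_mem[OF v(2)] by simp
        qed
      qed
    qed
  qed
  moreover have "G.stable Z"
    unfolding G.stable_def using tor_pair.cyc_submodule[OF tp] y_power_Z(1)[where m = 1] y_closed by simp
  moreover have "G.stable B"
    unfolding G.stable_def using tor_pair.bnd_submodule[OF tp] y_power_Z(2)[where m = 1] y_closed by simp
  moreover have "noetherian_module R W"
    by (rule W.fin_gen_imp_noetherian[OF noeth_ring gpow_fin_gen[OF module_axioms fgM]])
  moreover have "Z n \<subseteq> vecs (P n) k" for n by (auto simp: cyc_def)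
  ultimately have "quotient_family R W y {1..c} d Z B (\<lambda>n. vecs (P n) k) m"
    using vsub noeth_ring d_mono tor_pair.bnd_cyc[OF tp] tor_pair.cyc_hom_closed[OF tp P_hom Q_hom]
      tor_pair.bnd_hom_closed[OF tp P_hom Q_hom]
    by (intro quotient_family.intro quotient_family_axioms.intro G.graded_elements_axioms) auto
  then show ?thesis by blast
qed


section \<open>The Tor modules of the Rees pieces and the action of the Rees algebra\<close>

abbreviation "H n \<equiv> Tor R k L (rees_piece R I M N n)"
abbreviation "cl n \<equiv> tor_pair.tor_class R M L (P n) (Q n) k"
abbreviation "rees_H \<equiv> Tor_rees R k L I M N"

lemma H_module: "module R (H n)"
  unfolding rees_piece_def by (rule tor_pair.Tor_module[OF tp])

lemma cl_closed: "w \<in> Z n \<Longrightarrow> cl n w \<in> carrier (H n)"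
  unfolding rees_piece_def by (rule tor_pair.tor_class_closed[OF tp])

lemma cl_surj: "h \<in> carrier (H n) \<Longrightarrow> \<exists>w\<in>Z n. h = cl n w"
  unfolding rees_piece_def by (rule tor_pair.tor_class_surj[OF tp])

lemma cl_zero_iff: "w \<in> Z n \<Longrightarrow> cl n w = \<zero>\<^bsub>H n\<^esub> \<longleftrightarrow> w \<in> B n"
  unfolding rees_piece_def by (rule tor_pair.tor_class_zero_iff[OF tp])

lemma cl_smult: "w \<in> Z n \<Longrightarrow> r \<in> carrier R \<Longrightarrow> r \<odot>\<^bsub>H n\<^esub> cl n w = cl n (r \<odot>\<^bsub>W\<^esub> w)"
  unfolding rees_piece_def W_smult by (rule tor_pair.tor_class_smult[OF tp, symmetric])

lemma H_part: "mod_part (H n) i = cl n ` (Z n \<inter> mod_part W i)"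
  unfolding rees_piece_def by (rule tor_pair.Tor_part[OF tp])

lemma Z_sub: "submodule (Z n) R W" and B_sub: "submodule (B n) R W" and BZ: "B n \<subseteq> Z n"
  by (rule tor_pair.cyc_submodule[OF tp] tor_pair.bnd_submodule[OF tp] tor_pair.bnd_cyc[OF tp])+

lemma Tor_map_cl:
  assumes "a \<in> carrier R" "\<And>x. x \<in> P n \<Longrightarrow> a \<odot>\<^bsub>M\<^esub> x \<in> P l" "\<And>x. x \<in> Q n \<Longrightarrow> a \<odot>\<^bsub>M\<^esub> x \<in> Q l" "w \<in> Z n"
  shows "Tor_map R k L (rees_piece R I M N l) (rees_piece_mult R I M N l a) (cl n w) = cl l (a \<odot>\<^bsub>W\<^esub> w)"
  unfolding rees_piece_def rees_piece_mult_def W_smult by (rule Tor_map_class(3)[OF tp tp assms])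

text \<open>In \<open>Tor_rees\<close> every coefficient of a polynomial acts, so terms with
  coefficient zero have to be seen to vanish. Zero maps any \<open>P n\<close> into any
  \<open>P l\<close>, so this works without relating \<open>n\<close> and \<open>l\<close>.\<close>

lemma Tor_map_zero:
  assumes "w \<in> Z n"
  shows "Tor_map R k L (rees_piece R I M N l) (rees_piece_mult R I M N l \<zero>) (cl n w) = \<zero>\<^bsub>H l\<^esub>"
proof -
  have PM: "x \<in> carrier M" if "x \<in> P n" for x using submoduleD(1)[OF P_sub that] .
  have zP: "\<zero> \<odot>\<^bsub>M\<^esub> x \<in> P l" if "x \<in> P n" for x using PM[OF that] submoduleD(2)[OF P_sub] by simp
  have zQ: "\<zero> \<odot>\<^bsub>M\<^esub> x \<in> Q l" if "x \<in> Q n" for x using PM[of x] QP[of n] that submoduleD(2)[OF Q_sub, of l] by auto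
  have w0: "\<zero> \<odot>\<^bsub>W\<^esub> w \<in> B l"
    using W.submoduleD(1)[OF Z_sub assms] W.submoduleD(2)[OF B_sub] W.smult_l_null by (simp del: gpow_simps)
  show ?thesis using Tor_map_cl[OF R.zero_closed zP zQ assms] cl_zero_iff[of "\<zero> \<odot>\<^bsub>W\<^esub> w" l] w0 BZ[of l]
    by (simp add: subset_iff del: gpow_simps)
qed

lemma rees_H_simps:
  "carrier rees_H = {h. (\<forall>n. h n \<in> carrier (H n)) \<and> finite {n. h n \<noteq> \<zero>\<^bsub>H n\<^esub>}}"
  "\<zero>\<^bsub>rees_H\<^esub> = (\<lambda>n. \<zero>\<^bsub>H n\<^esub>)"
  "s \<odot>\<^bsub>rees_H\<^esub> h = (\<lambda>m. \<Oplus>\<^bsub>H m\<^esub> r\<in>{..m}. Tor_map R k L (rees_piece R I M N m)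
     (rees_piece_mult R I M N m (up_ring.coeff (UP R) s r)) (h (m - r)))"
  by (simp_all add: Tor_rees_def Let_def)

lemma UP_cring: "UP_cring R"
  by unfold_locales

text \<open>A monomial of degree \<open>m\<close> has one nonzero coefficient at most, so only the
  summand \<open>r = m\<close> of the action can contribute, and it exists only in degrees at least
  \<open>m\<close>.\<close>

lemma monom_smult:
  assumes j: "j \<in> {1..c}" and h: "h \<in> carrier rees_H"
  shows "l < m \<Longrightarrow> (up_ring.monom (UP R) (y j [^] m) m \<odot>\<^bsub>rees_H\<^esub> h) l = \<zero>\<^bsub>H l\<^esub>"
    and "w \<in> Z n \<Longrightarrow> h n = cl n w \<Longrightarrow> (up_ring.monom (UP R) (y j [^] m) m \<odot>\<^bsub>rees_H\<^esub> h) (n + m) = cl (n + m) ((y j [^] m) \<odot>\<^bsub>W\<^esub> w)"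
proof -
  interpret U: UP_cring R "UP R" by (rule UP_cring)
  let ?s = "up_ring.monom (UP R) (y j [^] m) m"
  let ?t = "\<lambda>l r. Tor_map R k L (rees_piece R I M N l) (rees_piece_mult R I M N l (up_ring.coeff (UP R) ?s r)) (h (l - r))"
  have co: "up_ring.coeff (UP R) ?s r = (if m = r then y j [^] m else \<zero>)" for r
    using y_closed[OF j] by (intro U.coeff_monom) simp
  have hc: "\<exists>w\<in>Z n. h n = cl n w" for n using h cl_surj unfolding rees_H_simps by blast
  have other: "?t l r = \<zero>\<^bsub>H l\<^esub>" if "r \<noteq> m" for l r
    using hc[of "l - r"] Tor_map_zero that unfolding co by auto
  have main: "?t (n + m) m = cl (n + m) ((y j [^] m) \<odot>\<^bsub>W\<^esub> w)" if w: "w \<in> Z n" "h n = cl n w" for n w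
    using Tor_map_cl[OF R.nat_pow_closed[OF y_closed[OF j]] y_steps[OF j carrier_is_submodule] y_steps[OF j N_sub(1)] w(1)]
    unfolding co by (simp add: w(2) del: gpow_simps)
  show "(?s \<odot>\<^bsub>rees_H\<^esub> h) l = \<zero>\<^bsub>H l\<^esub>" if "l < m" for l
  proof -
    interpret Hl: module R "H l" by (rule H_module)
    show ?thesis unfolding rees_H_simps
      by (rule Hl.M.add.finprod_one_eqI) (use other that in auto)
  qed
  show "(?s \<odot>\<^bsub>rees_H\<^esub> h) (n + m) = cl (n + m) ((y j [^] m) \<odot>\<^bsub>W\<^esub> w)" if w: "w \<in> Z n" "h n = cl n w" for n w
  proof -
    interpret Hl: module R "H (n + m)" by (rule H_module)
    have c: "cl (n + m) ((y j [^] m) \<odot>\<^bsub>W\<^esub> w) \<in> carrier (H (n + m))"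
      by (rule cl_closed[OF y_power_Z(1)[OF j w(1)]])
    have "(?s \<odot>\<^bsub>rees_H\<^esub> h) (n + m) =
        finsum (H (n + m)) (\<lambda>r. if m = r then cl (n + m) ((y j [^] m) \<odot>\<^bsub>W\<^esub> w) else \<zero>\<^bsub>H (n + m)\<^esub>) {..n + m}"
      unfolding rees_H_simps(3)
    proof (rule Hl.M.finsum_cong'[OF refl])
      show "(\<lambda>r. if m = r then cl (n + m) ((y j [^] m) \<odot>\<^bsub>W\<^esub> w) else \<zero>\<^bsub>H (n + m)\<^esub>) \<in> {..n + m} \<rightarrow> carrier (H (n + m))"
        by (intro Pi_I) (simp only: c Hl.M.zero_closed simp_thms split: if_split)
      show "?t (n + m) r = (if m = r then cl (n + m) ((y j [^] m) \<odot>\<^bsub>W\<^esub> w) else \<zero>\<^bsub>H (n + m)\<^esub>)" for r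
        using main[OF w] other by (cases "m = r") (simp_all del: gpow_simps)
    qed
    also have "\<dots> = cl (n + m) ((y j [^] m) \<odot>\<^bsub>W\<^esub> w)"
      by (rule Hl.M.finsum_singleton[of m _ "\<lambda>_. cl (n + m) ((y j [^] m) \<odot>\<^bsub>W\<^esub> w)"])
        (simp_all only: c Pi_I finite_atMost atMost_iff le_add2)
    finally show ?thesis .
  qed
qed

lemma J_pow_zero: "\<zero> \<in> ideal_pow R J n"
  using R.ideal_pow_ideal[OF J_ideal] by (simp add: ideal_def additive_subgroup.zero_closed)

lemma monom_rees:
  assumes "j \<in> {1..c}"
  shows "up_ring.monom (UP R) (y j [^] m) m \<in> carrier (rees_algebra R J)"
proof -
  interpret U: UP_cring R "UP R" by (rule UP_cring)
  note yR = y_closed[OF assms]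
  show ?thesis
    using yR R.pow_mem_ideal_pow[OF J_ideal y_J[OF assms], of m] J_pow_zero by (simp add: rees_algebra_def)
qed

text \<open>Every element of the direct sum is given by cycles in each degree, and the monomial acts
  on these one degree at a time.\<close>

lemma monom_annihilator_iff:
  assumes j: "j \<in> {1..c}"
  shows "up_ring.monom (UP R) (y j [^] m) m \<in> annihilator (rees_algebra R J) rees_H \<longleftrightarrow>
    (\<forall>n. \<forall>w\<in>Z n. (y j [^] m) \<odot>\<^bsub>W\<^esub> w \<in> B (n + m))"
proof (intro iffI allI ballI)
  fix n w assume ann: "up_ring.monom (UP R) (y j [^] m) m \<in> annihilator (rees_algebra R J) rees_H" and w: "w \<in> Z n"
  \<comment> \<open>The class of \<open>w\<close> placed in degree \<open>n\<close>, as a test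
    element for the annihilator.\<close>
  let ?h = "\<lambda>i. if i = n then cl n w else \<zero>\<^bsub>H i\<^esub>"
  have zero: "\<zero>\<^bsub>H i\<^esub> \<in> carrier (H i)" for i
  proof -
    interpret Hi: module R "H i" by (rule H_module)
    show ?thesis by simp
  qed
  have "finite {i. ?h i \<noteq> \<zero>\<^bsub>H i\<^esub>}" by (rule finite_subset[of _ "{n}"]) auto
  then have h: "?h \<in> carrier rees_H" using zero cl_closed[OF w] unfolding rees_H_simps by simp
  then have "up_ring.monom (UP R) (y j [^] m) m \<odot>\<^bsub>rees_H\<^esub> ?h = \<zero>\<^bsub>rees_H\<^esub>" using ann by (simp only: annihilator_def mem_Collect_eq)
  then have "cl (n + m) ((y j [^] m) \<odot>\<^bsub>W\<^esub> w) = \<zero>\<^bsub>H (n + m)\<^esub>"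
    using monom_smult(2)[OF j h w, of m] unfolding rees_H_simps(2) by simp
  then show "(y j [^] m) \<odot>\<^bsub>W\<^esub> w \<in> B (n + m)" using cl_zero_iff[OF y_power_Z(1)[OF j w]] by simp
next
  assume all: "\<forall>n. \<forall>w\<in>Z n. (y j [^] m) \<odot>\<^bsub>W\<^esub> w \<in> B (n + m)"
  have "up_ring.monom (UP R) (y j [^] m) m \<odot>\<^bsub>rees_H\<^esub> h = \<zero>\<^bsub>rees_H\<^esub>" if h: "h \<in> carrier rees_H" for h
    unfolding rees_H_simps(2)
  proof
    fix l
    show "(up_ring.monom (UP R) (y j [^] m) m \<odot>\<^bsub>rees_H\<^esub> h) l = \<zero>\<^bsub>H l\<^esub>"
    proof (cases "l < m")
      case False
      then obtain n where l: "l = n + m" by (metis add.commute le_add_diff_inverse not_less)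
      obtain w where w: "w \<in> Z n" "h n = cl n w" using h cl_surj unfolding rees_H_simps by blast
      show ?thesis
        unfolding l monom_smult(2)[OF j h w] cl_zero_iff[OF y_power_Z(1)[OF j w(1)]] using all w(1) by blast
    qed (rule monom_smult(1)[OF j h])
  qed
  then show "up_ring.monom (UP R) (y j [^] m) m \<in> annihilator (rees_algebra R J) rees_H"
    unfolding annihilator_def using monom_rees[OF j] by blast
qed

lemma monom_power:
  assumes "j \<in> {1..c}"
  shows "up_ring.monom (UP R) (y j) 1 [^]\<^bsub>rees_algebra R J\<^esub> m = up_ring.monom (UP R) (y j [^] m) m"
proof -
  interpret U: UP_cring R "UP R" by (rule UP_cring)
  have "up_ring.monom (UP R) (y j) 1 [^]\<^bsub>rees_algebra R J\<^esub> m = up_ring.monom (UP R) (y j) 1 [^]\<^bsub>UP R\<^esub> m"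
    by (simp add: nat_pow_def rees_algebra_def)
  then show ?thesis using U.monom_pow[OF y_closed[OF assms], of 1 m] by simp
qed

section \<open>The invariants of the Tor modules in terms of the two families\<close>

context
  fixes m assumes qf: "quotient_family R W y {1..c} d Z B (\<lambda>n. vecs (P n) k) m"
begin

interpretation QF: quotient_family R W y "{1..c}" d Z B "\<lambda>n. vecs (P n) k" m
  by (rule qf)

text \<open>A power of \<open>y j\<close> in Rees degree one annihilates everything exactly when it
  sends all cycles to boundaries, so membership in the radical is nilpotency on the
  quotients.\<close>

lemma radical_eq_lead:
  "{j \<in> {1..c}. up_ring.monom (UP R) (y j) 1 \<notin> radical (rees_algebra R J) (annihilator (rees_algebra R J) rees_H)} = QF.lead"
proof -
  have "up_ring.monom (UP R) (y j) 1 \<in> radical (rees_algebra R J) (annihilator (rees_algebra R J) rees_H) \<longleftrightarrow>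
      (\<exists>m. \<forall>n. \<forall>w\<in>Z n. (y j [^] m) \<odot>\<^bsub>W\<^esub> w \<in> B (n + m))" if j: "j \<in> {1..c}" for j
    unfolding radical_def mem_Collect_eq monom_power[OF j] monom_annihilator_iff[OF j]
    using monom_rees[OF j, of 1] y_closed[OF j] by simp
  then show ?thesis unfolding QF.non_nilpotent_def by blast
qed

lemma ann_elem_cl:
  assumes w: "w \<in> Z n"
  shows "ann_elem R (H n) (cl n w) = QF.colon (B n) w"
  unfolding ann_elem_def QF.colon_def
proof (rule Collect_cong, rule conj_cong[OF refl])
  fix r assume r: "r \<in> carrier R"
  show "r \<odot>\<^bsub>H n\<^esub> cl n w = \<zero>\<^bsub>H n\<^esub> \<longleftrightarrow> r \<odot>\<^bsub>W\<^esub> w \<in> B n"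
    unfolding cl_smult[OF w r] by (rule cl_zero_iff[OF W.submoduleD(4)[OF Z_sub r w]])
qed

lemma Ass_H: "Ass R (H n) = QF.ass n"
proof -
  have "(\<exists>x\<in>carrier (H n). p = ann_elem R (H n) x) \<longleftrightarrow> (\<exists>z\<in>Z n. p = QF.colon (B n) z)" for p
    using ann_elem_cl[of _ n] cl_closed[of _ n] cl_surj[of _ n] by metis
  then show ?thesis unfolding Ass_def QF.ass_def by simp
qed

lemma indeg_H: "indeg (H n) = QF.quot_indeg (Z n) (B n)"
proof -
  have "mod_part (H n) i \<noteq> {\<zero>\<^bsub>H n\<^esub>} \<longleftrightarrow> (\<exists>w\<in>Z n \<inter> mod_part W i. w \<notin> B n)" for i
  proof -
    \<comment> \<open>Zero lies in every graded part, so a part is trivial exactly when all its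
      classes vanish.\<close>
    have "\<zero>\<^bsub>W\<^esub> \<in> Z n \<inter> mod_part W i"
      using W.submoduleD(2)[OF Z_sub] W.MG.part_zero by (simp del: gpow_simps)
    then have "mod_part (H n) i = {\<zero>\<^bsub>H n\<^esub>} \<longleftrightarrow> (\<forall>w\<in>Z n \<inter> mod_part W i. cl n w = \<zero>\<^bsub>H n\<^esub>)"
      unfolding H_part by blast
    then show ?thesis using cl_zero_iff[of _ n] by (simp add: Bex_def Ball_def del: gpow_simps)
  qed
  then show ?thesis unfolding indeg_def QF.quot_indeg_def by simp
qed

text \<open>The annihilator of a class is a colon ideal, and by \<open>colon_iff\<close> it equals
  \<open>p\<close> exactly for vectors that are killed by \<open>p\<close> without being
  torsion.\<close>

lemma local_v_number_H:
  assumes p: "p \<subseteq> carrier R"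
  shows "local_v_number R p (H n) = QF.quot_indeg (QF.killed p n) (QF.torsion p n)"
proof -
  have "(\<exists>x\<in>mod_part (H n) i. p = ann_elem R (H n) x) \<longleftrightarrow> (\<exists>w\<in>QF.killed p n \<inter> mod_part W i. w \<notin> QF.torsion p n)" for i
  proof -
    have "(\<exists>x\<in>mod_part (H n) i. p = ann_elem R (H n) x) \<longleftrightarrow> (\<exists>w\<in>Z n \<inter> mod_part W i. p = QF.colon (B n) w)"
      unfolding H_part using ann_elem_cl[of _ n] by (auto simp del: gpow_simps)
    also have "\<dots> \<longleftrightarrow> (\<exists>w\<in>Z n \<inter> mod_part W i. w \<in> QF.killed p n \<and> w \<notin> QF.torsion p n)"
      using QF.colon_iff[OF p] by (intro bex_cong refl) blast
    also have "\<dots> \<longleftrightarrow> (\<exists>w\<in>QF.killed p n \<inter> mod_part W i. w \<notin> QF.torsion p n)"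
      unfolding QF.killed_def by blast
    finally show ?thesis .
  qed
  then show ?thesis unfolding local_v_number_def QF.quot_indeg_def by simp
qed

lemma v_number_H: "v_number R (H n) = Inf {QF.quot_indeg (QF.killed q n) (QF.torsion q n) | q. q \<in> QF.ass n}"
proof -
  have "local_v_number R q (H n) = QF.quot_indeg (QF.killed q n) (QF.torsion q n)" if "q \<in> QF.ass n" for q
    by (rule local_v_number_H) (use that in \<open>auto simp: QF.ass_def QF.colon_def\<close>)
  then have "{local_v_number R q (H n) | q. q \<in> QF.ass n} = {QF.quot_indeg (QF.killed q n) (QF.torsion q n) | q. q \<in> QF.ass n}"
    unfolding setcompr_eq_image by (intro image_cong) simp_all
  then show ?thesis unfolding v_number_def Ass_H by simp
qed

end

text \<open>Nonemptiness of \<open>S\<close> belongs to the conclusion because the infimum of an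
  empty set of naturals would not designate any of the \<open>y j\<close>; it follows from
  \<open>p\<close> being associated for all large \<open>n\<close>.\<close>

theorem v_numbers_eventually_linear:
  fixes p :: "'a set"
  defines "S \<equiv> {j \<in> {1..c}. up_ring.monom (UP R) (y j) 1 \<notin> radical (rees_algebra R J) (annihilator (rees_algebra R J) rees_H)}"
  assumes p: "eventually (\<lambda>n. p \<in> Ass R (H n)) sequentially"
  shows "S \<noteq> {}
    \<and> (\<exists>a \<in> d ` {Inf S..c}. \<exists>b::int. eventually (\<lambda>n.
          local_v_number R p (H n) = ereal (of_int (int a * int n + b))) sequentially)
    \<and> (\<exists>b::int. eventually (\<lambda>n. indeg (H n) = ereal (of_int (int (d (Inf S)) * int n + b))) sequentially)
    \<and> (\<exists>b::int. eventually (\<lambda>n. v_number R (H n) = ereal (of_int (int (d (Inf S)) * int n + b))) sequentially)"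
proof -
  obtain m where qf: "quotient_family R W y {1..c} d Z B (\<lambda>n. vecs (P n) k) m" using quotient_family by blast
  interpret QF: quotient_family R W y "{1..c}" d Z B "\<lambda>n. vecs (P n) k" m by (rule qf)
  have S: "S = QF.lead" unfolding S_def by (rule radical_eq_lead[OF qf])
  have pass: "eventually (\<lambda>n. p \<in> QF.ass n) sequentially" using p unfolding Ass_H[OF qf] .
  obtain l where "p \<in> Ass R (H l)" using eventually_happens[OF p] by auto
  then have pR: "p \<subseteq> carrier R" by (auto simp: Ass_def ann_elem_def)
  have sub: "d ` {j \<in> {1..c}. Inf QF.lead \<le> j} \<subseteq> d ` {Inf QF.lead..c}" by (rule image_mono) auto
  note bex = subset_Bex[OF sub QF.stable_v_numbers(2)[OF pass]]
  show ?thesis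
    unfolding S indeg_H[OF qf] local_v_number_H[OF qf pR] v_number_H[OF qf]
    by (rule conjI[OF QF.stable_v_numbers(1)[OF pass] conjI[OF bex conjI[OF QF.stable_v_numbers(3,4)[OF pass]]]])
qed

end

theorem proposition2p5:
  fixes R :: "'a gring" and L :: "('a, 'l) gmodule" and M :: "('a, 'm) gmodule"
    and N :: "'m set" and I J p :: "'a set" and x y :: "nat \<Rightarrow> 'a" and d :: "nat \<Rightarrow> nat"
    and e c k \<delta> :: nat
    and H :: "nat \<Rightarrow> ('a, ('a, 'm set) tor) gmodule" and S :: "nat set"
  defines "H \<equiv> \<lambda>n. Tor R k L (rees_piece R I M N n)"
    and "S \<equiv> {j \<in> {1..c}. monom (UP R) (y j) 1 \<notin>
              radical (rees_algebra R J) (annihilator (rees_algebra R J) (Tor_rees R k L I M N))}"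
    and "\<delta> \<equiv> Inf S"
  assumes "graded_ring R" and "noetherian_ring R"
    and "\<And>i. i \<in> {1..e} \<Longrightarrow> homogeneous R (x i)"
    and "generate_ring R (ring_part R 0 \<union> x ` {1..e}) = carrier R"
    and "graded_module R L" and "fin_gen_module R L"
    and "graded_module R M" and "fin_gen_module R M"
    and "graded_submodule R M N"
    and "homogeneous_ideal R I"
    and "reduction R J I"
    and "\<And>j. j \<in> {1..c} \<Longrightarrow> y j \<in> ring_part R (d j)"
    and "mono_on {1..c} d"
    and "J = genideal R (y ` {1..c})"
    and "eventually (\<lambda>n. p \<in> Ass R (H n)) sequentially"
  shows "S \<noteq> {}
    \<and> (\<exists>a \<in> d ` {\<delta>..c}. \<exists>b::int. eventually (\<lambda>n.
          local_v_number R p (H n) = ereal (of_int (int a * int n + b))) sequentially)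
    \<and> (\<exists>b::int. eventually (\<lambda>n. indeg (H n) = ereal (of_int (int (d \<delta>) * int n + b))) sequentially)
    \<and> (\<exists>b::int. eventually (\<lambda>n. v_number R (H n) = ereal (of_int (int (d \<delta>) * int n + b))) sequentially)"
proof -
  note A = assms(4-)
  have "tor_context R M L"
    by (intro tor_context.intro tor_context_axioms.intro graded_modI A(1,2,5,6,7))
  then have "rees_tor R M L N I J y d c"
    by (intro rees_tor.intro rees_tor_axioms.intro A(8-14))
  then show ?thesis
    using A(15) unfolding \<delta>_def S_def H_def by (rule rees_tor.v_numbers_eventually_linear)
qed

end
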